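(* Let $Q\to X$ be a continuous principal $G$-bundle over a compact metric space $X$, let $\phi$ be a continuous automorphism of $Q$, and let $\nu$ be an ergodic $\phi$-invariant probability measure on $X$. Let $\mu$ be an ergodic measure for the flow on the maximal flag bundle $\mathbb{E}$ that projects onto $\nu$. Then there exists $w\in\mathcal{W}$ such that $\mu(\mathrm{st}(w))=1$ and $\mu(\mathrm{st}(w'))=0$ if $\mathcal{W}_{\Theta_{\mathrm{Ly}}}w\neq\mathcal{W}_{\Theta_{\mathrm{Ly}}}w'$. In this case $$\int q\,d\mu=w^{-1}H_{\mathrm{Ly}}.$$
   Context: Lie notation. $G$ is a noncompact semi-simple Lie group, or more generally a reductive Lie group with noncompact semi-simple component, with Lie algebra $\mathfrak{g}$. Fix a Cartan decomposition $\mathfrak{g}=\mathfrak{k}\oplus\mathfrak{s}$, a maximal abelian $\mathfrak{a}\subset\mathfrak{s}$, the set $\Pi$ of roots of $(\mathfrak{g},\mathfrak{a})$ with root spaces $\mathfrak{g}_\alpha$, positive roots $\Pi^+$ and simple roots $\Sigma$. Put $\mathfrak{n}=\sum_{\alpha\in\Pi^+}\mathfrak{g}_\alpha$, $\mathfrak{a}^+=\{H\in\mathfrak{a}:\alpha(H)>0,\ \alpha\in\Sigma\}$ with closure $\mathrm{cl}\,\mathfrak{a}^+$, $K=\exp\mathfrak{k}$ (maximal compact), $A=\exp\mathfrak{a}$, $N=\exp\mathfrak{n}$, $S=\exp\mathfrak{s}$; $G=KAN=KS=K(\mathrm{cl}\exp\mathfrak{a}^+)K$. $\mathcal{W}$ is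 the Weyl group (normalizer modulo centralizer of $\mathfrak{a}$ in $K$); for $\Theta\subset\Sigma$, $\mathcal{W}_\Theta$ is the subgroup generated by the reflections with respect to the roots in $\Theta$ and $\langle\Theta\rangle$ is the set of roots spanned over $\mathbb{Z}$ by $\Theta$. $P$ is the minimal parabolic subgroup (normalizer in $G$ of $\mathfrak{m}\oplus\mathfrak{a}\oplus\mathfrak{n}$, $\mathfrak{m}$ the centralizer of $\mathfrak{a}$ in $\mathfrak{k}$) and $\mathbb{F}=G/P$ is the maximal flag manifold, with origin $b_0$. For $H\in\mathrm{cl}\,\mathfrak{a}^+$: $\Theta(H)=\{\alpha\in\Sigma:\alpha(H)=0\}$, $Z_H=\{g\in G:\mathrm{Ad}(g)H=H\}$, $K_H=Z_H\cap K$, $N_H^-=\exp\sum_{\alpha\in\Pi^+\setminus\langle\Theta(H)\rangle}\mathfrak{g}_{-\alpha}$. For $D=\mathrm{Ad}(g)H$, $w\in\mathcal{W}$: $\mathrm{st}(D,w)=gN_H^-K_H\cdot wb_0\subset\mathbb{F}$. Bundles and flow. $\phi$ generates a discrete-time flow $\phi_n$ on $Q$; the induced flows on $X$ and on associated bundles are also denoted $\phi$. $\mathbb{E}=Q\times_G\mathbb{F}$ is the maximal flag bundle. Fix a continuous $K$-subbundle $R\subset Q$. For $r\in R$ write $\phi_n(r)=r'\cdot hn'$ with $r'\in R$, $h\in A$, $n'\in N$, and put $\mathsf{a}(n,r)=\log h\in\mathfrak{a}$; this factors through $R\to\mathbb{E}$, $r\mapsto r\cdot b_0$, to an additive cocycle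 $\mathsf{a}(n,\xi)$ over the flow on $\mathbb{E}$. Put $q(\xi)=\mathsf{a}(1,\xi)$. Also write $\phi_n(r)=r''\cdot s$, $r''\in R$, $s\in S$, $s=k\exp(\mathsf{a}^+(n,r))k^{-1}$, $k\in K$, $\mathsf{a}^+(n,r)\in\mathrm{cl}\,\mathfrak{a}^+$. Multiplicative Ergodic Theorem (known). There are a set $\Omega\subset X$ of full $\nu$-measure, $H_{\mathrm{Ly}}=H_{\mathrm{Ly}}(\nu)\in\mathrm{cl}\,\mathfrak{a}^+$ (polar exponent) with $\lim_k\frac1k\mathsf{a}^+(k,r)=H_{\mathrm{Ly}}$ for $r\in R$ above $\Omega$, and a measurable $\phi$-invariant section $\chi_{\mathrm{Ly}}$ over $\Omega$ of $Q\times_G\mathrm{Ad}(G)H_{\mathrm{Ly}}$ with $\lim_{k\to+\infty}\frac1k\mathsf{a}(k,\xi)=w^{-1}H_{\mathrm{Ly}}$ for $\xi\in\mathrm{st}(\chi_{\mathrm{Ly}}(x),w)$, $x\in\Omega$, where $\mathrm{st}(\chi_{\mathrm{Ly}}(x),w)=p\cdot\mathrm{st}(D,w)$ if $\chi_{\mathrm{Ly}}(x)=p\cdot D$, $p\in Q$. $\Theta_{\mathrm{Ly}}=\{\alpha\in\Sigma:\alpha(H_{\mathrm{Ly}})=0\}$ and $\mathrm{st}(w)=\bigcup_{x\in\Omega}\mathrm{st}(\chi_{\mathrm{Ly}}(x),w)$. *)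

theory Defs
  imports "HOL-Probability.Probability" "HOL-Algebra.Generated_Groups"
begin

section \<open>Smooth maps and Lie groups\<close>

primrec C_diff_on :: "nat \<Rightarrow> 'a::euclidean_space set \<Rightarrow> ('a \<Rightarrow> 'b::euclidean_space) \<Rightarrow> bool" where
  "C_diff_on 0 U f \<longleftrightarrow> continuous_on U f"
| "C_diff_on (Suc n) U f \<longleftrightarrow>
     (\<forall>x\<in>U. f differentiable (at x)) \<and> (\<forall>v. C_diff_on n U (\<lambda>x. frechet_derivative f (at x) v))"

definition smooth_on :: "'a::euclidean_space set \<Rightarrow> ('a \<Rightarrow> 'b::euclidean_space) \<Rightarrow> bool" where
  "smooth_on U f \<longleftrightarrow> open U \<and> (\<forall>n. C_diff_on n U f)"

text \<open>
  A Lie group is carried by a topological type \<open>'g\<close> and modelled on a Euclidean space \<open>'l\<close>.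
  The tangent space at the identity is identified with \<open>'l\<close> by means of the distinguished
  chart \<open>id_chart\<close> around the identity, so that \<open>'l\<close> is also the underlying vector space of
  the Lie algebra.
\<close>

record ('g, 'l) lie_group = "'g monoid" +
  atlas :: "('g set \<times> ('g \<Rightarrow> 'l)) set"
  id_chart :: "'g set \<times> ('g \<Rightarrow> 'l)"

abbreviation chart_inv :: "'g set \<times> ('g \<Rightarrow> 'l) \<Rightarrow> 'l \<Rightarrow> 'g" where
  "chart_inv \<kappa> \<equiv> inv_into (fst \<kappa>) (snd \<kappa>)"

definition is_chart :: "'g::topological_space set \<times> ('g \<Rightarrow> 'l::euclidean_space) \<Rightarrow> bool" where
  "is_chart \<kappa> \<longleftrightarrow> open (fst \<kappa>) \<and> open (snd \<kappa> ` fst \<kappa>) \<and>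
     homeomorphism (fst \<kappa>) (snd \<kappa> ` fst \<kappa>) (snd \<kappa>) (chart_inv \<kappa>)"

definition is_lie_group ::
  "('g::{t2_space,second_countable_topology}, 'l::euclidean_space, 'm) lie_group_scheme \<Rightarrow> bool" where
  "is_lie_group G \<longleftrightarrow>
     group G \<and> carrier G = UNIV \<and>
     continuous_on UNIV (\<lambda>(x, y). x \<otimes>\<^bsub>G\<^esub> y) \<and> continuous_on UNIV (\<lambda>x. inv\<^bsub>G\<^esub> x) \<and>
     (\<forall>\<kappa>\<in>atlas G. is_chart \<kappa>) \<and> (\<Union>\<kappa>\<in>atlas G. fst \<kappa>) = UNIV \<and>
     (\<forall>\<kappa>\<in>atlas G. \<forall>\<kappa>'\<in>atlas G. smooth_on (snd \<kappa> ` (fst \<kappa> \<inter> fst \<kappa>')) (snd \<kappa>' \<circ> chart_inv \<kappa>)) \<and>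
     (\<forall>\<kappa>1\<in>atlas G. \<forall>\<kappa>2\<in>atlas G. \<forall>\<kappa>3\<in>atlas G. smooth_on
        {(x, y). x \<in> snd \<kappa>1 ` fst \<kappa>1 \<and> y \<in> snd \<kappa>2 ` fst \<kappa>2 \<and>
                 chart_inv \<kappa>1 x \<otimes>\<^bsub>G\<^esub> chart_inv \<kappa>2 y \<in> fst \<kappa>3}
        (\<lambda>(x, y). snd \<kappa>3 (chart_inv \<kappa>1 x \<otimes>\<^bsub>G\<^esub> chart_inv \<kappa>2 y))) \<and>
     (\<forall>\<kappa>1\<in>atlas G. \<forall>\<kappa>2\<in>atlas G. smooth_on
        {x. x \<in> snd \<kappa>1 ` fst \<kappa>1 \<and> inv\<^bsub>G\<^esub> (chart_inv \<kappa>1 x) \<in> fst \<kappa>2}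
        (\<lambda>x. snd \<kappa>2 (inv\<^bsub>G\<^esub> (chart_inv \<kappa>1 x)))) \<and>
     id_chart G \<in> atlas G \<and> \<one>\<^bsub>G\<^esub> \<in> fst (id_chart G)"

definition id_coord :: "('g, 'l, 'm) lie_group_scheme \<Rightarrow> 'g \<Rightarrow> 'l" where
  "id_coord G = snd (id_chart G)"

text \<open>The curve \<open>t \<mapsto> chart_inv (id_chart G) (id_coord G \<one> + t X)\<close> has tangent vector \<open>X\<close> at the
  identity; \<open>Ad g\<close> is the differential of conjugation by \<open>g\<close>.\<close>

definition Ad :: "('g, 'l::euclidean_space, 'm) lie_group_scheme \<Rightarrow> 'g \<Rightarrow> 'l \<Rightarrow> 'l" where
  "Ad G g X = vector_derivative
     (\<lambda>t::real. id_coord G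
        (g \<otimes>\<^bsub>G\<^esub> chart_inv (id_chart G) (id_coord G \<one>\<^bsub>G\<^esub> + t *\<^sub>R X) \<otimes>\<^bsub>G\<^esub> inv\<^bsub>G\<^esub> g)) (at 0)"

definition one_parameter_subgroup ::
  "('g::topological_space, 'l::euclidean_space, 'm) lie_group_scheme \<Rightarrow> 'l \<Rightarrow> (real \<Rightarrow> 'g) \<Rightarrow> bool" where
  "one_parameter_subgroup G X \<gamma> \<longleftrightarrow>
     continuous_on UNIV \<gamma> \<and> (\<forall>s t. \<gamma> (s + t) = \<gamma> s \<otimes>\<^bsub>G\<^esub> \<gamma> t) \<and>
     ((id_coord G \<circ> \<gamma>) has_vector_derivative X) (at 0)"

definition lie_exp :: "('g::topological_space, 'l::euclidean_space, 'm) lie_group_scheme \<Rightarrow> 'l \<Rightarrow> 'g" where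
  "lie_exp G X = (THE \<gamma>. one_parameter_subgroup G X \<gamma>) 1"

definition bracket ::
  "('g::topological_space, 'l::euclidean_space, 'm) lie_group_scheme \<Rightarrow> 'l \<Rightarrow> 'l \<Rightarrow> 'l" where
  "bracket G X Y = vector_derivative (\<lambda>t::real. Ad G (lie_exp G (t *\<^sub>R X)) Y) (at 0)"

definition lie_ideal ::
  "('g::topological_space, 'l::euclidean_space, 'm) lie_group_scheme \<Rightarrow> 'l set \<Rightarrow> bool" where
  "lie_ideal G I \<longleftrightarrow> subspace I \<and> (\<forall>X. \<forall>Y\<in>I. bracket G X Y \<in> I)"

definition reductive_lie_algebra ::
  "('g::topological_space, 'l::euclidean_space, 'm) lie_group_scheme \<Rightarrow> bool" where
  "reductive_lie_algebra G \<longleftrightarrow>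
     (\<forall>I. lie_ideal G I \<longrightarrow>
        (\<exists>J. lie_ideal G J \<and> I \<inter> J = {0} \<and> (\<forall>Z. \<exists>X\<in>I. \<exists>Y\<in>J. Z = X + Y)))"

definition semisimple_component ::
  "('g::topological_space, 'l::euclidean_space, 'm) lie_group_scheme \<Rightarrow> 'g set" where
  "semisimple_component G = generate G (lie_exp G ` span {bracket G X Y | X Y. True})"

section \<open>Cartan decomposition, roots, Weyl group, flag manifold\<close>

text \<open>
  The Lie group together with the choices fixed throughout: a Cartan decomposition
  \<open>\<gg> = \<kk> \<oplus> \<ss>\<close> (\<open>inv_form\<close> being an invariant form for it; for semisimple \<open>G\<close> the Killing
  form qualifies), a maximal abelian \<open>\<aa> \<subseteq> \<ss>\<close> and a set of positive roots.
\<close>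

record ('g, 'l) cartan_group = "('g, 'l) lie_group" +
  inv_form :: "'l \<Rightarrow> 'l \<Rightarrow> real"
  kk :: "'l set"
  ss :: "'l set"
  aa :: "'l set"
  pos_roots :: "('l \<Rightarrow> real) set"

text \<open>Linear functionals on \<open>\<aa>\<close> are encoded as functions on \<open>\<gg>\<close> that vanish off the set \<open>\<aa>\<close>.\<close>

definition aa_dual :: "('g, 'l::euclidean_space, 'm) cartan_group_scheme \<Rightarrow> ('l \<Rightarrow> real) set" where
  "aa_dual G = {\<alpha>. (\<forall>H\<in>aa G. \<forall>H'\<in>aa G. \<alpha> (H + H') = \<alpha> H + \<alpha> H') \<and>
                   (\<forall>H\<in>aa G. \<forall>c. \<alpha> (c *\<^sub>R H) = c * \<alpha> H) \<and> (\<forall>X. X \<notin> aa G \<longrightarrow> \<alpha> X = 0)}"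

definition root_space ::
  "('g::topological_space, 'l::euclidean_space, 'm) cartan_group_scheme \<Rightarrow> ('l \<Rightarrow> real) \<Rightarrow> 'l set" where
  "root_space G \<alpha> = {X. \<forall>H\<in>aa G. bracket G H X = \<alpha> H *\<^sub>R X}"

definition roots ::
  "('g::topological_space, 'l::euclidean_space, 'm) cartan_group_scheme \<Rightarrow> ('l \<Rightarrow> real) set" where
  "roots G = {\<alpha> \<in> aa_dual G. \<alpha> \<noteq> (\<lambda>_. 0) \<and> root_space G \<alpha> \<noteq> {0}}"

definition simple_roots :: "('g, 'l, 'm) cartan_group_scheme \<Rightarrow> ('l \<Rightarrow> real) set" where
  "simple_roots G = {\<alpha> \<in> pos_roots G.
     \<not> (\<exists>\<beta>\<in>pos_roots G. \<exists>\<gamma>\<in>pos_roots G. \<alpha> = (\<lambda>H. \<beta> H + \<gamma> H))}"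

definition root_span ::
  "('g::topological_space, 'l::euclidean_space, 'm) cartan_group_scheme \<Rightarrow> ('l \<Rightarrow> real) set \<Rightarrow> ('l \<Rightarrow> real) set" where
  "root_span G \<Theta> = {\<alpha> \<in> roots G. \<exists>c :: ('l \<Rightarrow> real) \<Rightarrow> int.
     \<alpha> = (\<lambda>H. \<Sum>\<beta>\<in>\<Theta>. of_int (c \<beta>) * \<beta> H)}"

definition nn :: "('g::topological_space, 'l::euclidean_space, 'm) cartan_group_scheme \<Rightarrow> 'l set" where
  "nn G = span (\<Union>\<alpha>\<in>pos_roots G. root_space G \<alpha>)"

definition mm :: "('g::topological_space, 'l::euclidean_space, 'm) cartan_group_scheme \<Rightarrow> 'l set" where
  "mm G = {X \<in> kk G. \<forall>H\<in>aa G. bracket G H X = 0}"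

definition aa_plus :: "('g, 'l::euclidean_space, 'm) cartan_group_scheme \<Rightarrow> 'l set" where
  "aa_plus G = {H \<in> aa G. \<forall>\<alpha>\<in>simple_roots G. 0 < \<alpha> H}"

definition KK :: "('g::topological_space, 'l::euclidean_space, 'm) cartan_group_scheme \<Rightarrow> 'g set" where
  "KK G = lie_exp G ` kk G"

definition SS :: "('g::topological_space, 'l::euclidean_space, 'm) cartan_group_scheme \<Rightarrow> 'g set" where
  "SS G = lie_exp G ` ss G"

definition AA :: "('g::topological_space, 'l::euclidean_space, 'm) cartan_group_scheme \<Rightarrow> 'g set" where
  "AA G = lie_exp G ` aa G"

definition NN :: "('g::topological_space, 'l::euclidean_space, 'm) cartan_group_scheme \<Rightarrow> 'g set" where
  "NN G = lie_exp G ` nn G"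

definition cartan_decomposition ::
  "('g::topological_space, 'l::euclidean_space, 'm) cartan_group_scheme \<Rightarrow> bool" where
  "cartan_decomposition G \<longleftrightarrow>
     subspace (kk G) \<and> subspace (ss G) \<and> kk G \<inter> ss G = {0} \<and>
     (\<forall>Z. \<exists>X\<in>kk G. \<exists>Y\<in>ss G. Z = X + Y) \<and>
     (\<forall>X\<in>kk G. \<forall>Y\<in>kk G. bracket G X Y \<in> kk G) \<and>
     (\<forall>X\<in>kk G. \<forall>Y\<in>ss G. bracket G X Y \<in> ss G) \<and>
     (\<forall>X\<in>ss G. \<forall>Y\<in>ss G. bracket G X Y \<in> kk G) \<and>
     bilinear (inv_form G) \<and>
     (\<forall>X Y. inv_form G X Y = inv_form G Y X) \<and>
     (\<forall>g X Y. inv_form G (Ad G g X) (Ad G g Y) = inv_form G X Y) \<and>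
     (\<forall>X\<in>kk G. X \<noteq> 0 \<longrightarrow> inv_form G X X < 0) \<and>
     (\<forall>Y\<in>ss G. Y \<noteq> 0 \<longrightarrow> 0 < inv_form G Y Y) \<and>
     (\<forall>X\<in>kk G. \<forall>Y\<in>ss G. inv_form G X Y = 0)"

definition maximal_compact_subgroup :: "('g::topological_space, 'm) monoid_scheme \<Rightarrow> 'g set \<Rightarrow> bool" where
  "maximal_compact_subgroup G K \<longleftrightarrow>
     subgroup K G \<and> compact K \<and> (\<forall>L. subgroup L G \<and> compact L \<and> K \<subseteq> L \<longrightarrow> L = K)"

definition maximal_abelian_in_ss ::
  "('g::topological_space, 'l::euclidean_space, 'm) cartan_group_scheme \<Rightarrow> bool" where
  "maximal_abelian_in_ss G \<longleftrightarrow>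
     (let abelian = (\<lambda>V. subspace V \<and> V \<subseteq> ss G \<and> (\<forall>X\<in>V. \<forall>Y\<in>V. bracket G X Y = 0))
      in abelian (aa G) \<and> (\<forall>V. abelian V \<and> aa G \<subseteq> V \<longrightarrow> V = aa G))"

text \<open>A system of positive roots is the one determined by some regular element of \<open>\<aa>\<close>.\<close>

definition positive_system ::
  "('g::topological_space, 'l::euclidean_space, 'm) cartan_group_scheme \<Rightarrow> bool" where
  "positive_system G \<longleftrightarrow>
     (\<exists>H\<in>aa G. (\<forall>\<alpha>\<in>roots G. \<alpha> H \<noteq> 0) \<and> pos_roots G = {\<alpha>\<in>roots G. 0 < \<alpha> H})"

text \<open>
  Reductive Lie groups with noncompact semisimple component, with the standing choices. As usual
  for reductive groups, the global Cartan decomposition \<open>K \<times> \<ss> \<cong> G\<close> is part of the notion; since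
  \<open>K = exp \<kk>\<close>, the group is connected. The last two clauses are the decompositions \<open>G = KAN\<close>
  and \<open>G = K (cl exp \<aa>\<^sup>+) K\<close>, which hold for all these groups.
\<close>

definition reductive_cartan_group ::
  "('g::{t2_space,second_countable_topology}, 'l::euclidean_space, 'm) cartan_group_scheme \<Rightarrow> bool" where
  "reductive_cartan_group G \<longleftrightarrow>
     is_lie_group G \<and> reductive_lie_algebra G \<and> \<not> compact (semisimple_component G) \<and>
     cartan_decomposition G \<and> maximal_abelian_in_ss G \<and> positive_system G \<and>
     maximal_compact_subgroup G (KK G) \<and>
     (\<exists>f. homeomorphism (KK G \<times> ss G) UNIV (\<lambda>(k, Y). k \<otimes>\<^bsub>G\<^esub> lie_exp G Y) f) \<and>
     KK G <#>\<^bsub>G\<^esub> AA G <#>\<^bsub>G\<^esub> NN G = UNIV \<and>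
     KK G <#>\<^bsub>G\<^esub> closure (lie_exp G ` aa_plus G) <#>\<^bsub>G\<^esub> KK G = UNIV"

definition weyl_group ::
  "('g::topological_space, 'l::euclidean_space, 'm) cartan_group_scheme \<Rightarrow> 'g set monoid" where
  "weyl_group G =
     (G\<lparr>carrier := {k \<in> KK G. Ad G k ` aa G = aa G}\<rparr>) Mod {k \<in> KK G. \<forall>H\<in>aa G. Ad G k H = H}"

definition weyl_act :: "('g, 'l::euclidean_space, 'm) cartan_group_scheme \<Rightarrow> 'g set \<Rightarrow> 'l \<Rightarrow> 'l" where
  "weyl_act G w H = Ad G (SOME k. k \<in> w) H"

text \<open>\<open>w\<close> acts on \<open>\<aa>\<close> as the reflection in the root \<open>\<alpha>\<close>; \<open>H\<^sub>\<alpha>\<close> is dual to \<open>\<alpha>\<close> under the form.\<close>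

definition is_reflection ::
  "('g, 'l::euclidean_space, 'm) cartan_group_scheme \<Rightarrow> ('l \<Rightarrow> real) \<Rightarrow> 'g set \<Rightarrow> bool" where
  "is_reflection G \<alpha> w \<longleftrightarrow>
     (\<exists>H\<alpha>\<in>aa G. (\<forall>H\<in>aa G. inv_form G H\<alpha> H = \<alpha> H) \<and>
        (\<forall>H\<in>aa G. weyl_act G w H = H - (2 * \<alpha> H / \<alpha> H\<alpha>) *\<^sub>R H\<alpha>))"

definition weyl_subgroup ::
  "('g::topological_space, 'l::euclidean_space, 'm) cartan_group_scheme \<Rightarrow> ('l \<Rightarrow> real) set \<Rightarrow> 'g set set" where
  "weyl_subgroup G \<Theta> =
     generate (weyl_group G) {w \<in> carrier (weyl_group G). \<exists>\<alpha>\<in>\<Theta>. is_reflection G \<alpha> w}"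

definition min_parabolic ::
  "('g::topological_space, 'l::euclidean_space, 'm) cartan_group_scheme \<Rightarrow> 'g set" where
  "min_parabolic G =
     (let pp = span (mm G \<union> aa G \<union> nn G) in {g \<in> carrier G. Ad G g ` pp = pp})"

definition flag_point ::
  "('g::topological_space, 'l::euclidean_space, 'm) cartan_group_scheme \<Rightarrow> 'g \<Rightarrow> 'g set" where
  "flag_point G g = g <#\<^bsub>G\<^esub> min_parabolic G"

definition weyl_flag_point ::
  "('g::topological_space, 'l::euclidean_space, 'm) cartan_group_scheme \<Rightarrow> 'g set \<Rightarrow> 'g set" where
  "weyl_flag_point G w = flag_point G (SOME k. k \<in> w)"

definition Theta :: "('g, 'l, 'm) cartan_group_scheme \<Rightarrow> 'l \<Rightarrow> ('l \<Rightarrow> real) set" where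
  "Theta G H = {\<alpha> \<in> simple_roots G. \<alpha> H = 0}"

definition K_H :: "('g::topological_space, 'l::euclidean_space, 'm) cartan_group_scheme \<Rightarrow> 'l \<Rightarrow> 'g set" where
  "K_H G H = {k \<in> KK G. Ad G k H = H}"

definition N_H_minus ::
  "('g::topological_space, 'l::euclidean_space, 'm) cartan_group_scheme \<Rightarrow> 'l \<Rightarrow> 'g set" where
  "N_H_minus G H = lie_exp G `
     span (\<Union>\<alpha>\<in>pos_roots G - root_span G (Theta G H). root_space G (\<lambda>X. - \<alpha> X))"

text \<open>\<open>st(D, w) = g N_H\<^sup>- K_H w b\<^sub>0\<close> for \<open>D = Ad(g) H\<close>; it does not depend on the choice of \<open>g\<close>.\<close>

definition flag_st ::
  "('g::topological_space, 'l::euclidean_space, 'm) cartan_group_scheme \<Rightarrow> 'l \<Rightarrow> 'l \<Rightarrow> 'g set \<Rightarrow> 'g set set" where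
  "flag_st G H D w =
     {(g \<otimes>\<^bsub>G\<^esub> n \<otimes>\<^bsub>G\<^esub> k) <#\<^bsub>G\<^esub> weyl_flag_point G w | g n k.
        g \<in> carrier G \<and> D = Ad G g H \<and> n \<in> N_H_minus G H \<and> k \<in> K_H G H}"

section \<open>Principal bundles, associated bundles, flows\<close>

definition final_topology :: "('a \<Rightarrow> 'b) \<Rightarrow> 'a topology \<Rightarrow> 'b topology" where
  "final_topology f T =
     topology (\<lambda>V. V \<subseteq> f ` topspace T \<and> openin T {x \<in> topspace T. f x \<in> V})"

lemma openin_final_topology:
  "openin (final_topology f T) V \<longleftrightarrow>
     V \<subseteq> f ` topspace T \<and> openin T {x \<in> topspace T. f x \<in> V}"
proof -
  let ?P = "\<lambda>V. V \<subseteq> f ` topspace T \<and> openin T {x \<in> topspace T. f x \<in> V}"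
  have inter: "?P (A \<inter> B)" if "?P A" "?P B" for A B
  proof -
    have "{x \<in> topspace T. f x \<in> A \<inter> B} = {x \<in> topspace T. f x \<in> A} \<inter> {x \<in> topspace T. f x \<in> B}"
      by auto
    with that show ?thesis by auto
  qed
  have union: "?P (\<Union>\<A>)" if "\<forall>A\<in>\<A>. ?P A" for \<A>
  proof -
    have "{x \<in> topspace T. f x \<in> \<Union>\<A>} = (\<Union>A\<in>\<A>. {x \<in> topspace T. f x \<in> A})"
      by auto
    with that show ?thesis by auto
  qed
  have "istopology ?P"
    unfolding istopology_def using inter union by blast
  then show ?thesis
    by (simp add: final_topology_def topology_inverse')
qed

definition borel_of_topology :: "'a topology \<Rightarrow> 'a measure" where
  "borel_of_topology T = sigma (topspace T) {U. openin T U}"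

definition principal_bundle ::
  "('g::topological_space, 'm) monoid_scheme \<Rightarrow> 'g set \<Rightarrow> 'q::topological_space set \<Rightarrow>
   ('q \<Rightarrow> 'g \<Rightarrow> 'q) \<Rightarrow> ('q \<Rightarrow> 'x::topological_space) \<Rightarrow> bool" where
  "principal_bundle G H R \<rho> \<pi> \<longleftrightarrow>
     (\<forall>p\<in>R. \<forall>g\<in>H. \<rho> p g \<in> R \<and> \<pi> (\<rho> p g) = \<pi> p) \<and>
     (\<forall>p\<in>R. \<rho> p \<one>\<^bsub>G\<^esub> = p) \<and>
     (\<forall>p\<in>R. \<forall>g\<in>H. \<forall>h\<in>H. \<rho> (\<rho> p g) h = \<rho> p (g \<otimes>\<^bsub>G\<^esub> h)) \<and>
     continuous_on (R \<times> H) (\<lambda>(p, g). \<rho> p g) \<and> continuous_on R \<pi> \<and>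
     (\<forall>x. \<exists>U \<Psi> \<Psi>'. open U \<and> x \<in> U \<and> homeomorphism (U \<times> H) (R \<inter> \<pi> -` U) \<Psi> \<Psi>' \<and>
        (\<forall>y\<in>U. \<forall>g\<in>H. \<pi> (\<Psi> (y, g)) = y \<and> (\<forall>h\<in>H. \<rho> (\<Psi> (y, g)) h = \<Psi> (y, g \<otimes>\<^bsub>G\<^esub> h))))"

text \<open>A principal bundle with total space the type \<open>'q\<close> and base the type \<open>'x\<close>, a bundle
  automorphism, and a subbundle \<open>red\<close> of the total space.\<close>

record ('g, 'q, 'x) bundle_flow =
  ract :: "'q \<Rightarrow> 'g \<Rightarrow> 'q"
  proj :: "'q \<Rightarrow> 'x"
  aut :: "'q \<Rightarrow> 'q"
  red :: "'q set"

definition principal_bundle_flow ::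
  "('g::topological_space, 'l::euclidean_space, 'm) cartan_group_scheme \<Rightarrow>
   ('g, 'q::topological_space, 'x::topological_space) bundle_flow \<Rightarrow> bool" where
  "principal_bundle_flow G Q \<longleftrightarrow>
     principal_bundle G (carrier G) UNIV (ract Q) (proj Q) \<and>
     (\<exists>\<psi>. homeomorphism UNIV UNIV (aut Q) \<psi>) \<and>
     (\<forall>p. \<forall>g\<in>carrier G. aut Q (ract Q p g) = ract Q (aut Q p) g) \<and>
     principal_bundle G (KK G) (red Q) (ract Q) (proj Q)"

definition base_map :: "('g, 'q, 'x) bundle_flow \<Rightarrow> 'x \<Rightarrow> 'x" where
  "base_map Q x = proj Q (aut Q (SOME p. proj Q p = x))"

text \<open>Points and topology of the bundle \<open>Q \<times>\<^sub>G V\<close> associated to a left action \<open>\<lambda>\<close> on \<open>V\<close>: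
  \<open>p \<cdot> v\<close> is the class of \<open>(p, v)\<close> under \<open>(p, v) \<sim> (p g, g\<^sup>-\<^sup>1 v)\<close>.\<close>

definition assoc_point ::
  "('g, 'm) monoid_scheme \<Rightarrow> ('g, 'q, 'x) bundle_flow \<Rightarrow> ('g \<Rightarrow> 'v \<Rightarrow> 'v) \<Rightarrow> 'q \<Rightarrow> 'v \<Rightarrow> ('q \<times> 'v) set" where
  "assoc_point G Q act p v = {(ract Q p g, act (inv\<^bsub>G\<^esub> g) v) | g. g \<in> carrier G}"

definition assoc_topology ::
  "('g, 'm) monoid_scheme \<Rightarrow> ('g, 'q::topological_space, 'x) bundle_flow \<Rightarrow> ('g \<Rightarrow> 'v \<Rightarrow> 'v) \<Rightarrow>
   'v topology \<Rightarrow> ('q \<times> 'v) set topology" where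
  "assoc_topology G Q act T =
     final_topology (\<lambda>(p, v). assoc_point G Q act p v) (prod_topology euclidean T)"

definition assoc_proj :: "('g, 'q, 'x) bundle_flow \<Rightarrow> ('q \<times> 'v) set \<Rightarrow> 'x" where
  "assoc_proj Q \<zeta> = proj Q (fst (SOME z. z \<in> \<zeta>))"

definition assoc_map :: "('g, 'q, 'x) bundle_flow \<Rightarrow> ('q \<times> 'v) set \<Rightarrow> ('q \<times> 'v) set" where
  "assoc_map Q \<zeta> = (\<lambda>(p, v). (aut Q p, v)) ` \<zeta>"

abbreviation flag_bundle_point ::
  "('g::topological_space, 'l::euclidean_space, 'm) cartan_group_scheme \<Rightarrow>
   ('g, 'q, 'x) bundle_flow \<Rightarrow> 'q \<Rightarrow> 'g set \<Rightarrow> ('q \<times> 'g set) set" where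
  "flag_bundle_point G Q \<equiv> assoc_point G Q (\<lambda>g b. g <#\<^bsub>G\<^esub> b)"

definition flag_bundle ::
  "('g::topological_space, 'l::euclidean_space, 'm) cartan_group_scheme \<Rightarrow>
   ('g, 'q::topological_space, 'x) bundle_flow \<Rightarrow> ('q \<times> 'g set) set topology" where
  "flag_bundle G Q =
     assoc_topology G Q (\<lambda>g b. g <#\<^bsub>G\<^esub> b) (final_topology (flag_point G) euclidean)"

definition adjoint_orbit_bundle ::
  "('g::topological_space, 'l::euclidean_space, 'm) cartan_group_scheme \<Rightarrow>
   ('g, 'q::topological_space, 'x) bundle_flow \<Rightarrow> 'l \<Rightarrow> ('q \<times> 'l) set topology" where
  "adjoint_orbit_bundle G Q H =
     assoc_topology G Q (Ad G) (top_of_set {Ad G g H | g. g \<in> carrier G})"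

section \<open>Cocycles and the data of the Multiplicative Ergodic Theorem\<close>

definition iwasawa_log ::
  "('g::topological_space, 'l::euclidean_space, 'm) cartan_group_scheme \<Rightarrow>
   ('g, 'q, 'x) bundle_flow \<Rightarrow> nat \<Rightarrow> 'q \<Rightarrow> 'l" where
  "iwasawa_log G Q n r = (THE L. L \<in> aa G \<and>
     (\<exists>r'\<in>red Q. \<exists>u\<in>NN G. (aut Q ^^ n) r = ract Q r' (lie_exp G L \<otimes>\<^bsub>G\<^esub> u)))"

definition flag_cocycle ::
  "('g::topological_space, 'l::euclidean_space, 'm) cartan_group_scheme \<Rightarrow>
   ('g, 'q, 'x) bundle_flow \<Rightarrow> nat \<Rightarrow> ('q \<times> 'g set) set \<Rightarrow> 'l" where
  "flag_cocycle G Q n \<xi> = (THE L. \<exists>r\<in>red Q.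
     \<xi> = flag_bundle_point G Q r (flag_point G \<one>\<^bsub>G\<^esub>) \<and> L = iwasawa_log G Q n r)"

definition polar_log ::
  "('g::topological_space, 'l::euclidean_space, 'm) cartan_group_scheme \<Rightarrow>
   ('g, 'q, 'x) bundle_flow \<Rightarrow> nat \<Rightarrow> 'q \<Rightarrow> 'l" where
  "polar_log G Q n r = (THE L. L \<in> closure (aa_plus G) \<and>
     (\<exists>r'\<in>red Q. \<exists>s\<in>SS G. \<exists>k\<in>KK G.
        (aut Q ^^ n) r = ract Q r' s \<and> s = k \<otimes>\<^bsub>G\<^esub> lie_exp G L \<otimes>\<^bsub>G\<^esub> inv\<^bsub>G\<^esub> k))"

definition section_st ::
  "('g::topological_space, 'l::euclidean_space, 'm) cartan_group_scheme \<Rightarrow>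
   ('g, 'q, 'x) bundle_flow \<Rightarrow> 'l \<Rightarrow> ('q \<times> 'l) set \<Rightarrow> 'g set \<Rightarrow> ('q \<times> 'g set) set set" where
  "section_st G Q H c w =
     {flag_bundle_point G Q p b | p D b. c = assoc_point G Q (Ad G) p D \<and> b \<in> flag_st G H D w}"

definition bundle_st ::
  "('g::topological_space, 'l::euclidean_space, 'm) cartan_group_scheme \<Rightarrow>
   ('g, 'q, 'x) bundle_flow \<Rightarrow> 'x set \<Rightarrow> 'l \<Rightarrow> ('x \<Rightarrow> ('q \<times> 'l) set) \<Rightarrow> 'g set \<Rightarrow>
   ('q \<times> 'g set) set set" where
  "bundle_st G Q \<Omega> H chi w = (\<Union>x\<in>\<Omega>. section_st G Q H (chi x) w)"

definition invariant_measure :: "('a \<Rightarrow> 'a) \<Rightarrow> 'a measure \<Rightarrow> bool" where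
  "invariant_measure T M \<longleftrightarrow> prob_space M \<and> T \<in> measurable M M \<and> distr M M T = M"

definition ergodic_measure :: "('a \<Rightarrow> 'a) \<Rightarrow> 'a measure \<Rightarrow> bool" where
  "ergodic_measure T M \<longleftrightarrow> invariant_measure T M \<and>
     (\<forall>A\<in>sets M. T -` A \<inter> space M = A \<longrightarrow> measure M A = 0 \<or> measure M A = 1)"

text \<open>What the Multiplicative Ergodic Theorem provides: \<open>\<Omega>\<close>, \<open>H = H\<^sub>L\<^sub>y\<close> and \<open>chi = chi\<^sub>L\<^sub>y\<close>.\<close>

definition met_data ::
  "('g::topological_space, 'l::euclidean_space, 'm) cartan_group_scheme \<Rightarrow>
   ('g, 'q::topological_space, 'x) bundle_flow \<Rightarrow> 'x measure \<Rightarrow> 'x set \<Rightarrow> 'l \<Rightarrow>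
   ('x \<Rightarrow> ('q \<times> 'l) set) \<Rightarrow> bool" where
  "met_data G Q \<nu> \<Omega> H chi \<longleftrightarrow>
     \<Omega> \<in> sets \<nu> \<and> measure \<nu> \<Omega> = 1 \<and> H \<in> closure (aa_plus G) \<and>
     (\<forall>r\<in>red Q. proj Q r \<in> \<Omega> \<longrightarrow> (\<lambda>k. polar_log G Q k r /\<^sub>R real k) \<longlonglongrightarrow> H) \<and>
     chi \<in> measurable (restrict_space \<nu> \<Omega>) (borel_of_topology (adjoint_orbit_bundle G Q H)) \<and>
     (\<forall>x\<in>\<Omega>. assoc_proj Q (chi x) = x) \<and>
     (\<forall>x\<in>\<Omega>. base_map Q x \<in> \<Omega> \<longrightarrow> chi (base_map Q x) = assoc_map Q (chi x)) \<and>
     (\<forall>x\<in>\<Omega>. \<forall>w\<in>carrier (weyl_group G). \<forall>\<xi>\<in>section_st G Q H (chi x) w.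
        (\<lambda>k. flag_cocycle G Q k \<xi> /\<^sub>R real k)
          \<longlonglongrightarrow> weyl_act G (inv\<^bsub>weyl_group G\<^esub> w) H)"

text \<open>The full and null values are asked of measurable sets, since \<open>emeasure\<close> is \<open>0\<close> by convention
  on non-measurable ones (so the first clause already implies measurability).\<close>

definition carried_by ::
  "('g::topological_space, 'l::euclidean_space, 'm) cartan_group_scheme \<Rightarrow>
   ('g, 'q, 'x) bundle_flow \<Rightarrow> 'x set \<Rightarrow> 'l \<Rightarrow> ('x \<Rightarrow> ('q \<times> 'l) set) \<Rightarrow>
   ('q \<times> 'g set) set measure \<Rightarrow> 'g set \<Rightarrow> bool" where
  "carried_by G Q \<Omega> H chi \<mu> w \<longleftrightarrow>
     emeasure \<mu> (bundle_st G Q \<Omega> H chi w) = 1 \<and>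
     (\<forall>w'\<in>carrier (weyl_group G).
        weyl_subgroup G (Theta G H) #>\<^bsub>weyl_group G\<^esub> w \<noteq> weyl_subgroup G (Theta G H) #>\<^bsub>weyl_group G\<^esub> w' \<longrightarrow>
        bundle_st G Q \<Omega> H chi w' \<in> sets \<mu> \<and> emeasure \<mu> (bundle_st G Q \<Omega> H chi w') = 0)"

end

theory Submission
  imports Defs
begin

text \<open>
  The strata \<open>st(\<chi>(x), w)\<close> cover the fibre of the flag bundle over \<open>x\<close>, by the Bruhat decomposition
  \<open>G = N\<^sub>H\<^sup>- K\<^sub>H N\<^sub>K(\<aa>) P\<close>, and on \<open>st(\<chi>(x), w)\<close> the averages \<open>a(k, \<xi>) / k\<close> converge to \<open>w\<^sup>-\<^sup>1 H\<close>.
  By Chevalley's theorem the stabilizer of \<open>H\<close> in the Weyl group is generated by the reflections in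
  the simple roots vanishing at \<open>H\<close>, so different cosets \<open>W\<^sub>\<Theta> w\<close> give different limits, while equal
  limits give equal strata. Hence \<open>st(w)\<close> is the part over \<open>\<Omega>\<close> of the invariant measurable set where
  the averages converge to \<open>w\<^sup>-\<^sup>1 H\<close>. There are finitely many of these sets and they cover almost
  everything, so ergodicity singles out one of them. The cocycle \<open>a(k, \<xi>)\<close> is the Birkhoff sum of the
  bounded continuous function \<open>q\<close>, so \<open>\<integral>q d\<mu>\<close> is the integral of \<open>a(k, \<xi>) / k\<close> for every \<open>k > 0\<close>,
  and dominated convergence gives its value.

  On the Lie side, a regular element \<open>H0\<close> of the positive chamber does most of the work: conjugation
  by \<open>exp (- t H0)\<close> contracts \<open>N\<close>, which yields uniqueness and continuity of the Iwasawa projection,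
  and maximising the function \<open>\<langle>Ad k X, H0\<rangle>\<close> over compact or finite orbits yields the
  conjugacy statements behind the Bruhat decomposition and Chevalley's theorem.
\<close>

section \<open>Ordinary differential equations and the operator exponential\<close>

text \<open>\<open>lie_exp\<close> is a \<open>THE\<close> over one-parameter subgroups, and
  \<open>Ad\<close> and \<open>bracket\<close> are derivatives of curves, so each of them has
  meaning only after an existence or differentiability proof in charts; hence the differential
  equations. Root spaces are handled through one orthonormal basis \<open>eb\<close> of joint
  eigenvectors of the operators \<open>bracket G H\<close>, \<open>H\<close> in \<open>aa G\<close>:
  the subspaces that matter have the form \<open>gr H P\<close>, and \<open>Ad (exp H)\<close> is
  diagonal in this basis. Two obstacles shape the Lie part. \<open>G\<close> is only reductive, so
  its Lie algebra may have a centre inside \<open>aa G\<close> that the roots do not see; arguments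
  with roots settle matters up to a central summand, which is removed by uniqueness in
  \<open>G = K S\<close> or by the invariance of central elements under \<open>K\<close>. And
  products of elements of \<open>exp (nn G)\<close> are awkward to control, so \<open>N\<close> is
  replaced by the group \<open>NC\<close> of contracted elements that contains it. On the bundle
  side everything is lifted along \<open>q \<mapsto> q b0\<close> to \<open>Q\<close>, where the
  cocycle is a coboundary and where continuity can be tested.\<close>

lemma gronwall_forward:
  fixes u :: "real \<Rightarrow> 'a::euclidean_space"
  assumes der: "\<And>t. t \<in> {0..T} \<Longrightarrow> (u has_vector_derivative u' t) (at t within {0..T})"
    and bnd: "\<And>t. t \<in> {0..T} \<Longrightarrow> norm (u' t) \<le> L * norm (u t) + \<epsilon>"
    and L: "0 \<le> L" and u0: "u 0 = 0" and t: "t \<in> {0..T}"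
  shows "(norm (u t))\<^sup>2 \<le> \<epsilon>\<^sup>2 * t * exp ((2 * L + 1) * t)"
proof -
  \<comment> \<open>The weight \<open>2 * L\<close> absorbs the linear part of the derivative of
    \<open>u \<bullet> u\<close>; the extra 1 absorbs the cross term
    \<open>2 * \<epsilon> * norm (u s)\<close>, which is at most
    \<open>(norm (u s))\<^sup>2 + \<epsilon>\<^sup>2\<close>. With this \<open>c\<close> the
    function \<open>g\<close> is nonincreasing.\<close>
  define c where "c = 2 * L + 1"
  define g where "g s = (u s \<bullet> u s) * exp (- c * s) - \<epsilon>\<^sup>2 * s" for s
  have contu: "continuous_on {0..T} u"
    using der by (meson continuous_on_vector_derivative)
  have "g t \<le> g 0"
  proof (cases "t = 0")
    case False
    with t have tp: "0 < t" "t \<le> T" by auto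
    show ?thesis
    proof (rule DERIV_nonpos_imp_decreasing_open[where a = 0 and b = t and f = g])
      show "0 \<le> t" using tp by simp
      show "continuous_on {0..t} g"
        unfolding g_def
        by (intro continuous_intros continuous_on_subset[OF contu]) (use tp in auto)
    next
      fix s assume s: "0 < s" "s < t"
      with tp have sT: "s \<in> {0..T}" "s \<in> {0<..<T}" by auto
      have d: "(u has_vector_derivative u' s) (at s)"
        using der[OF sT(1)] sT(2) by (simp add: at_within_Icc_at)
      have du: "(u has_derivative (\<lambda>h. h *\<^sub>R u' s)) (at s)"
        using d by (simp add: has_vector_derivative_def)
      have "((\<lambda>s. u s \<bullet> u s) has_derivative (\<lambda>h. u s \<bullet> (h *\<^sub>R u' s) + (h *\<^sub>R u' s) \<bullet> u s)) (at s)"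
        by (rule has_derivative_inner[OF du du])
      then have d2: "((\<lambda>s. u s \<bullet> u s) has_real_derivative (2 * (u s \<bullet> u' s))) (at s)"
        unfolding has_field_derivative_def
        by (rule has_derivative_eq_rhs) (auto simp: inner_commute algebra_simps)
      have D: "(g has_real_derivative (2 * (u s \<bullet> u' s)) * exp (- c * s)
            + (u s \<bullet> u s) * (exp (- c * s) * (- c)) - \<epsilon>\<^sup>2) (at s)"
        unfolding g_def by (auto intro!: derivative_eq_intros d2)
      have n: "u s \<bullet> u s = (norm (u s))\<^sup>2" by (simp add: power2_norm_eq_inner)
      have "u s \<bullet> u' s \<le> norm (u s) * norm (u' s)" by (rule norm_cauchy_schwarz)
      also have "\<dots> \<le> norm (u s) * (L * norm (u s) + \<epsilon>)"
        by (rule mult_left_mono[OF bnd[OF sT(1)]]) simp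
      finally have a: "2 * (u s \<bullet> u' s) \<le> 2 * L * (norm (u s))\<^sup>2 + 2 * \<epsilon> * norm (u s)"
        by (simp add: power2_eq_square algebra_simps)
      have b: "2 * \<epsilon> * norm (u s) \<le> (norm (u s))\<^sup>2 + \<epsilon>\<^sup>2"
        using sum_squares_bound[of \<epsilon> "norm (u s)"] by (simp add: algebra_simps)
      have ab: "2 * (u s \<bullet> u' s) - c * (norm (u s))\<^sup>2 \<le> \<epsilon>\<^sup>2"
        using a b unfolding c_def by (simp add: algebra_simps)
      show "\<exists>y. (g has_real_derivative y) (at s) \<and> y \<le> 0"
      proof (intro exI conjI, rule D)
        show "(2 * (u s \<bullet> u' s)) * exp (- c * s) + (u s \<bullet> u s) * (exp (- c * s) * (- c)) - \<epsilon>\<^sup>2 \<le> 0"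
        proof -
          have "0 \<le> c" using L unfolding c_def by simp
          then have "0 \<le> c * s" using s by simp
          then have e1: "exp (- c * s) \<le> 1" by simp
          have "(2 * (u s \<bullet> u' s) - c * (norm (u s))\<^sup>2) * exp (- c * s) \<le> \<epsilon>\<^sup>2 * exp (- c * s)"
            using ab by (intro mult_right_mono) auto
          also have "\<dots> \<le> \<epsilon>\<^sup>2 * 1" using e1 by (intro mult_left_mono) auto
          finally show ?thesis by (simp add: n algebra_simps)
        qed
      qed
    qed
  qed simp
  then have "(u t \<bullet> u t) * exp (- c * t) \<le> \<epsilon>\<^sup>2 * t" unfolding g_def by (simp add: u0)
  then have "(u t \<bullet> u t) * exp (- c * t) * exp (c * t) \<le> \<epsilon>\<^sup>2 * t * exp (c * t)"
    by (intro mult_right_mono) auto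
  moreover have "exp (- c * t) * exp (c * t) = 1" by (simp flip: exp_add)
  ultimately have "u t \<bullet> u t \<le> \<epsilon>\<^sup>2 * t * exp (c * t)"
    by (simp only: mult.assoc mult_1_right)
  then show ?thesis by (simp add: power2_norm_eq_inner c_def)
qed

text \<open>The case \<open>\<epsilon> = 0\<close>, two-sided: negative times are reached by
  reversing time. It is applied to differences of two solutions, so it serves as a uniqueness
  theorem.\<close>

lemma gronwall_zero:
  fixes u :: "real \<Rightarrow> 'a::euclidean_space"
  assumes der: "\<And>t. t \<in> {-T..T} \<Longrightarrow> (u has_vector_derivative u' t) (at t within {-T..T})"
    and bnd: "\<And>t. t \<in> {-T..T} \<Longrightarrow> norm (u' t) \<le> L * norm (u t)"
    and L: "0 \<le> L" and u0: "u 0 = 0" and t: "t \<in> {-T..T}"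
  shows "u t = 0"
proof (cases "0 \<le> t")
  case True
  have "(norm (u t))\<^sup>2 \<le> 0\<^sup>2 * t * exp ((2 * L + 1) * t)"
  proof (rule gronwall_forward[where u' = u' and T = T])
    show "(u has_vector_derivative u' s) (at s within {0..T})" if "s \<in> {0..T}" for s
      using that by (intro has_vector_derivative_within_subset[OF der]) auto
  qed (use True t L u0 bnd in auto)
  then show ?thesis by simp
next
  case False
  have "(norm (u (- (- t))))\<^sup>2 \<le> 0\<^sup>2 * (- t) * exp ((2 * L + 1) * (- t))"
  proof (rule gronwall_forward[where u' = "\<lambda>s. - u' (- s)" and T = T and u = "\<lambda>s. u (- s)"])
    show "((\<lambda>s. u (- s)) has_vector_derivative - u' (- s)) (at s within {0..T})" if "s \<in> {0..T}" for s
    proof -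
      have "(u has_vector_derivative u' (- s)) (at (- s) within uminus ` {0..T})"
        using that by (intro has_vector_derivative_within_subset[OF der]) auto
      moreover have "(uminus has_vector_derivative -1) (at s within {0..T})"
        by (auto intro!: derivative_eq_intros)
      ultimately have "((u \<circ> uminus) has_vector_derivative (-1) *\<^sub>R u' (- s)) (at s within {0..T})"
        by (intro vector_diff_chain_within) auto
      then show ?thesis by (simp add: o_def)
    qed
  qed (use False t L u0 bnd in auto)
  then show ?thesis by simp
qed

text \<open>The integral operator is a contraction with factor 1/2: both integrals in
  \<open>J\<close> run over an interval of length at most \<open>2 * T\<close>, so their difference
  is at most \<open>4 * L * T\<close> times the distance.\<close>

lemma picard:
  fixes f :: "'a::euclidean_space \<Rightarrow> 'a"
  assumes lip: "\<And>x y. norm (f x - f y) \<le> L * norm (x - y)"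
    and bd: "\<And>x. norm (f x) \<le> M" and T: "0 < T" and LT: "8 * L * T \<le> 1" and L: "0 \<le> L"
  shows "\<exists>x. x 0 = x0 \<and> (\<forall>t\<in>{-T..T}. (x has_vector_derivative f (x t)) (at t within {-T..T}))"
proof -
  have contf: "continuous_on UNIV f"
    by (rule lipschitz_on_continuous_on[of L]) (auto intro!: lipschitz_onI lip L simp: dist_norm)
  \<comment> \<open>Clamping the time to \<open>[-T, T]\<close> turns every iterate into a bounded
    continuous function on the whole line, so that Banach's theorem applies in the complete space of
    bounded continuous functions.\<close>
  define cl :: "real \<Rightarrow> real" where "cl t = max (-T) (min T t)" for t
  have cl_in: "cl t \<in> {-T..T}" for t using T unfolding cl_def by auto
  have cl_id: "cl t = t" if "t \<in> {-T..T}" for t using that unfolding cl_def by auto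
  have cl_cont: "continuous_on UNIV cl" unfolding cl_def by (intro continuous_intros)
  \<comment> \<open>The signed integral from 0 to \<open>t\<close>, written with base point
    \<open>-T\<close> so that negative \<open>t\<close> needs no separate case.\<close>
  define J where "J x t = integral {-T..t} (\<lambda>s. f (x s)) - integral {-T..0} (\<lambda>s. f (x s))"
    for x :: "real \<Rightarrow> 'a" and t
  define \<Phi> where "\<Phi> x t = x0 + J x (cl t)" for x t
  have intf: "(\<lambda>s. f (x s)) integrable_on {-T..t}" if "continuous_on UNIV x" "t \<le> T" for x t
    by (intro integrable_continuous_interval continuous_on_compose2[OF contf]
        continuous_on_subset[OF that(1)]) auto
  have Jcont: "continuous_on {-T..T} (J x)" if "continuous_on UNIV x" for x
    unfolding J_def
    by (intro continuous_intros indefinite_integral_continuous_1 intf that) auto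
  have \<Phi>cont: "continuous_on UNIV (\<Phi> x)" if "continuous_on UNIV x" for x
    unfolding \<Phi>_def
    by (intro continuous_intros continuous_on_compose2[OF Jcont[OF that] cl_cont]) (use cl_in in auto)
  have \<Phi>bdd: "bounded (range (\<Phi> x))" if "continuous_on UNIV x" for x
  proof -
    have "bounded (J x ` {-T..T})"
      by (intro compact_imp_bounded compact_continuous_image Jcont that) auto
    then have "bounded ((+) x0 ` J x ` {-T..T})" by (rule bounded_translation)
    then show ?thesis by (rule bounded_subset) (auto simp: \<Phi>_def image_image intro!: imageI cl_in)
  qed
  define \<Psi> :: "(real \<Rightarrow>\<^sub>C 'a) \<Rightarrow> (real \<Rightarrow>\<^sub>C 'a)" where "\<Psi> x = Bcontfun (\<Phi> x)" for x
  have contx: "continuous_on UNIV (apply_bcontfun x)" for x :: "real \<Rightarrow>\<^sub>C 'a"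
    using apply_bcontfun[of x] by (simp add: bcontfun_def)
  have \<Psi>app: "apply_bcontfun (\<Psi> x) t = \<Phi> x t" for x t
    unfolding \<Psi>_def using \<Phi>cont[OF contx] \<Phi>bdd[OF contx]
    by (subst Bcontfun_inverse) (auto simp: bcontfun_def)
  have Jdiff: "norm (J x t - J y t) \<le> (1/2) * d"
    if c: "continuous_on UNIV x" "continuous_on UNIV y" and d: "\<And>s. norm (x s - y s) \<le> d"
      and t: "t \<in> {-T..T}" for x y t d
  proof -
    have d0: "0 \<le> d" using d[of 0] norm_ge_zero order_trans by blast
    have *: "norm (integral {-T..r} (\<lambda>s. f (x s)) - integral {-T..r} (\<lambda>s. f (y s))) \<le> L * d * (r + T)"
      if r: "r \<in> {-T..T}" for r
    proof -
      have "integral {-T..r} (\<lambda>s. f (x s)) - integral {-T..r} (\<lambda>s. f (y s))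
          = integral {-T..r} (\<lambda>s. f (x s) - f (y s))"
        using r by (intro Henstock_Kurzweil_Integration.integral_diff[symmetric] intf c) auto
      moreover have "norm (integral {-T..r} (\<lambda>s. f (x s) - f (y s))) \<le> L * d * (r - (-T))"
      proof (rule integral_bound)
        show "continuous_on {-T..r} (\<lambda>s. f (x s) - f (y s))"
          by (intro continuous_intros continuous_on_compose2[OF contf]
              continuous_on_subset[OF c(1)] continuous_on_subset[OF c(2)]) auto
        show "norm (f (x s) - f (y s)) \<le> L * d" for s
          using lip[of "x s" "y s"] mult_left_mono[OF d[of s] L] by linarith
      qed (use r in auto)
      ultimately show ?thesis by simp
    qed
    have "norm (J x t - J y t) \<le> norm (integral {-T..t} (\<lambda>s. f (x s)) - integral {-T..t} (\<lambda>s. f (y s)))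
       + norm (integral {-T..0} (\<lambda>s. f (x s)) - integral {-T..0} (\<lambda>s. f (y s)))"
      unfolding J_def by (rule order_trans[OF eq_refl norm_triangle_ineq4]) (simp add: algebra_simps)
    also have "\<dots> \<le> L * d * (t + T) + L * d * (0 + T)"
      by (intro add_mono *) (use t T in auto)
    also have "\<dots> \<le> L * d * (T + T) + L * d * (T + T)"
      by (intro add_mono mult_left_mono mult_nonneg_nonneg L d0) (use t T in auto)
    also have "\<dots> = (8 * L * T) * d / 2" by (simp add: algebra_simps)
    also have "\<dots> \<le> 1 * d / 2" by (intro divide_right_mono mult_right_mono[OF LT d0]) auto
    finally show ?thesis by simp
  qed
  have "\<exists>!x. \<Psi> x = x"
  proof (rule banach_fix_type[of "1/2"])
    show "\<forall>x y. dist (\<Psi> x) (\<Psi> y) \<le> 1/2 * dist x y"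
    proof (intro allI dist_bound)
      fix x y t
      have "dist (\<Psi> x t) (\<Psi> y t) = norm (J x (cl t) - J y (cl t))"
        by (simp add: \<Psi>app \<Phi>_def dist_norm)
      also have "\<dots> \<le> 1/2 * dist x y"
        by (rule Jdiff[OF contx contx _ cl_in]) (metis dist_bounded dist_norm)
      finally show "dist (\<Psi> x t) (\<Psi> y t) \<le> 1/2 * dist x y" .
    qed
  qed auto
  then obtain z where z: "\<Psi> z = z" by auto
  have zt: "apply_bcontfun z t = x0 + J z (cl t)" for t
    using \<Psi>app[of z t] z by (simp add: \<Phi>_def)
  show ?thesis
  proof (intro exI[of _ "apply_bcontfun z"] conjI ballI)
    show "apply_bcontfun z 0 = x0" using T zt[of 0] cl_id[of 0] J_def[of z 0] by simp
    fix t assume t: "t \<in> {-T..T}"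
    have "((\<lambda>t. integral {-T..t} (\<lambda>s. f (z s))) has_vector_derivative f (z t)) (at t within {-T..T})"
      by (intro integral_has_vector_derivative t continuous_on_compose2[OF contf]
          continuous_on_subset[OF contx]) auto
    then have "((\<lambda>t. x0 + J z t) has_vector_derivative f (z t)) (at t within {-T..T})"
      unfolding J_def by (auto intro!: derivative_eq_intros)
    then show "(z has_vector_derivative f (z t)) (at t within {-T..T})"
      by (rule has_vector_derivative_transform[OF t, rotated]) (metis zt cl_id)
  qed
qed

section \<open>The exponential of a linear operator\<close>

definition mexp :: "('a::euclidean_space \<Rightarrow> 'a) \<Rightarrow> 'a \<Rightarrow> 'a" where
  "mexp A x = (\<Sum>n. (A ^^ n) x /\<^sub>R fact n)"

lemma linear_funpow:
  fixes A :: "'a::real_vector \<Rightarrow> 'a"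
  shows "linear A \<Longrightarrow> linear (A ^^ n)"
  by (induction n) (auto simp: linear_id id_def[symmetric] intro: linear_compose)

lemma funpow_norm_le:
  fixes A :: "'a::real_normed_vector \<Rightarrow> 'a"
  assumes "\<And>x. norm (A x) \<le> K * norm x" "0 \<le> K"
  shows "norm ((A ^^ n) x) \<le> K ^ n * norm x"
proof (induction n)
  case (Suc n)
  have "norm ((A ^^ Suc n) x) \<le> K * norm ((A ^^ n) x)" using assms(1) by simp
  also have "\<dots> \<le> K * (K ^ n * norm x)" by (rule mult_left_mono[OF Suc assms(2)])
  finally show ?case by (simp add: mult.assoc)
qed simp

lemma exp_series_sums: "(\<lambda>n. K ^ n / fact n) sums exp (K::real)"
  using exp_converges[of K] by (simp add: divide_inverse mult.commute scaleR_conv_of_real)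

lemma exp_series_mult_sums: "(\<lambda>n. K ^ n / fact n * c) sums (exp K * (c::real))"
  by (rule sums_mult2[OF exp_series_sums])

context
  fixes A :: "'a::euclidean_space \<Rightarrow> 'a" and K :: real
  assumes A: "linear A" and K: "\<And>x. norm (A x) \<le> K * norm x" "0 \<le> K"
begin

lemma mexp_term_le: "norm ((A ^^ n) x /\<^sub>R fact n) \<le> K ^ n / fact n * norm x"
proof -
  have "norm ((A ^^ n) x /\<^sub>R fact n) = norm ((A ^^ n) x) / fact n"
    by (simp add: divide_inverse)
  also have "\<dots> \<le> (K ^ n * norm x) / fact n"
    by (intro divide_right_mono funpow_norm_le K) auto
  finally show ?thesis by simp
qed

lemma mexp_summable_norm: "summable (\<lambda>n. norm ((A ^^ n) x /\<^sub>R fact n))"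
proof (rule summable_comparison_test')
  show "summable (\<lambda>n. K ^ n / fact n * norm x)"
    by (rule sums_summable[OF exp_series_mult_sums])
qed (use mexp_term_le in auto)

lemma mexp_summable: "summable (\<lambda>n. (A ^^ n) x /\<^sub>R fact n)"
  by (rule summable_norm_cancel[OF mexp_summable_norm])

lemma mexp_sums: "(\<lambda>n. (A ^^ n) x /\<^sub>R fact n) sums mexp A x"
  unfolding mexp_def using mexp_summable by (rule summable_sums)

lemma mexp_linear: "linear (mexp A)"
proof (rule linearI)
  note lf = linear_funpow[OF A]
  fix x y r
  show "mexp A (x + y) = mexp A x + mexp A y"
    using sums_add[OF mexp_sums mexp_sums, of x y] mexp_sums[of "x + y"]
    by (simp add: linear_add[OF lf] scaleR_right_distrib sums_iff)
  show "mexp A (r *\<^sub>R x) = r *\<^sub>R mexp A x"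
    by (rule sums_unique2[OF mexp_sums])
       (use sums_scaleR_right[OF mexp_sums, of r x] in \<open>simp add: linear_scale[OF lf] mult.commute\<close>)
qed

lemma mexp_intertwine:
  assumes "linear c" "\<And>x. c (A x) = A' (c x)"
  shows "c (mexp A x) = mexp A' (c x)"
proof -
  have "bounded_linear c" using assms(1) linear_conv_bounded_linear by blast
  then have "(\<lambda>n. c ((A ^^ n) x /\<^sub>R fact n)) sums c (mexp A x)"
    by (rule bounded_linear.sums[OF _ mexp_sums])
  moreover have "c ((A ^^ n) x) = (A' ^^ n) (c x)" for n
    by (induction n) (auto simp: assms(2))
  ultimately show ?thesis by (simp add: mexp_def sums_iff linear_scale[OF assms(1)])
qed

lemma mexp_invariant:
  assumes S: "subspace S" "\<And>x. x \<in> S \<Longrightarrow> A x \<in> S" and x: "x \<in> S"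
  shows "mexp A x \<in> S"
proof -
  have *: "(A ^^ n) x \<in> S" for n by (induction n) (auto simp: x S(2))
  have "(\<lambda>n. \<Sum>i<n. (A ^^ i) x /\<^sub>R fact i) \<longlonglongrightarrow> mexp A x"
    using mexp_sums[of x] by (simp add: sums_def)
  then show ?thesis
    by (rule Lim_in_closed_set[OF closed_subspace[OF S(1)], rotated 2])
       (auto intro!: always_eventually subspace_sum subspace_scale S(1) *)
qed

lemma mexp_eigen:
  assumes "A x = r *\<^sub>R x"
  shows "mexp A x = exp r *\<^sub>R x"
proof -
  have *: "(A ^^ n) x = r ^ n *\<^sub>R x" for n
    by (induction n) (auto simp: assms linear_scale[OF A])
  have "(\<lambda>n. (r ^ n / fact n) *\<^sub>R x) sums (exp r *\<^sub>R x)"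
    by (rule sums_scaleR_left[OF exp_series_sums])
  with mexp_sums[of x] show ?thesis by (simp add: * sums_iff divide_inverse mult.commute)
qed

text \<open>Shifting the series by two terms and using \<open>fact n \<le> fact (n + 2)\<close>
  leaves \<open>K\<^sup>2\<close> times the exponential series. It gives the derivative at 0 of the
  orbit map \<open>Z \<mapsto> Ad (exp Z) H\<close>.\<close>

lemma mexp_second_order: "norm (mexp A x - x - A x) \<le> K\<^sup>2 * exp K * norm x"
proof -
  have tail: "norm (\<Sum>n. (A ^^ (n + m)) x /\<^sub>R fact (n + m)) \<le> K ^ m * exp K * norm x" for m
  proof -
    have "norm ((A ^^ (n + m)) x /\<^sub>R fact (n + m)) \<le> K ^ n / fact n * (K ^ m * norm x)" for n
    proof -
      have "norm ((A ^^ (n + m)) x /\<^sub>R fact (n + m)) \<le> K ^ (n + m) / fact (n + m) * norm x"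
        by (rule mexp_term_le)
      also have "\<dots> \<le> K ^ (n + m) / fact n * norm x"
        by (intro mult_right_mono divide_left_mono fact_mono) (auto simp: K(2))
      finally show ?thesis by (simp add: power_add algebra_simps)
    qed
    then have "norm (\<Sum>n. (A ^^ (n + m)) x /\<^sub>R fact (n + m)) \<le> (\<Sum>n. K ^ n / fact n * (K ^ m * norm x))"
      by (rule norm_suminf_le) (rule sums_summable[OF exp_series_mult_sums])
    also have "\<dots> = exp K * (K ^ m * norm x)"
      by (rule sums_unique[symmetric, OF exp_series_mult_sums])
    finally show ?thesis by (simp add: algebra_simps)
  qed
  have split: "mexp A x = (\<Sum>n. (A ^^ (n + m)) x /\<^sub>R fact (n + m)) + (\<Sum>n<m. (A ^^ n) x /\<^sub>R fact n)" for m
    unfolding mexp_def by (rule suminf_split_initial_segment[OF mexp_summable])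
  show "norm (mexp A x - x - A x) \<le> K\<^sup>2 * exp K * norm x"
  proof -
    have "{..<2::nat} = {0, 1}" by auto
    then have "(\<Sum>n<2. (A ^^ n) x /\<^sub>R fact n) = x + A x" by simp
    with split[of 2] have "mexp A x - x - A x = (\<Sum>n. (A ^^ (n + 2)) x /\<^sub>R fact (n + 2))"
      by (metis add_diff_cancel_right' diff_diff_add)
    then show ?thesis using tail[of 2] by (simp only:)
  qed
qed

end

context
  fixes A :: "'a::euclidean_space \<Rightarrow> 'a" and K :: real
  assumes A: "linear A" and K: "\<And>x. norm (A x) \<le> K * norm x" "0 \<le> K"
begin

text \<open>Powers are compared by the telescoping step \<open>A (A^n - B^n) + (A - B) B^n\<close>;
  the factor \<open>n\<close> that accumulates cancels against the factorial. The estimate makes the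
  exponential continuous in its operator.\<close>

lemma mexp_lipschitz:
  assumes B: "linear B" "\<And>x. norm (B x) \<le> K * norm x" and d: "\<And>x. norm (A x - B x) \<le> \<delta> * norm x"
  shows "norm (mexp A x - mexp B x) \<le> \<delta> * exp K * norm x"
proof -
  have d0: "0 \<le> \<delta> * norm y" for y :: 'a
    using order_trans[OF norm_ge_zero d[of y]] .
  have pw: "norm ((A ^^ n) x - (B ^^ n) x) \<le> real n * \<delta> * K ^ (n - 1) * norm x" for n
  proof (induction n)
    case (Suc n)
    have "(A ^^ Suc n) x - (B ^^ Suc n) x = A ((A ^^ n) x - (B ^^ n) x) + (A ((B ^^ n) x) - B ((B ^^ n) x))"
      unfolding linear_diff[OF A] funpow.simps o_apply by (metis add_diff_eq diff_add_cancel)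
    also have "norm \<dots> \<le> K * norm ((A ^^ n) x - (B ^^ n) x) + \<delta> * norm ((B ^^ n) x)"
      by (rule norm_triangle_le[OF add_mono[OF K(1) d]])
    also have "\<dots> \<le> K * (real n * \<delta> * K ^ (n - 1) * norm x) + \<delta> * (K ^ n * norm x)"
    proof (rule add_mono)
      show "K * norm ((A ^^ n) x - (B ^^ n) x) \<le> K * (real n * \<delta> * K ^ (n - 1) * norm x)"
        by (rule mult_left_mono[OF Suc K(2)])
      show "\<delta> * norm ((B ^^ n) x) \<le> \<delta> * (K ^ n * norm x)"
      proof (cases "\<delta> \<ge> 0")
        case True
        show ?thesis by (rule mult_left_mono[OF funpow_norm_le[OF B(2) K(2)] True])
      next
        case False
        then have z: "y = 0" for y :: 'a using d0[of y] mult_neg_pos[of \<delta> "norm y"] by (cases "y = 0") auto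
        show ?thesis using z[of "(B ^^ n) x"] z[of x] by (metis norm_zero mult_zero_right order_refl)
      qed
    qed
    also have "\<dots> = real (Suc n) * \<delta> * K ^ n * norm x"
      by (cases n) (auto simp: algebra_simps)
    finally show ?case by simp
  qed simp
  have tm: "norm ((A ^^ n) x /\<^sub>R fact n - (B ^^ n) x /\<^sub>R fact n)
      \<le> (if n = 0 then 0 else K ^ (n - 1) / fact (n - 1)) * (\<delta> * norm x)" for n
  proof -
    have "norm ((A ^^ n) x /\<^sub>R fact n - (B ^^ n) x /\<^sub>R fact n) = norm ((A ^^ n) x - (B ^^ n) x) / fact n"
      by (simp add: scaleR_diff_right[symmetric] divide_inverse)
    also have "\<dots> \<le> (real n * \<delta> * K ^ (n - 1) * norm x) / fact n"
      by (rule divide_right_mono[OF pw]) simp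
    also have "\<dots> = (if n = 0 then 0 else K ^ (n - 1) / fact (n - 1)) * (\<delta> * norm x)"
      by (cases n) (simp_all add: fact_Suc del: of_nat_Suc)
    finally show ?thesis .
  qed
  have s: "(\<lambda>n. if n = 0 then 0 else K ^ (n - 1) / fact (n - 1)) sums exp K"
    by (rule sums_Suc_imp) (use exp_series_sums[of K] in auto)
  have "norm (\<Sum>n. (A ^^ n) x /\<^sub>R fact n - (B ^^ n) x /\<^sub>R fact n)
     \<le> (\<Sum>n. (if n = 0 then 0 else K ^ (n - 1) / fact (n - 1)) * (\<delta> * norm x))"
    using tm by (rule norm_suminf_le) (rule sums_summable[OF sums_mult2[OF s]])
  also have "\<dots> = exp K * (\<delta> * norm x)"
    by (rule sums_unique[symmetric, OF sums_mult2[OF s]])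
  also have "(\<Sum>n. (A ^^ n) x /\<^sub>R fact n - (B ^^ n) x /\<^sub>R fact n) = mexp A x - mexp B x"
    unfolding mexp_def
    by (rule suminf_diff[symmetric]) (intro mexp_summable[OF A K] mexp_summable[OF B K(2)])+
  finally show ?thesis by (simp add: algebra_simps)
qed

end

lemma linear_bound:
  fixes A :: "'a::euclidean_space \<Rightarrow> 'a"
  assumes "linear A"
  obtains K where "0 \<le> K" "\<And>x. norm (A x) \<le> K * norm x"
  using linear_bounded_pos[OF assms] by (metis less_imp_le mult.commute)

context
  fixes A :: "'a::euclidean_space \<Rightarrow> 'a"
  assumes A: "linear A"
begin

lemma linear_mexp: "linear (mexp A)"
  using linear_bound[OF A] mexp_linear[OF A] by metis

lemma mexp_in_subspace:
  "subspace S \<Longrightarrow> (\<And>x. x \<in> S \<Longrightarrow> A x \<in> S) \<Longrightarrow> x \<in> S \<Longrightarrow> mexp A x \<in> S"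
  using linear_bound[OF A] mexp_invariant[OF A] by metis

lemma mexp_eigenvector: "A x = r *\<^sub>R x \<Longrightarrow> mexp A x = exp r *\<^sub>R x"
  using linear_bound[OF A] mexp_eigen[OF A] by metis

lemma mexp_kernel: "A x = 0 \<Longrightarrow> mexp A x = x"
  using mexp_eigenvector[of x 0] by simp

lemma mexp_conj: "linear c \<Longrightarrow> (\<And>x. c (A x) = A' (c x)) \<Longrightarrow> c (mexp A x) = mexp A' (c x)"
  using linear_bound[OF A] mexp_intertwine[OF A] by metis

lemma linear_scaled: "linear (\<lambda>y. (t::real) *\<^sub>R A y)"
  using A by (rule linear_compose_scale_right)

text \<open>Paired with a basis vector, the curve is a scalar power series in \<open>t\<close>, for
  which termwise differentiation is available; the components are then assembled.\<close>

lemma mexp_has_vector_derivative: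
  "((\<lambda>t. mexp (\<lambda>y. t *\<^sub>R A y) x) has_vector_derivative A (mexp (\<lambda>y. t *\<^sub>R A y) x)) (at t within S)"
proof -
  obtain K where K: "0 \<le> K" "\<And>x. norm (A x) \<le> K * norm x" using linear_bound[OF A] by blast
  have pw: "((\<lambda>y. t *\<^sub>R A y) ^^ n) x = t ^ n *\<^sub>R (A ^^ n) x" for t n x
    by (induction n) (auto simp: linear_scale[OF A])
  have sm: "(\<lambda>n. ((A ^^ n) x \<bullet> b / fact n) * t ^ n) sums (mexp (\<lambda>y. t *\<^sub>R A y) x \<bullet> b)" for t x b
  proof -
    have "norm (t *\<^sub>R A y) \<le> (\<bar>t\<bar> * K) * norm y" for y
      using mult_left_mono[OF K(2)[of y], of "\<bar>t\<bar>"] by (simp add: mult.assoc)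
    then have "(\<lambda>n. ((\<lambda>y. t *\<^sub>R A y) ^^ n) x /\<^sub>R fact n) sums mexp (\<lambda>y. t *\<^sub>R A y) x"
      using K by (intro mexp_sums[OF linear_scaled, where K = "\<bar>t\<bar> * K"]) auto
    then have "(\<lambda>n. (((\<lambda>y. t *\<^sub>R A y) ^^ n) x /\<^sub>R fact n) \<bullet> b) sums (mexp (\<lambda>y. t *\<^sub>R A y) x \<bullet> b)"
      by (rule bounded_linear.sums[OF bounded_linear_inner_left])
    then show ?thesis by (simp add: pw divide_inverse mult_ac)
  qed
  have d: "((\<lambda>t. mexp (\<lambda>y. t *\<^sub>R A y) x \<bullet> b) has_real_derivative A (mexp (\<lambda>y. t *\<^sub>R A y) x) \<bullet> b) (at t)" for b
  proof -
    define c where "c n = (A ^^ n) x \<bullet> b / fact n" for n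
    have "DERIV (\<lambda>t. \<Sum>n. c n * t ^ n) t :> (\<Sum>n. diffs c n * t ^ n)"
      using sm by (intro termdiffs_strong_converges_everywhere) (auto simp: c_def sums_iff)
    moreover have "diffs c n = (A ^^ n) (A x) \<bullet> b / fact n" for n
      by (simp add: diffs_def c_def funpow_swap1 fact_Suc del: of_nat_Suc)
    ultimately have "DERIV (\<lambda>t. mexp (\<lambda>y. t *\<^sub>R A y) x \<bullet> b) t :> mexp (\<lambda>y. t *\<^sub>R A y) (A x) \<bullet> b"
      using sm[of x b] sm[of "A x" b] by (simp add: c_def sums_iff)
    moreover have "A (mexp (\<lambda>y. t *\<^sub>R A y) x) = mexp (\<lambda>y. t *\<^sub>R A y) (A x)"
    proof -
      have "norm (t *\<^sub>R A y) \<le> (\<bar>t\<bar> * K) * norm y" for y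
        using mult_left_mono[OF K(2)[of y], of "\<bar>t\<bar>"] by (simp add: mult.assoc)
      then show ?thesis using K
        by (intro mexp_intertwine[OF linear_scaled, where K = "\<bar>t\<bar> * K"] A) (auto simp: linear_scale[OF A])
    qed
    ultimately show ?thesis by simp
  qed
  have "((\<lambda>t. mexp (\<lambda>y. t *\<^sub>R A y) x) has_vector_derivative A (mexp (\<lambda>y. t *\<^sub>R A y) x)) (at t)"
    unfolding has_vector_derivative_def
    by (subst has_derivative_componentwise_within)
       (use d in \<open>auto simp: has_field_derivative_def intro!: has_derivative_eq_rhs[OF d[unfolded has_field_derivative_def]]\<close>)
  then show ?thesis by (rule has_vector_derivative_at_within)
qed

text \<open>Gronwall for the difference with the exponential solution. Identities about
  \<open>Ad (exp X)\<close> are proved by checking that a curve solves such an equation.\<close>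

lemma linear_ode_unique:
  assumes "\<And>t. (c has_vector_derivative A (c t)) (at t)"
  shows "c t = mexp (\<lambda>y. t *\<^sub>R A y) (c 0)"
proof -
  obtain K where K: "0 \<le> K" "\<And>x. norm (A x) \<le> K * norm x" using linear_bound[OF A] by blast
  define u where "u s = c s - mexp (\<lambda>y. s *\<^sub>R A y) (c 0)" for s
  have "u t = 0"
  proof (rule gronwall_zero[where u' = "\<lambda>s. A (u s)" and T = "\<bar>t\<bar>" and L = K])
    show "(u has_vector_derivative A (u s)) (at s within {-\<bar>t\<bar>..\<bar>t\<bar>})" for s
      unfolding u_def linear_diff[OF A]
      by (intro has_vector_derivative_diff mexp_has_vector_derivative
          has_vector_derivative_at_within[OF assms])
    have z: "linear (\<lambda>y. 0 :: 'a)" by (simp add: linear_iff)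
    have "mexp (\<lambda>y. 0) (c 0) = c 0"
      using mexp_eigen[OF z, where K = 0 and x = "c 0" and r = 0] by simp
    then show "u 0 = 0" unfolding u_def by simp
  qed (use K in auto)
  then show ?thesis by (simp add: u_def)
qed

lemma mexp_add: "mexp (\<lambda>y. (s + t) *\<^sub>R A y) x = mexp (\<lambda>y. s *\<^sub>R A y) (mexp (\<lambda>y. t *\<^sub>R A y) x)"
proof -
  define c where "c r = mexp (\<lambda>y. (r + t) *\<^sub>R A y) x" for r
  have "(c has_vector_derivative A (c r)) (at r)" for r
  proof -
    have "((\<lambda>r. r + t) has_vector_derivative 1) (at r)" by (auto intro!: derivative_eq_intros)
    then have "((\<lambda>s. mexp (\<lambda>y. s *\<^sub>R A y) x) \<circ> (\<lambda>r. r + t) has_vector_derivative 1 *\<^sub>R A (c r)) (at r)"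
      unfolding c_def by (intro vector_diff_chain_at mexp_has_vector_derivative)
    then show ?thesis by (simp add: c_def[abs_def] o_def)
  qed
  from linear_ode_unique[OF this, of s] show ?thesis by (simp add: c_def)
qed

lemma mexp_zero: "mexp (\<lambda>y. 0 *\<^sub>R A y) x = x"
  using mexp_eigen[of "\<lambda>y. 0" 0 x 0] by (simp add: linear_iff)

end

section \<open>One-parameter subgroups and the adjoint representation\<close>

lemma smooth_on_differentiable: "smooth_on U f \<Longrightarrow> x \<in> U \<Longrightarrow> f differentiable (at x)"
  unfolding smooth_on_def by (metis C_diff_on.simps(2))

lemma smooth_on_has_derivative:
  "smooth_on U f \<Longrightarrow> x \<in> U \<Longrightarrow> (f has_derivative frechet_derivative f (at x)) (at x)"
  using smooth_on_differentiable frechet_derivative_works by blast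

lemma smooth_on_derivative: "smooth_on U f \<Longrightarrow> smooth_on U (\<lambda>x. frechet_derivative f (at x) v)"
  unfolding smooth_on_def by (metis C_diff_on.simps(2))

lemma smooth_on_continuous: "smooth_on U f \<Longrightarrow> continuous_on U f"
  unfolding smooth_on_def by (metis C_diff_on.simps(1))

lemma smooth_on_open: "smooth_on U f \<Longrightarrow> open U"
  by (simp add: smooth_on_def)

text \<open>The directional derivatives along the basis are continuous, hence bounded on
  \<open>K\<close>; convexity then allows the mean value inequality.\<close>

lemma smooth_on_lipschitz:
  assumes f: "smooth_on U f" and K: "compact K" "convex K" "K \<subseteq> U"
  obtains L where "0 \<le> L" "\<And>x y. x \<in> K \<Longrightarrow> y \<in> K \<Longrightarrow> norm (f x - f y) \<le> L * norm (x - y)"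
proof -
  let ?f' = "\<lambda>x. frechet_derivative f (at x)"
  have "continuous_on K (\<lambda>x. \<Sum>b\<in>Basis. norm (?f' x b))"
    by (intro continuous_intros continuous_on_subset[OF smooth_on_continuous[OF smooth_on_derivative[OF f]] K(3)])
  then have "bounded ((\<lambda>x. \<Sum>b\<in>Basis. norm (?f' x b)) ` K)"
    by (intro compact_imp_bounded compact_continuous_image K)
  then obtain L where L: "\<And>x. x \<in> K \<Longrightarrow> (\<Sum>b\<in>Basis. norm (?f' x b)) \<le> L"
    by (auto simp: bounded_real abs_le_iff)
  have "norm (f x - f y) \<le> max 0 L * norm (x - y)" if "x \<in> K" "y \<in> K" for x y
  proof (rule differentiable_bound[OF K(2) _ _ that])
    show "(f has_derivative ?f' z) (at z within K)" if "z \<in> K" for z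
      using smooth_on_has_derivative[OF f] that K(3) has_derivative_at_withinI by blast
    show "onorm (?f' z) \<le> max 0 L" if "z \<in> K" for z
    proof -
      have "bounded_linear (?f' z)"
        using smooth_on_has_derivative[OF f] that K(3) has_derivative_bounded_linear by blast
      then have "onorm (?f' z) \<le> (\<Sum>b\<in>Basis. norm (?f' z b))"
        by (rule onorm_componentwise)
      with L[OF that] show ?thesis by linarith
    qed
  qed
  then show ?thesis using that[of "max 0 L"] by auto
qed

lemma has_derivative_ev:
  assumes f: "(f has_derivative f') (at x)" and ev: "\<forall>\<^sub>F y in nhds x. f y = g y"
  shows "(g has_derivative f') (at x)"
proof (rule has_derivative_transform_eventually[OF f])
  show "\<forall>\<^sub>F x' in at x. f x' = g x'" using ev by (simp add: eventually_at_filter eventually_mono)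
  show "f x = g x" using ev by (rule eventually_nhds_x_imp_x)
qed simp

lemma has_vector_derivative_ev:
  assumes "(f has_vector_derivative v) (at t)" and "\<forall>\<^sub>F s in nhds t. f s = g s"
  shows "(g has_vector_derivative v) (at t)"
  using assms unfolding has_vector_derivative_def by (rule has_derivative_ev)

section \<open>Left-invariant fields, one-parameter subgroups and the exponential map\<close>

locale lie_grp =
  fixes G :: "('g::{t2_space,second_countable_topology}, 'l::euclidean_space, 'm) lie_group_scheme" (structure)
  assumes lie: "is_lie_group G"
begin

lemma is_group: "group G" and carrier_UNIV[simp]: "carrier G = UNIV"
  using lie by (auto simp: is_lie_group_def)

sublocale group G by (rule is_group)

lemma continuous_mult: "continuous_on UNIV (\<lambda>(x, y). x \<otimes> y)"
  and continuous_inv: "continuous_on UNIV (\<lambda>x. inv x)"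
  using lie by (auto simp: is_lie_group_def)

lemma continuous_on_mult[continuous_intros]:
  "continuous_on S f \<Longrightarrow> continuous_on S g \<Longrightarrow> continuous_on S (\<lambda>x. f x \<otimes> g x)"
  using continuous_on_compose2[OF continuous_mult, of S "\<lambda>x. (f x, g x)"]
  by (auto intro: continuous_intros)

lemma continuous_on_inv[continuous_intros]:
  "continuous_on S f \<Longrightarrow> continuous_on S (\<lambda>x. inv (f x))"
  using continuous_on_compose2[OF continuous_inv, of S f] by auto

lemma tendsto_mult_group[tendsto_intros]:
  "(f \<longlongrightarrow> a) F \<Longrightarrow> (g \<longlongrightarrow> b) F \<Longrightarrow> ((\<lambda>x. f x \<otimes> g x) \<longlongrightarrow> a \<otimes> b) F"
  using continuous_on_tendsto_compose[OF continuous_mult, of "\<lambda>x. (f x, g x)" "(a, b)" F]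
  by (auto intro: tendsto_Pair)

lemma tendsto_inv_group[tendsto_intros]:
  "(f \<longlongrightarrow> a) F \<Longrightarrow> ((\<lambda>x. inv (f x)) \<longlongrightarrow> inv a) F"
  using continuous_on_tendsto_compose[OF continuous_inv, of f a F] by auto

lemma continuous_on_pow[continuous_intros]:
  "continuous_on S f \<Longrightarrow> continuous_on S (\<lambda>x. f x [^] (n::nat))"
  by (induction n) (auto intro!: continuous_intros)

abbreviation U where "U \<equiv> fst (id_chart G)"
abbreviation \<phi> where "\<phi> \<equiv> id_coord G"
abbreviation \<psi> where "\<psi> \<equiv> inv_into U \<phi>"
abbreviation x0 where "x0 \<equiv> id_coord G \<one>"
abbreviation D where "D \<equiv> \<phi> ` U"

lemma atlas_chart: "\<kappa> \<in> atlas G \<Longrightarrow> is_chart \<kappa>"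
  and id_chart_atlas: "id_chart G \<in> atlas G" and one_U: "\<one> \<in> U"
  and atlas_cover: "\<exists>\<kappa>\<in>atlas G. g \<in> fst \<kappa>"
  using lie by (auto simp: is_lie_group_def)

lemma chart_facts:
  assumes "is_chart \<kappa>"
  shows "open (fst \<kappa>)" "open (snd \<kappa> ` fst \<kappa>)"
    "continuous_on (fst \<kappa>) (snd \<kappa>)" "continuous_on (snd \<kappa> ` fst \<kappa>) (chart_inv \<kappa>)"
    "\<And>g. g \<in> fst \<kappa> \<Longrightarrow> chart_inv \<kappa> (snd \<kappa> g) = g"
    "\<And>x. x \<in> snd \<kappa> ` fst \<kappa> \<Longrightarrow> snd \<kappa> (chart_inv \<kappa> x) = x"
    "\<And>x. x \<in> snd \<kappa> ` fst \<kappa> \<Longrightarrow> chart_inv \<kappa> x \<in> fst \<kappa>"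
  using assms by (auto simp: is_chart_def homeomorphism_def)

lemmas id_facts = chart_facts[OF atlas_chart[OF id_chart_atlas], folded id_coord_def]

lemma x0_D: "x0 \<in> D" using one_U by auto

text \<open>Three charts are kept as parameters: one-parameter subgroups need only the chart around
  the identity, but conjugation by \<open>g\<close> passes through charts around \<open>g\<close>
  and \<open>inv g\<close>.\<close>

definition prod_dom where
  "prod_dom \<kappa>1 \<kappa>2 \<kappa>3 = {(x, y). x \<in> snd \<kappa>1 ` fst \<kappa>1 \<and> y \<in> snd \<kappa>2 ` fst \<kappa>2 \<and>
     chart_inv \<kappa>1 x \<otimes> chart_inv \<kappa>2 y \<in> fst \<kappa>3}"

definition prod_coord where
  "prod_coord \<kappa>1 \<kappa>2 \<kappa>3 = (\<lambda>(x, y). snd \<kappa>3 (chart_inv \<kappa>1 x \<otimes> chart_inv \<kappa>2 y))"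

lemma prod_smooth:
  "\<kappa>1 \<in> atlas G \<Longrightarrow> \<kappa>2 \<in> atlas G \<Longrightarrow> \<kappa>3 \<in> atlas G \<Longrightarrow>
    smooth_on (prod_dom \<kappa>1 \<kappa>2 \<kappa>3) (prod_coord \<kappa>1 \<kappa>2 \<kappa>3)"
  using lie unfolding is_lie_group_def prod_dom_def prod_coord_def by blast

lemma inv_smooth:
  "smooth_on {x. x \<in> D \<and> inv (\<psi> x) \<in> U} (\<lambda>x. \<phi> (inv (\<psi> x)))"
  using lie id_chart_atlas unfolding is_lie_group_def id_coord_def by blast

abbreviation W where "W \<equiv> prod_dom (id_chart G) (id_chart G) (id_chart G)"
abbreviation \<mu> where "\<mu> \<equiv> prod_coord (id_chart G) (id_chart G) (id_chart G)"

lemmas mu_smooth = prod_smooth[OF id_chart_atlas id_chart_atlas id_chart_atlas]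
lemmas W_open = smooth_on_open[OF mu_smooth]
lemmas mu_deriv = smooth_on_has_derivative[OF mu_smooth]

lemma mem_W: "(x, y) \<in> W \<longleftrightarrow> x \<in> D \<and> y \<in> D \<and> \<psi> x \<otimes> \<psi> y \<in> U"
  by (simp add: prod_dom_def id_coord_def)

lemma mu_eq: "\<mu> (x, y) = \<phi> (\<psi> x \<otimes> \<psi> y)"
  by (simp add: prod_coord_def id_coord_def)

lemma psi_x0[simp]: "\<psi> x0 = \<one>" using id_facts(5)[OF one_U] .

lemma W_x0: "x \<in> D \<Longrightarrow> (x, x0) \<in> W" "x \<in> D \<Longrightarrow> (x0, x) \<in> W"
  using id_facts(7) x0_D by (auto simp: mem_W)

lemma mu_x0[simp]: "x \<in> D \<Longrightarrow> \<mu> (x, x0) = x" "x \<in> D \<Longrightarrow> \<mu> (x0, x) = x"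
  using id_facts(6) by (auto simp: mu_eq)

lemma mu_D: "z \<in> W \<Longrightarrow> \<mu> z \<in> D" 
  by (cases z) (auto simp: mem_W mu_eq)

lemma psi_mu: "(x, y) \<in> W \<Longrightarrow> \<psi> (\<mu> (x, y)) = \<psi> x \<otimes> \<psi> y"
  by (simp add: mem_W mu_eq id_facts(5))

text \<open>The left-invariant vector field of \<open>v\<close>, in the chart around the identity.\<close>

definition lfield :: "'l \<Rightarrow> 'l \<Rightarrow> 'l" where
  "lfield x v = frechet_derivative \<mu> (at (x, x0)) (0, v)"

lemma lfield_smooth: "smooth_on W (\<lambda>z. frechet_derivative \<mu> (at z) v)"
  by (rule smooth_on_derivative[OF mu_smooth])

lemma lfield_linear: "x \<in> D \<Longrightarrow> linear (lfield x)"
proof -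
  assume x: "x \<in> D"
  have "linear (frechet_derivative \<mu> (at (x, x0)))"
    using mu_deriv[OF W_x0(1)[OF x]] has_derivative_linear by blast
  moreover have "linear (\<lambda>v::'l. (0::'l, v))" by (auto intro!: linearI)
  ultimately show ?thesis unfolding lfield_def
    using linear_compose[of "\<lambda>v::'l. (0::'l, v)"] by (auto simp: o_def)
qed

lemma mu_right_deriv:
  assumes c: "(c has_vector_derivative c') (at t within S)" and "(a, c t) \<in> W"
  shows "((\<lambda>t. \<mu> (a, c t)) has_vector_derivative frechet_derivative \<mu> (at (a, c t)) (0, c')) (at t within S)"
proof -
  have p: "((\<lambda>t. (a, c t)) has_vector_derivative (0, c')) (at t within S)"
    using c by (intro has_vector_derivative_Pair) auto
  have "((\<mu> \<circ> (\<lambda>t. (a, c t))) has_vector_derivative frechet_derivative \<mu> (at (a, c t)) (0, c')) (at t within S)"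
    by (rule vector_derivative_diff_chain_within[OF p])
       (rule has_derivative_at_withinI[OF mu_deriv[OF assms(2)]])
  then show ?thesis by (simp add: o_def)
qed

lemma lfield_x0: "lfield x0 v = v"
proof -
  have c: "((\<lambda>t. x0 + t *\<^sub>R v) has_vector_derivative v) (at 0)"
    by (auto intro!: derivative_eq_intros)
  have e: "((\<lambda>t. \<mu> (x0, x0 + t *\<^sub>R v)) has_vector_derivative lfield x0 v) (at 0)"
    unfolding lfield_def using mu_right_deriv[OF c, of x0] W_x0 x0_D by simp
  have "\<forall>\<^sub>F t in nhds 0. x0 + t *\<^sub>R v \<in> D"
  proof (rule topological_tendstoD)
    have "((\<lambda>t. x0 + t *\<^sub>R v) \<longlongrightarrow> x0 + 0 *\<^sub>R v) (nhds 0)" by (intro tendsto_intros filterlim_ident)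
    then show "((\<lambda>t. x0 + t *\<^sub>R v) \<longlongrightarrow> x0) (nhds 0)" by simp
  qed (use id_facts x0_D in auto)
  then have "\<forall>\<^sub>F t in nhds 0. \<mu> (x0, x0 + t *\<^sub>R v) = x0 + t *\<^sub>R v"
    by eventually_elim simp
  then have "((\<lambda>t. x0 + t *\<^sub>R v) has_vector_derivative lfield x0 v) (at 0)"
    by (rule has_vector_derivative_ev[OF e])
  with c show ?thesis using vector_derivative_unique_at by blast
qed

text \<open>Associativity differentiated in the last factor: both sides are the velocity at
  \<open>t = 0\<close> of the product of \<open>a\<close>, \<open>b\<close> and the curve
  \<open>x0 + t *\<^sub>R v\<close>. Hence left translates of integral curves are integral
  curves.\<close>

lemma lfield_left_invariant:
  assumes ab: "(a, b) \<in> W"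
  shows "lfield (\<mu> (a, b)) v = frechet_derivative \<mu> (at (a, b)) (0, lfield b v)"
proof -
  have bD: "b \<in> D" using ab by (simp add: mem_W)
  have c: "((\<lambda>t. x0 + t *\<^sub>R v) has_vector_derivative v) (at 0)"
    by (auto intro!: derivative_eq_intros)
  have 1: "((\<lambda>t. \<mu> (\<mu> (a, b), x0 + t *\<^sub>R v)) has_vector_derivative lfield (\<mu> (a, b)) v) (at 0)"
    unfolding lfield_def using mu_right_deriv[OF c, of "\<mu> (a, b)"] W_x0(1)[OF mu_D[OF ab]] by simp
  have 2: "((\<lambda>t. \<mu> (b, x0 + t *\<^sub>R v)) has_vector_derivative lfield b v) (at 0)"
    unfolding lfield_def using mu_right_deriv[OF c, of b] W_x0(1)[OF bD] by simp
  have 3: "((\<lambda>t. \<mu> (a, \<mu> (b, x0 + t *\<^sub>R v))) has_vector_derivative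
     frechet_derivative \<mu> (at (a, b)) (0, lfield b v)) (at 0)"
    using mu_right_deriv[OF 2, of a] bD ab by simp
  have lim: "((\<lambda>t. x0 + t *\<^sub>R v) \<longlongrightarrow> x0) (nhds 0)"
  proof -
    have "((\<lambda>t. x0 + t *\<^sub>R v) \<longlongrightarrow> x0 + 0 *\<^sub>R v) (nhds 0)" by (intro tendsto_intros filterlim_ident)
    then show ?thesis by simp
  qed
  have w1: "\<forall>\<^sub>F t in nhds 0. (\<mu> (a, b), x0 + t *\<^sub>R v) \<in> W"
    by (rule topological_tendstoD[OF tendsto_Pair[OF tendsto_const lim] W_open W_x0(1)[OF mu_D[OF ab]]])
  have w2: "\<forall>\<^sub>F t in nhds 0. (b, x0 + t *\<^sub>R v) \<in> W"
    by (rule topological_tendstoD[OF tendsto_Pair[OF tendsto_const lim] W_open W_x0(1)[OF bD]])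
  have "isCont \<mu> (b, x0)" using mu_deriv[OF W_x0(1)[OF bD]] has_derivative_continuous by blast
  then have "((\<lambda>t. \<mu> (b, x0 + t *\<^sub>R v)) \<longlongrightarrow> \<mu> (b, x0)) (nhds 0)"
    by (rule isCont_tendsto_compose[OF _ tendsto_Pair[OF tendsto_const lim]])
  then have "((\<lambda>t. \<mu> (b, x0 + t *\<^sub>R v)) \<longlongrightarrow> b) (nhds 0)" using bD by simp
  then have w3: "\<forall>\<^sub>F t in nhds 0. (a, \<mu> (b, x0 + t *\<^sub>R v)) \<in> W"
    by (rule topological_tendstoD[OF tendsto_Pair[OF tendsto_const] W_open ab])
  have "\<forall>\<^sub>F t in nhds 0. \<mu> (\<mu> (a, b), x0 + t *\<^sub>R v) = \<mu> (a, \<mu> (b, x0 + t *\<^sub>R v))"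
    using w1 w2 w3
  proof eventually_elim
    case (elim t)
    then have "\<psi> (\<mu> (\<mu> (a, b), x0 + t *\<^sub>R v)) = \<psi> (\<mu> (a, \<mu> (b, x0 + t *\<^sub>R v)))"
      using ab by (simp add: psi_mu m_assoc)
    then show ?case using id_facts(6) mu_D elim by metis
  qed
  then have "((\<lambda>t. \<mu> (a, \<mu> (b, x0 + t *\<^sub>R v))) has_vector_derivative lfield (\<mu> (a, b)) v) (at 0)"
    by (rule has_vector_derivative_ev[OF 1])
  with 3 show ?thesis using vector_derivative_unique_at by blast
qed

lemma lfield_bounds:
  obtains r L M where "0 < r" "cball x0 r \<subseteq> D" "0 \<le> L" "0 \<le> M"
    "\<And>x y v. x \<in> cball x0 r \<Longrightarrow> y \<in> cball x0 r \<Longrightarrow> norm (lfield x v - lfield y v) \<le> L * norm (x - y) * norm v"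
    "\<And>x v. x \<in> cball x0 r \<Longrightarrow> norm (lfield x v) \<le> M * norm v"
proof -
  have "open D" using id_facts by auto
  then obtain r where r: "0 < r" "cball x0 r \<subseteq> D" using x0_D open_contains_cball by blast
  have sub: "cball x0 r \<times> {x0} \<subseteq> W" using r W_x0 by blast
  have "\<exists>l\<ge>0. \<forall>x\<in>cball x0 r. \<forall>y\<in>cball x0 r. norm (lfield x b - lfield y b) \<le> l * norm (x - y)" for b
  proof -
    obtain l where l: "0 \<le> l" "\<And>z z'. z \<in> cball x0 r \<times> {x0} \<Longrightarrow> z' \<in> cball x0 r \<times> {x0} \<Longrightarrow>
        norm (frechet_derivative \<mu> (at z) (0, b) - frechet_derivative \<mu> (at z') (0, b)) \<le> l * norm (z - z')"
      by (rule smooth_on_lipschitz[OF lfield_smooth _ _ sub]) (auto intro: compact_Times convex_Times)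
    have "norm (lfield x b - lfield y b) \<le> l * norm (x - y)" if "x \<in> cball x0 r" "y \<in> cball x0 r" for x y
      using l(2)[of "(x, x0)" "(y, x0)"] that by (auto simp: lfield_def)
    with l(1) show ?thesis by blast
  qed
  then obtain l where l: "\<And>b. 0 \<le> l b" "\<And>b x y. x \<in> cball x0 r \<Longrightarrow> y \<in> cball x0 r \<Longrightarrow>
      norm (lfield x b - lfield y b) \<le> l b * norm (x - y)"
    by metis
  \<comment> \<open>Smoothness gives a Lipschitz constant in \<open>x\<close> for each fixed
    direction only; linearity in \<open>v\<close> lets the constants of the basis directions be
    added up.\<close>
  define L where "L = (\<Sum>b\<in>Basis. l b)"
  have L0: "0 \<le> L" unfolding L_def by (intro sum_nonneg l)
  have exp: "lfield x v = (\<Sum>b\<in>Basis. (v \<bullet> b) *\<^sub>R lfield x b)" if "x \<in> cball x0 r" for x v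
  proof -
    have lin: "linear (lfield x)" using lfield_linear that r(2) by blast
    have "lfield x (\<Sum>b\<in>Basis. (v \<bullet> b) *\<^sub>R b) = (\<Sum>b\<in>Basis. (v \<bullet> b) *\<^sub>R lfield x b)"
      by (simp add: linear_sum[OF lin] linear_scale[OF lin])
    then show ?thesis by (simp add: euclidean_representation)
  qed
  have Lip: "norm (lfield x v - lfield y v) \<le> L * norm (x - y) * norm v"
    if "x \<in> cball x0 r" "y \<in> cball x0 r" for x y v
  proof -
    have "lfield x v - lfield y v = (\<Sum>b\<in>Basis. (v \<bullet> b) *\<^sub>R (lfield x b - lfield y b))"
      unfolding exp[OF that(1), of v] exp[OF that(2), of v]
      by (simp add: sum_subtractf scaleR_diff_right)
    also have "norm \<dots> \<le> (\<Sum>b\<in>Basis. norm v * (l b * norm (x - y)))"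
      by (rule sum_norm_le) (auto intro!: mult_mono l that simp: Basis_le_norm)
    also have "\<dots> = L * norm (x - y) * norm v"
      by (simp add: L_def sum_distrib_left sum_distrib_right mult_ac)
    finally show ?thesis .
  qed
  have "norm (lfield x v) \<le> (L * r + 1) * norm v" if x: "x \<in> cball x0 r" for x v
  proof -
    have "norm (lfield x v) \<le> norm (lfield x v - lfield x0 v) + norm (lfield x0 v)"
      by (metis norm_triangle_sub add.commute)
    also have "\<dots> \<le> L * norm (x - x0) * norm v + norm v"
      using Lip[OF x, of x0 v] r by (simp add: lfield_x0)
    also have "\<dots> \<le> L * r * norm v + norm v"
      using x L0 by (intro add_right_mono mult_right_mono mult_left_mono) (auto simp: dist_norm norm_minus_commute)
    finally show ?thesis by (simp add: algebra_simps)
  qed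
  then show ?thesis using that[OF r L0 _ Lip, of "L * r + 1"] L0 r(1) by simp
qed

lemma hom_zero:
  assumes "\<gamma> (0 + 0) = \<gamma> 0 \<otimes> \<gamma> (0::real)"
  shows "\<gamma> 0 = \<one>"
  using assms by (metis add_0 carrier_UNIV UNIV_I l_cancel_one')

lemma hom_pow:
  assumes "\<And>s t. \<gamma> (s + t) = \<gamma> s \<otimes> \<gamma> (t::real)"
  shows "\<gamma> (real n * t) = \<gamma> t [^] n"
proof (induction n)
  case 0
  show ?case using hom_zero[of \<gamma>] assms[of 0 0] by simp
next
  case (Suc n)
  have "\<gamma> (real (Suc n) * t) = \<gamma> (real n * t + t)" by (simp add: algebra_simps)
  then show ?case using Suc by (simp add: assms)
qed

text \<open>The extension is forced: \<open>\<gamma> t = g (t / N) ^ N\<close> for any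
  \<open>N\<close> that brings \<open>t / N\<close> into the given interval. Two choices of
  \<open>N\<close> agree because both agree with their product.\<close>

lemma local_hom_extends:
  fixes g :: "real \<Rightarrow> 'g"
  assumes a: "0 < a" and hom: "\<And>s t. \<bar>s\<bar> \<le> a \<Longrightarrow> \<bar>t\<bar> \<le> a \<Longrightarrow> g (s + t) = g s \<otimes> g t"
    and cont: "continuous_on {-a..a} g"
  shows "\<exists>\<gamma>. continuous_on UNIV \<gamma> \<and> (\<forall>s t. \<gamma> (s + t) = \<gamma> s \<otimes> \<gamma> t) \<and>
    (\<forall>t. \<bar>t\<bar> \<le> a \<longrightarrow> \<gamma> t = g t)"
proof -
  have g0: "g 0 = \<one>" using hom_zero[of g] hom[of 0 0] a by simp
  have pw: "g (real j * s) = g s [^] j" if "\<bar>real j * s\<bar> \<le> a" for j s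
    using that
  proof (induction j)
    case (Suc j)
    have le: "\<bar>real j * s\<bar> \<le> \<bar>real (Suc j) * s\<bar>" "\<bar>s\<bar> \<le> \<bar>real (Suc j) * s\<bar>"
      unfolding abs_mult by (simp_all add: mult_right_mono mult_le_cancel_right1)
    have "g (real (Suc j) * s) = g (real j * s + s)" by (simp add: algebra_simps)
    also have "\<dots> = g (real j * s) \<otimes> g s" using le Suc.prems by (intro hom) auto
    finally show ?case using Suc le by simp
  qed (simp add: g0)
  have half: "g (t / real N) [^] N = g (t / real (N * M)) [^] (M * N)"
    if "N > 0" "M > 0" "\<bar>t\<bar> \<le> a * real N" for t N M
  proof -
    have e: "t / real N = real M * (t / real (N * M))" using that by (simp add: field_simps)
    have "\<bar>real M * (t / real (N * M))\<bar> \<le> a" 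
      unfolding e[symmetric] using that by (simp add: field_simps abs_mult)
    from pw[OF this] show ?thesis unfolding e by (simp add: nat_pow_pow)
  qed
  have indep: "g (t / real N) [^] N = g (t / real M) [^] M"
    if "N > 0" "M > 0" "\<bar>t\<bar> \<le> a * real N" "\<bar>t\<bar> \<le> a * real M" for t N M
    using half[of N M t] half[of M N t] that by (simp add: mult.commute)
  define Nt where "Nt t = Suc (nat \<lceil>\<bar>t\<bar> / a\<rceil>)" for t
  have Nt: "\<bar>t\<bar> \<le> a * real (Nt t)" for t
  proof -
    have "\<bar>t\<bar> / a \<le> real (Nt t)" unfolding Nt_def by linarith
    then show ?thesis using a by (simp add: field_simps)
  qed
  define \<gamma> where "\<gamma> t = g (t / real (Nt t)) [^] Nt t" for t
  have \<gamma>: "\<gamma> t = g (t / real N) [^] N" if "N > 0" "\<bar>t\<bar> \<le> a * real N" for t N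
    unfolding \<gamma>_def using indep[of "Nt t" N t] Nt[of t] that by (simp add: Nt_def)
  show ?thesis
  proof (intro exI[of _ \<gamma>] conjI allI impI)
    show "\<gamma> t = g t" if "\<bar>t\<bar> \<le> a" for t using \<gamma>[of 1 t] that by simp
    show "\<gamma> (s + t) = \<gamma> s \<otimes> \<gamma> t" for s t
    proof -
      define N where "N = Nt (\<bar>s\<bar> + \<bar>t\<bar>)"
      have N: "N > 0" "\<bar>s\<bar> + \<bar>t\<bar> \<le> a * real N" using Nt[of "\<bar>s\<bar> + \<bar>t\<bar>"] by (auto simp: N_def Nt_def)
      then have b: "\<bar>s / real N\<bar> \<le> a" "\<bar>t / real N\<bar> \<le> a" by (auto simp: field_simps)
      have "\<gamma> (s + t) = g (s / real N + t / real N) [^] N"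
        using N by (subst \<gamma>[of N]) (auto simp: add_divide_distrib)
      also have "\<dots> = (g (s / real N) \<otimes> g (t / real N)) [^] N" using hom b by simp
      also have "\<dots> = g (s / real N) [^] N \<otimes> g (t / real N) [^] N"
        using hom[OF b] hom[OF b(2,1)] by (intro pow_mult_distrib) (auto simp: add.commute)
      also have "\<dots> = \<gamma> s \<otimes> \<gamma> t" using N by (subst (1 2) \<gamma>[of N]) auto
      finally show ?thesis .
    qed
    show "continuous_on UNIV \<gamma>"
    proof (rule continuous_at_imp_continuous_on, rule ballI)
      fix t0 :: real
      \<comment> \<open>The additional 1 makes the inequality at \<open>t0\<close> strict, so the
        same \<open>N\<close> serves a whole open interval around \<open>t0\<close> and continuity
        can be read off there.\<close>
      define N where "N = Suc (Nt t0)"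
      define S where "S = {- (a * real N) <..< a * real N}"
      have "\<bar>t0\<bar> < a * real N" using Nt[of t0] a by (simp add: N_def algebra_simps)
      then have t0: "t0 \<in> S" by (auto simp: S_def)
      have "continuous_on S (\<lambda>t. g (t / real N) [^] N)"
      proof (rule continuous_on_pow, rule continuous_on_compose2[OF cont])
        show "(\<lambda>t. t / real N) ` S \<subseteq> {-a..a}"
          by (auto simp: S_def N_def field_simps)
      qed (auto intro!: continuous_intros simp: N_def)
      then have "continuous_on S \<gamma>"
      proof (rule continuous_on_eq)
        show "g (t / real N) [^] N = \<gamma> t" if "t \<in> S" for t
          by (rule \<gamma>[symmetric]) (use that in \<open>auto simp: S_def N_def\<close>)
      qed
      then show "isCont \<gamma> t0" using t0 by (auto simp: S_def continuous_on_eq_continuous_at)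
    qed
  qed
qed

lemma ops_hom: "one_parameter_subgroup G X \<gamma> \<Longrightarrow> \<gamma> (s + t) = \<gamma> s \<otimes> \<gamma> t"
  and ops_cont: "one_parameter_subgroup G X \<gamma> \<Longrightarrow> continuous_on UNIV \<gamma>"
  and ops_deriv0: "one_parameter_subgroup G X \<gamma> \<Longrightarrow> ((\<lambda>t. \<phi> (\<gamma> t)) has_vector_derivative X) (at 0)"
  by (auto simp: one_parameter_subgroup_def o_def)

lemma ops_zero: "one_parameter_subgroup G X \<gamma> \<Longrightarrow> \<gamma> 0 = \<one>"
  using hom_zero[of \<gamma>] ops_hom by blast

lemma ops_ev_U:
  assumes "one_parameter_subgroup G X \<gamma>" "\<gamma> t \<in> V" "open V"
  shows "\<forall>\<^sub>F s in nhds t. \<gamma> s \<in> V"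
proof -
  have "isCont \<gamma> t" using ops_cont[OF assms(1)] by (simp add: continuous_on_eq_continuous_at)
  then have "(\<gamma> \<longlongrightarrow> \<gamma> t) (nhds t)" by (simp add: isCont_def tendsto_at_iff_tendsto_nhds)
  then show ?thesis by (rule topological_tendstoD[OF _ assms(3,2)])
qed

text \<open>Since \<open>\<gamma> (t + h) = \<gamma> t \<otimes> \<gamma> h\<close>, the velocity at
  \<open>t\<close> is the left translate of the velocity at 0: a one-parameter subgroup is an
  integral curve of its left-invariant field.\<close>

lemma ops_deriv:
  assumes X: "one_parameter_subgroup G X \<gamma>" and t: "\<gamma> t \<in> U"
  shows "((\<lambda>t. \<phi> (\<gamma> t)) has_vector_derivative lfield (\<phi> (\<gamma> t)) X) (at t)"
proof -
  have "((\<lambda>h. \<mu> (\<phi> (\<gamma> t), \<phi> (\<gamma> h))) has_vector_derivative lfield (\<phi> (\<gamma> t)) X) (at 0)"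
    unfolding lfield_def using mu_right_deriv[OF ops_deriv0[OF X], of "\<phi> (\<gamma> t)"] W_x0 t
    by (simp add: ops_zero[OF X])
  moreover have "\<forall>\<^sub>F h in nhds 0. \<mu> (\<phi> (\<gamma> t), \<phi> (\<gamma> h)) = \<phi> (\<gamma> (t + h))"
  proof -
    have "\<forall>\<^sub>F h in nhds 0. \<gamma> h \<in> U"
      using ops_ev_U[OF X, of 0 U] one_U id_facts(1) ops_zero[OF X] by simp
    then show ?thesis
      by eventually_elim (simp add: mu_eq id_facts(5) t ops_hom[OF X])
  qed
  ultimately have d: "((\<lambda>h. \<phi> (\<gamma> (t + h))) has_vector_derivative lfield (\<phi> (\<gamma> t)) X) (at 0)"
    by (rule has_vector_derivative_ev)
  have "((\<lambda>s. s - t) has_vector_derivative 1) (at t)" by (auto intro!: derivative_eq_intros)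
  from vector_diff_chain_at[OF this, of "\<lambda>h. \<phi> (\<gamma> (t + h))" "lfield (\<phi> (\<gamma> t)) X"] d
  show ?thesis by (simp add: o_def)
qed

text \<open>Near 0 both curves solve the same Lipschitz equation and agree by Gronwall; agreement
  spreads to all times through \<open>\<gamma> t = \<gamma> (t / N) ^ N\<close>.\<close>

lemma ops_unique:
  assumes 1: "one_parameter_subgroup G X \<gamma>1" and 2: "one_parameter_subgroup G X \<gamma>2"
  shows "\<gamma>1 = \<gamma>2"
proof -
  obtain r L M where r: "0 < r" "cball x0 r \<subseteq> D" and L: "0 \<le> L" and
    Lip: "\<And>x y v. x \<in> cball x0 r \<Longrightarrow> y \<in> cball x0 r \<Longrightarrow> norm (lfield x v - lfield y v) \<le> L * norm (x - y) * norm v"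
    by (rule lfield_bounds) blast
  define V where "V = U \<inter> \<phi> -` ball x0 r"
  have V: "open V" unfolding V_def
    by (rule continuous_open_preimage[OF id_facts(3,1)]) simp
  have V1: "\<one> \<in> V" using one_U r by (simp add: V_def)
  have "\<forall>\<^sub>F s in nhds 0. \<gamma>1 s \<in> V \<and> \<gamma>2 s \<in> V"
    using ops_ev_U[OF 1 _ V, of 0] ops_ev_U[OF 2 _ V, of 0] V1
    by (auto simp: ops_zero[OF 1] ops_zero[OF 2] eventually_conj_iff)
  then obtain a where a: "0 < a" "\<And>s. dist s 0 < a \<Longrightarrow> \<gamma>1 s \<in> V \<and> \<gamma>2 s \<in> V"
    unfolding eventually_nhds_metric by auto
  define u where "u s = \<phi> (\<gamma>1 s) - \<phi> (\<gamma>2 s)" for s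
  have mem: "\<gamma>1 s \<in> V" "\<gamma>2 s \<in> V" if "s \<in> {-(a/2)..a/2}" for s
  proof -
    have "dist s 0 < a" using that a(1) by (auto simp: dist_real_def)
    from a(2)[OF this] show "\<gamma>1 s \<in> V" "\<gamma>2 s \<in> V" by blast+
  qed
  have "u t = 0" if t: "t \<in> {-(a/2)..a/2}" for t
  proof (rule gronwall_zero[where u = u and L = "L * norm X" and T = "a/2"])
    show "(u has_vector_derivative (lfield (\<phi> (\<gamma>1 s)) X - lfield (\<phi> (\<gamma>2 s)) X)) (at s within {-(a/2)..a/2})"
      if "s \<in> {-(a/2)..a/2}" for s
    proof -
      have "\<gamma>1 s \<in> U" "\<gamma>2 s \<in> U" using mem[OF that] by (auto simp: V_def)
      then show ?thesis unfolding u_def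
        by (rule has_vector_derivative_diff[OF has_vector_derivative_at_within[OF ops_deriv[OF 1]]
            has_vector_derivative_at_within[OF ops_deriv[OF 2]]])
    qed
    show "norm (lfield (\<phi> (\<gamma>1 s)) X - lfield (\<phi> (\<gamma>2 s)) X) \<le> L * norm X * norm (u s)"
      if "s \<in> {-(a/2)..a/2}" for s
      using Lip[of "\<phi> (\<gamma>1 s)" "\<phi> (\<gamma>2 s)" X] mem[OF that] by (auto simp: V_def u_def mult_ac)
    show "u 0 = 0" by (simp add: u_def ops_zero[OF 1] ops_zero[OF 2])
  qed (use L t in auto)
  then have loc: "\<gamma>1 t = \<gamma>2 t" if "t \<in> {-(a/2)..a/2}" for t
    using that mem[OF that] id_facts(5) unfolding u_def V_def by (metis IntE eq_iff_diff_eq_0)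
  show ?thesis
  proof
    fix t
    obtain N :: nat where N: "\<bar>t\<bar> / (a/2) < real N" using reals_Archimedean2 by blast
    then have N0: "0 < real N" using a(1) by (smt (verit) divide_nonneg_pos abs_ge_zero half_gt_zero)
    then have "\<bar>t / real N\<bar> \<le> a/2" using N a(1) by (simp add: field_simps)
    then have "t / real N \<in> {-(a/2)..a/2}" by (metis abs_le_iff atLeastAtMost_iff minus_le_iff)
    then have "\<gamma>1 (t / real N) = \<gamma>2 (t / real N)" by (rule loc)
    then have "\<gamma>1 (real N * (t / real N)) = \<gamma>2 (real N * (t / real N))"
      by (simp only: hom_pow[OF ops_hom[OF 1]] hom_pow[OF ops_hom[OF 2]])
    then show "\<gamma>1 t = \<gamma>2 t" using N0 by simp
  qed
qed

lemma lie_exp_eqI: "one_parameter_subgroup G X \<gamma> \<Longrightarrow> lie_exp G X = \<gamma> 1"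
  unfolding lie_exp_def by (subst the_equality[where a = \<gamma>]) (auto intro: ops_unique)

lemma ops_rescale:
  assumes "one_parameter_subgroup G X \<gamma>"
  shows "one_parameter_subgroup G (c *\<^sub>R X) (\<lambda>t. \<gamma> (c * t))"
  unfolding one_parameter_subgroup_def
proof (intro conjI allI)
  show "continuous_on UNIV (\<lambda>t. \<gamma> (c * t))"
    by (rule continuous_on_compose2[OF ops_cont[OF assms]]) (auto intro: continuous_intros)
  show "\<gamma> (c * (s + t)) = \<gamma> (c * s) \<otimes> \<gamma> (c * t)" for s t
    by (simp add: ops_hom[OF assms, symmetric] distrib_left)
  have "((*) c has_vector_derivative c) (at 0)" by (auto intro!: derivative_eq_intros)
  from vector_diff_chain_at[OF this, of "\<lambda>t. \<phi> (\<gamma> t)" X] ops_deriv0[OF assms]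
  show "(\<phi> \<circ> (\<lambda>t. \<gamma> (c * t)) has_vector_derivative c *\<^sub>R X) (at 0)" by (simp add: o_def)
qed

text \<open>Small one-parameter subgroups are obtained from Picard's theorem for the left-invariant
  fields; Gronwall's inequality makes them depend continuously on the initial velocity.\<close>

lemma local_exp:
  obtains \<delta> C x where "0 < \<delta>" "0 \<le> C"
    "\<And>X t. norm X \<le> \<delta> \<Longrightarrow> \<bar>t\<bar> \<le> 1/2 \<Longrightarrow> x X t \<in> D"
    "\<And>X. norm X \<le> \<delta> \<Longrightarrow> \<exists>\<gamma>. one_parameter_subgroup G X \<gamma> \<and> (\<forall>t. \<bar>t\<bar> \<le> 1/2 \<longrightarrow> \<gamma> t = \<psi> (x X t))"
    "\<And>X Y. norm X \<le> \<delta> \<Longrightarrow> norm Y \<le> \<delta> \<Longrightarrow> norm (x X (1/2) - x Y (1/2)) \<le> C * norm (X - Y)"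
proof -
  obtain r L M where r: "0 < r" "cball x0 r \<subseteq> D" and L: "0 \<le> L" and M: "0 \<le> M" and
    Lip: "\<And>x y v. x \<in> cball x0 r \<Longrightarrow> y \<in> cball x0 r \<Longrightarrow> norm (lfield x v - lfield y v) \<le> L * norm (x - y) * norm v" and
    Bd: "\<And>x v. x \<in> cball x0 r \<Longrightarrow> norm (lfield x v) \<le> M * norm v"
    by (rule lfield_bounds) blast
  have "open (W \<inter> \<mu> -` ball x0 r)"
    by (rule continuous_open_preimage[OF smooth_on_continuous[OF mu_smooth] W_open]) simp
  moreover have "(x0, x0) \<in> W \<inter> \<mu> -` ball x0 r" using W_x0 x0_D r by simp
  ultimately obtain A B where AB: "open A" "open B" "(x0, x0) \<in> A \<times> B" "A \<times> B \<subseteq> W \<inter> \<mu> -` ball x0 r"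
    by (rule open_prod_elim) blast
  then obtain r1 where r1: "0 < r1" "cball x0 r1 \<subseteq> A \<inter> B"
    by (metis IntI SigmaE2 open_Int open_contains_cball)
  \<comment> \<open>Products of two points of the smaller ball stay in the chart and land in the
    ball of radius \<open>r\<close>, where the field is controlled.\<close>
  define r' where "r' = min r r1"
  have r': "0 < r'" "r' \<le> r" using r r1 by (auto simp: r'_def)
  have Wr: "(y, z) \<in> W \<and> \<mu> (y, z) \<in> cball x0 r" if "y \<in> cball x0 r'" "z \<in> cball x0 r'" for y z
  proof -
    have "y \<in> A" "z \<in> B" using that r1(2) by (auto simp: r'_def)
    then have "(y, z) \<in> W \<inter> \<mu> -` ball x0 r" using AB(4) by blast
    then show ?thesis using ball_subset_cball by blast
  qed
  \<comment> \<open>The first bound is the smallness that Picard's theorem asks for at time 1 with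
    Lipschitz constant \<open>L * norm X\<close>; the second keeps the solution inside the ball of
    radius \<open>r'\<close> up to that time. The added 1 avoids division by 0.\<close>
  define \<delta> where "\<delta> = min (1 / (8 * L + 1)) (r' / (M + 1))"
  have \<delta>: "0 < \<delta>" using L M r' by (simp add: \<delta>_def)
  have \<delta>1: "8 * (L * d) * 1 \<le> 1" "M * d \<le> r'" if "0 \<le> d" "d \<le> \<delta>" for d
  proof -
    have "d * (8 * L + 1) \<le> 1" using that L by (simp add: \<delta>_def field_simps)
    then show "8 * (L * d) * 1 \<le> 1" using that by (simp add: algebra_simps)
    have "d * (M + 1) \<le> r'" using that M by (simp add: \<delta>_def field_simps)
    then show "M * d \<le> r'" using that by (simp add: algebra_simps)
  qed
  \<comment> \<open>Composition with the nearest-point projection makes the field globally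
    Lipschitz. The solutions never leave the ball, so the projection disappears again in
    \<open>x_d\<close>.\<close>
  define cp where "cp = closest_point (cball x0 r)"
  have cp: "cp x \<in> cball x0 r" for x unfolding cp_def
    using r by (intro closest_point_in_set) auto
  have cp_id: "cp x = x" if "x \<in> cball x0 r" for x unfolding cp_def using that by (rule closest_point_self)
  have cp_lip: "norm (cp x - cp y) \<le> norm (x - y)" for x y
    unfolding cp_def dist_norm[symmetric] using r by (intro closest_point_lipschitz) auto
  have "\<exists>x. x 0 = x0 \<and> (\<forall>t\<in>{-1..1}. (x has_vector_derivative lfield (cp (x t)) X) (at t within {-1..1}))"
    if X: "norm X \<le> \<delta>" for X
  proof (rule picard[where L = "L * norm X" and M = "M * norm X"])
    fix y z
    have "norm (lfield (cp y) X - lfield (cp z) X) \<le> L * norm (cp y - cp z) * norm X"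
      by (rule Lip[OF cp cp])
    also have "\<dots> \<le> L * norm (y - z) * norm X"
      by (intro mult_right_mono mult_left_mono cp_lip L) auto
    finally show "norm (lfield (cp y) X - lfield (cp z) X) \<le> L * norm X * norm (y - z)"
      by (simp add: mult_ac)
    show "norm (lfield (cp y) X) \<le> M * norm X" by (rule Bd[OF cp])
  qed (use \<delta>1[of "norm X"] X L in auto)
  then obtain x where x_0: "\<And>X. norm X \<le> \<delta> \<Longrightarrow> x X 0 = x0" and
    x_d': "\<And>X t. norm X \<le> \<delta> \<Longrightarrow> t \<in> {-1..1} \<Longrightarrow> (x X has_vector_derivative lfield (cp (x X t)) X) (at t within {-1..1})"
    by metis
  have x_r': "x X t \<in> cball x0 r'" if X: "norm X \<le> \<delta>" and t: "t \<in> {-1..1}" for X t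
  proof -
    have "norm (x X t - x X 0) \<le> M * norm X * norm (t - 0)"
    proof (rule differentiable_bound)
      show "(x X has_derivative (\<lambda>h. h *\<^sub>R lfield (cp (x X s)) X)) (at s within {-1..1})" if "s \<in> {-1..1}" for s
        using x_d'[OF X that] by (simp add: has_vector_derivative_def)
      show "onorm (\<lambda>h. h *\<^sub>R lfield (cp (x X s)) X) \<le> M * norm X" for s
        by (rule onorm_le) (use Bd[OF cp, of _ X] in \<open>simp add: mult.commute mult_left_mono\<close>)
    qed (use t in auto)
    also have "\<dots> \<le> M * norm X * 1" using t M by (intro mult_left_mono) auto
    also have "\<dots> \<le> r'" using \<delta>1(2)[of "norm X"] X by simp
    finally show ?thesis using x_0[OF X] by (simp add: dist_norm norm_minus_commute)
  qed
  have x_r: "x X t \<in> cball x0 r" if "norm X \<le> \<delta>" "t \<in> {-1..1}" for X t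
    using x_r'[OF that] r'(2) by simp
  have x_d: "(x X has_vector_derivative lfield (x X t) X) (at t within {-1..1})"
    if "norm X \<le> \<delta>" "t \<in> {-1..1}" for X t
    using x_d'[OF that] cp_id[OF x_r[OF that]] by simp
  \<comment> \<open>Times are at most 1/2 so that their sum stays in the interval of existence. As
    functions of the second time, both sides solve the equation of the left-invariant field with the
    same initial value.\<close>
  have hom: "\<psi> (x X (s + t)) = \<psi> (x X s) \<otimes> \<psi> (x X t)"
    if X: "norm X \<le> \<delta>" and s: "\<bar>s\<bar> \<le> 1/2" and t: "\<bar>t\<bar> \<le> 1/2" for X s t
  proof -
    define u where "u h = x X (s + h) - \<mu> (x X s, x X h)" for h
    have xs: "x X s \<in> cball x0 r'" using X s by (intro x_r') auto
    have xh: "x X h \<in> cball x0 r'" if "h \<in> {-(1/2)..1/2}" for h using that by (intro x_r' X) auto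
    have "u t = 0"
    proof (rule gronwall_zero[where u = u and L = "L * norm X" and T = "1/2"])
      fix h :: real assume h: "h \<in> {-(1/2)..1/2}"
      have w: "(x X s, x X h) \<in> W" "\<mu> (x X s, x X h) \<in> cball x0 r" using Wr[OF xs xh[OF h]] by auto
      have d1: "((\<lambda>h. x X (s + h)) has_vector_derivative lfield (x X (s + h)) X) (at h within {-(1/2)..1/2})"
      proof -
        have "(x X has_vector_derivative lfield (x X (s + h)) X) (at (s + h) within (+) s ` {-(1/2)..1/2})"
          by (rule has_vector_derivative_within_subset[OF x_d[OF X]]) (use s h in auto)
        moreover have "((+) s has_vector_derivative 1) (at h within {-(1/2)..1/2})"
          by (auto intro!: derivative_eq_intros)
        ultimately have "((x X \<circ> (+) s) has_vector_derivative 1 *\<^sub>R lfield (x X (s + h)) X) (at h within {-(1/2)..1/2})"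
          by (intro vector_diff_chain_within)
        then show ?thesis by (simp add: o_def)
      qed
      have "(x X has_vector_derivative lfield (x X h) X) (at h within {-(1/2)..1/2})"
        by (rule has_vector_derivative_within_subset[OF x_d[OF X]]) (use h in auto)
      from mu_right_deriv[OF this w(1)]
      have d2: "((\<lambda>h. \<mu> (x X s, x X h)) has_vector_derivative lfield (\<mu> (x X s, x X h)) X) (at h within {-(1/2)..1/2})"
        by (simp add: lfield_left_invariant[OF w(1)])
      show "(u has_vector_derivative (lfield (x X (s + h)) X - lfield (\<mu> (x X s, x X h)) X)) (at h within {-(1/2)..1/2})"
        unfolding u_def by (rule has_vector_derivative_diff[OF d1 d2])
      have "x X (s + h) \<in> cball x0 r" using s h by (intro x_r X) auto
      from Lip[OF this w(2), of X]
      show "norm (lfield (x X (s + h)) X - lfield (\<mu> (x X s, x X h)) X) \<le> L * norm X * norm (u h)"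
        by (simp add: u_def mult_ac)
    next
      have "x X s \<in> D" using xs r' r by auto
      then show "u 0 = 0" by (simp add: u_def x_0[OF X])
    qed (use L t in auto)
    then have "x X (s + t) = \<mu> (x X s, x X t)" by (simp add: u_def)
    moreover have "(x X s, x X t) \<in> W" using Wr[OF xs xh[of t]] t by (metis abs_le_iff atLeastAtMost_iff minus_le_iff)
    ultimately show ?thesis by (simp add: psi_mu)
  qed
  define C where "C = M * sqrt (exp ((2 * (L * \<delta>) + 1) * (1/2)))"
  show ?thesis
  proof (rule that[of \<delta> C x])
    show "0 < \<delta>" by fact
    show "0 \<le> C" using M by (simp add: C_def)
    show "x X t \<in> D" if "norm X \<le> \<delta>" "\<bar>t\<bar> \<le> 1/2" for X t
    proof -
      have "t \<in> {-1..1}" using that by auto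
      from x_r[OF that(1) this] show ?thesis using r by blast
    qed
    show "\<exists>\<gamma>. one_parameter_subgroup G X \<gamma> \<and> (\<forall>t. \<bar>t\<bar> \<le> 1/2 \<longrightarrow> \<gamma> t = \<psi> (x X t))" if X: "norm X \<le> \<delta>" for X
    proof -
      have "continuous_on {-1..1} (x X)"
        using x_d[OF X] by (meson continuous_on_vector_derivative)
      then have c: "continuous_on {-(1/2)..1/2} (x X)" by (rule continuous_on_subset) auto
      have cpsi: "continuous_on {-(1/2)..1/2} (\<lambda>t. \<psi> (x X t))"
        by (rule continuous_on_compose2[OF id_facts(4) c]) (use x_r[OF X] r in auto)
      have "\<exists>\<gamma>. continuous_on UNIV \<gamma> \<and> (\<forall>s t. \<gamma> (s + t) = \<gamma> s \<otimes> \<gamma> t) \<and>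
          (\<forall>t. \<bar>t\<bar> \<le> 1/2 \<longrightarrow> \<gamma> t = \<psi> (x X t))"
      proof (rule local_hom_extends[where a = "1/2" and g = "\<lambda>t. \<psi> (x X t)"])
        fix s t :: real assume "\<bar>s\<bar> \<le> 1/2" "\<bar>t\<bar> \<le> 1/2"
        then show "\<psi> (x X (s + t)) = \<psi> (x X s) \<otimes> \<psi> (x X t)" by (rule hom[OF X])
      qed (simp, rule cpsi)
      then obtain \<gamma> where \<gamma>: "continuous_on UNIV \<gamma>" "\<forall>s t. \<gamma> (s + t) = \<gamma> s \<otimes> \<gamma> t"
        "\<forall>t. \<bar>t\<bar> \<le> 1/2 \<longrightarrow> \<gamma> t = \<psi> (x X t)" by (elim exE conjE)
      have "(x X has_vector_derivative X) (at 0)"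
        using x_d[OF X, of 0] by (simp add: x_0[OF X] lfield_x0 at_within_Icc_at)
      moreover have "\<forall>\<^sub>F t in nhds 0. x X t = \<phi> (\<gamma> t)"
        unfolding eventually_nhds_metric
      proof (intro exI[of _ "1/2"] conjI allI impI)
        fix t :: real assume "dist t 0 < 1/2"
        then have "\<bar>t\<bar> \<le> 1/2" "t \<in> {-1..1}" by (auto simp: dist_real_def)
        then have "\<gamma> t = \<psi> (x X t)" "x X t \<in> D" using \<gamma>(3)[rule_format, of t] x_r[OF X, of t] r(2) by blast+
        then show "x X t = \<phi> (\<gamma> t)" by (simp only: id_facts(6))
      qed simp
      ultimately have "((\<lambda>t. \<phi> (\<gamma> t)) has_vector_derivative X) (at 0)"
        by (rule has_vector_derivative_ev)
      then have "one_parameter_subgroup G X \<gamma>"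
        unfolding one_parameter_subgroup_def o_def using \<gamma>(1,2) by (intro conjI)
      then show ?thesis using \<gamma>(3) by (intro exI[of _ \<gamma>] conjI)
    qed
    show "norm (x X (1/2) - x Y (1/2)) \<le> C * norm (X - Y)" if X: "norm X \<le> \<delta>" and Y: "norm Y \<le> \<delta>" for X Y
    proof -
      define u where "u t = x X t - x Y t" for t
      have "(norm (u (1/2)))\<^sup>2 \<le> (M * norm (X - Y))\<^sup>2 * (1/2) * exp ((2 * (L * \<delta>) + 1) * (1/2))"
      proof (rule gronwall_forward[where T = 1])
        fix t :: real assume t: "t \<in> {0..1}"
        show "(u has_vector_derivative (lfield (x X t) X - lfield (x Y t) Y)) (at t within {0..1})"
          unfolding u_def using t
          by (intro has_vector_derivative_diff has_vector_derivative_within_subset[OF x_d] X Y) auto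
        have m: "x X t \<in> cball x0 r" "x Y t \<in> cball x0 r" using t by (auto intro!: x_r X Y simp del: mem_cball)
        have lin: "linear (lfield (x Y t))" using m r by (intro lfield_linear) auto
        have "lfield (x X t) X - lfield (x Y t) Y = (lfield (x X t) X - lfield (x Y t) X) + lfield (x Y t) (X - Y)"
          by (simp add: linear_diff[OF lin])
        also have "norm \<dots> \<le> L * norm (x X t - x Y t) * norm X + M * norm (X - Y)"
          by (rule norm_triangle_le[OF add_mono[OF Lip[OF m] Bd[OF m(2)]]])
        also have "L * norm (x X t - x Y t) * norm X \<le> L * norm (x X t - x Y t) * \<delta>"
          using X L by (intro mult_left_mono) auto
        finally show "norm (lfield (x X t) X - lfield (x Y t) Y) \<le> (L * \<delta>) * norm (u t) + M * norm (X - Y)"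
          by (simp add: u_def mult_ac)
      qed (use L \<delta> in \<open>auto simp: u_def x_0[OF X] x_0[OF Y]\<close>)
      also have "\<dots> \<le> (M * norm (X - Y))\<^sup>2 * 1 * exp ((2 * (L * \<delta>) + 1) * (1/2))"
        by (intro mult_right_mono mult_left_mono) auto
      also have "\<dots> = (C * norm (X - Y))\<^sup>2"
        by (simp add: C_def power_mult_distrib)
      finally have "norm (u (1/2)) \<le> C * norm (X - Y)"
        by (rule power2_le_imp_le) (simp add: C_def M)
      then show ?thesis by (simp add: u_def)
    qed
  qed
qed

lemma ops_exists: "\<exists>\<gamma>. one_parameter_subgroup G X \<gamma>"
proof -
  obtain \<delta> C x where \<delta>: "0 < \<delta>" and
    ex: "\<And>X. norm X \<le> \<delta> \<Longrightarrow> \<exists>\<gamma>. one_parameter_subgroup G X \<gamma> \<and> (\<forall>t. \<bar>t\<bar> \<le> 1/2 \<longrightarrow> \<gamma> t = \<psi> (x X t))"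
    by (rule local_exp) blast
  define c where "c = \<delta> / (norm X + 1)"
  have c: "0 < c" using \<delta> by (simp add: c_def add_nonneg_pos)
  have "norm (c *\<^sub>R X) \<le> \<delta>"
  proof -
    have "norm (c *\<^sub>R X) = \<delta> * (norm X / (norm X + 1))" using \<delta> by (simp add: c_def)
    also have "\<dots> \<le> \<delta> * 1" using \<delta> by (intro mult_left_mono) (auto simp: divide_le_eq_1 add_nonneg_pos)
    finally show ?thesis by simp
  qed
  then obtain \<gamma> where "one_parameter_subgroup G (c *\<^sub>R X) \<gamma>" using ex by blast
  from ops_rescale[OF this, of "1 / c"] show ?thesis using c by auto
qed

lemma exp_ops: "one_parameter_subgroup G X (\<lambda>t. lie_exp G (t *\<^sub>R X))"
proof -
  obtain \<gamma> where \<gamma>: "one_parameter_subgroup G X \<gamma>" using ops_exists by blast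
  have "lie_exp G (t *\<^sub>R X) = \<gamma> t" for t
    using lie_exp_eqI[OF ops_rescale[OF \<gamma>, of t]] by simp
  then show ?thesis using \<gamma> by presburger
qed

lemma ops_exp: "one_parameter_subgroup G X \<gamma> \<Longrightarrow> \<gamma> t = lie_exp G (t *\<^sub>R X)"
  using ops_unique[OF _ exp_ops] by metis

lemmas exp_add = ops_hom[OF exp_ops]

lemma exp_zero[simp]: "lie_exp G 0 = \<one>"
  using ops_zero[OF exp_ops, of 0] by simp

lemma exp_minus: "lie_exp G (- X) = inv (lie_exp G X)"
proof -
  have "lie_exp G ((- 1) *\<^sub>R X) \<otimes> lie_exp G (1 *\<^sub>R X) = lie_exp G ((- 1 + 1) *\<^sub>R X)"
    by (rule exp_add[symmetric])
  then have "lie_exp G (- X) \<otimes> lie_exp G X = \<one>"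
    by (simp only: scaleR_minus1_left scaleR_one add.left_inverse scaleR_zero_left exp_zero)
  then have "inv (lie_exp G X) = lie_exp G (- X)" by (rule inv_equality) simp_all
  then show ?thesis by (rule sym)
qed

lemma exp_pow:
  assumes "n > 0"
  shows "lie_exp G X = lie_exp G ((1 / real n) *\<^sub>R X) [^] n"
proof -
  define \<gamma> where "\<gamma> t = lie_exp G (t *\<^sub>R X)" for t
  have "\<gamma> (s + t) = \<gamma> s \<otimes> \<gamma> t" for s t
    unfolding \<gamma>_def by (rule exp_add)
  then have "\<gamma> (real n * (1 / real n)) = \<gamma> (1 / real n) [^] n" by (rule hom_pow)
  moreover have "real n * (1 / real n) = 1" using assms by simp
  ultimately have "\<gamma> 1 = \<gamma> (1 / real n) [^] n" by metis
  then show ?thesis unfolding \<gamma>_def by (metis scaleR_one)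
qed

text \<open>Continuity near 0 comes from the Lipschitz dependence of the local solutions on
  \<open>X\<close>; elsewhere \<open>exp X\<close> is a fixed power of
  \<open>exp (X / n)\<close>.\<close>

lemma continuous_exp: "continuous_on UNIV (lie_exp G)"
proof -
  obtain \<delta> C x where \<delta>: "0 < \<delta>" "0 \<le> C" and
    xD: "\<And>X t. norm X \<le> \<delta> \<Longrightarrow> \<bar>t\<bar> \<le> 1/2 \<Longrightarrow> x X t \<in> D" and
    ex: "\<And>X. norm X \<le> \<delta> \<Longrightarrow> \<exists>\<gamma>. one_parameter_subgroup G X \<gamma> \<and> (\<forall>t. \<bar>t\<bar> \<le> 1/2 \<longrightarrow> \<gamma> t = \<psi> (x X t))" and
    lip: "\<And>X Y. norm X \<le> \<delta> \<Longrightarrow> norm Y \<le> \<delta> \<Longrightarrow> norm (x X (1/2) - x Y (1/2)) \<le> C * norm (X - Y)"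
    by (rule local_exp) blast
  have e: "lie_exp G (X /\<^sub>R 2) = \<psi> (x X (1/2))" if nX: "norm X \<le> \<delta>" for X
  proof -
    obtain \<gamma> where \<gamma>: "one_parameter_subgroup G X \<gamma>" and g: "\<forall>t. \<bar>t\<bar> \<le> 1/2 \<longrightarrow> \<gamma> t = \<psi> (x X t)"
      using ex[OF nX] by (elim exE conjE)
    have "\<gamma> (1/2) = \<psi> (x X (1/2))" using g by simp
    moreover have "\<gamma> (1/2) = lie_exp G ((1/2) *\<^sub>R X)" by (rule ops_exp[OF \<gamma>])
    moreover have "(1/2) *\<^sub>R X = X /\<^sub>R 2" by simp
    ultimately show ?thesis by metis
  qed
  have "continuous_on (cball 0 \<delta>) (\<lambda>X. x X (1/2))"
    by (rule lipschitz_on_continuous_on[of C]) (auto intro!: lipschitz_onI lip \<delta> simp: dist_norm)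
  then have "continuous_on (cball 0 \<delta>) (\<lambda>X. \<psi> (x X (1/2)))"
    by (rule continuous_on_compose2[OF id_facts(4)]) (auto intro!: xD)
  then have c0: "continuous_on (cball 0 \<delta>) (\<lambda>X. lie_exp G (X /\<^sub>R 2))"
    by (rule continuous_on_eq) (rule e[symmetric], simp)
  show ?thesis
  proof (rule continuous_at_imp_continuous_on, rule ballI)
    fix X0 :: 'l
    \<comment> \<open>The factor 2 compensates that near 0 continuity is known for
      \<open>X \<mapsto> exp (X / 2)\<close>; the 1 covers the unit ball around
      \<open>X0\<close>.\<close>
    obtain n :: nat where n: "2 * (norm X0 + 1) / \<delta> < real n" using reals_Archimedean2 by blast
    then have n0: "0 < real n" using \<delta> by (smt (verit) divide_nonneg_pos norm_ge_zero)
    have "continuous_on (ball X0 1) (\<lambda>X. lie_exp G ((1 / real n) *\<^sub>R X) [^] n)"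
    proof (rule continuous_on_pow)
      have "continuous_on (ball X0 1) (\<lambda>X. lie_exp G (((2 / real n) *\<^sub>R X) /\<^sub>R 2))"
      proof (rule continuous_on_compose2[OF c0])
        show "(\<lambda>X. (2 / real n) *\<^sub>R X) ` ball X0 1 \<subseteq> cball 0 \<delta>"
        proof clarsimp
          fix X assume "dist X0 X < 1"
          then have "norm X \<le> norm X0 + 1"
            using norm_triangle_ineq2[of X X0] by (simp add: dist_norm norm_minus_commute)
          then have "2 * norm X \<le> 2 * (norm X0 + 1)" by simp
          also have "\<dots> \<le> \<delta> * real n" using n \<delta> by (simp add: field_simps)
          finally show "2 * norm X / real n \<le> \<delta>" using n0 by (simp add: field_simps)
        qed
      qed (intro continuous_intros)
      moreover have "((2 / real n) *\<^sub>R X) /\<^sub>R 2 = (1 / real n) *\<^sub>R X" for X :: 'l by simp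
      ultimately show "continuous_on (ball X0 1) (\<lambda>X. lie_exp G ((1 / real n) *\<^sub>R X))" by simp
    qed
    then have "continuous_on (ball X0 1) (lie_exp G)"
    proof (rule continuous_on_eq)
      show "lie_exp G ((1 / real n) *\<^sub>R X) [^] n = lie_exp G X" for X
        using exp_pow[of n X] n0 by simp
    qed
    then show "isCont (lie_exp G) X0"
      by (simp add: continuous_on_eq_continuous_at)
  qed
qed

lemmas continuous_on_exp[continuous_intros] = continuous_on_compose2[OF continuous_exp _ subset_UNIV]

lemma tendsto_exp_group[tendsto_intros]: "(f \<longlongrightarrow> X) F \<Longrightarrow> ((\<lambda>x. lie_exp G (f x)) \<longlongrightarrow> lie_exp G X) F"
  using continuous_on_tendsto_compose[OF continuous_exp, of f X F] by simp

end

lemma frechet_derivative_fixed_first: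
  assumes "(f has_derivative f') (at (a, y))"
  shows "((\<lambda>y. f (a, y)) has_derivative (\<lambda>v. f' (0, v))) (at y)"
proof -
  have "((\<lambda>y. (a, y)) has_derivative (\<lambda>v. (0, v))) (at y)" by (auto intro!: derivative_eq_intros)
  from diff_chain_at[OF this assms] show ?thesis by (simp add: o_def)
qed

lemma frechet_derivative_fixed_second:
  assumes "(f has_derivative f') (at (x, b))"
  shows "((\<lambda>x. f (x, b)) has_derivative (\<lambda>v. f' (v, 0))) (at x)"
proof -
  have "((\<lambda>x. (x, b)) has_derivative (\<lambda>v. (v, 0))) (at x)" by (auto intro!: derivative_eq_intros)
  from diff_chain_at[OF this assms] show ?thesis by (simp add: o_def)
qed

lemma vector_derivative_chain:
  assumes "(c has_vector_derivative c') (at t)" "(f has_derivative f') (at (c t))"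
  shows "((\<lambda>t. f (c t)) has_vector_derivative f' c') (at t)"
  using vector_derivative_diff_chain_within[OF assms(1) has_derivative_at_withinI[OF assms(2)]]
  by (simp add: o_def)

lemma isCont_nhds: "isCont f x \<Longrightarrow> (f \<longlongrightarrow> f x) (nhds x)"
  by (simp add: isCont_def tendsto_at_iff_tendsto_nhds)

lemma nhds_isCont: "(f \<longlongrightarrow> f x) (nhds x) \<Longrightarrow> isCont f x"
  by (simp add: isCont_def tendsto_at_iff_tendsto_nhds)

section \<open>The adjoint representation and the Lie bracket\<close>

context lie_grp
begin

lemma inv_cancel[simp]: "inv g \<otimes> (g \<otimes> x) = x" "g \<otimes> (inv g \<otimes> x) = x"
  by (simp_all flip: m_assoc)

definition conj_coord :: "'g \<Rightarrow> 'l \<Rightarrow> 'l" where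
  "conj_coord g y = \<phi> (g \<otimes> \<psi> y \<otimes> inv g)"

lemma psi_tendsto: "(\<psi> \<longlongrightarrow> \<one>) (nhds x0)"
proof -
  have "isCont \<psi> x0" using id_facts(2,4) x0_D continuous_on_eq_continuous_at by blast
  from isCont_nhds[OF this] show ?thesis by simp
qed

text \<open>The intermediate product \<open>g \<otimes> \<psi> y\<close> is near \<open>g\<close>
  and need not lie in the chart around the identity. Conjugation is therefore split into two
  multiplications that meet in a chart around \<open>g\<close>.\<close>

lemma conj_differentiable: "\<exists>f'. (conj_coord g has_derivative f') (at x0)"
proof -
  obtain \<kappa> where \<kappa>: "\<kappa> \<in> atlas G" "g \<in> fst \<kappa>" using atlas_cover by blast
  obtain \<kappa>' where \<kappa>': "\<kappa>' \<in> atlas G" "inv g \<in> fst \<kappa>'" using atlas_cover by blast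
  note f = chart_facts[OF atlas_chart[OF \<kappa>(1)]] and f' = chart_facts[OF atlas_chart[OF \<kappa>'(1)]]
  define a where "a = snd \<kappa> g"
  define b where "b = snd \<kappa>' (inv g)"
  have a: "a \<in> snd \<kappa> ` fst \<kappa>" "chart_inv \<kappa> a = g" using \<kappa> f by (auto simp: a_def)
  have b: "b \<in> snd \<kappa>' ` fst \<kappa>'" "chart_inv \<kappa>' b = inv g" using \<kappa>' f' by (auto simp: b_def)
  let ?m1 = "prod_coord \<kappa> (id_chart G) \<kappa>"
  let ?m2 = "prod_coord \<kappa> \<kappa>' (id_chart G)"
  have m1: "?m1 (a, y) = snd \<kappa> (g \<otimes> \<psi> y)" for y by (simp add: prod_coord_def a id_coord_def)
  have m2: "?m2 (z, b) = \<phi> (chart_inv \<kappa> z \<otimes> inv g)" for z by (simp add: prod_coord_def b id_coord_def)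
  have d1: "(a, x0) \<in> prod_dom \<kappa> (id_chart G) \<kappa>"
    using a x0_D psi_x0 \<kappa> by (simp add: prod_dom_def id_coord_def)
  have d2: "(a, b) \<in> prod_dom \<kappa> \<kappa>' (id_chart G)"
    using a b one_U by (simp add: prod_dom_def)
  have s1: "smooth_on (prod_dom \<kappa> (id_chart G) \<kappa>) ?m1"
    and s2: "smooth_on (prod_dom \<kappa> \<kappa>' (id_chart G)) ?m2"
    by (rule prod_smooth[OF \<kappa>(1) id_chart_atlas \<kappa>(1)], rule prod_smooth[OF \<kappa>(1) \<kappa>'(1) id_chart_atlas])
  have D1: "((\<lambda>y. ?m1 (a, y)) has_derivative (\<lambda>v. frechet_derivative ?m1 (at (a, x0)) (0, v))) (at x0)"
    by (rule frechet_derivative_fixed_first[OF smooth_on_has_derivative[OF s1 d1]])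
  have D2: "((\<lambda>z. ?m2 (z, b)) has_derivative (\<lambda>v. frechet_derivative ?m2 (at (a, b)) (v, 0))) (at a)"
    by (rule frechet_derivative_fixed_second[OF smooth_on_has_derivative[OF s2 d2]])
  have e: "?m1 (a, x0) = a" unfolding m1 by (simp add: a_def)
  have "((\<lambda>y. ?m2 (?m1 (a, y), b)) has_derivative
      (\<lambda>v. frechet_derivative ?m2 (at (a, b)) (frechet_derivative ?m1 (at (a, x0)) (0, v), 0))) (at x0)"
    using diff_chain_at[OF D1] D2 e by (simp add: o_def)
  moreover have "\<forall>\<^sub>F y in nhds x0. ?m2 (?m1 (a, y), b) = conj_coord g y"
  proof -
    have "((\<lambda>y. g \<otimes> \<psi> y) \<longlongrightarrow> g \<otimes> \<one>) (nhds x0)" by (intro tendsto_intros psi_tendsto)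
    then have "((\<lambda>y. g \<otimes> \<psi> y) \<longlongrightarrow> g) (nhds x0)" by simp
    then have "\<forall>\<^sub>F y in nhds x0. g \<otimes> \<psi> y \<in> fst \<kappa>"
      by (rule topological_tendstoD) (use f(1) \<kappa>(2) in auto)
    then show ?thesis
      by eventually_elim (simp only: m1 m2 f(5) conj_coord_def)
  qed
  ultimately show ?thesis using has_derivative_ev by blast
qed

lemma Ad_has_derivative: "(conj_coord g has_derivative Ad G g) (at x0)"
proof -
  obtain f' where f': "(conj_coord g has_derivative f') (at x0)" using conj_differentiable by blast
  have "Ad G g X = f' X" for X
  proof -
    have c: "((\<lambda>t. x0 + t *\<^sub>R X) has_vector_derivative X) (at 0)"
      by (auto intro!: derivative_eq_intros)
    have "((\<lambda>t. conj_coord g (x0 + t *\<^sub>R X)) has_vector_derivative f' X) (at 0)"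
      by (rule vector_derivative_chain[OF c]) (simp add: f')
    then show ?thesis unfolding Ad_def conj_coord_def id_coord_def
      by (rule vector_derivative_at)
  qed
  then have "Ad G g = f'" by (rule ext)
  with f' show ?thesis by simp
qed

lemma Ad_linear: "linear (Ad G g)"
  using Ad_has_derivative has_derivative_linear by blast

lemma conj_coord_x0[simp]: "conj_coord g x0 = x0"
  by (simp add: conj_coord_def)

lemma Ad_one[simp]: "Ad G \<one> X = X"
proof -
  have "((\<lambda>y. y) has_derivative Ad G \<one>) (at x0)"
  proof (rule has_derivative_ev[OF Ad_has_derivative])
    have "\<forall>\<^sub>F y in nhds x0. y \<in> D" using id_facts(2) x0_D eventually_nhds by blast
    then show "\<forall>\<^sub>F y in nhds x0. conj_coord \<one> y = y"
      by eventually_elim (simp add: conj_coord_def id_facts(6))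
  qed
  from has_derivative_unique[OF this has_derivative_ident] show ?thesis by metis
qed

lemma conj_ev_U: "\<forall>\<^sub>F y in nhds x0. g \<otimes> \<psi> y \<otimes> inv g \<in> U"
proof -
  have "((\<lambda>y. g \<otimes> \<psi> y \<otimes> inv g) \<longlongrightarrow> g \<otimes> \<one> \<otimes> inv g) (nhds x0)" by (intro tendsto_intros psi_tendsto)
  then have "((\<lambda>y. g \<otimes> \<psi> y \<otimes> inv g) \<longlongrightarrow> \<one>) (nhds x0)" by simp
  then show ?thesis by (rule topological_tendstoD) (use id_facts(1) one_U in auto)
qed

lemma Ad_mult: "Ad G (g \<otimes> h) X = Ad G g (Ad G h X)"
proof -
  have "(conj_coord g \<circ> conj_coord h has_derivative Ad G g \<circ> Ad G h) (at x0)"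
    by (rule diff_chain_at[OF Ad_has_derivative]) (simp add: Ad_has_derivative)
  moreover have "\<forall>\<^sub>F y in nhds x0. (conj_coord g \<circ> conj_coord h) y = conj_coord (g \<otimes> h) y"
    using conj_ev_U[of h]
    by eventually_elim (simp add: conj_coord_def id_facts(5) inv_mult_group m_assoc)
  ultimately have "(conj_coord (g \<otimes> h) has_derivative Ad G g \<circ> Ad G h) (at x0)"
    by (rule has_derivative_ev)
  from has_derivative_unique[OF this Ad_has_derivative] show ?thesis by (metis o_apply)
qed

lemma Ad_inv[simp]: "Ad G (inv g) (Ad G g X) = X" "Ad G g (Ad G (inv g) X) = X"
  by (simp_all flip: Ad_mult)

lemma conj_curve:
  assumes c: "((\<lambda>t. \<phi> (\<gamma> t)) has_vector_derivative X) (at 0)" "\<gamma> 0 = \<one>" "isCont \<gamma> 0"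
  shows "((\<lambda>t. \<phi> (g \<otimes> \<gamma> t \<otimes> inv g)) has_vector_derivative Ad G g X) (at 0)"
proof -
  have "((\<lambda>t. conj_coord g (\<phi> (\<gamma> t))) has_vector_derivative Ad G g X) (at 0)"
    by (rule vector_derivative_chain[OF c(1)]) (simp add: c(2) Ad_has_derivative)
  moreover have "\<forall>\<^sub>F t in nhds 0. conj_coord g (\<phi> (\<gamma> t)) = \<phi> (g \<otimes> \<gamma> t \<otimes> inv g)"
  proof -
    have "(\<gamma> \<longlongrightarrow> \<gamma> 0) (nhds 0)" using c(3) by (rule isCont_nhds)
    then have "\<forall>\<^sub>F t in nhds 0. \<gamma> t \<in> U"
      by (rule topological_tendstoD) (use id_facts(1) one_U c(2) in auto)
    then show ?thesis by eventually_elim (simp add: conj_coord_def id_facts(5))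
  qed
  ultimately show ?thesis by (rule has_vector_derivative_ev)
qed

lemma conj_ops:
  assumes "one_parameter_subgroup G X \<gamma>"
  shows "one_parameter_subgroup G (Ad G g X) (\<lambda>t. g \<otimes> \<gamma> t \<otimes> inv g)"
  unfolding one_parameter_subgroup_def
proof (intro conjI allI)
  show "continuous_on UNIV (\<lambda>t. g \<otimes> \<gamma> t \<otimes> inv g)"
    by (intro continuous_intros ops_cont[OF assms])
  show "g \<otimes> \<gamma> (s + t) \<otimes> inv g = g \<otimes> \<gamma> s \<otimes> inv g \<otimes> (g \<otimes> \<gamma> t \<otimes> inv g)" for s t
    by (simp add: ops_hom[OF assms] m_assoc)
  have "isCont \<gamma> 0" using ops_cont[OF assms] by (simp add: continuous_on_eq_continuous_at)
  then show "(\<phi> \<circ> (\<lambda>t. g \<otimes> \<gamma> t \<otimes> inv g) has_vector_derivative Ad G g X) (at 0)"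
    unfolding o_def by (rule conj_curve[OF ops_deriv0[OF assms] ops_zero[OF assms]])
qed

lemma exp_Ad: "lie_exp G (Ad G g X) = g \<otimes> lie_exp G X \<otimes> inv g"
  using lie_exp_eqI[OF conj_ops[OF exp_ops[of X]], of g] by simp

text \<open>In the chart around the identity, \<open>Ad\<close> is a partial derivative of the product
  \<open>(x, y) \<mapsto> x y x\<^sup>-\<^sup>1\<close>, hence itself differentiable.\<close>

lemma Ad_differentiable: "\<exists>A'. ((\<lambda>x. Ad G (\<psi> x) Y) has_derivative A') (at x0)"
proof -
  define \<iota> where "\<iota> x = \<phi> (inv (\<psi> x))" for x
  have \<iota>x0: "\<iota> x0 = x0" by (simp add: \<iota>_def)
  have \<iota>d: "\<iota> differentiable (at x0)"
    unfolding \<iota>_def by (rule smooth_on_differentiable[OF inv_smooth]) (use x0_D one_U in auto)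
  define F where "F z v = frechet_derivative \<mu> (at z) v" for z v
  have Fd: "(\<lambda>z. F z v) differentiable (at (x0, x0))" for v
    unfolding F_def by (rule smooth_on_differentiable[OF lfield_smooth]) (use W_x0 x0_D in auto)
  \<comment> \<open>Smoothness makes the derivative of the product differentiable in its base point
    for a fixed direction, but here the direction also moves with \<open>x\<close>. Expanding it
    over the basis leaves scalar functions times vectors in fixed directions.\<close>
  have eq: "Ad G (\<psi> x) Y = (\<Sum>b\<in>Basis. (F (x, x0) (0, Y) \<bullet> b) *\<^sub>R F (x, \<iota> x) (b, 0))"
    if x: "x \<in> D" "inv (\<psi> x) \<in> U" for x
  proof -
    have xi: "\<iota> x \<in> D" "\<psi> (\<iota> x) = inv (\<psi> x)" using x by (auto simp: \<iota>_def id_facts(5))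
    have W1: "(x, \<iota> x) \<in> W" using x xi one_U by (auto simp: mem_W)
    have D1: "((\<lambda>y. \<mu> (x, y)) has_derivative (\<lambda>v. F (x, x0) (0, v))) (at x0)"
      unfolding F_def by (rule frechet_derivative_fixed_first[OF mu_deriv[OF W_x0(1)[OF x(1)]]])
    have D2: "((\<lambda>z. \<mu> (z, \<iota> x)) has_derivative (\<lambda>v. F (x, \<iota> x) (v, 0))) (at x)"
      unfolding F_def by (rule frechet_derivative_fixed_second[OF mu_deriv[OF W1]])
    have "((\<lambda>y. \<mu> (\<mu> (x, y), \<iota> x)) has_derivative (\<lambda>v. F (x, \<iota> x) (F (x, x0) (0, v), 0))) (at x0)"
      using diff_chain_at[OF D1] D2 x by (simp add: o_def)
    moreover have "\<forall>\<^sub>F y in nhds x0. \<mu> (\<mu> (x, y), \<iota> x) = conj_coord (\<psi> x) y"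
    proof -
      have "\<forall>\<^sub>F y in nhds x0. (x, y) \<in> W"
        by (rule topological_tendstoD[OF tendsto_Pair[OF tendsto_const filterlim_ident] W_open W_x0(1)[OF x(1)]])
      then show ?thesis
      proof eventually_elim
        case (elim y)
        have "\<mu> (\<mu> (x, y), \<iota> x) = \<phi> (\<psi> (\<mu> (x, y)) \<otimes> \<psi> (\<iota> x))" by (rule mu_eq)
        then show ?case by (simp add: psi_mu[OF elim] xi conj_coord_def)
      qed
    qed
    ultimately have "(conj_coord (\<psi> x) has_derivative (\<lambda>v. F (x, \<iota> x) (F (x, x0) (0, v), 0))) (at x0)"
      by (rule has_derivative_ev)
    from has_derivative_unique[OF Ad_has_derivative this]
    have "Ad G (\<psi> x) Y = F (x, \<iota> x) (F (x, x0) (0, Y), 0)" by metis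
    also have "\<dots> = F (x, \<iota> x) (\<Sum>b\<in>Basis. (F (x, x0) (0, Y) \<bullet> b) *\<^sub>R b, 0)"
      by (simp add: euclidean_representation)
    also have "\<dots> = (\<Sum>b\<in>Basis. (F (x, x0) (0, Y) \<bullet> b) *\<^sub>R F (x, \<iota> x) (b, 0))"
    proof -
      have l: "linear (\<lambda>v. F (x, \<iota> x) (v, 0))" using D2 has_derivative_linear by blast
      show ?thesis by (simp add: linear_sum[OF l] linear_scale[OF l])
    qed
    finally show ?thesis .
  qed
  have ev: "\<forall>\<^sub>F x in nhds x0. (\<Sum>b\<in>Basis. (F (x, x0) (0, Y) \<bullet> b) *\<^sub>R F (x, \<iota> x) (b, 0)) = Ad G (\<psi> x) Y"
  proof -
    have "open {x. x \<in> D \<and> inv (\<psi> x) \<in> U}" by (rule smooth_on_open[OF inv_smooth])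
    then have "\<forall>\<^sub>F x in nhds x0. x \<in> {x. x \<in> D \<and> inv (\<psi> x) \<in> U}"
      using x0_D one_U by (intro eventually_nhds_in_open) auto
    then show ?thesis by eventually_elim (simp add: eq)
  qed
  have p1: "(\<lambda>x. F (x, x0) v) differentiable (at x0)" for v
  proof -
    have a: "((\<lambda>x. (x, x0)) has_derivative (\<lambda>h. (h, 0))) (at x0)" by (auto intro!: derivative_eq_intros)
    obtain f' where f': "((\<lambda>z. F z v) has_derivative f') (at (x0, x0))" using Fd differentiable_def by blast
    from diff_chain_at[OF a f'] show ?thesis unfolding o_def by (rule differentiableI)
  qed
  have p2: "(\<lambda>x. F (x, \<iota> x) v) differentiable (at x0)" for v
  proof -
    obtain i' where "(\<iota> has_derivative i') (at x0)" using \<iota>d differentiable_def by blast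
    then have a: "((\<lambda>x. (x, \<iota> x)) has_derivative (\<lambda>h. (h, i' h))) (at x0)"
      by (auto intro!: derivative_eq_intros)
    obtain f' where f': "((\<lambda>z. F z v) has_derivative f') (at (x0, \<iota> x0))" using Fd \<iota>x0 differentiable_def by metis
    from diff_chain_at[OF a f'] show ?thesis unfolding o_def by (rule differentiableI)
  qed
  have "(\<lambda>x. \<Sum>b\<in>Basis. (F (x, x0) (0, Y) \<bullet> b) *\<^sub>R F (x, \<iota> x) (b, 0)) differentiable (at x0)"
    by (intro differentiable_sum finite_Basis ballI differentiable_scaleR differentiable_inner p1 p2 differentiable_const)
  then obtain A' where "((\<lambda>x. \<Sum>b\<in>Basis. (F (x, x0) (0, Y) \<bullet> b) *\<^sub>R F (x, \<iota> x) (b, 0)) has_derivative A') (at x0)"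
    using differentiable_def by blast
  then have "((\<lambda>x. Ad G (\<psi> x) Y) has_derivative A') (at x0)" by (rule has_derivative_ev[OF _ ev])
  then show ?thesis by blast
qed

lemma bracket_deriv:
  "((\<lambda>t. Ad G (lie_exp G (t *\<^sub>R X)) Y) has_vector_derivative bracket G X Y) (at 0)"
  and bracket_linear_left: "linear (\<lambda>X. bracket G X Y)"
proof -
  obtain A' where A': "((\<lambda>x. Ad G (\<psi> x) Y) has_derivative A') (at x0)" using Ad_differentiable by blast
  have d: "((\<lambda>t. Ad G (lie_exp G (t *\<^sub>R X)) Y) has_vector_derivative A' X) (at 0)" for X
  proof -
    have "((\<lambda>t. Ad G (\<psi> (\<phi> (lie_exp G (t *\<^sub>R X)))) Y) has_vector_derivative A' X) (at 0)"
      by (rule vector_derivative_chain[OF ops_deriv0[OF exp_ops]]) (simp add: A')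
    moreover have "\<forall>\<^sub>F t in nhds 0. Ad G (\<psi> (\<phi> (lie_exp G (t *\<^sub>R X)))) Y
        = Ad G (lie_exp G (t *\<^sub>R X)) Y"
    proof -
      have "\<forall>\<^sub>F t in nhds 0. lie_exp G (t *\<^sub>R X) \<in> U"
        by (rule ops_ev_U[OF exp_ops]) (use one_U id_facts(1) in auto)
      then show ?thesis by eventually_elim (simp add: id_facts(5))
    qed
    ultimately show ?thesis by (rule has_vector_derivative_ev)
  qed
  then have e: "bracket G X Y = A' X" for X
    unfolding bracket_def by (rule vector_derivative_at)
  show "((\<lambda>t. Ad G (lie_exp G (t *\<^sub>R X)) Y) has_vector_derivative bracket G X Y) (at 0)"
    using d[of X] e by simp
  show "linear (\<lambda>X. bracket G X Y)" unfolding e using A' has_derivative_linear by blast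
qed

lemma bracket_linear_right: "linear (bracket G X)"
proof (rule linearI)
  fix Y Z and c :: real
  have "((\<lambda>t. Ad G (lie_exp G (t *\<^sub>R X)) (Y + Z)) has_vector_derivative bracket G X Y + bracket G X Z) (at 0)"
    unfolding linear_add[OF Ad_linear] by (intro has_vector_derivative_add bracket_deriv)
  from vector_derivative_unique_at[OF bracket_deriv this]
  show "bracket G X (Y + Z) = bracket G X Y + bracket G X Z" .
  have "((\<lambda>t. Ad G (lie_exp G (t *\<^sub>R X)) (c *\<^sub>R Y)) has_vector_derivative c *\<^sub>R bracket G X Y) (at 0)"
    unfolding linear_scale[OF Ad_linear]
    by (rule has_vector_derivative_scaleR[OF _ bracket_deriv, of "\<lambda>_. c" 0, simplified])
  from vector_derivative_unique_at[OF bracket_deriv this]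
  show "bracket G X (c *\<^sub>R Y) = c *\<^sub>R bracket G X Y" .
qed

text \<open>The curve \<open>c t\<close> satisfies \<open>c (h + t) = Ad (exp (h X)) (c t)\<close>,
  so it solves the linear equation whose operator is \<open>bracket G X\<close>.\<close>

lemma Ad_exp_mexp: "Ad G (lie_exp G X) Y = mexp (bracket G X) Y"
proof -
  define c where "c t = Ad G (lie_exp G (t *\<^sub>R X)) Y" for t
  have "(c has_vector_derivative bracket G X (c t)) (at t)" for t
  proof -
    have "((\<lambda>h. Ad G (lie_exp G (h *\<^sub>R X)) (c t)) has_vector_derivative bracket G X (c t)) (at 0)"
      by (rule bracket_deriv)
    then have d: "((\<lambda>h. c (h + t)) has_vector_derivative bracket G X (c t)) (at 0)"
      unfolding c_def by (simp add: exp_add Ad_mult)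
    have "((\<lambda>s. s - t) has_vector_derivative 1) (at t)" by (auto intro!: derivative_eq_intros)
    from vector_diff_chain_at[OF this, of "\<lambda>h. c (h + t)" "bracket G X (c t)"] d
    show ?thesis by (simp add: o_def)
  qed
  from linear_ode_unique[OF bracket_linear_right this, of 1] show ?thesis by (simp add: c_def)
qed

text \<open>\<open>exp (t X)\<close> commutes with \<open>exp (s X)\<close>, so conjugation by it
  leaves the one-parameter subgroup, and hence its velocity \<open>X\<close>, unchanged.\<close>

lemma bracket_self: "bracket G X X = 0"
proof -
  have "Ad G (lie_exp G (t *\<^sub>R X)) X = X" for t
  proof -
    have 1: "one_parameter_subgroup G (Ad G (lie_exp G (t *\<^sub>R X)) X)
        (\<lambda>s. lie_exp G (t *\<^sub>R X) \<otimes> lie_exp G (s *\<^sub>R X) \<otimes> inv (lie_exp G (t *\<^sub>R X)))"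
      by (rule conj_ops[OF exp_ops])
    have e: "lie_exp G (t *\<^sub>R X) \<otimes> lie_exp G (s *\<^sub>R X) \<otimes> inv (lie_exp G (t *\<^sub>R X)) = lie_exp G (s *\<^sub>R X)" for s
    proof -
      have "lie_exp G (t *\<^sub>R X) \<otimes> lie_exp G (s *\<^sub>R X) = lie_exp G (s *\<^sub>R X) \<otimes> lie_exp G (t *\<^sub>R X)"
        unfolding exp_add[symmetric] by (simp only: add.commute)
      then show ?thesis by (simp add: m_assoc)
    qed
    from vector_derivative_unique_at[OF ops_deriv0[OF 1[unfolded e]] ops_deriv0[OF exp_ops]]
    show ?thesis .
  qed
  then have "((\<lambda>t. X) has_vector_derivative bracket G X X) (at 0)"
    using bracket_deriv[of X X] by simp
  from vector_derivative_unique_at[OF this has_vector_derivative_const] show ?thesis .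
qed

lemma bracket_bilinear: "bilinear (bracket G)"
  unfolding bilinear_def using bracket_linear_left bracket_linear_right by blast

lemmas bracket_simps =
  linear_add[OF bracket_linear_right] linear_scale[OF bracket_linear_right]
  linear_diff[OF bracket_linear_right] linear_neg[OF bracket_linear_right] linear_0[OF bracket_linear_right]
  linear_add[OF bracket_linear_left] linear_scale[OF bracket_linear_left]
  linear_diff[OF bracket_linear_left] linear_neg[OF bracket_linear_left] linear_0[OF bracket_linear_left]

lemma bracket_antisym: "bracket G X Y = - bracket G Y X"
proof -
  have "bracket G (X + Y) (X + Y) = (bracket G X X + bracket G Y X) + (bracket G X Y + bracket G Y Y)"
    by (simp only: linear_add[OF bracket_linear_right] linear_add[OF bracket_linear_left])
  then have "bracket G X Y + bracket G Y X = 0" by (simp add: bracket_self add.commute)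
  then show ?thesis by (simp add: eq_neg_iff_add_eq_0)
qed

lemma Ad_bracket: "Ad G g (bracket G X Y) = bracket G (Ad G g X) (Ad G g Y)"
proof -
  have "bounded_linear (Ad G g)" using Ad_linear linear_conv_bounded_linear by blast
  from bounded_linear.has_vector_derivative[OF this bracket_deriv]
  have "((\<lambda>t. Ad G g (Ad G (lie_exp G (t *\<^sub>R X)) Y)) has_vector_derivative Ad G g (bracket G X Y)) (at 0)" .
  moreover have "Ad G g (Ad G (lie_exp G (t *\<^sub>R X)) Y) = Ad G (lie_exp G (t *\<^sub>R Ad G g X)) (Ad G g Y)" for t
    by (simp add: linear_scale[OF Ad_linear, symmetric] exp_Ad Ad_mult)
  ultimately have "((\<lambda>t. Ad G (lie_exp G (t *\<^sub>R Ad G g X)) (Ad G g Y)) has_vector_derivative Ad G g (bracket G X Y)) (at 0)"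
    by simp
  from vector_derivative_unique_at[OF this bracket_deriv] show ?thesis .
qed

text \<open>The derivative at \<open>t = 0\<close> of \<open>Ad_bracket\<close> along
  \<open>exp (t Z)\<close>, by the product rule.\<close>

lemma jacobi: "bracket G Z (bracket G X Y) = bracket G (bracket G Z X) Y + bracket G X (bracket G Z Y)"
proof -
  have bb: "bounded_bilinear (bracket G)"
    using bracket_bilinear bilinear_conv_bounded_bilinear by blast
  have "((\<lambda>t. bracket G (Ad G (lie_exp G (t *\<^sub>R Z)) X) (Ad G (lie_exp G (t *\<^sub>R Z)) Y))
      has_vector_derivative bracket G (Ad G (lie_exp G (0 *\<^sub>R Z)) X) (bracket G Z Y)
        + bracket G (bracket G Z X) (Ad G (lie_exp G (0 *\<^sub>R Z)) Y)) (at 0)"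
    by (rule bounded_bilinear.has_vector_derivative[OF bb bracket_deriv bracket_deriv])
  then have "((\<lambda>t. Ad G (lie_exp G (t *\<^sub>R Z)) (bracket G X Y)) has_vector_derivative
      bracket G X (bracket G Z Y) + bracket G (bracket G Z X) Y) (at 0)"
    by (simp add: Ad_bracket)
  from vector_derivative_unique_at[OF bracket_deriv this] show ?thesis by (simp add: add.commute)
qed

text \<open>Differentiability in the chart gives continuity at the identity; it is carried to
  \<open>g0\<close> by \<open>Ad g = Ad g0 \<circ> Ad (g0^-1 g)\<close>.\<close>

lemma continuous_Ad: "continuous_on UNIV (\<lambda>g. Ad G g Y)"
proof (rule continuous_at_imp_continuous_on, rule ballI)
  fix g0
  obtain A' where A': "((\<lambda>x. Ad G (\<psi> x) Y) has_derivative A') (at x0)" using Ad_differentiable by blast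
  have "isCont (\<lambda>x. Ad G (\<psi> x) Y) x0" using A' has_derivative_continuous by blast
  from isCont_nhds[OF this] have l1: "((\<lambda>x. Ad G (\<psi> x) Y) \<longlongrightarrow> Y) (nhds x0)" by simp
  have l2: "(\<phi> \<longlongrightarrow> x0) (nhds \<one>)"
  proof -
    have "isCont \<phi> \<one>" using id_facts(1,3) one_U continuous_on_eq_continuous_at by blast
    then show ?thesis by (rule isCont_nhds)
  qed
  have "((\<lambda>g. inv g0 \<otimes> g) \<longlongrightarrow> inv g0 \<otimes> g0) (nhds g0)" by (intro tendsto_intros filterlim_ident)
  then have l3: "((\<lambda>g. inv g0 \<otimes> g) \<longlongrightarrow> \<one>) (nhds g0)" by simp
  have l: "((\<lambda>g. Ad G (\<psi> (\<phi> (inv g0 \<otimes> g))) Y) \<longlongrightarrow> Y) (nhds g0)"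
    by (rule filterlim_compose[OF l1 filterlim_compose[OF l2 l3]])
  have ev: "\<forall>\<^sub>F g in nhds g0. inv g0 \<otimes> g \<in> U"
    by (rule topological_tendstoD[OF l3 id_facts(1) one_U])
  have "((\<lambda>g. Ad G (inv g0 \<otimes> g) Y) \<longlongrightarrow> Y) (nhds g0)"
    by (rule Lim_transform_eventually[OF l]) (use ev in eventually_elim, simp add: id_facts(5))
  then have "((\<lambda>g. Ad G g0 (Ad G (inv g0 \<otimes> g) Y)) \<longlongrightarrow> Ad G g0 Y) (nhds g0)"
    by (rule bounded_linear.tendsto[OF Ad_linear[unfolded linear_conv_bounded_linear]])
  moreover have "Ad G g0 (Ad G (inv g0 \<otimes> g) Y) = Ad G g Y" for g by (simp add: Ad_mult)
  ultimately have "((\<lambda>g. Ad G g Y) \<longlongrightarrow> Ad G g0 Y) (nhds g0)" by simp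
  then show "isCont (\<lambda>g. Ad G g Y) g0" by (rule nhds_isCont)
qed

end

section \<open>Cartan involution and roots\<close>

locale inner_form =
  fixes ip :: "'a::euclidean_space \<Rightarrow> 'a \<Rightarrow> real"
  assumes ip_bilinear: "bilinear ip" and ip_commute: "ip x y = ip y x"
    and ip_pos: "x \<noteq> 0 \<Longrightarrow> 0 < ip x x"
begin

lemma ip_linear: "linear (\<lambda>x. ip x y)" "linear (ip x)"
  using ip_bilinear unfolding bilinear_def by auto

lemmas ip_simps =
  linear_add[OF ip_linear(1)] linear_add[OF ip_linear(2)]
  linear_diff[OF ip_linear(1)] linear_diff[OF ip_linear(2)]
  linear_scale[OF ip_linear(1)] linear_scale[OF ip_linear(2)]
  linear_neg[OF ip_linear(1)] linear_neg[OF ip_linear(2)]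
  linear_0[OF ip_linear(1)] linear_0[OF ip_linear(2)]

lemma ip_nonneg: "0 \<le> ip x x" using ip_pos[of x] by (cases "x = 0") (auto simp: ip_simps)

lemma ip_eq_0: "ip x x = 0 \<longleftrightarrow> x = 0" using ip_pos[of x] by (cases "x = 0") (auto simp: ip_simps)

lemma bounded_bilinear_ip: "bounded_bilinear ip"
  using ip_bilinear bilinear_conv_bounded_bilinear by blast

lemma tendsto_ip[tendsto_intros]:
  "(f \<longlongrightarrow> a) F \<Longrightarrow> (g \<longlongrightarrow> b) F \<Longrightarrow> ((\<lambda>x. ip (f x) (g x)) \<longlongrightarrow> ip a b) F"
  by (rule bounded_bilinear.tendsto[OF bounded_bilinear_ip])

lemma continuous_on_ip[continuous_intros]:
  "continuous_on S f \<Longrightarrow> continuous_on S g \<Longrightarrow> continuous_on S (\<lambda>x. ip (f x) (g x))"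
  by (rule bounded_bilinear.continuous_on[OF bounded_bilinear_ip])

lemma ip_norm_bound: obtains c where "0 < c" "\<And>x. c * (norm x)\<^sup>2 \<le> ip x x"
proof (cases "\<exists>x::'a. norm x = 1")
  case True
  have "compact (sphere (0::'a) 1)" by simp
  moreover have "sphere (0::'a) 1 \<noteq> {}" using True by auto
  moreover have "continuous_on (sphere (0::'a) 1) (\<lambda>x. ip x x)" by (intro continuous_intros)
  ultimately obtain v where v: "norm v = 1" "\<And>x. norm x = 1 \<Longrightarrow> ip v v \<le> ip x x"
    using continuous_attains_inf[of "sphere (0::'a) 1" "\<lambda>x. ip x x"] by auto
  have "ip v v * (norm x)\<^sup>2 \<le> ip x x" for x
  proof (cases "x = 0")
    case False
    have "ip v v \<le> ip (x /\<^sub>R norm x) (x /\<^sub>R norm x)" using False by (intro v) simp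
    also have "\<dots> = ip x x / (norm x)\<^sup>2" by (simp add: ip_simps power2_eq_square divide_inverse)
    finally show ?thesis using False by (simp add: field_simps)
  qed (simp add: ip_simps)
  moreover have "0 < ip v v" using v(1) by (intro ip_pos) auto
  ultimately show ?thesis using that by blast
next
  case False
  then have "x = 0" for x :: 'a
    by (metis norm_sgn sgn_zero_iff norm_zero)
  then have "1 * (norm x)\<^sup>2 \<le> ip x x" for x by (metis ip_nonneg norm_zero mult_1 zero_power2)
  then show ?thesis using that[of 1] by simp
qed

lemma ip_cauchy_schwarz_unit:
  assumes "ip x x = 1" "ip y y = 1"
  shows "ip x y \<le> 1" "ip x y = 1 \<Longrightarrow> x = y"
proof -
  have e: "ip (x - y) (x - y) = 2 - 2 * ip x y"
    using assms by (simp add: ip_simps ip_commute[of y x])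
  show "ip x y \<le> 1" using ip_nonneg[of "x - y"] e by simp
  show "ip x y = 1 \<Longrightarrow> x = y" using ip_eq_0[of "x - y"] e by simp
qed

text \<open>A maximum of the Rayleigh quotient on the unit sphere of \<open>V\<close> is an
  eigenvector: otherwise moving in the direction \<open>w = A v - r v\<close> increases the quotient
  to first order.\<close>

lemma symmetric_eigenvector:
  assumes A: "linear A" "\<And>x y. ip (A x) y = ip x (A y)"
    and V: "subspace V" "\<And>x. x \<in> V \<Longrightarrow> A x \<in> V" "V \<noteq> {0}"
  obtains v r where "v \<in> V" "v \<noteq> 0" "A v = r *\<^sub>R v"
proof -
  obtain c where c: "0 < c" "\<And>x. c * (norm x)\<^sup>2 \<le> ip x x" by (rule ip_norm_bound) blast
  define S where "S = {x \<in> V. ip x x = 1}"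
  have clS: "closed S"
  proof -
    have "closed {x. ip x x = 1}" by (intro closed_Collect_eq continuous_intros)
    moreover have "S = V \<inter> {x. ip x x = 1}" by (auto simp: S_def)
    ultimately show ?thesis using closed_subspace[OF V(1)] by auto
  qed
  have "bounded S"
    unfolding bounded_iff
  proof (intro exI ballI)
    fix x assume "x \<in> S"
    then have "c * (norm x)\<^sup>2 \<le> 1" using c(2)[of x] by (simp add: S_def)
    then have "(norm x)\<^sup>2 \<le> (sqrt (1/c))\<^sup>2" using c(1) by (simp add: field_simps)
    then show "norm x \<le> sqrt (1/c)" by (rule power2_le_imp_le) (use c(1) in simp)
  qed
  with clS have comp: "compact S" by (simp add: compact_eq_bounded_closed)
  obtain x0 where x0: "x0 \<in> V" "x0 \<noteq> 0" using V(3) subspace_0[OF V(1)] by blast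
  have "x0 /\<^sub>R sqrt (ip x0 x0) \<in> S"
    using x0 ip_pos[OF x0(2)] V(1) by (auto simp: S_def ip_simps subspace_scale field_simps)
  then have ne: "S \<noteq> {}" by blast
  have contA: "continuous_on UNIV A" using A(1) by (rule linear_continuous_on[OF linear_conv_bounded_linear[THEN iffD1]])
  have "continuous_on S (\<lambda>x. ip (A x) x)"
    by (intro continuous_intros continuous_on_subset[OF contA]) auto
  from continuous_attains_sup[OF comp ne this]
  obtain v where v: "v \<in> S" "\<And>y. y \<in> S \<Longrightarrow> ip (A y) y \<le> ip (A v) v" by blast
  define r where "r = ip (A v) v"
  have vV: "v \<in> V" and v1: "ip v v = 1" using v(1) by (auto simp: S_def)
  have max: "ip (A y) y \<le> r * ip y y" if "y \<in> V" for y
  proof (cases "y = 0")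
    case False
    let ?s = "sqrt (ip y y)"
    have p: "0 < ip y y" by (rule ip_pos[OF False])
    have "y /\<^sub>R ?s \<in> S" using that p V(1) by (auto simp: S_def ip_simps subspace_scale field_simps)
    from v(2)[OF this] have "ip (A y) y / ip y y \<le> r"
      using p by (simp add: r_def linear_scale[OF A(1)] ip_simps field_simps)
    then show ?thesis using p by (simp add: field_simps)
  qed (simp add: linear_0[OF A(1)] ip_simps)
  have "A v = r *\<^sub>R v"
  proof (rule ccontr)
    define w where "w = A v - r *\<^sub>R v"
    assume "A v \<noteq> r *\<^sub>R v"
    then have w: "0 < ip w w" by (intro ip_pos) (simp add: w_def)
    have wV: "w \<in> V" unfolding w_def using vV V by (auto intro: subspace_diff subspace_scale)
    define q where "q = ip (A w) w - r * ip w w"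
    have ineq: "2 * t * ip w w + t\<^sup>2 * q \<le> 0" for t
    proof -
      have "v + t *\<^sub>R w \<in> V" using vV wV V(1) by (auto intro: subspace_add subspace_scale)
      from max[OF this] have "ip (A v + t *\<^sub>R A w) (v + t *\<^sub>R w) \<le> r * ip (v + t *\<^sub>R w) (v + t *\<^sub>R w)"
        by (simp add: linear_add[OF A(1)] linear_scale[OF A(1)])
      then have i: "ip (A v) v + t * ip (A v) w + (t * ip (A w) v + t * t * ip (A w) w)
         \<le> r * (ip v v + t * ip v w + (t * ip w v + t * t * ip w w))"
        by (simp add: ip_simps algebra_simps)
      have h1: "ip (A w) v = ip (A v) w" using A(2)[of w v] ip_commute by simp
      have Av: "A v = w + r *\<^sub>R v" by (simp add: w_def)
      have h2: "ip (A v) w = ip w w + r * ip v w" unfolding Av by (simp only: ip_simps real_scaleR_def)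
      have h4: "ip (A v) v = r" by (simp add: r_def)
      have "r + t * (ip w w + r * ip v w) + (t * (ip w w + r * ip v w) + t * t * ip (A w) w)
         \<le> r * (1 + t * ip v w + (t * ip v w + t * t * ip w w))"
        using i unfolding h4 h1 h2 ip_commute[of w v] v1 .
      then show ?thesis by (simp add: q_def power2_eq_square algebra_simps)
    qed
    \<comment> \<open>Small enough that the second-order term \<open>t * q\<close> cannot outweigh
      the first-order gain \<open>2 * ip w w\<close>.\<close>
    define t where "t = ip w w / (\<bar>q\<bar> + 1)"
    have t: "0 < t" using w by (simp add: t_def)
    have "t * (2 * ip w w + t * q) \<le> 0" using ineq[of t] by (simp add: power2_eq_square algebra_simps)
    then have "2 * ip w w + t * q \<le> 0" using t by (simp add: mult_le_0_iff)
    moreover have "t * q \<ge> - ip w w"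
    proof -
      have "t * \<bar>q\<bar> \<le> ip w w" using w by (simp add: t_def field_simps)
      moreover have "- (t * \<bar>q\<bar>) \<le> t * q" using t by (simp add: abs_if)
      ultimately show ?thesis by linarith
    qed
    ultimately show False using w by linarith
  qed
  moreover have "v \<noteq> 0" using v1 by (auto simp: ip_simps)
  ultimately show ?thesis using that vV by blast
qed

text \<open>On a nonzero invariant subspace of least dimension every operator is a scalar, because
  by commutativity each of its eigenspaces inside is again invariant.\<close>

lemma common_eigenvector:
  assumes lin: "\<And>A. A \<in> F \<Longrightarrow> linear A" and sym: "\<And>A x y. A \<in> F \<Longrightarrow> ip (A x) y = ip x (A y)"
    and comm: "\<And>A B x. A \<in> F \<Longrightarrow> B \<in> F \<Longrightarrow> A (B x) = B (A x)"
    and V: "subspace V" "\<And>A x. A \<in> F \<Longrightarrow> x \<in> V \<Longrightarrow> A x \<in> V" "V \<noteq> {0}"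
  shows "\<exists>v\<in>V. v \<noteq> 0 \<and> (\<forall>A\<in>F. \<exists>r. A v = r *\<^sub>R v)"
proof -
  define P where "P M \<longleftrightarrow> subspace M \<and> M \<subseteq> V \<and> M \<noteq> {0} \<and> (\<forall>A\<in>F. \<forall>x\<in>M. A x \<in> M)" for M
  have "P V" unfolding P_def using V by auto
  then obtain M where M: "P M" and min: "\<And>M'. P M' \<Longrightarrow> dim M \<le> dim M'"
    using ex_has_least_nat[of P V dim] by blast
  have sub: "subspace M" "M \<subseteq> V" "M \<noteq> {0}" "\<And>A x. A \<in> F \<Longrightarrow> x \<in> M \<Longrightarrow> A x \<in> M"
    using M by (auto simp: P_def)
  have "\<exists>r. \<forall>x\<in>M. A x = r *\<^sub>R x" if A: "A \<in> F" for A
  proof -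
    obtain v r where v: "v \<in> M" "v \<noteq> 0" "A v = r *\<^sub>R v"
      by (rule symmetric_eigenvector[OF lin[OF A] sym[OF A] sub(1) sub(4)[OF A] sub(3)])
    define M' where "M' = {x \<in> M. A x = r *\<^sub>R x}"
    have "subspace M'" unfolding M'_def subspace_def
      using sub(1) by (auto simp: subspace_0 subspace_add subspace_scale linear_0[OF lin[OF A]]
          linear_add[OF lin[OF A]] linear_scale[OF lin[OF A]] scaleR_add_right)
    moreover have "\<forall>B\<in>F. \<forall>x\<in>M'. B x \<in> M'"
      using sub(4) comm[OF A] lin by (auto simp: M'_def linear_scale)
    ultimately have "P M'" using v sub(2) by (auto simp: P_def M'_def)
    then have "M' = M"
      using min[of M'] \<open>subspace M'\<close> sub(1) by (intro subspace_dim_equal) (auto simp: M'_def)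
    then show ?thesis by (auto simp: M'_def)
  qed
  moreover obtain v where "v \<in> M" "v \<noteq> 0" using sub(1,3) subspace_0 by blast
  ultimately show ?thesis using sub(2) by blast
qed

text \<open>The orthogonal complement of a common eigenvector is invariant because the operators are
  symmetric; induction on the dimension then supplies the remaining basis vectors.\<close>

lemma common_eigenbasis_subspace:
  assumes lin: "\<And>A. A \<in> F \<Longrightarrow> linear A" and sym: "\<And>A x y. A \<in> F \<Longrightarrow> ip (A x) y = ip x (A y)"
    and comm: "\<And>A B x. A \<in> F \<Longrightarrow> B \<in> F \<Longrightarrow> A (B x) = B (A x)"
    and V: "subspace V" "\<And>A x. A \<in> F \<Longrightarrow> x \<in> V \<Longrightarrow> A x \<in> V"
  shows "\<exists>E. finite E \<and> E \<subseteq> V \<and> V \<subseteq> span E \<and> (\<forall>e\<in>E. ip e e = 1) \<and>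
    (\<forall>e\<in>E. \<forall>f\<in>E. e \<noteq> f \<longrightarrow> ip e f = 0) \<and> (\<forall>e\<in>E. \<forall>A\<in>F. \<exists>r. A e = r *\<^sub>R e)"
  using V
proof (induction "dim V" arbitrary: V rule: less_induct)
  case less
  note V = less.prems
  show ?case
  proof (cases "V = {0}")
    case True
    then show ?thesis by (intro exI[of _ "{}"]) auto
  next
    case False
    obtain v0 where v0: "v0 \<in> V" "v0 \<noteq> 0" "\<forall>A\<in>F. \<exists>r. A v0 = r *\<^sub>R v0"
      using common_eigenvector[of F V] lin sym comm V False by blast
    define v where "v = v0 /\<^sub>R sqrt (ip v0 v0)"
    have v: "v \<in> V" "ip v v = 1"
      using v0 ip_pos[OF v0(2)] V(1) by (auto simp: v_def ip_simps subspace_scale field_simps)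
    have vF: "\<exists>r. A v = r *\<^sub>R v" if AF: "A \<in> F" for A
    proof -
      obtain r where "A v0 = r *\<^sub>R v0" using bspec[OF v0(3) AF] by (elim exE)
      then have "A v = r *\<^sub>R v" by (simp add: v_def linear_scale[OF lin[OF that]])
      then show ?thesis by blast
    qed
    define V' where "V' = {x \<in> V. ip x v = 0}"
    have sV': "subspace V'" unfolding V'_def subspace_def
      using V(1) by (auto simp: subspace_0 subspace_add subspace_scale ip_simps)
    have iV': "A x \<in> V'" if A: "A \<in> F" and x: "x \<in> V'" for A x
    proof -
      obtain r where "A v = r *\<^sub>R v" using vF[OF A] by blast
      then show ?thesis using x V(2)[OF A] sym[OF A, of x v] by (simp add: V'_def ip_simps)
    qed
    have "dim V' < dim V"
    proof (rule ccontr)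
      assume "\<not> dim V' < dim V"
      then have "V' = V" using sV' V(1) by (intro subspace_dim_equal) (auto simp: V'_def)
      then have "v \<in> V'" using v by simp
      then show False using v(2) by (simp add: V'_def)
    qed
    then have "\<exists>E. finite E \<and> E \<subseteq> V' \<and> V' \<subseteq> span E \<and> (\<forall>e\<in>E. ip e e = 1) \<and>
      (\<forall>e\<in>E. \<forall>f\<in>E. e \<noteq> f \<longrightarrow> ip e f = 0) \<and> (\<forall>e\<in>E. \<forall>A\<in>F. \<exists>r. A e = r *\<^sub>R e)"
      by (rule less.hyps[OF _ sV']) (rule iV')
    then obtain E where E: "finite E" "E \<subseteq> V'" "V' \<subseteq> span E" "\<forall>e\<in>E. ip e e = 1"
      "\<forall>e\<in>E. \<forall>f\<in>E. e \<noteq> f \<longrightarrow> ip e f = 0" "\<forall>e\<in>E. \<forall>A\<in>F. \<exists>r. A e = r *\<^sub>R e"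
      by (elim exE conjE)
    have ev: "ip e v = 0" "ip v e = 0" if "e \<in> E" for e
      using E(2) that ip_commute[of v e] by (auto simp: V'_def)
    have "V \<subseteq> span (insert v E)"
    proof
      fix x assume x: "x \<in> V"
      have "x - ip x v *\<^sub>R v \<in> V'" using x v V(1)
        by (auto simp: V'_def ip_simps intro: subspace_diff subspace_scale)
      then show "x \<in> span (insert v E)" using E(3) by (subst span_insert) blast
    qed
    then show ?thesis
      using E v vF ev by (intro exI[of _ "insert v E"]) (auto simp: V'_def)
  qed
qed

lemma orthonormal_expansion:
  assumes E: "finite E" "\<And>e. e \<in> E \<Longrightarrow> ip e e = 1" "\<And>e f. e \<in> E \<Longrightarrow> f \<in> E \<Longrightarrow> e \<noteq> f \<Longrightarrow> ip e f = 0"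
    and x: "x \<in> span E"
  shows "x = (\<Sum>e\<in>E. ip x e *\<^sub>R e)"
  using x
proof (induction rule: span_induct_alt)
  case base
  then show ?case by (simp add: ip_simps)
next
  case (step c f y)
  have "(\<Sum>e\<in>E. ip f e *\<^sub>R e) = (\<Sum>e\<in>E. if e = f then f else 0)"
    using step(1) E by (intro sum.cong) auto
  also have "\<dots> = f" using step(1) E(1) by simp
  finally have f: "(\<Sum>e\<in>E. ip f e *\<^sub>R e) = f" .
  have "(\<Sum>e\<in>E. ip (c *\<^sub>R f + y) e *\<^sub>R e) = c *\<^sub>R (\<Sum>e\<in>E. ip f e *\<^sub>R e) + (\<Sum>e\<in>E. ip y e *\<^sub>R e)"
    by (simp add: ip_simps scaleR_left_distrib sum.distrib scaleR_sum_right)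
  then show ?case using f step(2) by simp
qed

end

text \<open>Only the terms of positive degree remain after \<open>x\<close> is subtracted, so
  \<open>x\<close> itself may lie outside \<open>S\<close>. It is used with \<open>x = H\<close> and
  \<open>S\<close> the sum of the negative eigenspaces.\<close>

lemma mexp_diff_in_subspace:
  assumes A: "linear A" and S: "subspace S" "\<And>x. x \<in> S \<Longrightarrow> A x \<in> S" and x: "A x \<in> S"
  shows "mexp A x - x \<in> S"
proof -
  obtain K where K: "0 \<le> K" "\<And>x. norm (A x) \<le> K * norm x" using linear_bound[OF A] by blast
  have *: "(A ^^ Suc n) x \<in> S" for n by (induction n) (auto simp: x S(2))
  have "(\<lambda>n. (\<Sum>i<Suc n. (A ^^ i) x /\<^sub>R fact i)) \<longlonglongrightarrow> mexp A x"
    using mexp_sums[OF A K(2,1), of x] unfolding sums_def by (rule LIMSEQ_Suc)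
  then have l: "(\<lambda>n. (\<Sum>i<Suc n. (A ^^ i) x /\<^sub>R fact i) - x) \<longlonglongrightarrow> mexp A x - x"
    by (intro tendsto_intros)
  have "(\<Sum>i<Suc n. (A ^^ i) x /\<^sub>R fact i) - x = (\<Sum>i<n. (A ^^ Suc i) x /\<^sub>R fact (Suc i))" for n
    by (subst sum.lessThan_Suc_shift) simp
  then have "(\<Sum>i<Suc n. (A ^^ i) x /\<^sub>R fact i) - x \<in> S" for n
    by (auto intro!: subspace_sum subspace_scale S(1) * simp del: funpow.simps)
  with l show ?thesis
    by (intro Lim_in_closed_set[OF closed_subspace[OF S(1)] _ _ l]) (auto intro!: always_eventually)
qed

section \<open>The Cartan involution and the inner product that it defines\<close>

locale cartan_grp =
  fixes G :: "('g::{t2_space,second_countable_topology}, 'l::euclidean_space, 'm) cartan_group_scheme" (structure)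
  assumes reductive: "reductive_cartan_group G"
begin

sublocale lie_grp G
  by standard (use reductive in \<open>simp add: reductive_cartan_group_def\<close>)

abbreviation br where "br \<equiv> bracket G"

lemma cartan: "cartan_decomposition G"
  using reductive by (simp add: reductive_cartan_group_def)

lemma kk_subspace: "subspace (kk G)" and ss_subspace: "subspace (ss G)"
  and kk_ss_0: "kk G \<inter> ss G = {0}" and kk_ss_ex: "\<exists>X\<in>kk G. \<exists>Y\<in>ss G. Z = X + Y"
  and br_kk: "X \<in> kk G \<Longrightarrow> X' \<in> kk G \<Longrightarrow> br X X' \<in> kk G"
  and br_ks: "X \<in> kk G \<Longrightarrow> Y \<in> ss G \<Longrightarrow> br X Y \<in> ss G"
  and br_ss: "Y \<in> ss G \<Longrightarrow> Y' \<in> ss G \<Longrightarrow> br Y Y' \<in> kk G"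
  and B_bilinear: "bilinear (inv_form G)" and B_sym: "inv_form G X Y = inv_form G Y X"
  and B_Ad: "inv_form G (Ad G g X) (Ad G g Y) = inv_form G X Y"
  and B_kk: "X \<in> kk G \<Longrightarrow> X \<noteq> 0 \<Longrightarrow> inv_form G X X < 0"
  and B_ss: "Y \<in> ss G \<Longrightarrow> Y \<noteq> 0 \<Longrightarrow> 0 < inv_form G Y Y"
  and B_ks: "X \<in> kk G \<Longrightarrow> Y \<in> ss G \<Longrightarrow> inv_form G X Y = 0"
  using cartan unfolding cartan_decomposition_def by (blast | metis)+

lemma br_sk: "Y \<in> ss G \<Longrightarrow> X \<in> kk G \<Longrightarrow> br Y X \<in> ss G"
  using br_ks[of X Y] bracket_antisym[of Y X] subspace_neg[OF ss_subspace] by simp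

lemma B_linear: "linear (\<lambda>X. inv_form G X Y)" "linear (inv_form G X)"
  using B_bilinear unfolding bilinear_def by auto

lemmas B_simps =
  linear_add[OF B_linear(1)] linear_add[OF B_linear(2)]
  linear_diff[OF B_linear(1)] linear_diff[OF B_linear(2)]
  linear_scale[OF B_linear(1)] linear_scale[OF B_linear(2)]
  linear_neg[OF B_linear(1)] linear_neg[OF B_linear(2)]
  linear_0[OF B_linear(1)] linear_0[OF B_linear(2)]

definition k_part :: "'l \<Rightarrow> 'l" where
  "k_part Z = (SOME X. X \<in> kk G \<and> Z - X \<in> ss G)"

text \<open>The Cartan involution: the identity on \<open>kk G\<close> and minus the identity on
  \<open>ss G\<close>.\<close>

definition theta :: "'l \<Rightarrow> 'l" where
  "theta Z = k_part Z - (Z - k_part Z)"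

lemma k_part_eq:
  assumes "X \<in> kk G" "Y \<in> ss G"
  shows "k_part (X + Y) = X"
proof -
  have "k_part (X + Y) \<in> kk G \<and> X + Y - k_part (X + Y) \<in> ss G"
    unfolding k_part_def by (rule someI[of _ X]) (use assms in simp)
  then have "k_part (X + Y) - X \<in> kk G" "(X + Y - k_part (X + Y)) - Y \<in> ss G"
    using assms subspace_diff[OF kk_subspace] subspace_diff[OF ss_subspace] by blast+
  moreover have "(X + Y - k_part (X + Y)) - Y = - (k_part (X + Y) - X)" by simp
  ultimately have "k_part (X + Y) - X \<in> kk G \<inter> ss G"
    using subspace_neg[OF ss_subspace] by (metis IntI minus_minus)
  then show ?thesis using kk_ss_0 by simp
qed

lemma theta_eq: "X \<in> kk G \<Longrightarrow> Y \<in> ss G \<Longrightarrow> theta (X + Y) = X - Y"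
  by (simp add: theta_def k_part_eq)

lemma theta_kk: "X \<in> kk G \<Longrightarrow> theta X = X"
  using theta_eq[of X 0] subspace_0[OF ss_subspace] by simp

lemma theta_ss: "Y \<in> ss G \<Longrightarrow> theta Y = - Y"
  using theta_eq[of 0 Y] subspace_0[OF kk_subspace] by simp

lemma theta_linear: "linear theta"
proof (rule linearI)
  fix Z Z' :: 'l and c :: real
  obtain X Y X' Y' where d: "X \<in> kk G" "Y \<in> ss G" "Z = X + Y" "X' \<in> kk G" "Y' \<in> ss G" "Z' = X' + Y'"
    using kk_ss_ex[of Z] kk_ss_ex[of Z'] by blast
  have "theta ((X + X') + (Y + Y')) = (X + X') - (Y + Y')"
    using d kk_subspace ss_subspace by (intro theta_eq subspace_add)
  moreover have "Z + Z' = (X + X') + (Y + Y')" by (simp add: d(3,6))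
  moreover have "theta Z = X - Y" "theta Z' = X' - Y'" using d theta_eq by auto
  ultimately show "theta (Z + Z') = theta Z + theta Z'" by simp
  have "theta (c *\<^sub>R X + c *\<^sub>R Y) = c *\<^sub>R X - c *\<^sub>R Y"
    using d kk_subspace ss_subspace by (intro theta_eq subspace_scale)
  moreover have "c *\<^sub>R Z = c *\<^sub>R X + c *\<^sub>R Y" by (simp add: d(3) scaleR_add_right)
  moreover have "theta Z = X - Y" using d theta_eq by auto
  ultimately show "theta (c *\<^sub>R Z) = c *\<^sub>R theta Z" by (simp add: scaleR_diff_right)
qed

lemma theta_theta[simp]: "theta (theta Z) = Z"
proof -
  obtain X Y where d: "X \<in> kk G" "Y \<in> ss G" "Z = X + Y" using kk_ss_ex[of Z] by blast
  then show ?thesis using theta_eq[of X Y] by (simp add: linear_diff[OF theta_linear] theta_kk theta_ss)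
qed

lemma theta_fixed: "theta Z = Z \<Longrightarrow> Z \<in> kk G" and theta_neg: "theta Z = - Z \<Longrightarrow> Z \<in> ss G"
proof -
  obtain X Y where d: "X \<in> kk G" "Y \<in> ss G" "Z = X + Y" using kk_ss_ex[of Z] by blast
  have e: "theta Z = X - Y" using d theta_eq by simp
  show "Z \<in> kk G" if "theta Z = Z"
  proof -
    have "(X + Y) - (X - Y) = 0" using that e d(3) by simp
    moreover have "(X + Y) - (X - Y) = 2 *\<^sub>R Y" by (simp add: scaleR_2)
    ultimately show ?thesis using d by simp
  qed
  show "Z \<in> ss G" if "theta Z = - Z"
  proof -
    have "X - Y = - (X + Y)" using that e d(3) by metis
    then have "(X + Y) + (X - Y) = 0" by (simp only: right_minus)
    moreover have "(X + Y) + (X - Y) = 2 *\<^sub>R X" by (simp add: scaleR_2)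
    ultimately show ?thesis using d by simp
  qed
qed

lemma theta_br: "theta (br X Y) = br (theta X) (theta Y)"
proof -
  obtain X1 X2 Y1 Y2 where d: "X1 \<in> kk G" "X2 \<in> ss G" "X = X1 + X2" "Y1 \<in> kk G" "Y2 \<in> ss G" "Y = Y1 + Y2"
    using kk_ss_ex[of X] kk_ss_ex[of Y] by blast
  have "br X Y = (br X1 Y1 + br X2 Y2) + (br X1 Y2 + br X2 Y1)"
    by (simp add: d bracket_simps)
  also have "theta \<dots> = (br X1 Y1 + br X2 Y2) - (br X1 Y2 + br X2 Y1)"
    by (rule theta_eq[OF subspace_add[OF kk_subspace br_kk[OF d(1,4)] br_ss[OF d(2,5)]]
        subspace_add[OF ss_subspace br_ks[OF d(1,5)] br_sk[OF d(2,4)]]])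
  also have "\<dots> = br (X1 - X2) (Y1 - Y2)"
    by (simp add: bracket_simps)
  finally show ?thesis using d theta_eq by simp
qed

text \<open>Twisting the invariant form by the involution makes it positive definite. Brackets with
  elements of \<open>ss G\<close> become symmetric operators, and \<open>Ad k\<close> becomes an
  isometry for \<open>k\<close> in \<open>KK G\<close>.\<close>

definition ip :: "'l \<Rightarrow> 'l \<Rightarrow> real" where
  "ip X Y = - inv_form G X (theta Y)"

sublocale inner_form ip
proof
  show "bilinear ip"
    unfolding bilinear_def ip_def
    by (auto intro!: linearI simp: B_simps linear_add[OF theta_linear] linear_scale[OF theta_linear])
next
  fix Z Z'
  obtain X Y X' Y' where d: "X \<in> kk G" "Y \<in> ss G" "Z = X + Y" "X' \<in> kk G" "Y' \<in> ss G" "Z' = X' + Y'"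
    using kk_ss_ex[of Z] kk_ss_ex[of Z'] by blast
  have b: "inv_form G X Y = 0" "inv_form G Y X = 0" "inv_form G X Y' = 0" "inv_form G Y X' = 0"
    "inv_form G X' Y = 0" "inv_form G Y' X = 0"
    using d B_ks B_sym by metis+
  show "ip Z Z' = ip Z' Z"
    unfolding ip_def using d theta_eq b B_sym[of X X'] B_sym[of Y Y'] by (simp add: B_simps)
  show "0 < ip Z Z" if "Z \<noteq> 0"
  proof -
    have "ip Z Z = - inv_form G X X + inv_form G Y Y"
      unfolding ip_def using d theta_eq b by (simp add: B_simps)
    moreover have "0 \<le> - inv_form G X X" "0 \<le> inv_form G Y Y"
      using B_kk[of X] B_ss[of Y] d by (cases "X = 0"; cases "Y = 0"; force simp: B_simps)+
    moreover have "0 < - inv_form G X X \<or> 0 < inv_form G Y Y"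
      using B_kk[of X] B_ss[of Y] d that by (cases "X = 0") auto
    ultimately show ?thesis by linarith
  qed
qed

lemma B_invariant: "inv_form G (br X Y) Z = - inv_form G Y (br X Z)"
proof -
  have bb: "bounded_bilinear (inv_form G)"
    using B_bilinear bilinear_conv_bounded_bilinear by blast
  have "((\<lambda>t. inv_form G (Ad G (lie_exp G (t *\<^sub>R X)) Y) (Ad G (lie_exp G (t *\<^sub>R X)) Z))
      has_vector_derivative inv_form G (Ad G (lie_exp G (0 *\<^sub>R X)) Y) (br X Z)
        + inv_form G (br X Y) (Ad G (lie_exp G (0 *\<^sub>R X)) Z)) (at 0)"
    by (rule bounded_bilinear.has_vector_derivative[OF bb bracket_deriv bracket_deriv])
  then have "((\<lambda>t::real. inv_form G Y Z) has_vector_derivative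
      inv_form G Y (br X Z) + inv_form G (br X Y) Z) (at 0)"
    by (simp add: B_Ad)
  from vector_derivative_unique_at[OF this has_vector_derivative_const] show ?thesis by simp
qed

lemma ip_br: "ip (br X Y) Z = - ip Y (br (theta X) Z)"
proof -
  have "br X (theta Z) = theta (br (theta X) Z)" by (simp add: theta_br)
  then show ?thesis by (simp add: ip_def B_invariant)
qed

lemma ip_br_ss: "S \<in> ss G \<Longrightarrow> ip (br S Y) Z = ip Y (br S Z)"
  by (simp add: ip_br theta_ss bracket_simps ip_simps)

lemma KK_subgroup: "subgroup (KK G) G" and KK_compact: "compact (KK G)"
  using reductive by (auto simp: reductive_cartan_group_def maximal_compact_subgroup_def)

lemma KK_closed: "k \<in> KK G \<Longrightarrow> h \<in> KK G \<Longrightarrow> k \<otimes> h \<in> KK G" "k \<in> KK G \<Longrightarrow> inv k \<in> KK G" "\<one> \<in> KK G"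
  using KK_subgroup by (auto simp: subgroup_def)

lemma KK_exp: assumes "k \<in> KK G" obtains T where "T \<in> kk G" "k = lie_exp G T"
  using assms by (auto simp: KK_def)

lemma exp_KK: "T \<in> kk G \<Longrightarrow> lie_exp G T \<in> KK G" by (simp add: KK_def)

text \<open>\<open>KK G\<close> consists by definition of exponentials of \<open>kk G\<close>, and
  the bracket with a fixed point of \<open>theta\<close> commutes with \<open>theta\<close>.\<close>

lemma Ad_theta: assumes "k \<in> KK G" shows "theta (Ad G k X) = Ad G k (theta X)"
proof -
  obtain T where T: "T \<in> kk G" "k = lie_exp G T" using assms by (rule KK_exp)
  show ?thesis unfolding T(2) Ad_exp_mexp
    by (rule mexp_conj[OF bracket_linear_right theta_linear]) (simp add: theta_br theta_kk T(1))
qed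

lemma Ad_ss: "k \<in> KK G \<Longrightarrow> X \<in> ss G \<Longrightarrow> Ad G k X \<in> ss G"
  by (rule theta_neg) (simp add: Ad_theta theta_ss linear_neg[OF Ad_linear])

lemma Ad_ip: "k \<in> KK G \<Longrightarrow> ip (Ad G k X) (Ad G k Y) = ip X Y"
  by (simp add: ip_def Ad_theta B_Ad)

section \<open>Roots, the joint eigenbasis of \<open>aa G\<close> and the eigenspace sums
  \<open>gr H P\<close>\<close>

lemma aa_subspace: "subspace (aa G)" and aa_ss: "aa G \<subseteq> ss G"
  and aa_abelian: "H \<in> aa G \<Longrightarrow> H' \<in> aa G \<Longrightarrow> br H H' = 0"
  and aa_max: "subspace V \<Longrightarrow> V \<subseteq> ss G \<Longrightarrow> \<forall>X\<in>V. \<forall>Y\<in>V. br X Y = 0 \<Longrightarrow> aa G \<subseteq> V \<Longrightarrow> V = aa G"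
  using reductive unfolding reductive_cartan_group_def maximal_abelian_in_ss_def Let_def by blast+

lemma aa_centralizer:
  assumes X: "X \<in> ss G" "\<And>H. H \<in> aa G \<Longrightarrow> br H X = 0"
  shows "X \<in> aa G"
proof -
  define V where "V = span (insert X (aa G))"
  have V: "Z \<in> V \<Longrightarrow> \<exists>c H. H \<in> aa G \<and> Z = c *\<^sub>R X + H" for Z
  proof -
    assume "Z \<in> V"
    then obtain c where "Z - c *\<^sub>R X \<in> aa G"
      unfolding V_def span_insert span_eq_iff[THEN iffD2, OF aa_subspace] by blast
    then show ?thesis by (intro exI[of _ c] exI[of _ "Z - c *\<^sub>R X"]) simp
  qed
  have X': "br X H = 0" if "H \<in> aa G" for H using bracket_antisym[of X H] X(2)[OF that] by simp
  have "V = aa G"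
  proof (rule aa_max)
    show "V \<subseteq> ss G" unfolding V_def
      by (rule span_minimal[OF _ ss_subspace]) (use X aa_ss in auto)
    show "aa G \<subseteq> V" unfolding V_def by (auto intro: span_base)
    show "\<forall>Y\<in>V. \<forall>Z\<in>V. br Y Z = 0"
      using V by (auto dest!: V simp: bracket_simps X' X(2) aa_abelian bracket_self)
  qed (simp add: V_def)
  then show ?thesis unfolding V_def by (metis insertI1 span_base)
qed

text \<open>An orthonormal basis adapted to all root spaces at once: brackets with elements of the
  abelian \<open>aa G\<close> are commuting symmetric operators. It replaces the root space
  decomposition throughout.\<close>

definition eb :: "'l set" where
  "eb = (SOME E. finite E \<and> span E = UNIV \<and> (\<forall>e\<in>E. ip e e = 1) \<and>
    (\<forall>e\<in>E. \<forall>f\<in>E. e \<noteq> f \<longrightarrow> ip e f = 0) \<and> (\<forall>e\<in>E. \<forall>H\<in>aa G. \<exists>r. br H e = r *\<^sub>R e))"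

lemma br_aa_commute: "H \<in> aa G \<Longrightarrow> H' \<in> aa G \<Longrightarrow> br H (br H' X) = br H' (br H X)"
  using jacobi[of H H' X] aa_abelian[of H H'] by (simp add: bracket_simps)

lemma eb: "finite eb" "span eb = UNIV" "e \<in> eb \<Longrightarrow> ip e e = 1"
  "e \<in> eb \<Longrightarrow> f \<in> eb \<Longrightarrow> e \<noteq> f \<Longrightarrow> ip e f = 0"
  "e \<in> eb \<Longrightarrow> H \<in> aa G \<Longrightarrow> \<exists>r. br H e = r *\<^sub>R e"
proof -
  have "\<exists>E. finite E \<and> E \<subseteq> UNIV \<and> UNIV \<subseteq> span E \<and> (\<forall>e\<in>E. ip e e = 1) \<and>
    (\<forall>e\<in>E. \<forall>f\<in>E. e \<noteq> f \<longrightarrow> ip e f = 0) \<and> (\<forall>e\<in>E. \<forall>A\<in>br ` aa G. \<exists>r. A e = r *\<^sub>R e)"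
    by (rule common_eigenbasis_subspace)
       (use aa_ss in \<open>auto simp: bracket_linear_right ip_br_ss br_aa_commute\<close>)
  then have "\<exists>E. finite E \<and> span E = UNIV \<and> (\<forall>e\<in>E. ip e e = 1) \<and>
    (\<forall>e\<in>E. \<forall>f\<in>E. e \<noteq> f \<longrightarrow> ip e f = 0) \<and> (\<forall>e\<in>E. \<forall>H\<in>aa G. \<exists>r. br H e = r *\<^sub>R e)"
    by (simp add: top.extremum_unique)
  from someI_ex[OF this, folded eb_def]
  show "finite eb" "span eb = UNIV" "e \<in> eb \<Longrightarrow> ip e e = 1"
    "e \<in> eb \<Longrightarrow> f \<in> eb \<Longrightarrow> e \<noteq> f \<Longrightarrow> ip e f = 0"
    "e \<in> eb \<Longrightarrow> H \<in> aa G \<Longrightarrow> \<exists>r. br H e = r *\<^sub>R e" by blast+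
qed

lemma eb_expand: "X = (\<Sum>e\<in>eb. ip X e *\<^sub>R e)"
  by (rule orthonormal_expansion) (use eb in auto)

lemma eb_eqI: "(\<And>e. e \<in> eb \<Longrightarrow> ip X e = ip Y e) \<Longrightarrow> X = Y"
  using eb_expand[of X] eb_expand[of Y] by (metis (no_types, lifting) sum.cong)

text \<open>The weight of a basis vector, extended by 0 off \<open>aa G\<close> so that it can be
  equal, as a function on the whole Lie algebra, to a root in the encoding of
  \<open>aa_dual\<close>.\<close>

definition wt :: "'l \<Rightarrow> 'l \<Rightarrow> real" where
  "wt e H = (if H \<in> aa G then ip (br H e) e else 0)"

lemma br_eb: "e \<in> eb \<Longrightarrow> H \<in> aa G \<Longrightarrow> br H e = wt e H *\<^sub>R e"
  using eb(3,5)[of e] by (force simp: wt_def ip_simps)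

lemma ip_br_eb: "e \<in> eb \<Longrightarrow> H \<in> aa G \<Longrightarrow> ip (br H X) e = wt e H * ip X e"
  using aa_ss by (simp add: ip_br_ss subset_iff br_eb ip_simps)

lemma wt_dual: "wt e \<in> aa_dual G"
  unfolding aa_dual_def wt_def
  by (auto simp: subspace_add[OF aa_subspace] subspace_scale[OF aa_subspace] bracket_simps ip_simps)

text \<open>The sum of the eigenspaces of \<open>ad H\<close> whose eigenvalue satisfies \<open>P\<close>.\<close>

definition gr :: "'l \<Rightarrow> (real \<Rightarrow> bool) \<Rightarrow> 'l set" where
  "gr H P = {X. \<forall>e\<in>eb. ip X e \<noteq> 0 \<longrightarrow> P (wt e H)}"

lemma gr_subspace: "subspace (gr H P)"
  unfolding gr_def subspace_def
proof (intro conjI ballI allI)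
  fix X Y assume "X \<in> {X. \<forall>e\<in>eb. ip X e \<noteq> 0 \<longrightarrow> P (wt e H)}" "Y \<in> {X. \<forall>e\<in>eb. ip X e \<noteq> 0 \<longrightarrow> P (wt e H)}"
  then show "X + Y \<in> {X. \<forall>e\<in>eb. ip X e \<noteq> 0 \<longrightarrow> P (wt e H)}"
    by (auto simp: ip_simps)
qed (auto simp: ip_simps)

lemma eb_gr: "e \<in> eb \<Longrightarrow> P (wt e H) \<Longrightarrow> e \<in> gr H P"
  unfolding gr_def using eb(4)[of e] by auto

lemma gr_subset:
  assumes S: "subspace S" "\<And>e. e \<in> eb \<Longrightarrow> P (wt e H) \<Longrightarrow> e \<in> S"
  shows "gr H P \<subseteq> S"
proof
  fix X assume X: "X \<in> gr H P"
  have "(\<Sum>e\<in>eb. ip X e *\<^sub>R e) \<in> S"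
  proof (rule subspace_sum[OF S(1)])
    fix e assume e: "e \<in> eb"
    show "ip X e *\<^sub>R e \<in> S"
      using X e S by (cases "ip X e = 0") (auto simp: gr_def subspace_0 subspace_scale)
  qed
  then show "X \<in> S" using eb_expand[of X] by simp
qed

lemma br_eigen_gr:
  assumes H: "H \<in> aa G" and X: "br H X = r *\<^sub>R X" and P: "P r"
  shows "X \<in> gr H P"
  unfolding gr_def
proof (clarify)
  fix e assume e: "e \<in> eb" "ip X e \<noteq> 0"
  have "wt e H * ip X e = r * ip X e"
    unfolding ip_br_eb[OF e(1) H, symmetric] by (simp add: X ip_simps)
  then have "(wt e H - r) * ip X e = 0" by (simp add: left_diff_distrib)
  then have "wt e H = r" using e(2) by simp
  then show "P (wt e H)" using P by simp
qed

lemma gr_bracket: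
  assumes H: "H \<in> aa G" and PQR: "\<And>a b. P a \<Longrightarrow> Q b \<Longrightarrow> R (a + b)"
    and X: "X \<in> gr H P" and Y: "Y \<in> gr H Q"
  shows "br X Y \<in> gr H R"
proof -
  have ef: "br e f \<in> gr H R" if "e \<in> eb" "P (wt e H)" "f \<in> eb" "Q (wt f H)" for e f
  proof (rule br_eigen_gr[OF H])
    show "br H (br e f) = (wt e H + wt f H) *\<^sub>R br e f"
      using that by (simp add: jacobi[of H] br_eb H bracket_simps scaleR_left_distrib)
  qed (use that PQR in blast)
  have "gr H Q \<subseteq> {Y. br e Y \<in> gr H R}" if "e \<in> eb" "P (wt e H)" for e
    by (rule gr_subset)
       (use ef[OF that] gr_subspace[of H R] in \<open>auto simp: subspace_def bracket_simps\<close>)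
  then have eY: "br e Y \<in> gr H R" if "e \<in> eb" "P (wt e H)" for e using that Y by blast
  have "gr H P \<subseteq> {X. br X Y \<in> gr H R}"
    by (rule gr_subset)
       (use eY gr_subspace[of H R] in \<open>auto simp: subspace_def bracket_simps\<close>)
  then show ?thesis using X by blast
qed

lemma aa_gr_0: "H \<in> aa G \<Longrightarrow> X \<in> aa G \<Longrightarrow> P 0 \<Longrightarrow> X \<in> gr H P"
  by (rule br_eigen_gr[where r = 0]) (simp_all add: aa_abelian)

lemma root_space_wt:
  assumes "\<alpha> \<in> aa_dual G" "X \<in> root_space G \<alpha>" "e \<in> eb" "ip X e \<noteq> 0"
  shows "wt e = \<alpha>"
proof
  fix H
  show "wt e H = \<alpha> H"
  proof (cases "H \<in> aa G")
    case True
    then show ?thesis using assms ip_br_eb[of e H X] by (simp add: root_space_def ip_simps)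
  next
    case False
    then show ?thesis using assms(1) by (simp add: wt_def aa_dual_def)
  qed
qed

lemma eb_nonzero: "e \<in> eb \<Longrightarrow> e \<noteq> 0"
  using eb(3)[of e] by (auto simp: ip_simps)

lemma nonzero_coord: "X \<noteq> 0 \<Longrightarrow> \<exists>e\<in>eb. ip X e \<noteq> 0"
  using eb_eqI[of X 0] by (auto simp: ip_simps)

lemma eb_root_space: "e \<in> eb \<Longrightarrow> e \<in> root_space G (wt e)"
  by (simp add: root_space_def br_eb)

lemma wt_root: "e \<in> eb \<Longrightarrow> wt e \<noteq> (\<lambda>_. 0) \<Longrightarrow> wt e \<in> roots G"
  unfolding roots_def using wt_dual eb_root_space eb_nonzero by blast

lemma root_space_subspace: "subspace (root_space G \<alpha>)"
  unfolding root_space_def subspace_def by (auto simp: bracket_simps algebra_simps)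

lemma root_vector: "\<alpha> \<in> roots G \<Longrightarrow> \<exists>X. X \<in> root_space G \<alpha> \<and> X \<noteq> 0"
  using subspace_0[OF root_space_subspace] by (auto simp: roots_def)

lemma root_wt: assumes "\<alpha> \<in> roots G" shows "\<exists>e\<in>eb. wt e = \<alpha>"
proof -
  obtain X where X: "X \<in> root_space G \<alpha>" "X \<noteq> 0" using root_vector[OF assms] by blast
  obtain e where "e \<in> eb" "ip X e \<noteq> 0" using nonzero_coord[OF X(2)] by blast
  then show ?thesis using root_space_wt X assms by (auto simp: roots_def)
qed

lemma finite_roots: "finite (roots G)"
  by (rule finite_subset[of _ "wt ` eb"]) (use root_wt eb(1) in \<open>auto simp: image_iff\<close>)

lemma root_linear: "\<alpha> \<in> roots G \<Longrightarrow> H \<in> aa G \<Longrightarrow> H' \<in> aa G \<Longrightarrow> \<alpha> (H + H') = \<alpha> H + \<alpha> H'"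
  "\<alpha> \<in> roots G \<Longrightarrow> H \<in> aa G \<Longrightarrow> \<alpha> (c *\<^sub>R H) = c * \<alpha> H"
  "\<alpha> \<in> roots G \<Longrightarrow> X \<notin> aa G \<Longrightarrow> \<alpha> X = 0"
  by (auto simp: roots_def aa_dual_def)

lemma root_gr: "\<alpha> \<in> roots G \<Longrightarrow> X \<in> root_space G \<alpha> \<Longrightarrow> P (\<alpha> H) \<Longrightarrow> X \<in> gr H P"
  unfolding gr_def using root_space_wt by (auto simp: roots_def)

lemma neg_root: assumes "\<alpha> \<in> roots G" shows "(\<lambda>H. - \<alpha> H) \<in> roots G"
proof -
  obtain X where X: "X \<in> root_space G \<alpha>" "X \<noteq> 0" using root_vector[OF assms] by blast
  have "br H (theta X) = - \<alpha> H *\<^sub>R theta X" if H: "H \<in> aa G" for H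
  proof -
    have "br H (theta X) = theta (br (theta H) X)" by (simp add: theta_br)
    also have "theta H = - H" using H aa_ss by (auto intro: theta_ss)
    also have "theta (br (- H) X) = - theta (\<alpha> H *\<^sub>R X)"
      using X H by (simp add: bracket_simps root_space_def linear_neg[OF theta_linear])
    finally show ?thesis by (simp add: linear_scale[OF theta_linear])
  qed
  then have "theta X \<in> root_space G (\<lambda>H. - \<alpha> H)" by (simp add: root_space_def)
  moreover have "theta X \<noteq> 0" using X(2) theta_theta linear_0[OF theta_linear] by metis
  ultimately show ?thesis
    using assms by (auto simp: roots_def aa_dual_def fun_eq_iff)
qed

text \<open>A regular element that defines the positive system. The sign of a root at
  \<open>H0\<close> decides whether the root is positive, so \<open>nn G\<close> and the parabolic
  subalgebra are read off from this one element.\<close>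

definition H0 :: 'l where
  "H0 = (SOME H. H \<in> aa G \<and> (\<forall>\<alpha>\<in>roots G. \<alpha> H \<noteq> 0) \<and> pos_roots G = {\<alpha>\<in>roots G. 0 < \<alpha> H})"

lemma H0: "H0 \<in> aa G" "\<alpha> \<in> roots G \<Longrightarrow> \<alpha> H0 \<noteq> 0" "pos_roots G = {\<alpha>\<in>roots G. 0 < \<alpha> H0}"
proof -
  have "\<exists>H. H \<in> aa G \<and> (\<forall>\<alpha>\<in>roots G. \<alpha> H \<noteq> 0) \<and> pos_roots G = {\<alpha>\<in>roots G. 0 < \<alpha> H}"
    using reductive unfolding reductive_cartan_group_def positive_system_def by blast
  from someI_ex[OF this, folded H0_def]
  show "H0 \<in> aa G" "\<alpha> \<in> roots G \<Longrightarrow> \<alpha> H0 \<noteq> 0" "pos_roots G = {\<alpha>\<in>roots G. 0 < \<alpha> H0}" by blast+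
qed

lemma wt_H0: "e \<in> eb \<Longrightarrow> wt e H0 = 0 \<longleftrightarrow> wt e = (\<lambda>_. 0)"
  using H0(2) wt_root by auto

lemma pos_root: "\<alpha> \<in> pos_roots G \<longleftrightarrow> \<alpha> \<in> roots G \<and> 0 < \<alpha> H0" by (simp add: H0(3))

lemma root_cases: "\<alpha> \<in> roots G \<Longrightarrow> \<alpha> \<in> pos_roots G \<or> (\<lambda>H. - \<alpha> H) \<in> pos_roots G"
  using H0(2)[of \<alpha>] neg_root by (auto simp: pos_root)

lemma nn_eq: "nn G = gr H0 (\<lambda>r. 0 < r)"
proof
  show "nn G \<subseteq> gr H0 (\<lambda>r. 0 < r)" unfolding nn_def
    by (rule span_minimal[OF _ gr_subspace]) (auto simp: pos_root intro: root_gr)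
  show "gr H0 (\<lambda>r. 0 < r) \<subseteq> nn G"
  proof (rule gr_subset)
    fix e assume e: "e \<in> eb" "0 < wt e H0"
    then have "wt e \<noteq> (\<lambda>_. 0)" by (metis less_irrefl)
    then have "wt e \<in> pos_roots G" using wt_root e by (auto simp: pos_root)
    then show "e \<in> nn G" unfolding nn_def using eb_root_space[OF e(1)] by (auto intro: span_base)
  qed (simp add: nn_def)
qed

lemma gr_H0_zero: "X \<in> gr H0 (\<lambda>r. r = 0) \<longleftrightarrow> (\<forall>H\<in>aa G. br H X = 0)"
proof
  assume X: "X \<in> gr H0 (\<lambda>r. r = 0)"
  have "gr H0 (\<lambda>r. r = 0) \<subseteq> {X. br H X = 0}" if "H \<in> aa G" for H
    by (rule gr_subset) (use that wt_H0 in \<open>auto simp: subspace_def bracket_simps br_eb\<close>)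
  then show "\<forall>H\<in>aa G. br H X = 0" using X by blast
next
  assume "\<forall>H\<in>aa G. br H X = 0"
  then show "X \<in> gr H0 (\<lambda>r. r = 0)" using H0(1) by (intro br_eigen_gr[where r = 0]) auto
qed

lemma gr_H0_zero_decomp: assumes X: "X \<in> gr H0 (\<lambda>r. r = 0)"
  obtains M A where "M \<in> mm G" "A \<in> aa G" "X = M + A"
proof -
  obtain M A where d: "M \<in> kk G" "A \<in> ss G" "X = M + A" using kk_ss_ex[of X] by blast
  have z: "br H M = 0 \<and> br H A = 0" if H: "H \<in> aa G" for H
  proof -
    have Hs: "H \<in> ss G" using H aa_ss by blast
    have "br H M + br H A = 0" using X H by (simp add: gr_H0_zero d(3) bracket_simps)
    moreover have "br H M \<in> ss G" "br H A \<in> kk G" using Hs d br_sk br_ss by auto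
    ultimately have "br H A \<in> kk G \<inter> ss G" using subspace_neg[OF ss_subspace]
      by (metis IntI add_eq_0_iff)
    then show ?thesis using kk_ss_0 \<open>br H M + br H A = 0\<close> by simp
  qed
  then have "A \<in> aa G" using d by (intro aa_centralizer) auto
  moreover have "M \<in> mm G" using d z by (auto simp: mm_def)
  ultimately show ?thesis using that d(3) by blast
qed

text \<open>The minimal parabolic subalgebra \<open>mm G + aa G + nn G\<close>, described by
  eigenvalues of \<open>H0\<close>.\<close>

definition pp :: "'l set" where "pp = gr H0 (\<lambda>r. 0 \<le> r)"

lemma pp_eq: "span (mm G \<union> aa G \<union> nn G) = pp"
proof
  have "mm G \<subseteq> pp" unfolding pp_def mm_def using H0(1)
    by (auto intro!: br_eigen_gr[where r = 0])
  moreover have "aa G \<subseteq> pp" unfolding pp_def using H0(1) by (auto intro: aa_gr_0)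
  moreover have "nn G \<subseteq> pp" unfolding pp_def nn_eq gr_def by auto
  ultimately show "span (mm G \<union> aa G \<union> nn G) \<subseteq> pp"
    by (intro span_minimal) (auto simp: pp_def gr_subspace)
  show "pp \<subseteq> span (mm G \<union> aa G \<union> nn G)"
    unfolding pp_def
  proof (rule gr_subset)
    fix e assume e: "e \<in> eb" "0 \<le> wt e H0"
    show "e \<in> span (mm G \<union> aa G \<union> nn G)"
    proof (cases "wt e H0 = 0")
      case True
      then have "e \<in> gr H0 (\<lambda>r. r = 0)" using e by (intro eb_gr)
      then obtain M A where "M \<in> mm G" "A \<in> aa G" "e = M + A" by (rule gr_H0_zero_decomp)
      then show ?thesis by (auto intro: span_add span_base)
    next
      case False
      then have "e \<in> nn G" unfolding nn_eq using e by (intro eb_gr) auto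
      then show ?thesis by (auto intro: span_base)
    qed
  qed simp
qed

lemma min_parabolic_iff: "g \<in> min_parabolic G \<longleftrightarrow> Ad G g ` pp = pp"
  by (simp add: min_parabolic_def Let_def pp_eq)

lemma finite_pos_roots: "finite (pos_roots G)"
  using finite_roots by (rule finite_subset[rotated]) (auto simp: pos_root)

lemma simple_pos: "\<beta> \<in> simple_roots G \<Longrightarrow> \<beta> \<in> pos_roots G"
  by (simp add: simple_roots_def)

lemma finite_simple_roots: "finite (simple_roots G)"
  using finite_pos_roots by (rule finite_subset[rotated]) (auto simp: simple_pos)

text \<open>A positive root that is not simple is a sum of two positive roots with smaller values at
  \<open>H0\<close>; the induction counts the positive roots below the given value.\<close>

lemma pos_root_sum:
  assumes "\<alpha> \<in> pos_roots G"
  shows "\<exists>c :: ('l \<Rightarrow> real) \<Rightarrow> nat. \<alpha> = (\<lambda>H. \<Sum>\<beta>\<in>simple_roots G. real (c \<beta>) * \<beta> H)"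
  using assms
proof (induction "card {\<beta> \<in> pos_roots G. \<beta> H0 < \<alpha> H0}" arbitrary: \<alpha> rule: less_induct)
  case less
  show ?case
  proof (cases "\<alpha> \<in> simple_roots G")
    case True
    have "\<alpha> H = (\<Sum>\<beta>\<in>simple_roots G. real (if \<beta> = \<alpha> then 1 else 0) * \<beta> H)" for H
    proof -
      have "(\<Sum>\<beta>\<in>simple_roots G. real (if \<beta> = \<alpha> then 1 else 0) * \<beta> H) = (\<Sum>\<beta>\<in>simple_roots G. if \<beta> = \<alpha> then \<alpha> H else 0)"
        by (rule sum.cong) auto
      then show ?thesis using True finite_simple_roots by simp
    qed
    then show ?thesis by (intro exI[of _ "\<lambda>\<beta>. if \<beta> = \<alpha> then 1 else 0"]) (rule ext)
  next
    case False
    then obtain \<beta> \<gamma> where bg: "\<beta> \<in> pos_roots G" "\<gamma> \<in> pos_roots G" "\<alpha> = (\<lambda>H. \<beta> H + \<gamma> H)"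
      using less.prems by (auto simp: simple_roots_def)
    have dec: "card {\<delta> \<in> pos_roots G. \<delta> H0 < \<eta> H0} < card {\<delta> \<in> pos_roots G. \<delta> H0 < \<alpha> H0}"
      if "\<eta> \<in> pos_roots G" "\<eta> H0 < \<alpha> H0" for \<eta>
      by (rule psubset_card_mono) (use that finite_pos_roots in auto)
    have lt: "\<beta> H0 < \<alpha> H0" "\<gamma> H0 < \<alpha> H0" using bg by (auto simp: pos_root)
    have IH: "\<exists>c :: ('l \<Rightarrow> real) \<Rightarrow> nat. \<eta> = (\<lambda>H. \<Sum>\<beta>\<in>simple_roots G. real (c \<beta>) * \<beta> H)"
      if "\<eta> \<in> pos_roots G" "\<eta> H0 < \<alpha> H0" for \<eta>
      by (rule less.hyps[OF dec[OF that] that(1)])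
    obtain c where c: "\<beta> = (\<lambda>H. \<Sum>\<beta>\<in>simple_roots G. real (c \<beta>) * \<beta> H)"
      using IH[OF bg(1) lt(1)] by (elim exE)
    obtain d where d: "\<gamma> = (\<lambda>H. \<Sum>\<beta>\<in>simple_roots G. real (d \<beta>) * \<beta> H)"
      using IH[OF bg(2) lt(2)] by (elim exE)
    have "\<alpha> H = (\<Sum>\<beta>\<in>simple_roots G. real (c \<beta> + d \<beta>) * \<beta> H)" for H
      unfolding bg(3) using fun_cong[OF c, of H] fun_cong[OF d, of H] by (simp add: sum.distrib algebra_simps)
    then show ?thesis by (intro exI[of _ "\<lambda>\<beta>. c \<beta> + d \<beta>"]) (rule ext)
  qed
qed

lemma tendsto_eb:
  assumes "\<And>e. e \<in> eb \<Longrightarrow> ((\<lambda>n. ip (f n) e) \<longlongrightarrow> ip X e) F"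
  shows "(f \<longlongrightarrow> X) F"
proof -
  have "((\<lambda>n. \<Sum>e\<in>eb. ip (f n) e *\<^sub>R e) \<longlongrightarrow> (\<Sum>e\<in>eb. ip X e *\<^sub>R e)) F"
    by (intro tendsto_intros assms)
  then show ?thesis unfolding eb_expand[symmetric] .
qed

lemma closure_aa_plus: assumes "H \<in> closure (aa_plus G)"
  shows "H \<in> aa G" "\<alpha> \<in> pos_roots G \<Longrightarrow> 0 \<le> \<alpha> H"
proof -
  have "closure (aa_plus G) \<subseteq> aa G"
    by (rule closure_minimal) (auto simp: aa_plus_def closed_subspace aa_subspace)
  then show "H \<in> aa G" using assms by blast
  assume "\<alpha> \<in> pos_roots G"
  then obtain e where e: "e \<in> eb" "wt e = \<alpha>" using root_wt pos_root by blast
  obtain c where c: "\<alpha> = (\<lambda>H. \<Sum>\<beta>\<in>simple_roots G. real (c \<beta>) * \<beta> H)"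
    using pos_root_sum[OF \<open>\<alpha> \<in> pos_roots G\<close>] by blast
  \<comment> \<open>As encoded, \<open>\<alpha>\<close> jumps to 0 off \<open>aa G\<close>. The
    functional \<open>ip (br H e) e\<close> is linear on the whole Lie algebra and agrees with
    \<open>\<alpha>\<close> on \<open>aa G\<close>, so it gives a closed half space.\<close>
  have "closure (aa_plus G) \<subseteq> {H. 0 \<le> ip (br H e) e}"
  proof (rule closure_minimal)
    show "aa_plus G \<subseteq> {H. 0 \<le> ip (br H e) e}"
    proof
      fix H assume H: "H \<in> aa_plus G"
      then have "ip (br H e) e = \<alpha> H" using e by (auto simp: wt_def aa_plus_def)
      moreover have "0 \<le> \<alpha> H" unfolding c
        by (rule sum_nonneg) (use H in \<open>auto simp: aa_plus_def less_imp_le\<close>)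
      ultimately show "H \<in> {H. 0 \<le> ip (br H e) e}" by simp
    qed
    have "continuous_on UNIV (\<lambda>H. br H e)"
      using bracket_linear_left linear_continuous_on linear_conv_bounded_linear by blast
    then show "closed {H. 0 \<le> ip (br H e) e}"
      by (intro closed_Collect_le continuous_intros)
  qed
  then have "0 \<le> ip (br H e) e" using assms by blast
  then show "0 \<le> \<alpha> H" using e(2) \<open>H \<in> aa G\<close> by (auto simp: wt_def)
qed

text \<open>A positive root is a nonnegative combination of simple roots, each of which is
  nonnegative at \<open>H\<close>. If the sum vanishes at \<open>H\<close>, every simple root
  outside \<open>Theta G H\<close> has coefficient 0.\<close>

lemma Theta_span:
  assumes H: "H \<in> closure (aa_plus G)" and a: "\<alpha> \<in> pos_roots G"
  shows "\<alpha> \<in> root_span G (Theta G H) \<longleftrightarrow> \<alpha> H = 0"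
    and "\<alpha> H = 0 \<Longrightarrow> \<exists>c :: ('l \<Rightarrow> real) \<Rightarrow> nat. \<alpha> = (\<lambda>X. \<Sum>\<beta>\<in>Theta G H. real (c \<beta>) * \<beta> X)"
proof -
  show sm: "\<exists>c :: ('l \<Rightarrow> real) \<Rightarrow> nat. \<alpha> = (\<lambda>X. \<Sum>\<beta>\<in>Theta G H. real (c \<beta>) * \<beta> X)" if "\<alpha> H = 0"
  proof -
    obtain c where c: "\<alpha> = (\<lambda>H. \<Sum>\<beta>\<in>simple_roots G. real (c \<beta>) * \<beta> H)"
      using pos_root_sum[OF a] by blast
    have "(\<Sum>\<beta>\<in>simple_roots G. real (c \<beta>) * \<beta> H) = 0" using that c by metis
    then have z: "\<forall>\<beta>\<in>simple_roots G. real (c \<beta>) * \<beta> H = 0"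
      using closure_aa_plus(2)[OF H] simple_pos finite_simple_roots
      by (subst (asm) sum_nonneg_eq_0_iff) auto
    have "\<alpha> X = (\<Sum>\<beta>\<in>Theta G H. real (c \<beta>) * \<beta> X)" for X
      unfolding c
      by (rule sum.mono_neutral_right) (use z finite_simple_roots in \<open>auto simp: Theta_def\<close>)
    then show ?thesis by blast
  qed
  show "\<alpha> \<in> root_span G (Theta G H) \<longleftrightarrow> \<alpha> H = 0"
  proof
    assume "\<alpha> \<in> root_span G (Theta G H)"
    then obtain c :: "('l \<Rightarrow> real) \<Rightarrow> int" where "\<alpha> = (\<lambda>X. \<Sum>\<beta>\<in>Theta G H. of_int (c \<beta>) * \<beta> X)"
      by (auto simp: root_span_def)
    then have "\<alpha> H = (\<Sum>\<beta>\<in>Theta G H. of_int (c \<beta>) * \<beta> H)" by metis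
    then show "\<alpha> H = 0" by (simp add: Theta_def)
  next
    assume "\<alpha> H = 0"
    then obtain c where "\<alpha> = (\<lambda>X. \<Sum>\<beta>\<in>Theta G H. real (c \<beta>) * \<beta> X)" using sm by blast
    then have "\<alpha> = (\<lambda>X. \<Sum>\<beta>\<in>Theta G H. of_int (int (c \<beta>)) * \<beta> X)" by simp
    moreover have "\<alpha> \<in> roots G" using a by (simp add: pos_root)
    ultimately show "\<alpha> \<in> root_span G (Theta G H)"
      unfolding root_span_def by (intro CollectI conjI exI[of _ "\<lambda>\<beta>. int (c \<beta>)"])
  qed
qed

lemma root_pos_at: "H \<in> closure (aa_plus G) \<Longrightarrow> \<alpha> \<in> roots G \<Longrightarrow> 0 < \<alpha> H \<Longrightarrow> \<alpha> \<in> pos_roots G"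
  using root_cases[of \<alpha>] closure_aa_plus(2)[of H "\<lambda>H. - \<alpha> H"] by fastforce

lemma N_H_minus_eq:
  assumes H: "H \<in> closure (aa_plus G)"
  shows "N_H_minus G H = lie_exp G ` gr H (\<lambda>r. r < 0)"
proof -
  let ?S = "\<Union>\<alpha>\<in>pos_roots G - root_span G (Theta G H). root_space G (\<lambda>X. - \<alpha> X)"
  have "span ?S = gr H (\<lambda>r. r < 0)"
  proof
    show "span ?S \<subseteq> gr H (\<lambda>r. r < 0)"
    proof (rule span_minimal[OF _ gr_subspace], clarify)
      fix \<alpha> X assume a: "\<alpha> \<in> pos_roots G" "\<alpha> \<notin> root_span G (Theta G H)" "X \<in> root_space G (\<lambda>X. - \<alpha> X)"
      then have "0 < \<alpha> H" using Theta_span(1)[OF H a(1)] closure_aa_plus(2)[OF H a(1)] by simp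
      then show "X \<in> gr H (\<lambda>r. r < 0)"
        using a neg_root by (intro root_gr[of "\<lambda>X. - \<alpha> X"]) (auto simp: pos_root)
    qed
    show "gr H (\<lambda>r. r < 0) \<subseteq> span ?S"
    proof (rule gr_subset[OF subspace_span])
      fix e assume e: "e \<in> eb" "wt e H < 0"
      have "wt e \<noteq> (\<lambda>_. 0)" using e(2) by (metis less_irrefl)
      then have r: "(\<lambda>X. - wt e X) \<in> roots G" using e wt_root neg_root by blast
      then have p: "(\<lambda>X. - wt e X) \<in> pos_roots G" using e root_pos_at[OF H] by simp
      then have "(\<lambda>X. - wt e X) \<notin> root_span G (Theta G H)" using Theta_span(1)[OF H p] e by simp
      moreover have "e \<in> root_space G (\<lambda>X. - (- wt e X))" using eb_root_space[OF e(1)] by simp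
      ultimately have "e \<in> ?S" using p by blast
      then show "e \<in> span ?S" by (rule span_base)
    qed
  qed
  then show ?thesis by (simp add: N_H_minus_def)
qed

section \<open>Contraction of negative eigenspaces and the unipotent orbit of
  \<open>H\<close>\<close>

lemma Ad_exp_eb:
  assumes H: "H \<in> aa G" and e: "e \<in> eb"
  shows "Ad G (lie_exp G (t *\<^sub>R H)) e = exp (t * wt e H) *\<^sub>R e"
  unfolding Ad_exp_mexp
  by (rule mexp_eigenvector[OF bracket_linear_right]) (simp add: bracket_simps br_eb[OF e H])

lemma ip_Ad_exp_eb:
  assumes H: "H \<in> aa G" and e: "e \<in> eb"
  shows "ip (Ad G (lie_exp G (t *\<^sub>R H)) X) e = exp (t * wt e H) * ip X e"
proof -
  have "Ad G (lie_exp G (t *\<^sub>R H)) X = (\<Sum>f\<in>eb. ip X f *\<^sub>R exp (t * wt f H) *\<^sub>R f)"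
    by (subst eb_expand[of X])
       (simp add: linear_sum[OF Ad_linear] linear_scale[OF Ad_linear] Ad_exp_eb[OF H])
  then have "ip (Ad G (lie_exp G (t *\<^sub>R H)) X) e = (\<Sum>f\<in>eb. ip X f * exp (t * wt f H) * ip f e)"
    by (simp add: linear_sum[OF ip_linear(1)] ip_simps)
  also have "\<dots> = (\<Sum>f\<in>eb. if f = e then exp (t * wt e H) * ip X e else 0)"
    by (rule sum.cong) (use eb(3,4) e in auto)
  finally show ?thesis using e eb(1) by simp
qed

lemma Ad_exp_gr: "H \<in> aa G \<Longrightarrow> X \<in> gr H' P \<Longrightarrow> Ad G (lie_exp G (t *\<^sub>R H)) X \<in> gr H' P"
  by (simp add: gr_def ip_Ad_exp_eb)

lemma Ad_exp_aa: "H \<in> aa G \<Longrightarrow> H' \<in> aa G \<Longrightarrow> Ad G (lie_exp G H) H' = H'"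
  unfolding Ad_exp_mexp by (rule mexp_kernel[OF bracket_linear_right]) (rule aa_abelian)

lemma contraction:
  assumes H: "H \<in> aa G" and X: "X \<in> gr H (\<lambda>r. r < 0)"
  shows "((\<lambda>t. Ad G (lie_exp G (t *\<^sub>R H)) X) \<longlongrightarrow> 0) at_top"
proof (rule tendsto_eb)
  fix e assume e: "e \<in> eb"
  show "((\<lambda>t. ip (Ad G (lie_exp G (t *\<^sub>R H)) X) e) \<longlongrightarrow> ip 0 e) at_top"
  proof (cases "ip X e = 0")
    case False
    then have w: "wt e H < 0" using X e by (auto simp: gr_def)
    have "((\<lambda>t. exp (t * wt e H)) \<longlongrightarrow> 0) at_top"
      by (rule filterlim_compose[OF exp_at_bot])
         (use w in \<open>auto intro!: filterlim_tendsto_neg_mult_at_bot[OF tendsto_const] filterlim_ident simp: mult.commute[of _ "wt e H"]\<close>)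
    then have "((\<lambda>t. exp (t * wt e H) * ip X e) \<longlongrightarrow> 0 * ip X e) at_top" by (intro tendsto_intros)
    then show ?thesis by (simp add: ip_Ad_exp_eb[OF H e] ip_simps)
  qed (simp add: ip_Ad_exp_eb[OF H e] ip_simps)
qed

lemma bracket_bound: obtains K where "0 \<le> K" "\<And>X Y. norm (br X Y) \<le> K * norm X * norm Y"
  using bilinear_bounded_pos[OF bracket_bilinear] by (metis less_imp_le)

lemma Ad_exp_quadratic:
  obtains C where "0 \<le> C" "\<And>Z. norm Z \<le> 1 \<Longrightarrow> norm (Ad G (lie_exp G Z) X - X - br Z X) \<le> C * (norm Z)\<^sup>2"
proof -
  obtain K where K: "0 \<le> K" "\<And>X Y. norm (br X Y) \<le> K * norm X * norm Y" by (rule bracket_bound) blast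
  have "norm (Ad G (lie_exp G Z) X - X - br Z X) \<le> (K\<^sup>2 * exp K * norm X) * (norm Z)\<^sup>2" if Z: "norm Z \<le> 1" for Z
  proof -
    have "norm (mexp (br Z) X - X - br Z X) \<le> (K * norm Z)\<^sup>2 * exp (K * norm Z) * norm X"
      by (rule mexp_second_order[OF bracket_linear_right]) (use K in auto)
    also have "\<dots> \<le> (K * norm Z)\<^sup>2 * exp K * norm X"
      using Z K(1) by (intro mult_right_mono mult_left_mono) (auto intro: mult_left_le)
    finally show ?thesis by (simp add: Ad_exp_mexp power_mult_distrib mult_ac)
  qed
  then show ?thesis using that[of "K\<^sup>2 * exp K * norm X"] by simp
qed

text \<open>The map \<open>Z \<mapsto> Ad (exp Z) H - H\<close> is a local homeomorphism at \<open>0\<close> of the sum of the negative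
  eigenspaces of \<open>ad H\<close>; it commutes with the contraction \<open>Ad (exp (t H))\<close>, hence is onto.\<close>

lemma orbit_in_gr:
  assumes H: "H \<in> aa G" and Z: "Z \<in> gr H (\<lambda>r. r < 0)"
  shows "Ad G (lie_exp G Z) H - H \<in> gr H (\<lambda>r. r < 0)"
  unfolding Ad_exp_mexp
proof (rule mexp_diff_in_subspace[OF bracket_linear_right gr_subspace])
  show "br Z X \<in> gr H (\<lambda>r. r < 0)" if "X \<in> gr H (\<lambda>r. r < 0)" for X
    by (rule gr_bracket[OF H _ Z that]) auto
  show "br Z H \<in> gr H (\<lambda>r. r < 0)"
    by (rule gr_bracket[OF H _ Z aa_gr_0[OF H H, where P = "\<lambda>r. r = 0"]]) auto
qed

lemma orbit_scale:
  assumes H: "H \<in> aa G"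
  shows "Ad G (lie_exp G (t *\<^sub>R H)) (Ad G (lie_exp G Z) H - H)
    = Ad G (lie_exp G (Ad G (lie_exp G (t *\<^sub>R H)) Z)) H - H"
proof -
  let ?h = "lie_exp G (t *\<^sub>R H)"
  have h: "Ad G ?h H = H" using H subspace_scale[OF aa_subspace] by (intro Ad_exp_aa)
  then have h': "Ad G (inv ?h) H = H" using Ad_inv(1)[of ?h H] by simp
  show ?thesis by (simp add: exp_Ad Ad_mult linear_diff[OF Ad_linear] h h')
qed

lemma orbit_onto:
  assumes H: "H \<in> aa G" and Y: "Y \<in> gr H (\<lambda>r. r < 0)"
  shows "\<exists>Z\<in>gr H (\<lambda>r. r < 0). Ad G (lie_exp G Z) H = H + Y"
proof -
  let ?m = "gr H (\<lambda>r. r < 0)"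
  define \<pi> where "\<pi> X = (\<Sum>e\<in>eb. (if wt e H < 0 then ip X e else 0) *\<^sub>R e)" for X
  \<comment> \<open>The eigenvalues of the derivative of \<open>\<Psi>\<close> at 0: on the negative
    part it is \<open>Z \<mapsto> br Z H = - br H Z\<close>, and elsewhere the identity. None of
    them is 0, so \<open>g'\<close> can divide by them.\<close>
  define d where "d e = (if wt e H < 0 then - wt e H else 1)" for e
  have d0: "d e \<noteq> 0" for e by (simp add: d_def)
  have coord: "ip (\<Sum>e\<in>eb. c e *\<^sub>R e) f = c f" if f: "f \<in> eb" for c f
  proof -
    have "ip (\<Sum>e\<in>eb. c e *\<^sub>R e) f = (\<Sum>e\<in>eb. if e = f then c f else 0)"
      unfolding linear_sum[OF ip_linear(1)] by (rule sum.cong) (use eb(3,4) f in \<open>auto simp: ip_simps\<close>)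
    then show ?thesis using f eb(1) by simp
  qed
  have \<pi>c: "ip (\<pi> X) e = (if wt e H < 0 then ip X e else 0)" if "e \<in> eb" for X e
    unfolding \<pi>_def by (rule coord[OF that])
  have \<pi>lin: "linear \<pi>"
    by (rule linearI) (auto intro!: eb_eqI simp: \<pi>c ip_simps)
  have \<pi>m: "\<pi> X \<in> ?m" for X by (auto simp: gr_def \<pi>c split: if_splits)
  have \<pi>id: "\<pi> X = X" if "X \<in> ?m" for X
    by (rule eb_eqI) (use that in \<open>auto simp: \<pi>c gr_def\<close>)
  \<comment> \<open>The orbit map is completed by the identity on the other eigenspaces. This gives
    a self-map of the whole Lie algebra with invertible derivative, to which the open mapping
    theorem applies at 0.\<close>
  define \<Psi> where "\<Psi> Z = Ad G (lie_exp G (\<pi> Z)) H - H + (Z - \<pi> Z)" for Z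
  define \<Psi>' where "\<Psi>' Z = br (\<pi> Z) H + (Z - \<pi> Z)" for Z
  define g' where "g' W = (\<Sum>e\<in>eb. (ip W e / d e) *\<^sub>R e)" for W
  have \<Psi>'c: "ip (\<Psi>' Z) e = d e * ip Z e" if e: "e \<in> eb" for Z e
  proof -
    have "br (\<pi> Z) H = - br H (\<pi> Z)" by (rule bracket_antisym)
    then show ?thesis
      by (simp add: \<Psi>'_def ip_simps ip_br_eb[OF e H] \<pi>c[OF e] d_def)
  qed
  have \<pi>b: "bounded_linear \<pi>" using \<pi>lin linear_conv_bounded_linear by blast
  have lin': "linear \<Psi>'"
    unfolding \<Psi>'_def by (rule linearI) (auto simp: linear_add[OF \<pi>lin] linear_scale[OF \<pi>lin] bracket_simps algebra_simps)
  have cont: "continuous_on UNIV \<Psi>"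
  proof -
    have "continuous_on UNIV \<pi>" by (rule linear_continuous_on[OF \<pi>b])
    then show ?thesis unfolding \<Psi>_def
      by (intro continuous_intros continuous_on_compose2[OF continuous_Ad]) auto
  qed
  have der: "(\<Psi> has_derivative \<Psi>') (at 0)"
  proof -
    obtain C where C: "0 \<le> C" "\<And>Z. norm Z \<le> 1 \<Longrightarrow> norm (Ad G (lie_exp G Z) H - H - br Z H) \<le> C * (norm Z)\<^sup>2"
      by (rule Ad_exp_quadratic) blast
    obtain B where B: "0 < B" "\<And>Z. norm (\<pi> Z) \<le> norm Z * B"
      using bounded_linear.pos_bounded[OF \<pi>b] by blast
    have q: "norm (\<Psi> Z - \<Psi> 0 - \<Psi>' Z) \<le> (C * B\<^sup>2) * (norm Z)\<^sup>2" if Z: "norm Z \<le> 1 / B" for Z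
    proof -
      have "\<Psi> Z - \<Psi> 0 - \<Psi>' Z = Ad G (lie_exp G (\<pi> Z)) H - H - br (\<pi> Z) H"
        by (simp add: \<Psi>_def \<Psi>'_def linear_0[OF \<pi>lin])
      also have "norm \<dots> \<le> C * (norm (\<pi> Z))\<^sup>2"
        using B(2)[of Z] mult_right_mono[OF Z less_imp_le[OF B(1)]] B(1) by (intro C(2)) simp
      also have "\<dots> \<le> C * (norm Z * B)\<^sup>2" using B C by (intro mult_left_mono power_mono) auto
      finally show ?thesis by (simp add: power_mult_distrib mult_ac)
    qed
    show ?thesis
      unfolding has_derivative_at2
    proof (intro conjI)
      show "bounded_linear \<Psi>'" using lin' linear_conv_bounded_linear by blast
      have "((\<lambda>Z::'l. (C * B\<^sup>2) * norm Z) \<longlongrightarrow> (C * B\<^sup>2) * norm (0::'l)) (at 0)"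
        by (rule tendsto_mult_left[OF tendsto_norm[OF tendsto_ident_at]])
      then have l: "((\<lambda>Z. (C * B\<^sup>2) * norm Z) \<longlongrightarrow> 0) (at (0::'l))" by simp
      show "((\<lambda>y. (1 / norm (y - 0)) *\<^sub>R (\<Psi> y - (\<Psi> 0 + \<Psi>' (y - 0)))) \<longlongrightarrow> 0) (at 0)"
      proof (rule Lim_null_comparison[OF _ l])
        have "\<forall>\<^sub>F Z::'l in at 0. norm Z < 1 / B"
          using B(1) eventually_at_ball[of "1 / B" "0::'l" UNIV] by (auto simp: dist_norm)
        moreover have "\<forall>\<^sub>F Z::'l in at 0. Z \<noteq> 0" by (simp add: eventually_at_filter)
        ultimately show "\<forall>\<^sub>F Z in at 0. norm ((1 / norm (Z - 0)) *\<^sub>R (\<Psi> Z - (\<Psi> 0 + \<Psi>' (Z - 0)))) \<le> (C * B\<^sup>2) * norm Z"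
        proof eventually_elim
          case (elim Z)
          have "norm ((1 / norm (Z - 0)) *\<^sub>R (\<Psi> Z - (\<Psi> 0 + \<Psi>' (Z - 0)))) = norm (\<Psi> Z - \<Psi> 0 - \<Psi>' Z) / norm Z"
            by (simp add: divide_inverse diff_diff_eq mult.commute)
          also have "\<dots> \<le> (C * B\<^sup>2) * (norm Z)\<^sup>2 / norm Z"
            using elim by (intro divide_right_mono q) auto
          also have "\<dots> = (C * B\<^sup>2) * norm Z" using elim(2) by (simp add: power2_eq_square)
          finally show ?case .
        qed
      qed
    qed
  qed
  have inv: "\<Psi>' \<circ> g' = id"
  proof
    fix W
    show "(\<Psi>' \<circ> g') W = id W"
      by (rule eb_eqI) (simp add: \<Psi>'c g'_def coord d0)
  qed
  have "bounded_linear g'"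
    unfolding linear_conv_bounded_linear[symmetric] g'_def
    by (rule linearI) (auto intro!: eb_eqI simp: coord ip_simps add_divide_distrib)
  from sussmann_open_mapping[OF open_UNIV cont UNIV_I der this inv subset_UNIV, of UNIV]
  have "\<Psi> 0 \<in> interior (range \<Psi>)" by simp
  moreover have "\<Psi> 0 = 0" by (simp add: \<Psi>_def linear_0[OF \<pi>lin])
  ultimately obtain \<epsilon> where \<epsilon>: "0 < \<epsilon>" "ball 0 \<epsilon> \<subseteq> range \<Psi>" by (metis mem_interior)
  \<comment> \<open>\<open>Y\<close> is contracted into the ball known to lie in the image, the
    equation is solved there, and the solution is expanded back by \<open>h\<close>.\<close>
  have "\<forall>\<^sub>F t in at_top. Ad G (lie_exp G (t *\<^sub>R H)) Y \<in> ball 0 \<epsilon>"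
    by (rule topological_tendstoD[OF contraction[OF H Y]]) (use \<epsilon> in auto)
  then obtain t where t: "Ad G (lie_exp G (t *\<^sub>R H)) Y \<in> ball 0 \<epsilon>"
    by (meson eventually_at_top_linorder order_refl)
  define Y' where "Y' = Ad G (lie_exp G (t *\<^sub>R H)) Y"
  have Y'm: "Y' \<in> ?m" unfolding Y'_def by (rule Ad_exp_gr[OF H Y])
  have "Y' \<in> range \<Psi>" using t \<epsilon>(2) unfolding Y'_def by (rule rev_subsetD)
  then obtain Z where Z: "\<Psi> Z = Y'" by (metis rangeE)
  \<comment> \<open>The completing summand \<open>Z - \<pi> Z\<close> lies in the negative part and
    is killed by the projection onto it, so it vanishes and only the orbit map remains.\<close>
  have "Z - \<pi> Z = Y' - (Ad G (lie_exp G (\<pi> Z)) H - H)" using Z by (simp add: \<Psi>_def algebra_simps)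
  also have "\<dots> \<in> ?m" by (rule subspace_diff[OF gr_subspace Y'm orbit_in_gr[OF H \<pi>m]])
  finally have "\<pi> (Z - \<pi> Z) = Z - \<pi> Z" by (rule \<pi>id)
  then have "Z - \<pi> Z = 0" using \<pi>id[OF \<pi>m] by (simp add: linear_diff[OF \<pi>lin])
  then have Ze: "Ad G (lie_exp G (\<pi> Z)) H - H = Y'" using Z by (simp add: \<Psi>_def)
  define h where "h = lie_exp G ((- t) *\<^sub>R H)"
  have hh: "h = inv (lie_exp G (t *\<^sub>R H))" by (simp add: h_def exp_minus)
  have "Y = Ad G h Y'" by (simp add: hh Y'_def)
  also have "\<dots> = Ad G (lie_exp G (Ad G h (\<pi> Z))) H - H"
    unfolding Ze[symmetric] h_def by (rule orbit_scale[OF H])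
  finally have "Ad G (lie_exp G (Ad G h (\<pi> Z))) H = H + Y" by simp
  moreover have "Ad G h (\<pi> Z) \<in> ?m" unfolding h_def by (rule Ad_exp_gr[OF H \<pi>m])
  ultimately show ?thesis by blast
qed

end

section \<open>Iwasawa decomposition\<close>

context lie_grp
begin

text \<open>The product of the two commuting one-parameter subgroups is again one, and its velocity
  is \<open>X + Y\<close> because the derivative of multiplication at the identity is addition.
  Uniqueness does the rest.\<close>

lemma exp_add_commuting:
  assumes "bracket G X Y = 0"
  shows "lie_exp G (X + Y) = lie_exp G X \<otimes> lie_exp G Y"
proof -
  define \<gamma> where "\<gamma> t = lie_exp G (t *\<^sub>R X) \<otimes> lie_exp G (t *\<^sub>R Y)" for t
  have comm: "lie_exp G (s *\<^sub>R X) \<otimes> lie_exp G (t *\<^sub>R Y) = lie_exp G (t *\<^sub>R Y) \<otimes> lie_exp G (s *\<^sub>R X)" for s t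
  proof -
    have "Ad G (lie_exp G (s *\<^sub>R X)) (t *\<^sub>R Y) = t *\<^sub>R Y"
      unfolding Ad_exp_mexp by (rule mexp_kernel[OF bracket_linear_right]) (simp add: bracket_simps assms)
    then have "lie_exp G (t *\<^sub>R Y) = lie_exp G (s *\<^sub>R X) \<otimes> lie_exp G (t *\<^sub>R Y) \<otimes> inv (lie_exp G (s *\<^sub>R X))"
      using exp_Ad[of "lie_exp G (s *\<^sub>R X)" "t *\<^sub>R Y"] by simp
    then show ?thesis by (metis m_assoc carrier_UNIV UNIV_I l_inv r_one)
  qed
  have f': "(\<mu> has_derivative frechet_derivative \<mu> (at (x0, x0))) (at (x0, x0))"
    by (rule mu_deriv[OF W_x0(1)[OF x0_D]])
  have D: "frechet_derivative \<mu> (at (x0, x0)) (v, w) = v + w" for v w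
  proof -
    have lin: "linear (frechet_derivative \<mu> (at (x0, x0)))" using f' has_derivative_linear by blast
    have "((\<lambda>x. \<mu> (x, x0)) has_derivative (\<lambda>v. frechet_derivative \<mu> (at (x0, x0)) (v, 0))) (at x0)"
      by (rule frechet_derivative_fixed_second[OF f'])
    moreover have "\<forall>\<^sub>F x in nhds x0. \<mu> (x, x0) = x"
      using eventually_nhds_in_open[OF id_facts(2) x0_D] by eventually_elim simp
    ultimately have "((\<lambda>x. x) has_derivative (\<lambda>v. frechet_derivative \<mu> (at (x0, x0)) (v, 0))) (at x0)"
      by (rule has_derivative_ev)
    from has_derivative_unique[OF this has_derivative_ident]
    have a: "frechet_derivative \<mu> (at (x0, x0)) (v, 0) = v" by metis
    have b: "frechet_derivative \<mu> (at (x0, x0)) (0, w) = w" using lfield_x0[of w] by (simp add: lfield_def)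
    show ?thesis using linear_add[OF lin, of "(v, 0)" "(0, w)"] a b by simp
  qed
  have "one_parameter_subgroup G (X + Y) \<gamma>"
    unfolding one_parameter_subgroup_def
  proof (intro conjI allI)
    show "continuous_on UNIV \<gamma>" unfolding \<gamma>_def by (intro continuous_intros)
    fix s t
    have "\<gamma> s \<otimes> \<gamma> t = lie_exp G (s *\<^sub>R X) \<otimes> (lie_exp G (s *\<^sub>R Y) \<otimes> lie_exp G (t *\<^sub>R X)) \<otimes> lie_exp G (t *\<^sub>R Y)"
      by (simp add: \<gamma>_def m_assoc)
    also have "\<dots> = (lie_exp G (s *\<^sub>R X) \<otimes> lie_exp G (t *\<^sub>R X)) \<otimes> (lie_exp G (s *\<^sub>R Y) \<otimes> lie_exp G (t *\<^sub>R Y))"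
      unfolding comm[of t s, symmetric] by (simp add: m_assoc)
    also have "\<dots> = \<gamma> (s + t)" unfolding \<gamma>_def by (simp only: exp_add)
    finally show "\<gamma> (s + t) = \<gamma> s \<otimes> \<gamma> t" by (rule sym)
  next
    have p: "((\<lambda>t. (\<phi> (lie_exp G (t *\<^sub>R X)), \<phi> (lie_exp G (t *\<^sub>R Y)))) has_vector_derivative (X, Y)) (at 0)"
      by (rule has_vector_derivative_Pair[OF ops_deriv0[OF exp_ops] ops_deriv0[OF exp_ops]])
    have "((\<lambda>t. \<mu> (\<phi> (lie_exp G (t *\<^sub>R X)), \<phi> (lie_exp G (t *\<^sub>R Y)))) has_vector_derivative
        frechet_derivative \<mu> (at (x0, x0)) (X, Y)) (at 0)"
      by (rule vector_derivative_chain[OF p]) (simp add: f')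
    moreover have "\<forall>\<^sub>F t in nhds 0. \<mu> (\<phi> (lie_exp G (t *\<^sub>R X)), \<phi> (lie_exp G (t *\<^sub>R Y))) = \<phi> (\<gamma> t)"
    proof -
      have "\<forall>\<^sub>F t in nhds 0. lie_exp G (t *\<^sub>R Z) \<in> U" for Z
        by (rule ops_ev_U[OF exp_ops]) (use one_U id_facts(1) in auto)
      from this[of X] this[of Y] show ?thesis
        by eventually_elim (simp add: mu_eq id_facts(5) \<gamma>_def)
    qed
    ultimately have "((\<lambda>t. \<phi> (\<gamma> t)) has_vector_derivative frechet_derivative \<mu> (at (x0, x0)) (X, Y)) (at 0)"
      by (rule has_vector_derivative_ev)
    then show "(\<phi> \<circ> \<gamma> has_vector_derivative X + Y) (at 0)" by (simp add: D o_def)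
  qed
  from lie_exp_eqI[OF this] show ?thesis by (simp add: \<gamma>_def)
qed

end

section \<open>The contracted group and the Iwasawa projection\<close>

context cartan_grp
begin

text \<open>Elements contracted to the identity under conjugation by \<open>exp (-t H0)\<close>. They form a group
  containing \<open>N\<close>, and this is the only property of \<open>N\<close> that the Iwasawa decomposition needs.\<close>

abbreviation conj_H0 :: "real \<Rightarrow> 'g \<Rightarrow> 'g" where
  "conj_H0 t g \<equiv> lie_exp G (t *\<^sub>R (- H0)) \<otimes> g \<otimes> inv (lie_exp G (t *\<^sub>R (- H0)))"

definition NC :: "'g set" where
  "NC = {g. ((\<lambda>t. conj_H0 t g) \<longlongrightarrow> \<one>) at_top}"

lemma conj_mult: "conj_H0 t (g \<otimes> h) = conj_H0 t g \<otimes> conj_H0 t h"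
  by (simp add: m_assoc)

lemma NC_mult: "g \<in> NC \<Longrightarrow> h \<in> NC \<Longrightarrow> g \<otimes> h \<in> NC"
  unfolding NC_def mem_Collect_eq conj_mult
  using tendsto_mult_group[of "\<lambda>t. conj_H0 t g" \<one> at_top "\<lambda>t. conj_H0 t h" \<one>] by simp

lemma NC_inv: "g \<in> NC \<Longrightarrow> inv g \<in> NC"
  using tendsto_inv_group[of "\<lambda>t. conj_H0 t g" \<one> at_top]
  by (simp add: NC_def inv_mult_group m_assoc)

lemma minus_H0: "- H0 \<in> aa G" using H0(1) subspace_neg[OF aa_subspace] by blast

lemma wt_linear: "H \<in> aa G \<Longrightarrow> H' \<in> aa G \<Longrightarrow> wt e (H + H') = wt e H + wt e H'"
  "H \<in> aa G \<Longrightarrow> wt e (c *\<^sub>R H) = c * wt e H" "H \<in> aa G \<Longrightarrow> wt e (- H) = - wt e H"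
  "H \<in> aa G \<Longrightarrow> H' \<in> aa G \<Longrightarrow> wt e (H - H') = wt e H - wt e H'"
  by (auto simp: wt_def subspace_add[OF aa_subspace] subspace_diff[OF aa_subspace]
      subspace_scale[OF aa_subspace] subspace_neg[OF aa_subspace] bracket_simps ip_simps)

lemma nn_gr_minus: "nn G = gr (- H0) (\<lambda>r. r < 0)"
  by (auto simp: nn_eq gr_def wt_linear H0(1))

lemma exp_NC: assumes "X \<in> nn G" shows "lie_exp G X \<in> NC"
proof -
  have "((\<lambda>t. lie_exp G (Ad G (lie_exp G (t *\<^sub>R (- H0))) X)) \<longlongrightarrow> lie_exp G 0) at_top"
    using assms unfolding nn_gr_minus by (intro tendsto_exp_group contraction minus_H0)
  then show ?thesis unfolding exp_Ad exp_zero by (simp only: NC_def mem_Collect_eq)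
qed

lemma NN_NC: "NN G \<subseteq> NC" using exp_NC by (auto simp: NN_def)

lemma exp_aa_add: "H \<in> aa G \<Longrightarrow> H' \<in> aa G \<Longrightarrow> lie_exp G (H + H') = lie_exp G H \<otimes> lie_exp G H'"
  by (rule exp_add_commuting) (rule aa_abelian)

lemma exp_aa_commute: "H \<in> aa G \<Longrightarrow> H' \<in> aa G \<Longrightarrow> lie_exp G H \<otimes> lie_exp G H' = lie_exp G H' \<otimes> lie_exp G H"
  by (metis exp_aa_add add.commute)

lemma conj_exp_aa: assumes "L \<in> aa G" shows "conj_H0 t (lie_exp G L) = lie_exp G L"
proof -
  have "lie_exp G (t *\<^sub>R (- H0)) \<otimes> lie_exp G L = lie_exp G L \<otimes> lie_exp G (t *\<^sub>R (- H0))"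
    by (rule exp_aa_commute[OF subspace_scale[OF aa_subspace minus_H0] assms])
  then show ?thesis by (simp add: m_assoc)
qed

lemma NC_conj_aa:
  assumes L: "L \<in> aa G" and u: "u \<in> NC"
  shows "inv (lie_exp G L) \<otimes> u \<otimes> lie_exp G L \<in> NC"
proof -
  have mL: "- L \<in> aa G" using L subspace_neg[OF aa_subspace] by blast
  have "((\<lambda>t. conj_H0 t (lie_exp G (- L)) \<otimes> conj_H0 t u \<otimes> conj_H0 t (lie_exp G L))
     \<longlongrightarrow> lie_exp G (- L) \<otimes> \<one> \<otimes> lie_exp G L) at_top"
    unfolding conj_exp_aa[OF L] conj_exp_aa[OF mL] using u by (intro tendsto_intros) (simp add: NC_def)
  then show ?thesis unfolding conj_mult[symmetric] by (simp add: NC_def exp_minus)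
qed

text \<open>Conjugating a matrix by a diagonal one leaves its diagonal entries unchanged, and
  \<open>exp (t H0)\<close> is diagonal in the basis \<open>eb\<close>.\<close>

lemma ip_Ad_conj_H0:
  assumes e: "e \<in> eb"
  shows "ip (Ad G (conj_H0 t g) e) e = ip (Ad G g e) e"
proof -
  have c: "conj_H0 t g = lie_exp G (t *\<^sub>R (- H0)) \<otimes> g \<otimes> lie_exp G ((- t) *\<^sub>R (- H0))"
    by (simp only: exp_minus[symmetric] scaleR_minus_left)
  have "ip (Ad G (conj_H0 t g) e) e = (exp (t * wt e (- H0)) * exp ((- t) * wt e (- H0))) * ip (Ad G g e) e"
    unfolding c
    by (simp only: Ad_mult ip_Ad_exp_eb[OF minus_H0 e] Ad_exp_eb[OF minus_H0 e]
        linear_scale[OF Ad_linear] ip_simps real_scaleR_def mult_ac)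
  then show ?thesis by (simp flip: Transcendental.exp_add)
qed

text \<open>The contraction removes the factor \<open>u\<close> and fixes the factors from
  \<open>exp (aa G)\<close>. Diagonal entries are constant along the way, so they can be computed in
  the limit: \<open>Ad g\<close> behaves like a triangular matrix.\<close>

lemma conj_limit:
  assumes L: "L \<in> aa G" "L' \<in> aa G" and u: "u \<in> NC" and g: "g = lie_exp G L' \<otimes> u \<otimes> inv (lie_exp G L)"
  shows "((\<lambda>t. conj_H0 t g) \<longlongrightarrow> lie_exp G (L' - L)) at_top"
    and "e \<in> eb \<Longrightarrow> ip (Ad G g e) e = exp (wt e (L' - L))"
proof -
  have mL: "- L \<in> aa G" using L subspace_neg[OF aa_subspace] by blast
  have "((\<lambda>t. conj_H0 t (lie_exp G L') \<otimes> conj_H0 t u \<otimes> conj_H0 t (lie_exp G (- L)))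
     \<longlongrightarrow> lie_exp G L' \<otimes> \<one> \<otimes> lie_exp G (- L)) at_top"
    unfolding conj_exp_aa[OF L(2)] conj_exp_aa[OF mL] using u by (intro tendsto_intros) (simp add: NC_def)
  moreover have "lie_exp G L' \<otimes> \<one> \<otimes> lie_exp G (- L) = lie_exp G (L' - L)"
    using exp_aa_add[OF L(2) mL] by simp
  ultimately show l: "((\<lambda>t. conj_H0 t g) \<longlongrightarrow> lie_exp G (L' - L)) at_top"
    unfolding conj_mult[symmetric] g by (simp add: exp_minus)
  assume e: "e \<in> eb"
  have "((\<lambda>t. ip (Ad G (conj_H0 t g) e) e) \<longlongrightarrow> ip (Ad G (lie_exp G (L' - L)) e) e) at_top"
    by (intro tendsto_intros continuous_on_tendsto_compose[OF continuous_Ad l]) auto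
  then have "((\<lambda>t::real. ip (Ad G g e) e) \<longlongrightarrow> ip (Ad G (lie_exp G (L' - L)) e) e) at_top"
    unfolding ip_Ad_conj_H0[OF e] .
  then have "ip (Ad G g e) e = ip (Ad G (lie_exp G (L' - L)) e) e"
    by (rule tendsto_unique[OF _ tendsto_const, rotated]) simp
  also have "\<dots> = exp (wt e (L' - L))"
    using ip_Ad_exp_eb[of "L' - L" e 1 e] L e eb(3) subspace_diff[OF aa_subspace] by simp
  finally show "ip (Ad G g e) e = exp (wt e (L' - L))" .
qed

lemma KS_unique:
  assumes "k \<in> KK G" "k' \<in> KK G" "Y \<in> ss G" "Y' \<in> ss G"
    and "k \<otimes> lie_exp G Y = k' \<otimes> lie_exp G Y'"
  shows "Y = Y'"
proof -
  obtain f where "homeomorphism (KK G \<times> ss G) UNIV (\<lambda>(k, Y). k \<otimes> lie_exp G Y) f"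
    using reductive unfolding reductive_cartan_group_def by blast
  from homeomorphism_apply1[OF this, of "(k, Y)"] homeomorphism_apply1[OF this, of "(k', Y')"]
  have "f (k \<otimes> lie_exp G Y) = (k, Y)" "f (k' \<otimes> lie_exp G Y') = (k', Y')"
    using assms(1-4) by simp_all
  then show ?thesis using assms(5) by (metis prod.inject)
qed

text \<open>The quotient \<open>g\<close> of the two compact factors acts isometrically and also has
  the diagonal entries \<open>exp (wt e (L' - L))\<close>. These and their inverses are at most 1,
  hence equal to 1, and equality in Cauchy-Schwarz gives \<open>Ad g = id\<close>. The weights
  determine \<open>L' - L\<close> only up to the centre, so the conclusion comes from uniqueness in
  \<open>G = K S\<close>: \<open>g\<close> commutes with all exponentials, so the contraction shows
  \<open>g = exp (L' - L)\<close>.\<close>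

lemma iwasawa_unique:
  assumes k: "k \<in> KK G" "k' \<in> KK G" and L: "L \<in> aa G" "L' \<in> aa G" and u: "u \<in> NC" "u' \<in> NC"
    and eq: "k \<otimes> lie_exp G L \<otimes> u = k' \<otimes> lie_exp G L' \<otimes> u'"
  shows "L = L'"
proof -
  define g where "g = inv k' \<otimes> k"
  have gK: "g \<in> KK G" unfolding g_def by (intro KK_closed k)
  have "k = k' \<otimes> lie_exp G L' \<otimes> u' \<otimes> inv u \<otimes> inv (lie_exp G L)"
    using arg_cong[OF eq, of "\<lambda>x. x \<otimes> inv u \<otimes> inv (lie_exp G L)"] by (simp add: m_assoc)
  then have g: "g = lie_exp G L' \<otimes> (u' \<otimes> inv u) \<otimes> inv (lie_exp G L)"
    unfolding g_def by (simp add: m_assoc)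
  have uu: "u' \<otimes> inv u \<in> NC" "u \<otimes> inv u' \<in> NC" using u by (auto intro: NC_mult NC_inv)
  have ig: "inv g = lie_exp G L \<otimes> (u \<otimes> inv u') \<otimes> inv (lie_exp G L')"
    unfolding g by (simp add: inv_mult_group m_assoc)
  have e1: "wt e (L' - L) = 0 \<and> Ad G g e = e" if e: "e \<in> eb" for e
  proof -
    have 1: "ip (Ad G g e) e = exp (wt e (L' - L))" by (rule conj_limit(2)[OF L uu(1) g e])
    have 2: "ip (Ad G (inv g) e) e = exp (wt e (L - L'))" by (rule conj_limit(2)[OF L(2,1) uu(2) ig e])
    have u1: "ip (Ad G g e) (Ad G g e) = 1" "ip (Ad G (inv g) e) (Ad G (inv g) e) = 1"
      using Ad_ip gK KK_closed(2) eb(3)[OF e] by simp_all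
    have "exp (wt e (L' - L)) \<le> 1" "exp (wt e (L - L')) \<le> 1"
      using ip_cauchy_schwarz_unit(1)[OF u1(1) eb(3)[OF e]] ip_cauchy_schwarz_unit(1)[OF u1(2) eb(3)[OF e]] 1 2 by auto
    then have "wt e (L' - L) = 0" by (simp add: wt_linear L)
    then show ?thesis using ip_cauchy_schwarz_unit(2)[OF u1(1) eb(3)[OF e]] 1 by simp
  qed
  have "Ad G g X = X" for X
  proof -
    have "Ad G g (\<Sum>e\<in>eb. ip X e *\<^sub>R e) = (\<Sum>e\<in>eb. ip X e *\<^sub>R e)"
      by (simp add: linear_sum[OF Ad_linear] linear_scale[OF Ad_linear] e1)
    then show ?thesis unfolding eb_expand[symmetric] .
  qed
  then have "g \<otimes> lie_exp G X \<otimes> inv g = lie_exp G X" for X using exp_Ad[of g X] by simp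
  then have comm: "g \<otimes> lie_exp G X = lie_exp G X \<otimes> g" for X by (metis m_assoc carrier_UNIV UNIV_I l_inv r_one)
  then have "conj_H0 t g = g" for t by (simp add: comm[symmetric] m_assoc)
  then have "((\<lambda>t::real. g) \<longlongrightarrow> lie_exp G (L' - L)) at_top" using conj_limit(1)[OF L uu(1) g] by simp
  then have "g = lie_exp G (L' - L)" by (rule tendsto_unique[OF _ tendsto_const, rotated]) simp
  then have "\<one> \<otimes> lie_exp G (L' - L) = g \<otimes> lie_exp G 0" by simp
  then have "L' - L = 0"
    using L aa_ss subspace_diff[OF aa_subspace] subspace_0[OF ss_subspace]
    by (intro KS_unique[OF KK_closed(3) gK]) auto
  then show ?thesis by simp
qed

lemma KAN: obtains k L Y where "k \<in> KK G" "L \<in> aa G" "Y \<in> nn G" "g = k \<otimes> lie_exp G L \<otimes> lie_exp G Y"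
proof -
  have "g \<in> KK G <#> AA G <#> NN G" using reductive by (simp add: reductive_cartan_group_def)
  then have "\<exists>k L Y. k \<in> KK G \<and> L \<in> aa G \<and> Y \<in> nn G \<and> g = k \<otimes> lie_exp G L \<otimes> lie_exp G Y"
    unfolding set_mult_def AA_def NN_def by blast
  then show ?thesis using that by (elim exE conjE)
qed

text \<open>The Iwasawa projection, with \<open>NC\<close> in place of \<open>NN G\<close>:
  uniqueness already holds there, and \<open>NC\<close> is known to be closed under products and
  under conjugation by \<open>exp (aa G)\<close>.\<close>

definition iw :: "'g \<Rightarrow> 'l" where
  "iw g = (SOME L. L \<in> aa G \<and> (\<exists>k\<in>KK G. \<exists>u\<in>NC. g = k \<otimes> lie_exp G L \<otimes> u))"

lemma iw_eq:
  assumes "k \<in> KK G" "L \<in> aa G" "u \<in> NC"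
  shows "iw (k \<otimes> lie_exp G L \<otimes> u) = L"
proof -
  have "iw (k \<otimes> lie_exp G L \<otimes> u) \<in> aa G \<and>
      (\<exists>k'\<in>KK G. \<exists>u'\<in>NC. k \<otimes> lie_exp G L \<otimes> u = k' \<otimes> lie_exp G (iw (k \<otimes> lie_exp G L \<otimes> u)) \<otimes> u')"
    unfolding iw_def by (rule someI[of _ L]) (use assms in blast)
  then obtain k' u' where "iw (k \<otimes> lie_exp G L \<otimes> u) \<in> aa G" "k' \<in> KK G" "u' \<in> NC"
    "k \<otimes> lie_exp G L \<otimes> u = k' \<otimes> lie_exp G (iw (k \<otimes> lie_exp G L \<otimes> u)) \<otimes> u'" by (elim exE conjE bexE)
  then show ?thesis by (intro iwasawa_unique[symmetric, OF assms(1) _ assms(2) _ assms(3)])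
qed

text \<open>Properness of \<open>Y \<mapsto> Ad (exp Y) H - H\<close>: contract \<open>Y\<close> by \<open>Ad (exp (s H))\<close> to a fixed small radius,
  where the map is bounded below; this bounds the time \<open>s\<close>, hence \<open>Y\<close>.\<close>

lemma orbit_proper:
  assumes H: "H \<in> aa G"
  shows "\<exists>R. \<forall>Y\<in>gr H (\<lambda>r. r < 0). norm (Ad G (lie_exp G Y) H - H) \<le> C \<longrightarrow> norm Y \<le> R"
proof -
  let ?m = "gr H (\<lambda>r. r < 0)"
  \<comment> \<open>The l1-norm in the basis \<open>eb\<close>. The diagonal operator
    \<open>Ad (h s)\<close> acts on each of its summands separately, so contraction rates are
    visible in it; \<open>C1\<close> and \<open>C2\<close> compare it with the Euclidean
    norm.\<close>
  define q where "q X = (\<Sum>e\<in>eb. \<bar>ip X e\<bar>)" for X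
  define h where "h s = lie_exp G (s *\<^sub>R H)" for s
  define \<Phi> where "\<Phi> Y = Ad G (lie_exp G Y) H - H" for Y
  obtain K where K: "0 \<le> K" "\<And>a b. norm (ip a b) \<le> norm a * norm b * K"
    using bounded_bilinear.nonneg_bounded[OF bounded_bilinear_ip] by blast
  define C1 where "C1 = (\<Sum>e\<in>eb. norm e * K)"
  have C1: "0 \<le> C1" "q X \<le> C1 * norm X" for X
  proof -
    show "0 \<le> C1" unfolding C1_def using K by (intro sum_nonneg) auto
    have "q X \<le> (\<Sum>e\<in>eb. norm X * norm e * K)"
      unfolding q_def using K(2) by (intro sum_mono) simp
    then show "q X \<le> C1 * norm X" by (simp add: C1_def sum_distrib_left mult_ac)
  qed
  define C2 where "C2 = (\<Sum>e\<in>eb. norm e) + 1"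
  have C2: "0 < C2" "norm X \<le> C2 * q X" for X
  proof -
    show "0 < C2" unfolding C2_def by (intro add_nonneg_pos sum_nonneg) auto
    have "norm X \<le> (\<Sum>e\<in>eb. \<bar>ip X e\<bar> * norm e)"
      using norm_sum[of "\<lambda>e. ip X e *\<^sub>R e" eb] unfolding eb_expand[symmetric] by simp
    also have "\<dots> \<le> (\<Sum>e\<in>eb. \<bar>ip X e\<bar> * C2)"
    proof (intro sum_mono mult_left_mono)
      fix e assume "e \<in> eb"
      then have "norm e \<le> (\<Sum>e\<in>eb. norm e)" using eb(1) by (intro member_le_sum) auto
      then show "norm e \<le> C2" by (simp add: C2_def)
    qed auto
    finally show "norm X \<le> C2 * q X" by (simp add: q_def sum_distrib_left mult.commute)
  qed
  obtain C3 where C3: "0 \<le> C3" "\<And>Z. norm Z \<le> 1 \<Longrightarrow> norm (Ad G (lie_exp G Z) H - H - br Z H) \<le> C3 * (norm Z)\<^sup>2"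
    by (rule Ad_exp_quadratic) blast
  \<comment> \<open>The slowest decay rate. The inserted 1 keeps the minimum meaningful when
    \<open>H\<close> has no negative weight.\<close>
  define la where "la = Min (insert 1 ((\<lambda>e. - wt e H) ` {e \<in> eb. wt e H < 0}))"
  have lam0: "0 < la" unfolding la_def using eb(1) by (subst Min_gr_iff) auto
  have lam: "la \<le> - wt e H" if "e \<in> eb" "wt e H < 0" for e
    unfolding la_def using eb(1) that by (intro Min_le) auto
  define M where "M = (\<Sum>e\<in>eb. \<bar>wt e H\<bar>)"
  have M: "\<bar>wt e H\<bar> \<le> M" if "e \<in> eb" for e
    unfolding M_def using eb(1) that by (intro member_le_sum) auto
  have M0: "0 \<le> M" unfolding M_def by (intro sum_nonneg) auto
  have qh: "q (Ad G (h s) X) = (\<Sum>e\<in>eb. exp (s * wt e H) * \<bar>ip X e\<bar>)" for s X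
    unfolding q_def h_def by (simp add: ip_Ad_exp_eb[OF H] abs_mult)
  have qcontr: "q (Ad G (h s) X) \<le> exp (- la * s) * q X" if s: "0 \<le> s" and X: "X \<in> ?m" for s X
    unfolding qh unfolding q_def sum_distrib_left
  proof (intro sum_mono)
    fix e assume e: "e \<in> eb"
    show "exp (s * wt e H) * \<bar>ip X e\<bar> \<le> exp (- la * s) * \<bar>ip X e\<bar>"
    proof (cases "ip X e = 0")
      case False
      then have "wt e H < 0" using X e by (auto simp: gr_def)
      then have "s * wt e H \<le> - la * s" using mult_left_mono[OF lam[OF e] s] by (simp add: algebra_simps)
      then show ?thesis by (intro mult_right_mono) auto
    qed simp
  qed
  \<comment> \<open>The first bound keeps \<open>norm W\<close> at most 1, where the quadratic
    estimate holds; the second makes the quadratic error at most half of the linear term, which is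
    at least \<open>la * \<rho>\<close>.\<close>
  define \<rho> where "\<rho> = min (1 / C2) (la / (2 * (C1 * C3 * C2\<^sup>2 + 1)))"
  have pos1: "0 < C1 * C3 * C2\<^sup>2 + 1" using C1(1) C3(1) by (simp add: add_nonneg_pos)
  have rho: "0 < \<rho>" "C2 * \<rho> \<le> 1" "C1 * C3 * C2\<^sup>2 * \<rho> \<le> la / 2"
  proof -
    show r0: "0 < \<rho>" unfolding \<rho>_def using C2(1) lam0 pos1 by simp
    have "\<rho> \<le> 1 / C2" by (simp add: \<rho>_def)
    then show "C2 * \<rho> \<le> 1" using C2(1) by (simp add: field_simps)
    have "\<rho> \<le> la / (2 * (C1 * C3 * C2\<^sup>2 + 1))" by (simp add: \<rho>_def)
    then have "\<rho> * (2 * (C1 * C3 * C2\<^sup>2 + 1)) \<le> la" using pos1 by (subst (asm) pos_le_divide_eq) auto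
    then show "C1 * C3 * C2\<^sup>2 * \<rho> \<le> la / 2" using r0 by (simp add: algebra_simps)
  qed
  have lower: "la * \<rho> / 2 \<le> q (\<Phi> W)" if W: "W \<in> ?m" "q W = \<rho>" for W
  proof -
    have nW: "norm W \<le> C2 * \<rho>" using C2(2)[of W] W by simp
    then have "norm W \<le> 1" using rho by simp
    define R where "R = \<Phi> W - br W H"
    have "q R \<le> C1 * norm R" by (rule C1)
    also have "\<dots> \<le> C1 * (C3 * (norm W)\<^sup>2)"
      unfolding R_def \<Phi>_def by (intro mult_left_mono C3(2) C1(1)) fact
    also have "\<dots> \<le> C1 * (C3 * (C2 * \<rho>)\<^sup>2)"
      using nW by (intro mult_left_mono power_mono C1(1) C3(1)) auto
    also have "\<dots> = (C1 * C3 * C2\<^sup>2 * \<rho>) * \<rho>" by (simp add: power2_eq_square)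
    also have "\<dots> \<le> la / 2 * \<rho>" using rho by (intro mult_right_mono) auto
    finally have qR: "q R \<le> la / 2 * \<rho>" .
    have "la * q W \<le> q (br W H)"
      unfolding q_def sum_distrib_left
    proof (intro sum_mono)
      fix e assume e: "e \<in> eb"
      have "ip (br W H) e = - (wt e H * ip W e)"
        unfolding bracket_antisym[of W H] by (simp add: ip_simps ip_br_eb[OF e H])
      moreover have "la * \<bar>ip W e\<bar> \<le> \<bar>wt e H\<bar> * \<bar>ip W e\<bar>"
        using W(1) e lam[OF e] by (cases "ip W e = 0") (auto simp: gr_def intro!: mult_right_mono)
      ultimately show "la * \<bar>ip W e\<bar> \<le> \<bar>ip (br W H) e\<bar>" by (simp add: abs_mult)
    qed
    moreover have "q (br W H) \<le> q (\<Phi> W) + q R"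
      unfolding q_def sum.distrib[symmetric]
      by (intro sum_mono) (simp add: R_def ip_simps)
    ultimately show ?thesis using qR W(2) by simp
  qed
  \<comment> \<open>The longest possible contraction time: when \<open>q\<close> reaches
    \<open>\<rho>\<close> at time \<open>s\<close>, the orbit displacement is at least
    \<open>la * \<rho> / 2\<close> and at most \<open>exp (- la * s) * (C1 * C)\<close>.\<close>
  define S where "S = ln (2 * (C1 * C) / (la * \<rho>)) / la"
  have "norm Y \<le> max (C2 * \<rho>) (C2 * (exp (S * M) * \<rho>))" if Y: "Y \<in> ?m" "norm (\<Phi> Y) \<le> C" for Y
  proof (cases "q Y \<le> \<rho>")
    case True
    then have "C2 * q Y \<le> C2 * \<rho>" using C2(1) by simp
    then show ?thesis using C2(2)[of Y] by linarith
  next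
    case False
    have cont: "continuous_on A (\<lambda>s. q (Ad G (h s) Y))" for A
      unfolding qh by (intro continuous_intros)
    have "((\<lambda>s. exp (- la * s) * q Y) \<longlongrightarrow> 0 * q Y) at_top"
    proof (intro tendsto_intros filterlim_compose[OF exp_at_bot])
      show "LIM x at_top. - la * x :> at_bot"
        by (rule filterlim_tendsto_neg_mult_at_bot[OF tendsto_const _ filterlim_ident]) (use lam0 in simp)
    qed
    then have "\<forall>\<^sub>F s in at_top. exp (- la * s) * q Y < \<rho>"
      using rho(1) by (intro order_tendstoD) auto
    then obtain s1 where s1: "\<And>s. s1 \<le> s \<Longrightarrow> exp (- la * s) * q Y < \<rho>"
      unfolding eventually_at_top_linorder by blast
    have "q (Ad G (h (max 0 s1)) Y) \<le> \<rho>"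
      using qcontr[of "max 0 s1" Y] s1[of "max 0 s1"] Y(1) by simp
    moreover have "\<rho> \<le> q (Ad G (h 0) Y)" using False by (simp add: h_def)
    ultimately obtain s where s: "0 \<le> s" "q (Ad G (h s) Y) = \<rho>"
      using IVT2'[of "\<lambda>s. q (Ad G (h s) Y)" "max 0 s1" \<rho> 0] cont by auto
    define W where "W = Ad G (h s) Y"
    have Wm: "W \<in> ?m" unfolding W_def h_def by (rule Ad_exp_gr[OF H Y(1)])
    have "la * \<rho> / 2 \<le> q (\<Phi> W)" by (rule lower[OF Wm]) (simp add: W_def s)
    also have "\<Phi> W = Ad G (h s) (\<Phi> Y)"
      unfolding \<Phi>_def W_def h_def by (rule orbit_scale[OF H, symmetric])
    also have "q \<dots> \<le> exp (- la * s) * q (\<Phi> Y)"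
      unfolding \<Phi>_def by (rule qcontr[OF s(1) orbit_in_gr[OF H Y(1)]])
    also have "\<dots> \<le> exp (- la * s) * (C1 * C)"
      using C1(2)[of "\<Phi> Y"] mult_left_mono[OF Y(2) C1(1)] by (intro mult_left_mono) auto
    finally have "la * \<rho> / 2 * exp (la * s) \<le> exp (- la * s) * (C1 * C) * exp (la * s)"
      by (rule mult_right_mono) simp
    then have "la * \<rho> / 2 * exp (la * s) \<le> C1 * C" by (simp add: Transcendental.exp_minus field_simps)
    then have "exp (la * s) \<le> 2 * (C1 * C) / (la * \<rho>)" using lam0 rho(1) by (simp add: field_simps)
    then have "la * s \<le> ln (2 * (C1 * C) / (la * \<rho>))"
      by (metis exp_gt_zero ln_exp ln_mono order_less_le_trans)
    then have sS: "s \<le> S" using lam0 by (simp add: S_def field_simps)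
    have "q Y \<le> (\<Sum>e\<in>eb. exp (S * M) * \<bar>ip W e\<bar>)"
      unfolding q_def
    proof (intro sum_mono)
      fix e assume e: "e \<in> eb"
      have "\<bar>ip Y e\<bar> = exp (- (s * wt e H)) * \<bar>ip W e\<bar>"
        unfolding W_def h_def by (simp add: ip_Ad_exp_eb[OF H e] abs_mult Transcendental.exp_minus)
      also have "- (s * wt e H) \<le> s * M"
        using mult_left_mono[OF M[OF e] s(1)] s(1)
        by (metis abs_ge_minus_self abs_mult abs_of_nonneg order_trans)
      then have "- (s * wt e H) \<le> S * M" using mult_right_mono[OF sS M0] by linarith
      then have "exp (- (s * wt e H)) * \<bar>ip W e\<bar> \<le> exp (S * M) * \<bar>ip W e\<bar>"
        by (intro mult_right_mono) auto
      finally show "\<bar>ip Y e\<bar> \<le> exp (S * M) * \<bar>ip W e\<bar>" .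
    qed
    also have "\<dots> = exp (S * M) * \<rho>"
      using s(2) unfolding W_def[symmetric] by (simp add: q_def sum_distrib_left[symmetric])
    finally have "C2 * q Y \<le> C2 * (exp (S * M) * \<rho>)" using C2(1) by simp
    then show ?thesis using C2(2)[of Y] by linarith
  qed
  then show ?thesis unfolding \<Phi>_def by blast
qed

text \<open>Each factor converges along a subsequence for its own reason: the \<open>K\<close>
  factor by compactness, \<open>Y\<close> by properness of the unipotent orbit map, and then
  \<open>L\<close> because \<open>exp L\<close> converges and the inverse of the Cartan
  decomposition is continuous.\<close>

lemma closed_KAN:
  assumes g: "g \<longlonglongrightarrow> g0"
  obtains r :: "nat \<Rightarrow> nat" where "strict_mono r" "(\<lambda>i. iw (g (r i))) \<longlonglongrightarrow> iw g0"
proof -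
  have "\<exists>k L Y. k \<in> KK G \<and> L \<in> aa G \<and> Y \<in> nn G \<and> g i = k \<otimes> lie_exp G L \<otimes> lie_exp G Y" for i
    by (rule KAN[of "g i"]) blast
  then obtain k L Y where d: "\<And>i. k i \<in> KK G" "\<And>i. L i \<in> aa G" "\<And>i. Y i \<in> nn G"
    "\<And>i. g i = k i \<otimes> lie_exp G (L i) \<otimes> lie_exp G (Y i)" by metis
  have iwg: "iw (g i) = L i" for i unfolding d(4) by (rule iw_eq[OF d(1,2) exp_NC[OF d(3)]])
  obtain k0 r1 where r1: "k0 \<in> KK G" "strict_mono r1" "(k \<circ> r1) \<longlonglongrightarrow> k0"
    using compact_imp_seq_compact[OF KK_compact] d(1) unfolding seq_compact_def by metis
  define b where "b i = lie_exp G (L (r1 i)) \<otimes> lie_exp G (Y (r1 i))" for i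
  have "(\<lambda>i. inv (k (r1 i)) \<otimes> g (r1 i)) \<longlonglongrightarrow> inv k0 \<otimes> g0"
    using r1(3) LIMSEQ_subseq_LIMSEQ[OF g r1(2)] by (intro tendsto_intros) (auto simp: o_def)
  then have b: "b \<longlonglongrightarrow> inv k0 \<otimes> g0" by (simp add: d(4) m_assoc b_def[abs_def])
  have bnd: "\<exists>B. \<forall>i. norm (Ad G (f i) X) \<le> B" if "f \<longlonglongrightarrow> f0" for f :: "nat \<Rightarrow> 'g" and f0 X
  proof -
    have "(\<lambda>i. Ad G (f i) X) \<longlonglongrightarrow> Ad G f0 X"
      by (rule continuous_on_tendsto_compose[OF continuous_Ad that]) auto
    then have "Bseq (\<lambda>i. Ad G (f i) X)" by (intro convergent_imp_Bseq) (auto simp: convergent_def)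
    then show ?thesis by (auto simp: Bseq_def)
  qed
  obtain Kip where Kip: "0 \<le> Kip" "\<And>a b. norm (ip a b) \<le> norm a * norm b * Kip"
    using bounded_bilinear.nonneg_bounded[OF bounded_bilinear_ip] by blast
  have ipb: "\<exists>B. \<forall>i. \<bar>ip (Ad G (f i) X) e\<bar> \<le> B" if f: "f \<longlonglongrightarrow> f0" for f :: "nat \<Rightarrow> 'g" and f0 X e
  proof -
    obtain B where B: "\<And>i. norm (Ad G (f i) X) \<le> B" using bnd[OF f] by blast
    have "\<bar>ip (Ad G (f i) X) e\<bar> \<le> B * norm e * Kip" for i
      using Kip(2)[of "Ad G (f i) X" e] mult_right_mono[OF mult_right_mono[OF B[of i] norm_ge_zero[of e]] Kip(1)]
      by simp
    then show ?thesis by blast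
  qed
  have ib: "(\<lambda>i. inv (b i)) \<longlonglongrightarrow> inv (inv k0 \<otimes> g0)" by (intro tendsto_intros b)
  \<comment> \<open>The weights of \<open>- L\<close> appear on the diagonal of
    \<open>Ad (inv (b i))\<close>, which is bounded because \<open>b\<close> converges. An upper
    bound on their exponentials is all that is used.\<close>
  have wm: "\<exists>B. \<forall>i. exp (wt e (- L (r1 i))) \<le> B" if e: "e \<in> eb" for e
  proof -
    have eq: "ip (Ad G (inv (b i)) e) e = exp (wt e (0 - L (r1 i)))" for i
    proof (rule conj_limit(2)[OF d(2) subspace_0[OF aa_subspace] NC_inv[OF exp_NC[OF d(3)]] _ e])
      show "inv (b i) = lie_exp G 0 \<otimes> inv (lie_exp G (Y (r1 i))) \<otimes> inv (lie_exp G (L (r1 i)))"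
        by (simp add: b_def inv_mult_group)
    qed
    obtain B where "\<And>i. \<bar>ip (Ad G (inv (b i)) e) e\<bar> \<le> B" using ipb[OF ib] by blast
    then have "exp (wt e (- L (r1 i))) \<le> B" for i using eq[of i] by (metis abs_le_D1 diff_0)
    then show ?thesis by blast
  qed
  \<comment> \<open>Writing \<open>exp Y\<close> as \<open>exp (- L)\<close> times
    \<open>b i\<close> bounds every coordinate by a diagonal factor times a convergent one;
    \<open>orbit_proper\<close> turns this bound on the orbit into one on \<open>Y\<close>.\<close>
  have "\<exists>B. \<forall>i. norm (Ad G (lie_exp G (Y (r1 i))) H0) \<le> B"
  proof -
    obtain B1 where B1: "\<And>e i. e \<in> eb \<Longrightarrow> exp (wt e (- L (r1 i))) \<le> B1 e" using wm by metis
    obtain B2 where B2: "\<And>e i. \<bar>ip (Ad G (b i) H0) e\<bar> \<le> B2 e" using ipb[OF b] by metis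
    have "norm (Ad G (lie_exp G (Y (r1 i))) H0) \<le> (\<Sum>e\<in>eb. B1 e * B2 e * norm e)" for i
    proof -
      let ?X = "Ad G (lie_exp G (Y (r1 i))) H0"
      have "lie_exp G (Y (r1 i)) = lie_exp G (1 *\<^sub>R (- L (r1 i))) \<otimes> b i"
        by (simp add: b_def exp_minus)
      then have c: "ip ?X e = exp (1 * wt e (- L (r1 i))) * ip (Ad G (b i) H0) e" if "e \<in> eb" for e
        using ip_Ad_exp_eb[OF _ that, of "- L (r1 i)" 1 "Ad G (b i) H0"] d(2)[of "r1 i"] subspace_neg[OF aa_subspace]
        by (simp add: Ad_mult)
      have "norm ?X \<le> (\<Sum>e\<in>eb. \<bar>ip ?X e\<bar> * norm e)"
        using norm_sum[of "\<lambda>e. ip ?X e *\<^sub>R e" eb] unfolding eb_expand[symmetric] by simp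
      also have "\<dots> \<le> (\<Sum>e\<in>eb. B1 e * B2 e * norm e)"
      proof (intro sum_mono mult_right_mono)
        fix e assume e: "e \<in> eb"
        have "0 \<le> B1 e" using B1[OF e, of 0] by (rule order_trans[OF exp_ge_zero])
        then show "\<bar>ip ?X e\<bar> \<le> B1 e * B2 e"
          unfolding c[OF e] abs_mult using B1[OF e, of i] B2[of i e] by (intro mult_mono) auto
      qed auto
      finally show ?thesis .
    qed
    then show ?thesis by blast
  qed
  then obtain B where B: "\<And>i. norm (Ad G (lie_exp G (Y (r1 i))) H0) \<le> B" by blast
  obtain R where R: "\<And>Y. Y \<in> nn G \<Longrightarrow> norm (Ad G (lie_exp G Y) (- H0) - (- H0)) \<le> B + norm H0 \<Longrightarrow> norm Y \<le> R"
    using orbit_proper[OF minus_H0, of "B + norm H0"] unfolding nn_gr_minus by blast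
  have "norm (Y (r1 i)) \<le> R" for i
  proof (rule R[OF d(3)])
    have "Ad G (lie_exp G (Y (r1 i))) (- H0) - (- H0) = - (Ad G (lie_exp G (Y (r1 i))) H0) + H0"
      by (simp add: linear_neg[OF Ad_linear])
    also have "norm \<dots> \<le> B + norm H0"
      using norm_triangle_ineq[of "- (Ad G (lie_exp G (Y (r1 i))) H0)" H0] B[of i] by simp
    finally show "norm (Ad G (lie_exp G (Y (r1 i))) (- H0) - (- H0)) \<le> B + norm H0" .
  qed
  then have "bounded (range (\<lambda>i. Y (r1 i)))" by (auto simp: bounded_iff)
  then obtain Y0 r2 where r2: "strict_mono r2" "(\<lambda>i. Y (r1 (r2 i))) \<longlonglongrightarrow> Y0"
    using bounded_imp_convergent_subsequence[of "\<lambda>i. Y (r1 i)"] by (auto simp: o_def)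
  have Y0: "Y0 \<in> nn G"
  proof (rule closed_sequentially[OF _ _ r2(2)])
    show "closed (nn G)" unfolding nn_eq by (rule closed_subspace[OF gr_subspace])
  qed (rule d(3))
  obtain f where f: "homeomorphism (KK G \<times> ss G) UNIV (\<lambda>(k, Y). k \<otimes> lie_exp G Y) f"
    using reductive unfolding reductive_cartan_group_def by blast
  have fe: "f (lie_exp G X) = (\<one>, X)" if "X \<in> aa G" for X
    using homeomorphism_apply1[OF f, of "(\<one>, X)"] that aa_ss KK_closed(3) by auto
  define c where "c = inv k0 \<otimes> g0 \<otimes> inv (lie_exp G Y0)"
  have "(\<lambda>i. b (r2 i) \<otimes> inv (lie_exp G (Y (r1 (r2 i))))) \<longlonglongrightarrow> c"
    unfolding c_def using LIMSEQ_subseq_LIMSEQ[OF b r2(1)] by (intro tendsto_intros r2(2)) (simp add: o_def)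
  then have ec: "(\<lambda>i. lie_exp G (L (r1 (r2 i)))) \<longlonglongrightarrow> c" by (simp add: b_def m_assoc)
  have "continuous_on UNIV f" using f by (simp add: homeomorphism_def)
  from continuous_on_tendsto_compose[OF this ec]
  have "(\<lambda>i. (\<one>, L (r1 (r2 i)))) \<longlonglongrightarrow> f c" by (simp add: fe d(2))
  then have Llim: "(\<lambda>i. L (r1 (r2 i))) \<longlonglongrightarrow> snd (f c)" using tendsto_snd by fastforce
  define L0 where "L0 = snd (f c)"
  have L0: "L0 \<in> aa G" unfolding L0_def
    by (rule closed_sequentially[OF closed_subspace[OF aa_subspace] _ Llim]) (rule d(2))
  have "(\<lambda>i. lie_exp G (L (r1 (r2 i)))) \<longlonglongrightarrow> lie_exp G L0"
    unfolding L0_def by (intro tendsto_intros Llim)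
  then have "c = lie_exp G L0" by (rule LIMSEQ_unique[OF ec])
  then have "inv k0 \<otimes> g0 = lie_exp G L0 \<otimes> lie_exp G Y0"
    unfolding c_def by (metis m_assoc carrier_UNIV UNIV_I l_inv r_one)
  then have "g0 = k0 \<otimes> lie_exp G L0 \<otimes> lie_exp G Y0" by (metis inv_cancel(2) m_assoc carrier_UNIV UNIV_I)
  then have "iw g0 = L0" using iw_eq[OF r1(1) L0 exp_NC[OF Y0]] by simp
  then show ?thesis using that[of "r1 \<circ> r2"] Llim strict_mono_o[OF r1(2) r2(1)]
    by (simp add: iwg L0_def)
qed

lemma continuous_iw: "continuous_on UNIV iw"
proof (rule continuous_at_imp_continuous_on, rule ballI)
  fix g0
  show "isCont iw g0"
    unfolding continuous_within_sequentially
  proof (intro allI impI)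
    fix g assume "(\<forall>n. g n \<in> UNIV) \<and> g \<longlonglongrightarrow> g0"
    then have g: "g \<longlonglongrightarrow> g0" by blast
    show "(iw \<circ> g) \<longlonglongrightarrow> iw g0"
    proof (rule ccontr)
      assume "\<not> (iw \<circ> g) \<longlonglongrightarrow> iw g0"
      then obtain \<epsilon> where e: "0 < \<epsilon>" "\<not> (\<forall>\<^sub>F i in sequentially. dist ((iw \<circ> g) i) (iw g0) < \<epsilon>)"
        unfolding tendsto_iff by blast
      then have "infinite {i. \<epsilon> \<le> dist (iw (g i)) (iw g0)}"
        unfolding cofinite_eq_sequentially[symmetric] eventually_cofinite by (simp add: not_less)
      then obtain r :: "nat \<Rightarrow> nat" where r: "strict_mono r" "\<And>i. \<epsilon> \<le> dist (iw (g (r i))) (iw g0)"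
        using infinite_enumerate[of "{i. \<epsilon> \<le> dist (iw (g i)) (iw g0)}"] by auto
      have "(\<lambda>i. g (r i)) \<longlonglongrightarrow> g0" using LIMSEQ_subseq_LIMSEQ[OF g r(1)] by (simp add: o_def)
      then obtain s where "(\<lambda>i. iw (g (r (s i)))) \<longlonglongrightarrow> iw g0" by (rule closed_KAN) blast
      then have "\<forall>\<^sub>F i in sequentially. dist (iw (g (r (s i)))) (iw g0) < \<epsilon>" using e(1) by (rule tendstoD)
      then obtain i where "dist (iw (g (r (s i)))) (iw g0) < \<epsilon>"
        using eventually_happens' sequentially_bot by blast
      then show False using r(2)[of "s i"] by simp
    qed
  qed
qed

end

section \<open>Bruhat decomposition\<close>

context lie_grp
begin

lemma tendsto_Ad[tendsto_intros]:
  assumes g: "(g \<longlongrightarrow> g0) F" and X: "(X \<longlongrightarrow> X0) F"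
  shows "((\<lambda>i. Ad G (g i) (X i)) \<longlongrightarrow> Ad G g0 X0) F"
proof -
  have e: "Ad G h Y = (\<Sum>b\<in>Basis. (Y \<bullet> b) *\<^sub>R Ad G h b)" for h Y
  proof -
    have "Ad G h (\<Sum>b\<in>Basis. (Y \<bullet> b) *\<^sub>R b) = (\<Sum>b\<in>Basis. (Y \<bullet> b) *\<^sub>R Ad G h b)"
      by (simp add: linear_sum[OF Ad_linear] linear_scale[OF Ad_linear])
    then show ?thesis by (simp add: euclidean_representation)
  qed
  have "((\<lambda>i. Ad G (g i) b) \<longlongrightarrow> Ad G g0 b) F" for b
    by (rule continuous_on_tendsto_compose[OF continuous_Ad g]) auto
  then have "((\<lambda>i. \<Sum>b\<in>Basis. (X i \<bullet> b) *\<^sub>R Ad G (g i) b) \<longlongrightarrow> (\<Sum>b\<in>Basis. (X0 \<bullet> b) *\<^sub>R Ad G g0 b)) F"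
    by (intro tendsto_intros X)
  then show ?thesis unfolding e[symmetric] .
qed

end

context cartan_grp
begin

lemma pp_subspace: "subspace pp" unfolding pp_def by (rule gr_subspace)

lemma pp_br: "X \<in> pp \<Longrightarrow> Y \<in> pp \<Longrightarrow> br X Y \<in> pp"
  unfolding pp_def by (rule gr_bracket[OF H0(1)]) auto

lemma aa_pp: "H \<in> aa G \<Longrightarrow> H \<in> pp"
  unfolding pp_def by (rule aa_gr_0[OF H0(1)]) auto

lemma nn_pp: "X \<in> nn G \<Longrightarrow> X \<in> pp"
  by (auto simp: pp_def nn_eq gr_def)

lemma Ad_exp_pp: "X \<in> pp \<Longrightarrow> Y \<in> pp \<Longrightarrow> Ad G (lie_exp G X) Y \<in> pp"
  unfolding Ad_exp_mexp by (rule mexp_in_subspace[OF bracket_linear_right pp_subspace]) (rule pp_br)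

lemma Ad_image_eqI:
  assumes "\<And>X. X \<in> V \<Longrightarrow> Ad G g X \<in> V" "\<And>X. X \<in> V \<Longrightarrow> Ad G (inv g) X \<in> V"
  shows "Ad G g ` V = V"
proof
  show "V \<subseteq> Ad G g ` V"
  proof
    fix X assume "X \<in> V"
    then have "Ad G g (Ad G (inv g) X) \<in> Ad G g ` V" using assms(2) by (intro imageI)
    then show "X \<in> Ad G g ` V" by simp
  qed
qed (use assms(1) in auto)

lemma Ad_image_inv: assumes "Ad G g ` V = V" "X \<in> V" shows "Ad G (inv g) X \<in> V"
proof -
  obtain Y where "Y \<in> V" "X = Ad G g Y" using assms by blast
  then show ?thesis by simp
qed

lemma mp_iff: "g \<in> min_parabolic G \<longleftrightarrow> (\<forall>X\<in>pp. Ad G g X \<in> pp \<and> Ad G (inv g) X \<in> pp)"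
  unfolding min_parabolic_iff using Ad_image_inv[of g pp] Ad_image_eqI[of pp g] by blast

lemma exp_mp: assumes "X \<in> pp" shows "lie_exp G X \<in> min_parabolic G"
  unfolding mp_iff exp_minus[symmetric]
  using Ad_exp_pp[OF assms] Ad_exp_pp[OF subspace_neg[OF pp_subspace assms]] by blast

lemma mp_mult: "g \<in> min_parabolic G \<Longrightarrow> h \<in> min_parabolic G \<Longrightarrow> g \<otimes> h \<in> min_parabolic G"
  unfolding mp_iff by (simp add: Ad_mult inv_mult_group)

lemma mp_inv: "g \<in> min_parabolic G \<Longrightarrow> inv g \<in> min_parabolic G"
  unfolding mp_iff by simp

lemma mp_one: "\<one> \<in> min_parabolic G"
  unfolding min_parabolic_iff by simp

lemma theta_gr: "X \<in> gr H P \<Longrightarrow> H \<in> aa G \<Longrightarrow> theta X \<in> gr H (\<lambda>r. P (- r))"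
proof -
  assume H: "H \<in> aa G" and X: "X \<in> gr H P"
  have "gr H P \<subseteq> {X. theta X \<in> gr H (\<lambda>r. P (- r))}"
  proof (rule gr_subset)
    show "subspace {X. theta X \<in> gr H (\<lambda>r. P (- r))}"
      using gr_subspace[of H "\<lambda>r. P (- r)"]
      by (auto simp: subspace_def linear_0[OF theta_linear] linear_add[OF theta_linear] linear_scale[OF theta_linear])
    fix e assume e: "e \<in> eb" "P (wt e H)"
    have "br H (theta e) = theta (br (theta H) e)" by (simp add: theta_br)
    also have "theta H = - H" using H aa_ss by (auto intro: theta_ss)
    finally have "br H (theta e) = - wt e H *\<^sub>R theta e"
      by (simp add: bracket_simps br_eb[OF e(1) H] linear_neg[OF theta_linear] linear_scale[OF theta_linear])
    then show "e \<in> {X. theta X \<in> gr H (\<lambda>r. P (- r))}" using e(2)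
      by (auto intro!: br_eigen_gr[OF H, where r = "- wt e H"])
  qed
  then show ?thesis using X by blast
qed

lemma ip_expand: "ip X Y = (\<Sum>e\<in>eb. ip X e * ip Y e)"
proof -
  have "ip X (\<Sum>e\<in>eb. ip Y e *\<^sub>R e) = (\<Sum>e\<in>eb. ip X e * ip Y e)"
    by (simp add: linear_sum[OF ip_linear(2)] ip_simps mult.commute)
  then show ?thesis unfolding eb_expand[symmetric] .
qed

lemma gr_orthogonal:
  assumes "X \<in> gr H P" "Y \<in> gr H Q" "\<And>r. P r \<Longrightarrow> \<not> Q r"
  shows "ip X Y = 0"
proof (subst ip_expand, rule sum.neutral, rule ballI)
  fix e assume e: "e \<in> eb"
  have "\<not> (P (wt e H) \<and> Q (wt e H))" using assms(3) by blast
  then have "ip X e = 0 \<or> ip Y e = 0" using assms(1,2) e unfolding gr_def by blast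
  then show "ip X e * ip Y e = 0" by simp
qed

lemma centralizer_H0_ss:
  assumes "X \<in> ss G" "br H0 X = 0"
  shows "X \<in> aa G"
proof -
  have "X \<in> gr H0 (\<lambda>r. r = 0)" by (rule br_eigen_gr[OF H0(1), where r = 0]) (use assms in auto)
  then show ?thesis using assms(1) by (intro aa_centralizer) (auto simp: gr_H0_zero)
qed

text \<open>For \<open>X\<close> in both spaces, \<open>Y = br H0 X\<close> lies in the positive
  eigenspaces and is fixed by \<open>theta\<close>, which exchanges positive and negative ones. So
  \<open>Y\<close> is orthogonal to itself, and \<open>X\<close> commutes with the regular element
  \<open>H0\<close>.\<close>

lemma pp_ss: assumes X: "X \<in> pp" "X \<in> ss G" shows "X \<in> aa G"
proof -
  define Y where "Y = br H0 X"
  have "Y \<in> gr H0 (\<lambda>r. 0 < r)"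
    using X(1) unfolding Y_def pp_def gr_def by (auto simp: ip_br_eb[OF _ H0(1)] less_le)
  moreover have "theta Y = Y"
    unfolding Y_def using X(2) H0(1) aa_ss by (intro theta_kk br_ss) auto
  ultimately have "Y \<in> gr H0 (\<lambda>r. 0 < - r)" using theta_gr[OF _ H0(1), of Y] by metis
  then have "ip Y Y = 0"
    by (rule gr_orthogonal[OF \<open>Y \<in> gr H0 (\<lambda>r. 0 < r)\<close>]) simp
  then have "Y = 0" by (simp add: ip_eq_0)
  then show ?thesis using X(2) unfolding Y_def by (intro centralizer_H0_ss)
qed

text \<open>Testing with \<open>Y = H0\<close> suffices: a component of \<open>X\<close> with
  negative eigenvalue would survive in \<open>br H0 X\<close>.\<close>

lemma pp_self_normalizing: assumes "\<And>Y. Y \<in> pp \<Longrightarrow> br X Y \<in> pp" shows "X \<in> pp"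
proof -
  have "br X H0 \<in> pp" using assms H0(1) aa_pp by blast
  then have "br H0 X \<in> pp" using bracket_antisym[of X H0] subspace_neg[OF pp_subspace] by fastforce
  then show ?thesis unfolding pp_def gr_def
    by (auto simp: ip_br_eb[OF _ H0(1)])
qed

abbreviation NKa :: "'g set" where "NKa \<equiv> {k \<in> KK G. Ad G k ` aa G = aa G}"

lemma NKa_Ad: "k \<in> NKa \<Longrightarrow> X \<in> aa G \<Longrightarrow> Ad G k X \<in> aa G" by blast

lemma NKa_closed: "k \<in> NKa \<Longrightarrow> h \<in> NKa \<Longrightarrow> k \<otimes> h \<in> NKa" "k \<in> NKa \<Longrightarrow> inv k \<in> NKa" "\<one> \<in> NKa"
proof -
  show "k \<otimes> h \<in> NKa" if "k \<in> NKa" "h \<in> NKa"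
  proof -
    have "Ad G (k \<otimes> h) ` aa G = Ad G k ` Ad G h ` aa G" by (auto simp: Ad_mult image_image)
    then show ?thesis using that KK_closed(1) by simp
  qed
  show "inv k \<in> NKa" if "k \<in> NKa"
  proof -
    have "Ad G (inv k) ` aa G = aa G" using that by (intro Ad_image_eqI) (auto intro: Ad_image_inv)
    then show ?thesis using that KK_closed(2) by simp
  qed
  show "\<one> \<in> NKa" using KK_closed(3) by simp
qed

text \<open>Both \<open>pp\<close> and \<open>ss G\<close> are preserved, and their intersection is
  \<open>aa G\<close>.\<close>

lemma KK_mp_NKa: assumes "k \<in> KK G" "k \<in> min_parabolic G" shows "k \<in> NKa"
proof -
  have *: "Ad G h X \<in> aa G" if "h \<in> KK G" "h \<in> min_parabolic G" "X \<in> aa G" for h X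
  proof (rule pp_ss)
    show "Ad G h X \<in> pp" using that aa_pp unfolding min_parabolic_iff by blast
    show "Ad G h X \<in> ss G" using that aa_ss by (intro Ad_ss) auto
  qed
  have "Ad G k ` aa G = aa G"
    using * assms KK_closed(2) mp_inv by (intro Ad_image_eqI) auto
  then show ?thesis using assms by simp
qed

lemma ip_critical:
  assumes "\<And>t. ip (Ad G (lie_exp G (t *\<^sub>R T)) S) Z \<le> ip S Z"
  shows "ip (br T S) Z = 0"
proof -
  have "bounded_linear (\<lambda>X. ip X Z)" using ip_linear(1) linear_conv_bounded_linear by blast
  from bounded_linear.has_vector_derivative[OF this bracket_deriv]
  have "((\<lambda>t. ip (Ad G (lie_exp G (t *\<^sub>R T)) S) Z) has_real_derivative ip (br T S) Z) (at 0)"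
    by (simp add: has_real_derivative_iff_has_vector_derivative)
  then show ?thesis by (rule DERIV_local_max[of _ _ _ 1]) (use assms in auto)
qed

lemma K_H_iff: "c \<in> K_H G H \<longleftrightarrow> c \<in> KK G \<and> Ad G c H = H" by (simp add: K_H_def)

text \<open>Maximal abelian subspaces of the centralizer of \<open>H\<close> are conjugate under \<open>K_H\<close>: maximise
  \<open>\<langle>Ad (c k) H0, H0\<rangle>\<close> over \<open>c \<in> K_H\<close>.\<close>

lemma K_H_decomposition:
  assumes H: "H \<in> aa G" and k: "k \<in> KK G" and H1: "H1 \<in> aa G" "Ad G k H1 = H"
  obtains c m where "c \<in> K_H G H" "m \<in> NKa" "k = c \<otimes> m"
proof -
  have "continuous_on UNIV (\<lambda>c. Ad G c H)" by (rule continuous_Ad)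
  then have "closed {c. Ad G c H = H}" by (intro closed_Collect_eq continuous_intros)
  then have "compact (KK G \<inter> {c. Ad G c H = H})" by (rule compact_Int_closed[OF KK_compact])
  moreover have "KK G \<inter> {c. Ad G c H = H} = K_H G H" by (auto simp: K_H_def)
  ultimately have comp: "compact (K_H G H)" by simp
  have "\<one> \<in> K_H G H" by (simp add: K_H_iff KK_closed)
  moreover have "continuous_on (K_H G H) (\<lambda>c. ip (Ad G c (Ad G k H0)) H0)"
    by (intro continuous_intros continuous_on_subset[OF continuous_Ad]) auto
  ultimately obtain c where c: "c \<in> K_H G H"
    "\<And>d. d \<in> K_H G H \<Longrightarrow> ip (Ad G d (Ad G k H0)) H0 \<le> ip (Ad G c (Ad G k H0)) H0"
    using continuous_attains_sup[OF comp] by blast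
  have cK: "c \<in> KK G" "Ad G c H = H" using c(1) by (auto simp: K_H_iff)
  define m where "m = c \<otimes> k"
  have mK: "m \<in> KK G" unfolding m_def by (intro KK_closed cK k)
  define S where "S = Ad G m H0"
  have Hs: "H \<in> ss G" "H0 \<in> ss G" using H H0(1) aa_ss by auto
  have S: "S \<in> ss G" unfolding S_def by (rule Ad_ss[OF mK Hs(2)])
  \<comment> \<open>\<open>Z\<close> commutes with \<open>H\<close>, so \<open>exp (t Z)\<close>
    moves the maximiser inside \<open>K_H G H\<close>. The derivative of the function in this
    direction is \<open>ip Z Z\<close>, so maximality forces \<open>Z = 0\<close>, and
    \<open>S\<close> lies in \<open>aa G\<close>.\<close>
  define Z where "Z = br H0 S"
  have Zk: "Z \<in> kk G" unfolding Z_def by (rule br_ss[OF Hs(2) S])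
  have HS: "br H S = 0"
  proof -
    have "H = Ad G m H1" using H1(2) cK(2) by (simp add: m_def Ad_mult)
    then show ?thesis using aa_abelian[OF H1(1) H0(1)]
      by (simp add: S_def Ad_bracket[symmetric] linear_0[OF Ad_linear])
  qed
  have HZ: "br Z H = 0"
  proof -
    have "br H Z = 0" unfolding Z_def jacobi[of H] HS aa_abelian[OF H H0(1)] by (simp add: bracket_simps)
    then show ?thesis using bracket_antisym[of Z H] by simp
  qed
  have "ip (br Z S) H0 = 0"
  proof (rule ip_critical)
    fix t
    have "lie_exp G (t *\<^sub>R Z) \<otimes> c \<in> K_H G H"
    proof -
      have "Ad G (lie_exp G (t *\<^sub>R Z)) H = H"
        unfolding Ad_exp_mexp by (rule mexp_kernel[OF bracket_linear_right]) (simp add: bracket_simps HZ)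
      moreover have "lie_exp G (t *\<^sub>R Z) \<in> KK G" using Zk subspace_scale[OF kk_subspace] by (intro exp_KK)
      ultimately show ?thesis using cK by (simp add: K_H_iff KK_closed Ad_mult)
    qed
    from c(2)[OF this] show "ip (Ad G (lie_exp G (t *\<^sub>R Z)) S) H0 \<le> ip S H0"
      by (simp add: S_def m_def Ad_mult)
  qed
  moreover have "ip (br Z S) H0 = ip Z Z"
  proof -
    have "ip (br Z S) H0 = - ip S (br Z H0)" using ip_br[of Z S H0] theta_kk[OF Zk] by simp
    also have "\<dots> = ip S (br H0 Z)" using bracket_antisym[of Z H0] by (simp add: ip_simps)
    also have "\<dots> = ip (br H0 S) Z" using ip_br_ss[OF Hs(2)] by simp
    finally show ?thesis by (simp add: Z_def)
  qed
  ultimately have "Z = 0" by (simp add: ip_eq_0)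
  then have Sa: "S \<in> aa G" using S unfolding Z_def by (intro centralizer_H0_ss)
  have sub: "Ad G (inv m) X \<in> aa G" if X: "X \<in> aa G" for X
  proof (rule centralizer_H0_ss)
    show "Ad G (inv m) X \<in> ss G" using X aa_ss mK KK_closed(2) by (intro Ad_ss) auto
    have "H0 = Ad G (inv m) S" by (simp add: S_def)
    then show "br H0 (Ad G (inv m) X) = 0"
      using aa_abelian[OF Sa X] by (simp add: Ad_bracket[symmetric] linear_0[OF Ad_linear])
  qed
  have "Ad G m ` aa G = aa G"
  proof (rule aa_max)
    show "subspace (Ad G m ` aa G)" using Ad_linear aa_subspace by (rule linear_subspace_image)
    show "Ad G m ` aa G \<subseteq> ss G" using mK aa_ss by (auto intro: Ad_ss)
    show "\<forall>X\<in>Ad G m ` aa G. \<forall>Y\<in>Ad G m ` aa G. br X Y = 0"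
      by (auto simp: Ad_bracket[symmetric] aa_abelian linear_0[OF Ad_linear])
    show "aa G \<subseteq> Ad G m ` aa G"
    proof
      fix X assume "X \<in> aa G"
      then have "Ad G m (Ad G (inv m) X) \<in> Ad G m ` aa G" by (intro imageI sub)
      then show "X \<in> Ad G m ` aa G" by simp
    qed
  qed
  then have "m \<in> NKa" using mK by simp
  moreover have "inv c \<in> K_H G H" using cK KK_closed(2) Ad_inv(1)[of c H] by (simp add: K_H_iff)
  moreover have "k = inv c \<otimes> m" by (simp add: m_def)
  ultimately show ?thesis using that by blast
qed

text \<open>Every limit along \<open>t i \<rightarrow> \<infinity>\<close> of the subspaces \<open>Ad (exp (t i H)) V\<close> is invariant under \<open>ad H\<close>,
  because it contains the leading terms of the elements of \<open>V\<close>. Here \<open>L\<close> is the limit; the induction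
  splits off the largest eigenvalue.\<close>

lemma limit_subspace_invariant:
  fixes t :: "nat \<Rightarrow> real"
  assumes H: "H \<in> aa G" and t: "filterlim t at_top sequentially" and L: "subspace L"
    and lim: "\<And>X Z. (\<And>i. X i \<in> V) \<Longrightarrow> (\<lambda>i. Ad G (lie_exp G (t i *\<^sub>R H)) (X i)) \<longlonglongrightarrow> Z \<Longrightarrow> Z \<in> L"
    and \<Lambda>: "finite \<Lambda>" and V': "subspace V'" "V' \<subseteq> V" "V' \<subseteq> gr H (\<lambda>r. r \<in> \<Lambda>)"
    and X: "\<And>i. X i \<in> V'" "(\<lambda>i. Ad G (lie_exp G (t i *\<^sub>R H)) (X i)) \<longlonglongrightarrow> Z"
  shows "br H Z \<in> L"
  using \<Lambda> V' X
proof (induction \<Lambda> arbitrary: V' X Z rule: finite_linorder_max_induct)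
  case empty
  have "x = 0" if "x \<in> V'" for x
    using that empty.prems(3) nonzero_coord[of x] by (auto simp: gr_def)
  then have "X i = 0" for i using empty.prems(4) by blast
  then have "(\<lambda>i. 0) \<longlonglongrightarrow> Z" using empty.prems(5) by (simp add: linear_0[OF Ad_linear])
  then have "Z = 0" by (simp add: LIMSEQ_const_iff)
  then show ?case using subspace_0[OF L] by (simp add: bracket_simps)
next
  case (insert b A)
  let ?D = "\<lambda>i. Ad G (lie_exp G (t i *\<^sub>R H))"
  define pr where "pr Y = (\<Sum>e\<in>eb. (if wt e H = b then ip Y e else 0) *\<^sub>R e)" for Y
  have prc: "ip (pr Y) f = (if wt f H = b then ip Y f else 0)" if f: "f \<in> eb" for Y f
  proof -
    have "ip (pr Y) f = (\<Sum>e\<in>eb. if e = f then (if wt f H = b then ip Y f else 0) else 0)"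
      unfolding pr_def linear_sum[OF ip_linear(1)]
      by (rule sum.cong) (use eb(3,4) f in \<open>auto simp: ip_simps\<close>)
    then show ?thesis using f eb(1) by simp
  qed
  have prlin: "linear pr" by (rule linearI) (auto intro!: eb_eqI simp: prc ip_simps)
  have brpr: "br H (pr Y) = b *\<^sub>R pr Y" for Y
    by (rule eb_eqI) (simp add: ip_br_eb[OF _ H] prc ip_simps)
  \<comment> \<open>A linear, hence continuous, choice of elements of \<open>V'\<close> with
    prescribed leading term.\<close>
  obtain R where R: "\<And>y. R y \<in> V'" "linear R" "\<And>y. y \<in> pr ` V' \<Longrightarrow> pr (R y) = y"
    using linear_exists_right_inverse_on[OF prlin insert.prems(1)] by blast
  define y where "y i = pr (?D i (X i))" for i
  have yeq: "y i = exp (t i * b) *\<^sub>R pr (X i)" for i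
    by (rule eb_eqI) (simp add: y_def prc ip_Ad_exp_eb[OF H] ip_simps)
  have ymem: "y i \<in> pr ` V'" for i
  proof -
    have "y i = pr (exp (t i * b) *\<^sub>R X i)" by (simp add: yeq linear_scale[OF prlin])
    then show ?thesis using subspace_scale[OF insert.prems(1)] insert.prems(4) by blast
  qed
  have contpr: "bounded_linear pr" "bounded_linear R" using prlin R(2) linear_conv_bounded_linear by auto
  have ylim: "y \<longlonglongrightarrow> pr Z"
    unfolding y_def by (rule bounded_linear.tendsto[OF contpr(1) insert.prems(5)])
  have "closed (pr ` V')" by (intro closed_subspace linear_subspace_image prlin insert.prems(1))
  then have prZ: "pr Z \<in> pr ` V'" using ymem ylim by (rule closed_sequentially)
  have Rlim: "(\<lambda>i. R (y i)) \<longlonglongrightarrow> R (pr Z)" by (rule bounded_linear.tendsto[OF contpr(2) ylim])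
  \<comment> \<open>Rescaled so that the leading terms of \<open>X2 i\<close> and \<open>X i\<close>
    agree. The smaller eigenvalues of the lift decay relative to \<open>b\<close>, so
    \<open>X2\<close> realises \<open>pr Z\<close> as a limit and \<open>X - X2\<close> has no
    component for \<open>b\<close>.\<close>
  define X2 where "X2 i = exp (- (t i * b)) *\<^sub>R R (y i)" for i
  have X2V: "X2 i \<in> V'" for i unfolding X2_def by (intro subspace_scale insert.prems(1) R(1))
  have lim2: "(\<lambda>i. ?D i (X2 i)) \<longlonglongrightarrow> pr Z"
  proof (rule tendsto_eb)
    fix e assume e: "e \<in> eb"
    have c: "ip (?D i (X2 i)) e = exp (t i * (wt e H - b)) * ip (R (y i)) e" for i
      by (simp add: ip_Ad_exp_eb[OF H e] X2_def ip_simps algebra_simps flip: Transcendental.exp_add)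
    show "(\<lambda>i. ip (?D i (X2 i)) e) \<longlonglongrightarrow> ip (pr Z) e"
    proof (cases "wt e H = b")
      case True
      have "ip (pr (R (pr Z))) e = ip (R (pr Z)) e" using True by (simp add: prc e)
      then have "ip (pr Z) e = ip (R (pr Z)) e" by (simp add: R(3)[OF prZ])
      moreover have "(\<lambda>i. ip (R (y i)) e) \<longlonglongrightarrow> ip (R (pr Z)) e" by (intro tendsto_intros Rlim)
      ultimately show ?thesis unfolding c using True by simp
    next
      case False
      have 0: "ip (pr Z) e = 0" using False by (simp add: prc e)
      show ?thesis
      proof (cases "wt e H \<in> insert b A")
        case True
        then have neg: "wt e H - b < 0" using False insert.hyps(2) by auto
        have "((\<lambda>i. exp (t i * (wt e H - b))) \<longlongrightarrow> 0) sequentially"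
        proof (rule filterlim_compose[OF exp_at_bot])
          show "LIM i sequentially. t i * (wt e H - b) :> at_bot"
            using filterlim_tendsto_neg_mult_at_bot[OF tendsto_const neg t] by (simp add: mult.commute)
        qed
        then have "(\<lambda>i. exp (t i * (wt e H - b)) * ip (R (y i)) e) \<longlonglongrightarrow> 0 * ip (R (pr Z)) e"
          by (intro tendsto_intros Rlim)
        then show ?thesis unfolding c 0 by simp
      next
        case False
        then have "ip (R (y i)) e = 0" for i using R(1)[of "y i"] insert.prems(3) e by (auto simp: gr_def)
        then show ?thesis unfolding c 0 by simp
      qed
    qed
  qed
  have "pr Z \<in> L" by (rule lim[OF _ lim2]) (use X2V insert.prems(2) in blast)
  then have 1: "br H (pr Z) \<in> L" unfolding brpr by (rule subspace_scale[OF L])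
  have 2: "br H (Z - pr Z) \<in> L"
  proof (rule insert.IH)
    show "subspace (V' \<inter> {Y. pr Y = 0})"
      using insert.prems(1) by (intro subspace_inter linear_subspace_kernel prlin)
    show "V' \<inter> {Y. pr Y = 0} \<subseteq> V" using insert.prems(2) by blast
    show "V' \<inter> {Y. pr Y = 0} \<subseteq> gr H (\<lambda>r. r \<in> A)"
    proof
      fix Y assume Y: "Y \<in> V' \<inter> {Y. pr Y = 0}"
      have "wt e H \<in> A" if "e \<in> eb" "ip Y e \<noteq> 0" for e
      proof -
        have "wt e H \<in> insert b A" using Y insert.prems(3) that by (auto simp: gr_def)
        moreover have "wt e H \<noteq> b" using prc[OF that(1), of Y] Y that(2) by (auto simp: ip_simps)
        ultimately show ?thesis by simp
      qed
      then show "Y \<in> gr H (\<lambda>r. r \<in> A)" by (simp add: gr_def)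
    qed
    show "X i - X2 i \<in> V' \<inter> {Y. pr Y = 0}" for i
    proof -
      have "pr (X2 i) = exp (- (t i * b)) *\<^sub>R y i" by (simp add: X2_def linear_scale[OF prlin] R(3)[OF ymem])
      then have "pr (X2 i) = pr (X i)" by (simp add: yeq flip: Transcendental.exp_add)
      then show ?thesis using insert.prems(1,4) X2V by (simp add: subspace_diff linear_diff[OF prlin])
    qed
    show "(\<lambda>i. ?D i (X i - X2 i)) \<longlonglongrightarrow> Z - pr Z"
      unfolding linear_diff[OF Ad_linear] by (intro tendsto_diff insert.prems(5) lim2)
  qed
  have "br H (pr Z) + br H (Z - pr Z) = br H Z" by (simp add: bracket_simps)
  then show ?case using subspace_add[OF L 1 2] by simp
qed

end

lemma mexp_continuous:
  fixes b :: "'a::euclidean_space \<Rightarrow> 'a \<Rightarrow> 'a"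
  assumes b: "bilinear b"
  shows "continuous_on UNIV (\<lambda>T. mexp (b T) Y)"
proof (rule continuous_at_imp_continuous_on, rule ballI)
  fix T0 :: 'a
  obtain K where K: "0 < K" "\<And>S X. norm (b S X) \<le> K * norm S * norm X"
    using bilinear_bounded_pos[OF b] by blast
  define M where "M = K * (norm T0 + 1)"
  have lin: "linear (b T)" "linear (\<lambda>T. b T X)" for T X using b by (auto simp: bilinear_def)
  have bd: "norm (b T X) \<le> M * norm X" if T: "T \<in> ball T0 1" for T X
  proof -
    have "norm T \<le> norm T0 + 1"
      using T norm_triangle_ineq2[of T T0] by (simp add: dist_norm norm_minus_commute)
    then have "K * norm T * norm X \<le> M * norm X"
      unfolding M_def using K(1) by (intro mult_right_mono mult_left_mono) auto
    with K(2)[of T X] show ?thesis by linarith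
  qed
  have M0: "0 \<le> M" unfolding M_def using K(1) by simp
  have "norm (mexp (b S) Y - mexp (b T) Y) \<le> (exp M * norm Y * K) * norm (S - T)"
    if "S \<in> ball T0 1" "T \<in> ball T0 1" for S T
  proof -
    have "norm (b S X - b T X) \<le> (K * norm (S - T)) * norm X" for X
      using K(2)[of "S - T" X] by (simp add: linear_diff[OF lin(2)])
    from mexp_lipschitz[OF lin(1) bd[OF that(1)] M0 lin(1) bd[OF that(2)] this]
    show ?thesis by (simp add: mult_ac)
  qed
  then have "continuous_on (ball T0 1) (\<lambda>T. mexp (b T) Y)"
    using K(1) by (intro lipschitz_on_continuous_on[of "exp M * norm Y * K"] lipschitz_onI) (auto simp: dist_norm)
  then show "isCont (\<lambda>T. mexp (b T) Y) T0" by (simp add: continuous_on_eq_continuous_at)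
qed

context cartan_grp
begin

lemma KAN_mp: obtains k p where "k \<in> KK G" "p \<in> min_parabolic G" "g = k \<otimes> p"
proof -
  obtain k L Y where "k \<in> KK G" "L \<in> aa G" "Y \<in> nn G" "g = k \<otimes> lie_exp G L \<otimes> lie_exp G Y" by (rule KAN)
  then show ?thesis
    using that[of k "lie_exp G L \<otimes> lie_exp G Y"] mp_mult exp_mp aa_pp nn_pp by (simp add: m_assoc)
qed

text \<open>Bruhat decomposition relative to \<open>H\<close>. A limit \<open>Ad k pp\<close> of \<open>Ad (exp (t H) g) pp\<close> is \<open>ad H\<close>-invariant, so it
  contains \<open>H\<close>, because \<open>pp\<close> is self-normalizing. Hence \<open>Ad g pp\<close> meets \<open>H\<close> + (negative eigenspaces), which
  is the orbit of \<open>H\<close> under \<open>N_H\<^sup>-\<close>.\<close>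

lemma bruhat:
  assumes H: "H \<in> aa G"
  obtains Z c m p where "Z \<in> gr H (\<lambda>r. r < 0)" "c \<in> K_H G H" "m \<in> NKa" "p \<in> min_parabolic G"
    "g = lie_exp G Z \<otimes> c \<otimes> m \<otimes> p"
proof -
  define V where "V = Ad G g ` pp"
  have V: "subspace V" unfolding V_def using Ad_linear pp_subspace by (rule linear_subspace_image)
  define h where "h i = lie_exp G (real i *\<^sub>R H)" for i
  have "\<exists>k p. k \<in> KK G \<and> p \<in> min_parabolic G \<and> h i \<otimes> g = k \<otimes> p" for i
    by (rule KAN_mp[of "h i \<otimes> g"]) blast
  then obtain k p where kp: "\<And>i. k i \<in> KK G" "\<And>i. p i \<in> min_parabolic G" "\<And>i. h i \<otimes> g = k i \<otimes> p i"
    by metis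
  obtain k0 r where r: "k0 \<in> KK G" "strict_mono r" "(k \<circ> r) \<longlonglongrightarrow> k0"
    using compact_imp_seq_compact[OF KK_compact] kp(1) unfolding seq_compact_def by metis
  have kr: "(\<lambda>i. k (r i)) \<longlonglongrightarrow> k0" using r(3) by (simp add: o_def)
  \<comment> \<open>Because \<open>G = K P\<close>, every translate of \<open>V\<close> is
    \<open>Ad k pp\<close> with \<open>k\<close> compact; compactness of \<open>K\<close> therefore
    yields the limit subspace, with no topology on the set of subspaces.\<close>
  have hV: "Ad G (h i) ` V = Ad G (k i) ` pp" for i
  proof -
    have "Ad G (h i) ` V = Ad G (k i) ` Ad G (p i) ` pp"
      unfolding V_def image_image Ad_mult[symmetric] kp(3) ..
    then show ?thesis using kp(2)[of i] by (simp add: min_parabolic_iff)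
  qed
  define L where "L = Ad G k0 ` pp"
  have L: "subspace L" unfolding L_def using Ad_linear pp_subspace by (rule linear_subspace_image)
  define t where "t i = real (r i)" for i
  have t: "filterlim t at_top sequentially"
    unfolding t_def by (rule filterlim_compose[OF filterlim_real_sequentially filterlim_subseq[OF r(2)]])
  have ht: "lie_exp G (t i *\<^sub>R H) = h (r i)" for i by (simp add: h_def t_def)
  have lim: "Z \<in> L" if X: "\<And>i. X i \<in> V" and Z: "(\<lambda>i. Ad G (lie_exp G (t i *\<^sub>R H)) (X i)) \<longlonglongrightarrow> Z" for X Z
  proof -
    have mem: "Ad G (inv (k (r i))) (Ad G (h (r i)) (X i)) \<in> pp" for i
    proof -
      have "Ad G (h (r i)) (X i) \<in> Ad G (k (r i)) ` pp" using hV[of "r i"] X[of i] by blast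
      then show ?thesis by force
    qed
    have "(\<lambda>i. Ad G (inv (k (r i))) (Ad G (h (r i)) (X i))) \<longlonglongrightarrow> Ad G (inv k0) Z"
      using Z unfolding ht by (intro tendsto_intros kr)
    with closed_subspace[OF pp_subspace] mem have "Ad G (inv k0) Z \<in> pp" by (rule closed_sequentially)
    then have "Ad G k0 (Ad G (inv k0) Z) \<in> L" unfolding L_def by (rule imageI)
    then show ?thesis by simp
  qed
  have approx: "\<exists>X. (\<forall>i. X i \<in> V) \<and> (\<lambda>i. Ad G (lie_exp G (t i *\<^sub>R H)) (X i)) \<longlonglongrightarrow> Z" if Z: "Z \<in> L" for Z
  proof -
    obtain P where P: "P \<in> pp" "Z = Ad G k0 P" using Z by (auto simp: L_def)
    have "\<exists>X\<in>V. Ad G (h (r i)) X = Ad G (k (r i)) P" for i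
      using hV[of "r i"] P(1) by (metis imageE imageI)
    then obtain X where X: "\<And>i. X i \<in> V" "\<And>i. Ad G (h (r i)) (X i) = Ad G (k (r i)) P" by metis
    have "(\<lambda>i. Ad G (h (r i)) (X i)) \<longlonglongrightarrow> Z"
      unfolding X(2) P(2) by (intro tendsto_intros kr)
    then show ?thesis using X(1) unfolding ht by blast
  qed
  have inv: "br H Z \<in> L" if Z: "Z \<in> L" for Z
  proof -
    obtain X where X: "\<And>i. X i \<in> V" "(\<lambda>i. Ad G (lie_exp G (t i *\<^sub>R H)) (X i)) \<longlonglongrightarrow> Z"
      using approx[OF Z] by blast
    show ?thesis
    proof (rule limit_subspace_invariant[OF H t L lim _ V subset_refl _ X])
      show "V \<subseteq> gr H (\<lambda>r. r \<in> (\<lambda>e. wt e H) ` eb)" by (auto simp: gr_def)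
      show "finite ((\<lambda>e. wt e H) ` eb)" using eb(1) by simp
    qed
  qed
  have "Ad G (inv k0) H \<in> pp"
  proof (rule pp_self_normalizing)
    fix Y assume "Y \<in> pp"
    then have "br H (Ad G k0 Y) \<in> Ad G k0 ` pp" using inv unfolding L_def by blast
    then have "Ad G (inv k0) (br H (Ad G k0 Y)) \<in> pp" by force
    then show "br (Ad G (inv k0) H) Y \<in> pp" by (simp add: Ad_bracket)
  qed
  then have "Ad G k0 (Ad G (inv k0) H) \<in> L" unfolding L_def by (rule imageI)
  then have "H \<in> L" by simp
  then obtain X where X: "\<And>i. X i \<in> V" "(\<lambda>i. Ad G (lie_exp G (t i *\<^sub>R H)) (X i)) \<longlonglongrightarrow> H"
    using approx by blast
  define \<pi> where "\<pi> X = (\<Sum>e\<in>eb. (if 0 \<le> wt e H then ip X e else 0) *\<^sub>R e)" for X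
  have \<pi>c: "ip (\<pi> X) f = (if 0 \<le> wt f H then ip X f else 0)" if f: "f \<in> eb" for X f
  proof -
    have "ip (\<pi> X) f = (\<Sum>e\<in>eb. if e = f then (if 0 \<le> wt f H then ip X f else 0) else 0)"
      unfolding \<pi>_def linear_sum[OF ip_linear(1)]
      by (rule sum.cong) (use eb(3,4) f in \<open>auto simp: ip_simps\<close>)
    then show ?thesis using f eb(1) by simp
  qed
  have \<pi>lin: "linear \<pi>" by (rule linearI) (auto intro!: eb_eqI simp: \<pi>c ip_simps)
  have Hc: "ip H e = 0" if "e \<in> eb" "wt e H \<noteq> 0" for e
    using aa_gr_0[OF H H, of "\<lambda>r. r = 0"] that by (auto simp: gr_def)
  have "(\<lambda>i. \<pi> (X i)) \<longlonglongrightarrow> H"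
  proof (rule tendsto_eb)
    fix e assume e: "e \<in> eb"
    have l: "(\<lambda>i. exp (t i * wt e H) * ip (X i) e) \<longlonglongrightarrow> ip H e"
      using tendsto_ip[OF X(2) tendsto_const, of e] by (simp add: ip_Ad_exp_eb[OF H e])
    show "(\<lambda>i. ip (\<pi> (X i)) e) \<longlonglongrightarrow> ip H e"
    proof (cases "wt e H" "0::real" rule: linorder_cases)
      case less
      then show ?thesis using Hc[OF e] by (simp add: \<pi>c[OF e])
    next
      case equal
      then show ?thesis using l by (simp add: \<pi>c[OF e])
    next
      case greater
      have "norm (ip (\<pi> (X i)) e) \<le> \<bar>exp (t i * wt e H) * ip (X i) e\<bar>" for i
      proof -
        have "0 \<le> t i * wt e H" using greater by (simp add: t_def)
        then have "1 * \<bar>ip (X i) e\<bar> \<le> exp (t i * wt e H) * \<bar>ip (X i) e\<bar>"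
          by (intro mult_right_mono) auto
        then show ?thesis using greater by (simp add: \<pi>c[OF e] abs_mult)
      qed
      moreover have "ip H e = 0" using Hc[OF e] greater by simp
      then have "(\<lambda>i. \<bar>exp (t i * wt e H) * ip (X i) e\<bar>) \<longlonglongrightarrow> 0"
        using tendsto_rabs[OF l] by simp
      ultimately have "(\<lambda>i. ip (\<pi> (X i)) e) \<longlonglongrightarrow> 0"
        by (rule Lim_null_comparison[OF always_eventually[OF allI]])
      then show ?thesis using Hc[OF e] greater by simp
    qed
  qed
  moreover have "closed (\<pi> ` V)" by (intro closed_subspace linear_subspace_image \<pi>lin V)
  ultimately have "H \<in> \<pi> ` V" using X(1) by (metis closed_sequentially imageI)
  then obtain X1 where X1: "X1 \<in> V" "\<pi> X1 = H" by blast
  have "X1 - H \<in> gr H (\<lambda>r. r < 0)"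
    unfolding gr_def
  proof (intro CollectI ballI impI)
    fix e assume e: "e \<in> eb" "ip (X1 - H) e \<noteq> 0"
    show "wt e H < 0" using \<pi>c[OF e(1), of X1] e(2) X1(2) by (auto simp: ip_simps split: if_splits)
  qed
  from orbit_onto[OF H this] obtain Z where Z: "Z \<in> gr H (\<lambda>r. r < 0)" "Ad G (lie_exp G Z) H = X1"
    by auto
  obtain k' p' where kp': "k' \<in> KK G" "p' \<in> min_parabolic G" "inv (lie_exp G Z) \<otimes> g = k' \<otimes> p'"
    by (rule KAN_mp)
  \<comment> \<open>After removal of the unipotent factor, \<open>H\<close> lies in
    \<open>Ad k' pp\<close>. Then \<open>H1\<close> lies in \<open>pp\<close> and in
    \<open>ss G\<close>, hence in \<open>aa G\<close>, which is the input of
    \<open>K_H_decomposition\<close>.\<close>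
  define H1 where "H1 = Ad G (inv k') H"
  have "H1 \<in> pp"
  proof -
    obtain Y where Y: "Y \<in> pp" "X1 = Ad G g Y" using X1(1) by (auto simp: V_def)
    have "H = Ad G (inv (lie_exp G Z) \<otimes> g) Y" unfolding Ad_mult Y(2)[symmetric] Z(2)[symmetric] by simp
    then have "H1 = Ad G p' Y" unfolding kp'(3) H1_def by (simp add: Ad_mult)
    then show ?thesis using kp'(2) Y(1) by (simp add: mp_iff)
  qed
  moreover have "H1 \<in> ss G" unfolding H1_def using H aa_ss kp'(1) KK_closed(2) by (intro Ad_ss) auto
  ultimately have "H1 \<in> aa G" by (rule pp_ss)
  moreover have "Ad G k' H1 = H" by (simp add: H1_def)
  ultimately obtain c m where cm: "c \<in> K_H G H" "m \<in> NKa" "k' = c \<otimes> m"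
    by (rule K_H_decomposition[OF H kp'(1)])
  have "g = lie_exp G Z \<otimes> (inv (lie_exp G Z) \<otimes> g)" by simp
  also have "\<dots> = lie_exp G Z \<otimes> c \<otimes> m \<otimes> p'" unfolding kp'(3) cm(3) by (simp add: m_assoc)
  finally show ?thesis using that Z(1) cm(1,2) kp'(2) by blast
qed

lemma root_Ad:
  assumes k: "k \<in> NKa" and a: "\<alpha> \<in> roots G"
  obtains \<beta> where "\<beta> \<in> roots G" "\<And>X. X \<in> aa G \<Longrightarrow> \<beta> X = \<alpha> (Ad G k X)"
proof -
  define \<beta> where "\<beta> X = (if X \<in> aa G then \<alpha> (Ad G k X) else 0)" for X
  have d: "\<beta> \<in> aa_dual G"
    using root_linear[OF a] NKa_Ad[OF k]
    by (auto simp: aa_dual_def \<beta>_def subspace_add[OF aa_subspace] subspace_scale[OF aa_subspace]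
        linear_add[OF Ad_linear] linear_scale[OF Ad_linear])
  obtain X where X: "X \<in> root_space G \<alpha>" "X \<noteq> 0" using root_vector[OF a] by blast
  have "br H (Ad G (inv k) X) = \<beta> H *\<^sub>R Ad G (inv k) X" if H: "H \<in> aa G" for H
  proof -
    have "br H (Ad G (inv k) X) = Ad G (inv k) (br (Ad G k H) X)" by (simp add: Ad_bracket)
    also have "br (Ad G k H) X = \<alpha> (Ad G k H) *\<^sub>R X" using X(1) NKa_Ad[OF k H] by (simp add: root_space_def)
    finally show ?thesis using H by (simp add: \<beta>_def linear_scale[OF Ad_linear])
  qed
  then have rs: "Ad G (inv k) X \<in> root_space G \<beta>" by (simp add: root_space_def)
  have "Ad G (inv k) X \<noteq> 0" using X(2) Ad_inv(2)[of k X] linear_0[OF Ad_linear] by metis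
  moreover have "\<beta> \<noteq> (\<lambda>_. 0)"
  proof
    assume z: "\<beta> = (\<lambda>_. 0)"
    have "\<alpha> Y = 0" for Y
    proof (cases "Y \<in> aa G")
      case True
      have "\<alpha> (Ad G k (Ad G (inv k) Y)) = \<beta> (Ad G (inv k) Y)"
        using NKa_Ad[OF NKa_closed(2)[OF k] True] by (simp add: \<beta>_def)
      then show ?thesis using z by simp
    qed (rule root_linear(3)[OF a])
    then show False using a by (auto simp: roots_def)
  qed
  ultimately have "\<beta> \<in> roots G" using d rs by (auto simp: roots_def)
  then show ?thesis using that by (simp add: \<beta>_def)
qed

lemma wt_zero_central:
  assumes C0: "C0 \<in> aa G" and z: "\<And>\<alpha>. \<alpha> \<in> roots G \<Longrightarrow> \<alpha> C0 = 0"
  shows "br X C0 = 0"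
proof -
  have "br C0 X = 0"
  proof (rule eb_eqI)
    fix e assume e: "e \<in> eb"
    have "wt e C0 = 0" using z[of "wt e"] wt_root[OF e] by (cases "wt e = (\<lambda>_. 0)") auto
    then show "ip (br C0 X) e = ip 0 e" by (simp add: ip_br_eb[OF e C0] ip_simps)
  qed
  then show ?thesis using bracket_antisym[of X C0] by simp
qed

text \<open>Roots take only the finitely many values \<open>\<beta> H\<close> on the orbit, but
  because of a possible centre they need not separate points of \<open>aa G\<close>.\<close>

lemma finite_orbit: assumes H: "H \<in> aa G" shows "finite {Ad G k H | k. k \<in> NKa}"
proof -
  let ?F = "\<lambda>X. restrict (\<lambda>\<alpha>. \<alpha> X) (roots G)"
  have "inj_on ?F {Ad G k H | k. k \<in> NKa}"
  proof (rule inj_onI, clarify)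
    fix k k' assume k: "k \<in> KK G" "Ad G k ` aa G = aa G" and k': "k' \<in> KK G" "Ad G k' ` aa G = aa G"
      and eq: "?F (Ad G k H) = ?F (Ad G k' H)"
    define C0 where "C0 = Ad G k H - Ad G k' H"
    have C0: "C0 \<in> aa G" unfolding C0_def using k k' H by (intro subspace_diff aa_subspace) auto
    have aH: "Ad G k H \<in> aa G" "Ad G k' H \<in> aa G" using k k' H by auto
    have "\<alpha> C0 = 0" if a: "\<alpha> \<in> roots G" for \<alpha>
    proof -
      have "\<alpha> (Ad G k H) = \<alpha> (Ad G k' H)" using fun_cong[OF eq, of \<alpha>] a by simp
      moreover have "\<alpha> (C0 + Ad G k' H) = \<alpha> C0 + \<alpha> (Ad G k' H)" by (rule root_linear(1)[OF a C0 aH(2)])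
      ultimately show ?thesis by (simp add: C0_def)
    qed
    \<comment> \<open>Two orbit points with the same root values differ by a central
      \<open>C0\<close>. It is fixed by \<open>K\<close>, so both points have the same inner product
      with \<open>C0\<close>, and \<open>C0\<close> is orthogonal to itself.\<close>
    then have c: "br X C0 = 0" for X by (rule wt_zero_central[OF C0])
    have fx: "Ad G h C0 = C0" if hK: "h \<in> KK G" for h
    proof -
      obtain T where T: "h = lie_exp G T" using hK by (rule KK_exp) blast
      show ?thesis unfolding T Ad_exp_mexp by (rule mexp_kernel[OF bracket_linear_right c])
    qed
    have "ip (Ad G h H) C0 = ip H C0" if "h \<in> KK G" for h
      using Ad_ip[OF that, of H C0] unfolding fx[OF that] .
    then have "ip (Ad G k H) C0 - ip (Ad G k' H) C0 = 0" using k(1) k'(1) by simp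
    then have "ip C0 C0 = 0" by (metis C0_def ip_simps(3))
    then show "Ad G k H = Ad G k' H" by (simp add: ip_eq_0 C0_def)
  qed
  moreover have "?F ` {Ad G k H | k. k \<in> NKa} \<subseteq> (roots G) \<rightarrow>\<^sub>E ((\<lambda>\<beta>. \<beta> H) ` roots G)"
  proof clarify
    fix k assume k: "k \<in> KK G" "Ad G k ` aa G = aa G"
    show "?F (Ad G k H) \<in> (roots G) \<rightarrow>\<^sub>E ((\<lambda>\<beta>. \<beta> H) ` roots G)"
    proof (rule restrict_PiE_iff[THEN iffD2], rule ballI)
      fix \<alpha> assume "\<alpha> \<in> roots G"
      then obtain \<beta> where "\<beta> \<in> roots G" "\<And>X. X \<in> aa G \<Longrightarrow> \<beta> X = \<alpha> (Ad G k X)"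
        using root_Ad[of k \<alpha>] k by blast
      then show "\<alpha> (Ad G k H) \<in> (\<lambda>\<beta>. \<beta> H) ` roots G" using H by (metis imageI)
    qed
  qed
  then have "finite (?F ` {Ad G k H | k. k \<in> NKa})"
    by (rule finite_subset) (intro finite_PiE finite_imageI finite_roots)
  ultimately show ?thesis using finite_imageD by blast
qed

end

section \<open>Weyl group\<close>

text \<open>The exponential of a derivation is an automorphism: along \<open>t\<close> the
  right-hand side solves the linear equation of the left-hand side.\<close>

lemma mexp_derivation:
  fixes b :: "'a::euclidean_space \<Rightarrow> 'a \<Rightarrow> 'a"
  assumes b: "bilinear b" and A: "linear A" and d: "\<And>x y. A (b x y) = b (A x) y + b x (A y)"
  shows "mexp A (b x y) = b (mexp A x) (mexp A y)"
proof -
  define c where "c t = b (mexp (\<lambda>y. t *\<^sub>R A y) x) (mexp (\<lambda>y. t *\<^sub>R A y) y)" for t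
  have "(c has_vector_derivative A (c t)) (at t)" for t
    unfolding c_def[abs_def] d
    using bounded_bilinear.has_vector_derivative[OF b[unfolded bilinear_conv_bounded_bilinear]
        mexp_has_vector_derivative[OF A, of x t UNIV] mexp_has_vector_derivative[OF A, of y t UNIV]]
    by (simp add: add.commute)
  from linear_ode_unique[OF A this, of 1] show ?thesis by (simp add: c_def mexp_zero[OF A, simplified])
qed

text \<open>The inner product of the two moving vectors has derivative 0 by skewness.\<close>

lemma (in inner_form) mexp_isometry:
  assumes A: "linear A" and skew: "\<And>x y. ip (A x) y = - ip x (A y)"
  shows "ip (mexp A x) (mexp A y) = ip x y"
proof -
  define c where "c t = ip (mexp (\<lambda>y. t *\<^sub>R A y) x) (mexp (\<lambda>y. t *\<^sub>R A y) y)" for t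
  have "(c has_vector_derivative 0) (at t within UNIV)" for t
    unfolding c_def[abs_def]
    using bounded_bilinear.has_vector_derivative[OF bounded_bilinear_ip
        mexp_has_vector_derivative[OF A, of x t UNIV] mexp_has_vector_derivative[OF A, of y t UNIV]]
    by (simp add: skew)
  then have "c 1 = c 0"
    using has_vector_derivative_zero_constant[of UNIV c] by (metis UNIV_I convex_UNIV)
  then show ?thesis by (simp add: c_def mexp_zero[OF A, simplified])
qed

context cartan_grp
begin

text \<open>The bracket of the compact dual \<open>\<kk> \<oplus> i\<ss>\<close>, carried by the vector space \<open>\<gg>\<close>: here every
  inner derivation is skew for \<open>ip\<close>.\<close>

definition tb :: "'l \<Rightarrow> 'l \<Rightarrow> 'l" where
  "tb X Y = (1/2) *\<^sub>R (br X Y + br (theta X) Y + br X (theta Y) - br (theta X) (theta Y))"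

lemmas theta_simps = linear_add[OF theta_linear] linear_diff[OF theta_linear]
  linear_scale[OF theta_linear] linear_0[OF theta_linear] linear_neg[OF theta_linear]

lemma tb_bilinear: "bilinear tb"
  unfolding bilinear_def tb_def
  by (auto intro!: linearI simp: theta_simps bracket_simps algebra_simps)

lemmas tb_linear = tb_bilinear[unfolded bilinear_def, THEN conjunct1, rule_format]
  tb_bilinear[unfolded bilinear_def, THEN conjunct2, rule_format]

lemma tb_kk: "T \<in> kk G \<Longrightarrow> tb T Y = br T Y"
  by (simp add: tb_def theta_kk flip: scaleR_2)

text \<open>For \<open>Y\<close> in \<open>ss G\<close> this is minus the original bracket, the sign
  coming from the square of \<open>i\<close> in the compact dual.\<close>

lemma tb_ss: "S \<in> ss G \<Longrightarrow> tb S Y = br S (theta Y)"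
  by (simp add: tb_def theta_ss bracket_simps flip: scaleR_2)

lemma tb_antisym: "tb X Y = - tb Y X"
  unfolding tb_def bracket_antisym[of Y X] bracket_antisym[of "theta Y" X] bracket_antisym[of Y "theta X"]
    bracket_antisym[of "theta Y" "theta X"]
  by (simp add: algebra_simps flip: scaleR_minus_right)

lemma tb_jacobi: "tb X (tb Y Z) = tb (tb X Y) Z + tb Y (tb X Z)"
proof -
  have j: "br X' (br Y' Z') = br (br X' Y') Z' + br Y' (br X' Z')" for X' Y' Z' by (rule jacobi)
  show ?thesis
    unfolding tb_def
    by (simp only: theta_simps theta_br theta_theta bracket_simps scaleR_add_right scaleR_diff_right
        j[of X Y] j[of "theta X" Y] j[of X "theta Y"] j[of "theta X" "theta Y"])
       (simp add: algebra_simps)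
qed

lemma ip_theta: "ip (theta X) Y = ip X (theta Y)"
  by (metis ip_commute ip_def theta_theta B_sym)

lemma tb_skew: "ip (tb X Y) Z = - ip Y (tb X Z)"
proof -
  have "ip (br X (theta Y)) Z = - ip Y (br X (theta Z))" "ip (br (theta X) Y) Z = - ip Y (br X Z)"
    "ip (br (theta X) (theta Y)) Z = - ip Y (br (theta X) (theta Z))"
    by (simp_all add: ip_br ip_theta theta_br)
  then show ?thesis unfolding tb_def ip_simps ip_br[of X Y] real_scaleR_def by argo
qed

lemma tb_self: "tb X X = 0"
  using tb_antisym[of X X] by (simp add: eq_neg_iff_add_eq_0 flip: scaleR_2)

lemma tb_mexp: "mexp (tb X) (tb Y Z) = tb (mexp (tb X) Y) (mexp (tb X) Z)"
  by (rule mexp_derivation[OF tb_bilinear tb_linear(1)]) (rule tb_jacobi)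

lemma regular_commute:
  assumes H1: "H1 \<in> aa G" "\<And>\<alpha>. \<alpha> \<in> roots G \<Longrightarrow> \<alpha> H1 \<noteq> 0" and Z: "br H1 Z = 0" and H: "H \<in> aa G"
  shows "br H Z = 0"
proof (rule eb_eqI)
  fix e assume e: "e \<in> eb"
  have "wt e H1 * ip Z e = 0" using ip_br_eb[OF e H1(1), of Z] Z by (simp add: ip_simps)
  then have "ip Z e = 0 \<or> wt e = (\<lambda>_. 0)" using H1(2) wt_root[OF e] by auto
  then show "ip (br H Z) e = ip 0 e" by (auto simp: ip_br_eb[OF e H] ip_simps)
qed

text \<open>In the compact dual, \<open>Ad k\<close> is the exponential of some inner derivation \<open>tb T'\<close>; among those \<open>T'\<close>
  of fixed length one that maximises \<open>\<langle>T', H1\<rangle>\<close> commutes with \<open>H1\<close>.\<close>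

lemma regular_centralizer:
  assumes k: "k \<in> KK G" and H1: "H1 \<in> aa G" "\<And>\<alpha>. \<alpha> \<in> roots G \<Longrightarrow> \<alpha> H1 \<noteq> 0"
    and fixed: "Ad G k H1 = H1" and H: "H \<in> aa G"
  shows "Ad G k H = H"
proof -
  obtain T where T: "T \<in> kk G" "k = lie_exp G T" using k by (rule KK_exp)
  define E where "E = Ad G k"
  have "tb T = br T" using tb_kk[OF T(1)] by blast
  then have ET: "E = mexp (tb T)" unfolding E_def T(2) Ad_exp_mexp[abs_def] by simp
  have Elin: "linear E" unfolding E_def by (rule Ad_linear)
  have Etb: "E (tb Y Z) = tb (E Y) (E Z)" for Y Z unfolding ET by (rule tb_mexp)
  \<comment> \<open>The logarithms of \<open>Ad k\<close> in the compact dual that have the length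
    of \<open>T\<close>. Continuity of the exponential makes the set closed and the fixed length
    makes it bounded, so a maximiser exists.\<close>
  define M where "M = {T'. ip T' T' = ip T T \<and> (\<forall>Y. mexp (tb T') Y = E Y)}"
  have "M = {T'. ip T' T' = ip T T} \<inter> (\<Inter>Y. {T'. mexp (tb T') Y = E Y})"
    unfolding M_def by blast
  then have "closed M"
    by (auto intro!: closed_Int closed_INT closed_Collect_eq continuous_intros mexp_continuous[OF tb_bilinear])
  moreover have "bounded M"
  proof -
    obtain c where c: "0 < c" "\<And>x. c * (norm x)\<^sup>2 \<le> ip x x" by (rule ip_norm_bound) blast
    have "norm T' \<le> sqrt (ip T T / c)" if "T' \<in> M" for T'
    proof (rule real_le_rsqrt)
      show "(norm T')\<^sup>2 \<le> ip T T / c"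
        using c(2)[of T'] that c(1) by (simp add: M_def pos_le_divide_eq mult.commute)
    qed
    then show ?thesis by (auto simp: bounded_iff)
  qed
  ultimately have "compact M" by (simp add: compact_eq_bounded_closed)
  moreover have "T \<in> M" by (simp add: M_def ET)
  then have "M \<noteq> {}" by blast
  moreover have "continuous_on M (\<lambda>T'. ip T' H1)" by (intro continuous_intros)
  ultimately obtain T' where T': "T' \<in> M" "\<And>T''. T'' \<in> M \<Longrightarrow> ip T'' H1 \<le> ip T' H1"
    using continuous_attains_sup by metis
  have ET': "mexp (tb T') Y = E Y" for Y using T'(1) by (simp add: M_def)
  define X where "X = tb T' H1"
  have "E T' = T'" using ET'[of T'] mexp_kernel[OF tb_linear(1) tb_self, of T'] by simp
  then have EX: "E X = X" unfolding X_def Etb using fixed by (simp add: E_def)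
  \<comment> \<open>\<open>X\<close> is fixed by \<open>E\<close>, because
    \<open>E = mexp (tb T')\<close> fixes \<open>T'\<close> and \<open>E\<close> fixes
    \<open>H1\<close>. Hence the rotations \<open>c s\<close> commute with \<open>E\<close> and keep
    \<open>M\<close> invariant, and the derivative of the maximised function along them is
    \<open>ip X X\<close>.\<close>
  define c where "c s = mexp (\<lambda>Y. s *\<^sub>R tb X Y)" for s :: real
  have ctb: "c s = mexp (tb (s *\<^sub>R X))" for s
  proof -
    have "tb (s *\<^sub>R X) = (\<lambda>Y. s *\<^sub>R tb X Y)" by (rule ext) (rule linear_scale[OF tb_linear(2)])
    then show ?thesis by (simp add: c_def)
  qed
  have cE: "E (c s Y) = c s (E Y)" for s Y
    unfolding ctb
    by (rule mexp_conj[OF tb_linear(1) Elin]) (simp add: Etb EX linear_scale[OF Elin])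
  have cM: "c s T' \<in> M" for s
  proof -
    have "ip (c s T') (c s T') = ip T' T'"
      unfolding ctb by (rule mexp_isometry[OF tb_linear(1) tb_skew])
    moreover have "mexp (tb (c s T')) Y = E Y" for Y
    proof -
      define Y' where "Y' = c (- s) Y"
      have Y: "Y = c s Y'"
        unfolding Y'_def c_def
        using mexp_add[OF tb_linear(1), of s "- s" X Y] mexp_zero[OF tb_linear(1), of X Y] by simp
      have "c s (mexp (tb T') Y') = mexp (tb (c s T')) (c s Y')"
      proof (rule mexp_conj[OF tb_linear(1)])
        show "linear (c s)" unfolding ctb by (rule linear_mexp[OF tb_linear(1)])
        show "c s (tb T' x) = tb (c s T') (c s x)" for x unfolding ctb by (rule tb_mexp)
      qed
      then show ?thesis unfolding ET' Y cE by simp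
    qed
    ultimately show ?thesis using T'(1) by (simp add: M_def)
  qed
  define f where "f s = ip (c s T') H1" for s
  have "(f has_vector_derivative ip (tb X (c 0 T')) H1 ) (at 0)"
    unfolding f_def[abs_def] c_def
    using bounded_bilinear.has_vector_derivative[OF bounded_bilinear_ip
        mexp_has_vector_derivative[OF tb_linear(1), of X T' 0 UNIV] has_vector_derivative_const[of H1]]
    by (simp add: ip_simps)
  moreover have c0: "c 0 Y = Y" for Y unfolding c_def by (rule mexp_zero[OF tb_linear(1)])
  ultimately have "DERIV f 0 :> ip (tb X T') H1"
    by (simp add: has_real_derivative_iff_has_vector_derivative)
  moreover have "f s \<le> f 0" for s using T'(2)[OF cM] by (simp add: f_def c0)
  ultimately have "ip (tb X T') H1 = 0"
    by (intro DERIV_local_max[where d = 1]) auto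
  moreover have "ip (tb X T') H1 = ip X X"
    using tb_antisym[of X T'] by (simp add: ip_simps tb_skew X_def)
  ultimately have "tb T' H1 = 0" by (simp add: ip_eq_0 X_def)
  then have "tb H1 T' = 0" using tb_antisym[of H1 T'] by simp
  then have "br H1 (theta T') = 0" using H1(1) aa_ss by (simp add: tb_ss subset_iff)
  then have "br H (theta T') = 0" using regular_commute[of H1 "theta T'" H] H1 H by blast
  then have "tb H T' = 0" using H aa_ss by (simp add: tb_ss subset_iff)
  then have "tb T' H = 0" using tb_antisym[of T' H] by simp
  then have "mexp (tb T') H = H" by (rule mexp_kernel[OF tb_linear(1)])
  then show ?thesis using ET' by (simp add: E_def)
qed

lemma root_neq_0: assumes k: "k \<in> NKa" and a: "\<alpha> \<in> roots G" shows "\<alpha> (Ad G k H0) \<noteq> 0"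
proof -
  obtain \<beta> where "\<beta> \<in> roots G" "\<And>X. X \<in> aa G \<Longrightarrow> \<beta> X = \<alpha> (Ad G k X)" by (rule root_Ad[OF k a]) blast
  then show ?thesis using H0(1,2) by metis
qed

text \<open>\<open>Ad k\<close> maps the open chamber \<open>C\<close> into itself. By finiteness of
  the orbit some power fixes \<open>H0\<close>, so the sum over the resulting cycle is a point of
  \<open>C\<close> fixed by \<open>Ad k\<close>; being regular, it brings the triviality on
  \<open>aa G\<close> through \<open>regular_centralizer\<close>.\<close>

lemma chamber_stabilizer:
  assumes k: "k \<in> NKa" and pos: "\<And>\<alpha>. \<alpha> \<in> pos_roots G \<Longrightarrow> 0 < \<alpha> (Ad G k H0)" and H: "H \<in> aa G"
  shows "Ad G k H = H"
proof -
  define C where "C = {X \<in> aa G. \<forall>\<alpha>\<in>pos_roots G. 0 < \<alpha> X}"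
  have C_Ad: "Ad G k X \<in> C" if "X \<in> C" for X
  proof -
    have X: "X \<in> aa G" using that by (simp add: C_def)
    have "0 < \<alpha> (Ad G k X)" if a: "\<alpha> \<in> pos_roots G" for \<alpha>
    proof -
      have "\<alpha> \<in> roots G" using a by (simp add: pos_root)
      then obtain \<beta> where b: "\<beta> \<in> roots G" "\<And>X. X \<in> aa G \<Longrightarrow> \<beta> X = \<alpha> (Ad G k X)" by (rule root_Ad[OF k]) blast
      then have "\<beta> \<in> pos_roots G" using pos[OF a] H0(1) by (simp add: pos_root)
      then show ?thesis using b(2)[OF X] \<open>X \<in> C\<close> by (auto simp: C_def)
    qed
    then show ?thesis using NKa_Ad[OF k X] by (simp add: C_def)
  qed
  define h where "h i = (Ad G k ^^ i) H0" for i
  have hC: "h i \<in> C" for i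
    by (induction i) (auto simp: h_def C_Ad, simp add: C_def H0(1) pos_root)
  have "\<exists>k'\<in>NKa. h i = Ad G k' H0" for i
  proof (induction i)
    case 0
    show ?case using NKa_closed(3) by (intro bexI[of _ \<one>]) (auto simp: h_def)
  next
    case (Suc i)
    then obtain k' where k': "k' \<in> NKa" "h i = Ad G k' H0" by blast
    have "h (Suc i) = Ad G (k \<otimes> k') H0" using k'(2) by (simp add: h_def Ad_mult)
    then show ?case using NKa_closed(1)[OF k k'(1)] by blast
  qed
  then have "range h \<subseteq> {Ad G k' H0 | k'. k' \<in> NKa}" by blast
  then have "finite (range h)" using finite_orbit[OF H0(1)] by (rule finite_subset)
  then have "\<not> inj h" using finite_imageD by blast
  then obtain i j where ij: "i < j" "h i = h j" by (metis injI linorder_neqE_nat)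
  define n where "n = j - i"
  have inj: "inj (Ad G k)" by (rule inj_on_inverseI[of _ "Ad G (inv k)"]) simp
  have "inj (Ad G k ^^ i)" by (rule inj_fn[OF inj])
  moreover have "(Ad G k ^^ i) (h n) = (Ad G k ^^ i) H0"
    using ij by (simp add: h_def n_def funpow_add[symmetric, unfolded o_def, THEN fun_cong])
  ultimately have hn: "h n = H0" by (simp add: inj_eq)
  have n: "n > 0" using ij by (simp add: n_def)
  define H1 where "H1 = (\<Sum>l<n. h l)"
  have C_add: "X + Y \<in> C" if XY: "X \<in> C" "Y \<in> C" for X Y
  proof -
    have "0 < \<alpha> (X + Y)" if "\<alpha> \<in> pos_roots G" for \<alpha>
    proof -
      have "\<alpha> (X + Y) = \<alpha> X + \<alpha> Y" using root_linear(1)[of \<alpha> X Y] that XY by (simp add: C_def pos_root)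
      then show ?thesis using XY that by (simp add: C_def add_pos_pos)
    qed
    then show ?thesis using XY by (simp add: C_def subspace_add[OF aa_subspace])
  qed
  have "(\<Sum>l<Suc m. h l) \<in> C" for m
    by (induction m) (use hC C_add in auto)
  from this[of "n - 1"] have H1: "H1 \<in> C" using n by (simp add: H1_def)
  have "Ad G k H1 = (\<Sum>l<n. h (Suc l))" by (simp add: H1_def linear_sum[OF Ad_linear] h_def)
  also have "\<dots> = H1"
  proof -
    have "(\<Sum>l<n. h (Suc l)) + h 0 = (\<Sum>l<Suc n. h l)" by (metis sum.lessThan_Suc_shift add.commute)
    then show ?thesis using hn by (simp add: H1_def h_def)
  qed
  finally have "Ad G k H1 = H1" .
  moreover have "\<alpha> H1 \<noteq> 0" if "\<alpha> \<in> roots G" for \<alpha>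
    using root_cases[OF that] H1 by (auto simp: C_def)
  moreover have "k \<in> KK G" "H1 \<in> aa G" using k H1 by (auto simp: C_def)
  ultimately show ?thesis using regular_centralizer[of k H1 H] H by blast
qed

text \<open>The parabolic element carries a positive root vector \<open>X\<close> back into
  \<open>pp\<close>, where \<open>H0\<close> has only nonnegative eigenvalues; this eigenvalue is
  \<open>\<alpha> (Ad k H0)\<close>, so \<open>k\<close> preserves the positive chamber.\<close>

lemma KK_mp_trivial:
  assumes k: "k \<in> KK G" "k \<in> min_parabolic G" and H: "H \<in> aa G"
  shows "Ad G k H = H"
proof (rule chamber_stabilizer[OF _ _ H])
  show kN: "k \<in> NKa" using k by (rule KK_mp_NKa)
  fix \<alpha> assume a: "\<alpha> \<in> pos_roots G"
  then have ar: "\<alpha> \<in> roots G" by (simp add: pos_root)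
  obtain X where X: "X \<in> root_space G \<alpha>" "X \<noteq> 0" using root_vector[OF ar] by blast
  define r where "r = \<alpha> (Ad G k H0)"
  define Y where "Y = Ad G (inv k) X"
  have "br (Ad G k H0) X = r *\<^sub>R X"
    using X(1) NKa_Ad[OF kN H0(1)] by (simp add: root_space_def r_def)
  then have "Ad G (inv k) (br (Ad G k H0) X) = r *\<^sub>R Y" by (simp add: Y_def linear_scale[OF Ad_linear])
  then have "br H0 Y = r *\<^sub>R Y" by (simp add: Ad_bracket Y_def)
  then have Yr: "Y \<in> gr H0 (\<lambda>s. s = r)" by (rule br_eigen_gr[OF H0(1)]) simp
  have "X \<in> gr H0 (\<lambda>r. 0 \<le> r)" using root_gr[OF ar X(1), of "\<lambda>r. 0 \<le> r" H0] a by (simp add: pos_root)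
  then have "Y \<in> pp" using k(2) by (simp add: Y_def mp_iff pp_def)
  moreover have "Y \<noteq> 0"
  proof
    assume "Y = 0"
    then have "Ad G k Y = 0" by (simp add: linear_0[OF Ad_linear])
    then show False using X(2) by (simp add: Y_def)
  qed
  ultimately have "0 \<le> r" using Yr nonzero_coord[of Y] by (auto simp: gr_def pp_def)
  then show "0 < \<alpha> (Ad G k H0)" using root_neq_0[OF kN ar] by (simp add: r_def)
qed

text \<open>The element \<open>T = X + theta X\<close> of \<open>kk G\<close> generates a rotation
  of the plane spanned by \<open>Ha\<close> and \<open>S = X - theta X\<close> and commutes with the
  kernel of \<open>\<alpha>\<close> in \<open>aa G\<close>. Half a turn is the reflection.\<close>

lemma root_reflection:
  assumes a: "\<alpha> \<in> roots G"
  obtains k Ha where "k \<in> NKa" "Ha \<in> aa G" "\<And>H. H \<in> aa G \<Longrightarrow> inv_form G Ha H = \<alpha> H" "0 < \<alpha> Ha"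
    "\<And>H. H \<in> aa G \<Longrightarrow> Ad G k H = H - (2 * \<alpha> H / \<alpha> Ha) *\<^sub>R Ha"
proof -
  obtain X where X: "X \<in> root_space G \<alpha>" "X \<noteq> 0" using root_vector[OF a] by blast
  define T S P where "T = X + theta X" and "S = X - theta X" and "P = br X (theta X)"
  define c where "c = ip X X"
  \<comment> \<open>The scale is chosen because the form of \<open>P\<close> with \<open>H\<close>
    equals \<open>- (\<alpha> H * c)\<close>; it makes \<open>Ha\<close> dual to
    \<open>\<alpha>\<close>.\<close>
  define Ha where "Ha = (- 1 / c) *\<^sub>R P"
  have c: "0 < c" unfolding c_def using X(2) by (rule ip_pos)
  have T: "T \<in> kk G" by (rule theta_fixed) (simp add: T_def theta_simps add.commute)
  have brX: "br H X = \<alpha> H *\<^sub>R X" if "H \<in> aa G" for H using X(1) that by (simp add: root_space_def)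
  have brtX: "br H (theta X) = - \<alpha> H *\<^sub>R theta X" if "H \<in> aa G" for H
  proof -
    have "theta H = - H" using that aa_ss theta_ss by blast
    then have "br H (theta X) = - theta (br H X)" by (simp add: theta_br bracket_simps)
    then show ?thesis by (simp add: brX[OF that] theta_simps)
  qed
  have P: "P \<in> aa G"
  proof (rule aa_centralizer)
    show "P \<in> ss G"
      by (rule theta_neg) (simp add: P_def theta_br bracket_antisym[of "theta X" X])
    show "br H P = 0" if "H \<in> aa G" for H
      unfolding P_def jacobi[of H] by (simp add: brX[OF that] brtX[OF that] bracket_simps)
  qed
  then have Ha: "Ha \<in> aa G" unfolding Ha_def by (rule subspace_scale[OF aa_subspace])
  have dual: "inv_form G Ha H = \<alpha> H" if H: "H \<in> aa G" for H
  proof -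
    have "inv_form G P H = - inv_form G (theta X) (br X H)" unfolding P_def by (rule B_invariant)
    also have "br X H = - \<alpha> H *\<^sub>R X" using bracket_antisym[of X H] brX[OF H] by simp
    finally have "inv_form G P H = - (\<alpha> H * c)"
      by (simp add: B_simps c_def ip_def B_sym[of X])
    then show ?thesis using c by (simp add: Ha_def B_simps)
  qed
  have Ha0: "Ha \<noteq> 0"
  proof
    assume "Ha = 0"
    then have "\<alpha> H0 = 0" using dual[OF H0(1)] by (simp add: B_simps)
    then show False using H0(2)[OF a] by simp
  qed
  have pos: "0 < \<alpha> Ha" using B_ss[OF _ Ha0] Ha aa_ss dual[OF Ha] by auto
  \<comment> \<open>The angular speed: applying \<open>br T\<close> twice to \<open>Ha\<close> gives
    \<open>- (2 * c * \<alpha> Ha)\<close> times \<open>Ha\<close>.\<close>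
  define \<omega> where "\<omega> = sqrt (2 * c * \<alpha> Ha)"
  have \<omega>: "0 < \<omega>" "\<omega> * \<omega> = 2 * c * \<alpha> Ha" using c pos by (auto simp: \<omega>_def)
  have brTH: "br T H = - \<alpha> H *\<^sub>R S" if "H \<in> aa G" for H
    unfolding bracket_antisym[of T H] by (simp add: T_def S_def bracket_simps brX[OF that] brtX[OF that] algebra_simps)
  have "br T S = - 2 *\<^sub>R P"
    unfolding T_def S_def P_def
    by (simp add: bracket_simps bracket_self bracket_antisym[of "theta X" X] scaleR_2)
  then have brTS: "br T S = (2 * c) *\<^sub>R Ha" using c by (simp add: Ha_def)
  \<comment> \<open>The explicit rotation starting at \<open>Ha\<close>; at time
    \<open>pi / \<omega>\<close> it reaches \<open>- Ha\<close>.\<close>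
  define f where "f s = cos (\<omega> * s) *\<^sub>R Ha - (\<alpha> Ha / \<omega> * sin (\<omega> * s)) *\<^sub>R S" for s
  have "(f has_vector_derivative br T (f s)) (at s)" for s
  proof -
    have "(f has_vector_derivative (- \<omega> * sin (\<omega> * s)) *\<^sub>R Ha - (\<alpha> Ha / \<omega> * (\<omega> * cos (\<omega> * s))) *\<^sub>R S) (at s)"
      unfolding f_def[abs_def]
      by (auto intro!: derivative_eq_intros simp: has_vector_derivative_def algebra_simps)
    moreover have "br T (f s) = (- \<alpha> Ha * cos (\<omega> * s)) *\<^sub>R S - (\<alpha> Ha / \<omega> * sin (\<omega> * s) * (2 * c)) *\<^sub>R Ha"
      by (simp add: f_def bracket_simps brTH[OF Ha] brTS)
    moreover have "\<alpha> Ha / \<omega> * sin (\<omega> * s) * (2 * c) = \<omega> * sin (\<omega> * s)"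
    proof -
      have "\<alpha> Ha / \<omega> * sin (\<omega> * s) * (2 * c) = (\<omega> * \<omega>) / \<omega> * sin (\<omega> * s)" unfolding \<omega>(2) by simp
      then show ?thesis using \<omega>(1) by simp
    qed
    ultimately show ?thesis using \<omega>(1) by (simp add: minus_diff_commute)
  qed
  from linear_ode_unique[OF bracket_linear_right this, of "pi / \<omega>"]
  have rot: "mexp (\<lambda>y. (pi / \<omega>) *\<^sub>R br T y) Ha = - Ha" using \<omega>(1) by (simp add: f_def)
  define k where "k = lie_exp G ((pi / \<omega>) *\<^sub>R T)"
  have kK: "k \<in> KK G" unfolding k_def by (intro exp_KK subspace_scale[OF kk_subspace] T)
  have "br ((pi / \<omega>) *\<^sub>R T) = (\<lambda>y. (pi / \<omega>) *\<^sub>R br T y)"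
    by (rule ext) (simp add: bracket_simps)
  then have kHa: "Ad G k Ha = - Ha" using rot by (simp only: k_def Ad_exp_mexp)
  have kH: "Ad G k H = H - (2 * \<alpha> H / \<alpha> Ha) *\<^sub>R Ha" if H: "H \<in> aa G" for H
  proof -
    define r where "r = \<alpha> H / \<alpha> Ha"
    define H' where "H' = H - r *\<^sub>R Ha"
    have H': "H' \<in> aa G" unfolding H'_def by (intro subspace_diff subspace_scale aa_subspace H Ha)
    have "\<alpha> (H' + r *\<^sub>R Ha) = \<alpha> H' + r * \<alpha> Ha"
      unfolding root_linear(1)[OF a H' subspace_scale[OF aa_subspace Ha]] root_linear(2)[OF a Ha] ..
    moreover have "H' + r *\<^sub>R Ha = H" by (simp add: H'_def)
    ultimately have "\<alpha> H' = 0" using pos by (simp add: r_def)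
    then have "br ((pi / \<omega>) *\<^sub>R T) H' = 0" by (simp add: bracket_simps brTH[OF H'])
    then have "Ad G k H' = H'" unfolding k_def Ad_exp_mexp by (rule mexp_kernel[OF bracket_linear_right])
    then have "Ad G k (H' + r *\<^sub>R Ha) = H' - r *\<^sub>R Ha"
      by (simp add: linear_add[OF Ad_linear] linear_scale[OF Ad_linear] kHa)
    then show ?thesis by (simp add: H'_def r_def algebra_simps flip: scaleR_2)
  qed
  have refl_aa: "Ad G k H \<in> aa G" if "H \<in> aa G" for H
    unfolding kH[OF that] by (intro subspace_diff subspace_scale aa_subspace that Ha)
  have "Ad G (inv k) H \<in> aa G" if H: "H \<in> aa G" for H
  proof -
    have "Ad G k (Ad G k H) = H"
      unfolding kH[OF H] linear_diff[OF Ad_linear] linear_scale[OF Ad_linear] kHa by simp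
    then have "Ad G (inv k) H = Ad G k H" by (metis Ad_inv(1))
    then show ?thesis using refl_aa[OF H] by simp
  qed
  then have "k \<in> NKa" using kK refl_aa Ad_image_eqI[of "aa G" k] by blast
  then show ?thesis using that Ha dual pos kH by blast
qed

section \<open>The Weyl group, its stabilizers and the strata of the flag manifold\<close>

abbreviation Zk :: "'g set" where "Zk \<equiv> {k \<in> KK G. \<forall>H\<in>aa G. Ad G k H = H}"

abbreviation cls :: "'g \<Rightarrow> 'g set" where "cls m \<equiv> Zk #> m"

abbreviation Wg :: "'g set monoid" where "Wg \<equiv> weyl_group G"

lemma Zk_NKa: "k \<in> Zk \<Longrightarrow> k \<in> NKa"
  by (auto simp: image_iff)

lemma carrier_UNIV[simp]: "x \<in> carrier G"
  using reductive by (simp add: reductive_cartan_group_def is_lie_group_def)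

lemma NKa_subgroup: "subgroup NKa G"
proof (rule subgroupI)
  show "NKa \<noteq> {}" using NKa_closed(3) by (metis empty_iff)
  show "inv k \<in> NKa" if "k \<in> NKa" for k using that by (rule NKa_closed(2))
  show "k \<otimes> h \<in> NKa" if "k \<in> NKa" "h \<in> NKa" for k h using that by (rule NKa_closed(1))
qed simp

lemma Zk_subgroup: "subgroup Zk G"
proof (rule subgroupI)
  show "inv k \<in> Zk" if "k \<in> Zk" for k
  proof -
    have "Ad G (inv k) H = H" if "H \<in> aa G" for H using \<open>k \<in> Zk\<close> that Ad_inv(1)[of k H] by simp
    then show ?thesis using \<open>k \<in> Zk\<close> KK_closed(2) by simp
  qed
  show "Zk \<noteq> {}" using KK_closed(3) by (auto intro!: exI[of _ \<one>])
qed (auto simp: Ad_mult KK_closed(1))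

lemma Zk_conj: assumes m: "m \<in> NKa" and z: "z \<in> Zk" shows "m \<otimes> z \<otimes> inv m \<in> Zk"
proof -
  have "Ad G (m \<otimes> z \<otimes> inv m) H = H" if "H \<in> aa G" for H
    using NKa_Ad[OF NKa_closed(2)[OF m] that] z by (simp add: Ad_mult)
  moreover have "m \<otimes> z \<otimes> inv m \<in> KK G" using m z by (simp add: KK_closed)
  ultimately show ?thesis by blast
qed

lemma Zk_normal: "Zk \<lhd> G\<lparr>carrier := NKa\<rparr>"
proof -
  interpret N: group "G\<lparr>carrier := NKa\<rparr>"
    by (rule subgroup.subgroup_is_group[OF NKa_subgroup is_group])
  have "Zk \<subseteq> NKa" using Zk_NKa by blast
  then show ?thesis
    unfolding N.normal_inv_iff
    using subgroup_incl[OF Zk_subgroup NKa_subgroup] Zk_conj m_inv_consistent[OF NKa_subgroup]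
    by simp
qed

sublocale W: group Wg
  unfolding weyl_group_def by (rule normal.factorgroup_is_group[OF Zk_normal])

lemma weyl_carrier: "w \<in> carrier Wg \<longleftrightarrow> (\<exists>m\<in>NKa. w = cls m)"
  by (simp add: weyl_group_def FactGroup_def RCOSETS_def r_coset_def)

lemma cls_carrier: "m \<in> NKa \<Longrightarrow> cls m \<in> carrier Wg"
  unfolding weyl_carrier by (rule bexI[where x = m]) (rule refl)

lemma cls_mult: "m \<in> NKa \<Longrightarrow> m' \<in> NKa \<Longrightarrow> cls m \<otimes>\<^bsub>Wg\<^esub> cls m' = cls (m \<otimes> m')"
  using normal.rcos_sum[OF Zk_normal, of m m']
  by (simp add: weyl_group_def FactGroup_def r_coset_def set_mult_def)

lemma cls_one: "cls \<one> = \<one>\<^bsub>Wg\<^esub>"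
  using Zk_subgroup by (simp add: weyl_group_def FactGroup_def coset_mult_one)

lemma cls_inv: assumes "m \<in> NKa" shows "inv\<^bsub>Wg\<^esub> (cls m) = cls (inv m)"
proof (rule W.inv_equality)
  show "cls (inv m) \<otimes>\<^bsub>Wg\<^esub> cls m = \<one>\<^bsub>Wg\<^esub>"
    using cls_mult[OF NKa_closed(2)[OF assms] assms] cls_one by simp
  show "cls m \<in> carrier Wg" "cls (inv m) \<in> carrier Wg"
    using assms NKa_closed(2)[OF assms] by (simp_all only: cls_carrier)
qed

lemma cls_Zk: "z \<in> Zk \<Longrightarrow> cls z = \<one>\<^bsub>Wg\<^esub>"
  using coset_join2[OF carrier_UNIV Zk_subgroup, of z] by (simp add: weyl_group_def FactGroup_def)

text \<open>The representative chosen by \<open>SOME\<close> in \<open>weyl_act\<close> and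
  \<open>weyl_flag_point\<close> differs from \<open>m\<close> by an element acting trivially on
  \<open>aa G\<close>; neither notion depends on it.\<close>

lemma cls_some: obtains z where "z \<in> Zk" "(SOME k. k \<in> cls m) = z \<otimes> m"
proof -
  have "m \<in> cls m" using Zk_subgroup carrier_UNIV by (rule rcos_self[rotated])
  then have "(SOME k. k \<in> cls m) \<in> cls m" by (rule someI)
  then show ?thesis using that unfolding r_coset_def by blast
qed

lemma weyl_act_cls: assumes "m \<in> NKa" "H \<in> aa G" shows "weyl_act G (cls m) H = Ad G m H"
proof -
  obtain z where "z \<in> Zk" "(SOME k. k \<in> cls m) = z \<otimes> m" by (rule cls_some)
  then show ?thesis using NKa_Ad[OF assms] by (simp add: weyl_act_def Ad_mult)
qed

lemma weyl_act_inv: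
  assumes "m \<in> NKa" "H \<in> aa G" shows "weyl_act G (inv\<^bsub>Wg\<^esub> (cls m)) H = Ad G (inv m) H"
  using assms NKa_closed(2) by (simp add: cls_inv weyl_act_cls)

lemma Zk_mp: assumes "z \<in> Zk" shows "z \<in> min_parabolic G"
proof -
  have *: "Ad G z X \<in> pp" if z: "z \<in> Zk" and X: "X \<in> pp" for z X
  proof -
    have "gr H0 (\<lambda>r. 0 \<le> r) \<subseteq> {X. Ad G z X \<in> pp}"
    proof (rule gr_subset)
      show "subspace {X. Ad G z X \<in> pp}"
        using pp_subspace unfolding subspace_def
        by (auto simp: linear_0[OF Ad_linear] linear_add[OF Ad_linear] linear_scale[OF Ad_linear])
      show "e \<in> {X. Ad G z X \<in> pp}" if e: "e \<in> eb" "0 \<le> wt e H0" for e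
      proof -
        have "Ad G z (br H0 e) = br H0 (Ad G z e)" using z H0(1) by (simp add: Ad_bracket)
        then have "br H0 (Ad G z e) = wt e H0 *\<^sub>R Ad G z e"
          by (simp add: br_eb[OF e(1) H0(1)] linear_scale[OF Ad_linear])
        then show ?thesis using br_eigen_gr[OF H0(1)] e(2) by (simp add: pp_def)
      qed
    qed
    then show ?thesis using X by (auto simp: pp_def)
  qed
  have "inv z \<in> Zk" using assms by (rule subgroup.m_inv_closed[OF Zk_subgroup])
  then show ?thesis unfolding mp_iff using * assms by blast
qed

lemma mem_flag: "x \<in> flag_point G g \<longleftrightarrow> inv g \<otimes> x \<in> min_parabolic G"
proof
  show "inv g \<otimes> x \<in> min_parabolic G" if "x \<in> flag_point G g"
    using that unfolding flag_point_def l_coset_def by auto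
  show "x \<in> flag_point G g" if "inv g \<otimes> x \<in> min_parabolic G"
    unfolding flag_point_def l_coset_def using that by (auto intro!: bexI[of _ "inv g \<otimes> x"])
qed

lemma flag_point_eq: "flag_point G g = flag_point G h \<longleftrightarrow> inv g \<otimes> h \<in> min_parabolic G"
proof
  assume "flag_point G g = flag_point G h"
  then have "h \<in> flag_point G g" by (simp add: mem_flag mp_one)
  then show "inv g \<otimes> h \<in> min_parabolic G" by (simp add: mem_flag)
next
  assume p: "inv g \<otimes> h \<in> min_parabolic G"
  have *: "flag_point G h' \<subseteq> flag_point G g'" if "inv g' \<otimes> h' \<in> min_parabolic G" for g' h'
  proof
    fix x assume "x \<in> flag_point G h'"
    then have "(inv g' \<otimes> h') \<otimes> (inv h' \<otimes> x) \<in> min_parabolic G"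
      using mp_mult[OF that] by (simp add: mem_flag)
    then show "x \<in> flag_point G g'" by (simp add: mem_flag m_assoc)
  qed
  have "inv h \<otimes> g \<in> min_parabolic G" using mp_inv[OF p] by (simp add: inv_mult_group)
  then show "flag_point G g = flag_point G h" by (rule subset_antisym[OF * *[OF p]])
qed

lemma l_coset_flag: "g <# flag_point G h = flag_point G (g \<otimes> h)"
proof (rule Set.set_eqI)
  fix x
  have "x \<in> g <# flag_point G h \<longleftrightarrow> inv g \<otimes> x \<in> flag_point G h"
  proof
    show "inv g \<otimes> x \<in> flag_point G h" if mem: "x \<in> g <# flag_point G h"
    proof -
      obtain y where "y \<in> flag_point G h" "x = g \<otimes> y"
        using mem unfolding l_coset_def UN_iff singleton_iff by (rule bexE)
      then show ?thesis by simp
    qed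
    show "x \<in> g <# flag_point G h" if "inv g \<otimes> x \<in> flag_point G h"
    proof -
      have "x = g \<otimes> (inv g \<otimes> x)" by simp
      then show ?thesis unfolding l_coset_def using that by blast
    qed
  qed
  then show "x \<in> g <# flag_point G h \<longleftrightarrow> x \<in> flag_point G (g \<otimes> h)"
    by (simp add: mem_flag inv_mult_group m_assoc)
qed

lemma weyl_flag_cls: assumes m: "m \<in> NKa" shows "weyl_flag_point G (cls m) = flag_point G m"
proof -
  obtain z where z: "z \<in> Zk" "(SOME k. k \<in> cls m) = z \<otimes> m" by (rule cls_some)
  have "inv z \<in> Zk" using z(1) by (rule subgroup.m_inv_closed[OF Zk_subgroup])
  then have "inv m \<otimes> inv z \<otimes> m \<in> Zk" using Zk_conj[OF NKa_closed(2)[OF m]] by simp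
  then show ?thesis
    using Zk_mp by (simp add: weyl_flag_point_def z(2) flag_point_eq inv_mult_group m_assoc)
qed

lemma weyl_subgroup_subgroup: "subgroup (weyl_subgroup G \<Theta>) Wg"
  unfolding weyl_subgroup_def by (rule W.generate_is_subgroup) auto

lemma Theta_nonneg:
  assumes H: "H \<in> closure (aa_plus G)" and a: "\<alpha> \<in> pos_roots G" "\<alpha> H = 0"
    and y: "\<And>\<beta>. \<beta> \<in> Theta G H \<Longrightarrow> 0 \<le> \<beta> y"
  shows "0 \<le> \<alpha> y"
proof -
  obtain c :: "('l \<Rightarrow> real) \<Rightarrow> nat" where c: "\<alpha> = (\<lambda>X. \<Sum>\<beta>\<in>Theta G H. real (c \<beta>) * \<beta> X)"
    by (rule exE[OF Theta_span(2)[OF H a]])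
  have 1: "0 \<le> (\<Sum>\<beta>\<in>Theta G H. real (c \<beta>) * \<beta> y)"
    by (rule sum_nonneg, rule mult_nonneg_nonneg[OF of_nat_0_le_iff y])
  have 2: "\<alpha> y = (\<lambda>X. \<Sum>\<beta>\<in>Theta G H. real (c \<beta>) * \<beta> X) y"
    using c by (rule fun_cong)
  show ?thesis using 1 2 by (simp only:)
qed

lemma is_reflectionI:
  assumes k: "k \<in> NKa" and Hb: "Hb \<in> aa G" "\<And>H. H \<in> aa G \<Longrightarrow> inv_form G Hb H = \<beta> H"
    and act: "\<And>H. H \<in> aa G \<Longrightarrow> Ad G k H = H - (2 * \<beta> H / \<beta> Hb) *\<^sub>R Hb"
  shows "is_reflection G \<beta> (cls k)"
  unfolding is_reflection_def
proof (rule bexI[OF _ Hb(1)], rule conjI; rule ballI)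
  fix H assume H: "H \<in> aa G"
  show "inv_form G Hb H = \<beta> H" using H by (rule Hb(2))
  have "weyl_act G (cls k) H = Ad G k H" using k H by (rule weyl_act_cls)
  also have "\<dots> = H - (2 * \<beta> H / \<beta> Hb) *\<^sub>R Hb" using H by (rule act)
  finally show "weyl_act G (cls k) H = H - (2 * \<beta> H / \<beta> Hb) *\<^sub>R Hb" .
qed

text \<open>Chevalley: among the elements \<open>v m\<close> with \<open>v\<close> a product of reflections fixing \<open>H\<close>, one
  maximising \<open>\<langle>v m H0, H0\<rangle>\<close> preserves the positive chamber.\<close>

lemma weyl_stabilizer:
  assumes H: "H \<in> closure (aa_plus G)" and m: "m \<in> NKa" and fixed: "Ad G m H = H"
  shows "cls m \<in> weyl_subgroup G (Theta G H)"
proof -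
  define WT where "WT = weyl_subgroup G (Theta G H)"
  have WT: "subgroup WT Wg" unfolding WT_def by (rule weyl_subgroup_subgroup)
  have Ha: "H \<in> aa G" using H by (rule closure_aa_plus)
  define V where "V = {v \<in> NKa. Ad G v H = H \<and> cls v \<in> WT}"
  define f where "f v = ip (Ad G (v \<otimes> m) H0) H0" for v
  have VN: "v \<otimes> m \<in> NKa" if "v \<in> V" for v using that m NKa_closed(1) unfolding V_def by blast
  have "f ` V \<subseteq> (\<lambda>X. ip X H0) ` {Ad G k H0 | k. k \<in> NKa}"
    unfolding f_def using VN by blast
  then have fin: "finite (f ` V)" using finite_orbit[OF H0(1)] by (meson finite_imageI finite_subset)
  have "\<one> \<in> V"
    using NKa_closed(3) subgroup.one_closed[OF WT] unfolding V_def cls_one[symmetric] by simp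
  then have "Max (f ` V) \<in> f ` V" by (intro Max_in fin) blast
  then obtain v where v1: "v \<in> V" "f v = Max (f ` V)" by (elim imageE) simp
  then have v: "v \<in> V" "\<And>v'. v' \<in> V \<Longrightarrow> f v' \<le> f v"
    using Max_ge[OF fin imageI] by simp_all
  define m' where "m' = v \<otimes> m"
  have m': "m' \<in> NKa" unfolding m'_def using v(1) by (rule VN)
  have m'H: "Ad G m' H = H" using v(1) by (simp add: m'_def Ad_mult fixed V_def)
  define y where "y = Ad G m' H0"
  have y: "y \<in> aa G" unfolding y_def by (rule NKa_Ad[OF m' H0(1)])
  \<comment> \<open>Replacing \<open>v\<close> by the reflection in \<open>\<beta>\<close> times
    \<open>v\<close> changes the maximised value by
    \<open>- 2 * \<beta> y / \<beta> Hb * \<beta> H0\<close>, so maximality gives the sign of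
    \<open>\<beta> y\<close>.\<close>
  have Theta_pos: "0 \<le> \<beta> y" if b: "\<beta> \<in> Theta G H" for \<beta>
  proof -
    have bs: "\<beta> \<in> simple_roots G" "\<beta> H = 0" using b by (auto simp: Theta_def)
    then have br: "\<beta> \<in> roots G" "0 < \<beta> H0" using simple_pos pos_root by auto
    obtain k Hb where k: "k \<in> NKa" "Hb \<in> aa G" "\<And>H. H \<in> aa G \<Longrightarrow> inv_form G Hb H = \<beta> H" "0 < \<beta> Hb"
      "\<And>H. H \<in> aa G \<Longrightarrow> Ad G k H = H - (2 * \<beta> H / \<beta> Hb) *\<^sub>R Hb"
      using root_reflection[OF br(1)] by blast
    have "is_reflection G \<beta> (cls k)" by (rule is_reflectionI[OF k(1,2,3,5)])
    moreover have "cls k \<in> carrier Wg" using k(1) by (rule cls_carrier)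
    ultimately have "cls k \<in> WT" unfolding WT_def weyl_subgroup_def using b by (intro generate.incl) blast
    then have "cls (k \<otimes> v) \<in> WT"
      using cls_mult[OF k(1), of v] v(1) subgroup.m_closed[OF WT, of "cls k" "cls v"] by (simp add: V_def)
    moreover have "Ad G k H = H" using k(5)[OF Ha] bs(2) by simp
    ultimately have "k \<otimes> v \<in> V" using v(1) NKa_closed(1)[OF k(1)] by (simp add: V_def Ad_mult)
    from v(2)[OF this] have "ip (Ad G k y) H0 \<le> ip y H0"
      by (simp add: f_def y_def m'_def m_assoc Ad_mult)
    moreover have "ip Hb H0 = \<beta> H0"
      using k(3)[OF H0(1)] H0(1) aa_ss by (simp add: ip_def theta_ss subset_iff B_simps)
    ultimately have "0 \<le> 2 * \<beta> y / \<beta> Hb * \<beta> H0" by (simp add: k(5)[OF y] ip_simps)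
    then show ?thesis using br(2) k(4) by (simp add: zero_le_mult_iff zero_le_divide_iff)
  qed
  \<comment> \<open>Roots vanishing at \<open>H\<close> are nonnegative combinations of
    \<open>Theta G H\<close> and inherit its signs. A root positive at \<open>H\<close> stays
    positive at \<open>H\<close> after composition with \<open>Ad m'\<close>, which fixes
    \<open>H\<close>, so the composite is a positive root.\<close>
  have "0 < \<alpha> (Ad G m' H0)" if a: "\<alpha> \<in> pos_roots G" for \<alpha>
  proof -
    have ar: "\<alpha> \<in> roots G" using a by (simp add: pos_root)
    show ?thesis
    proof (cases "\<alpha> H = 0")
      case True
      have "0 \<le> \<alpha> y" by (rule Theta_nonneg[OF H a True Theta_pos])
      moreover have "\<alpha> y \<noteq> 0" unfolding y_def by (rule root_neq_0[OF m' ar])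
      ultimately have "0 < \<alpha> y" by linarith
      then show ?thesis unfolding y_def .
    next
      case False
      moreover have "0 \<le> \<alpha> H" by (rule closure_aa_plus(2)[OF H a])
      ultimately have aH: "0 < \<alpha> H" by linarith
      obtain \<gamma> where g: "\<gamma> \<in> roots G" "\<And>X. X \<in> aa G \<Longrightarrow> \<gamma> X = \<alpha> (Ad G m' X)"
        by (rule root_Ad[OF m' ar], rule that)
      have "\<gamma> H = \<alpha> H" unfolding g(2)[OF Ha] m'H ..
      then have "\<gamma> \<in> pos_roots G" using root_pos_at[OF H g(1)] aH by simp
      then have "0 < \<gamma> H0" by (simp add: pos_root)
      then show ?thesis unfolding g(2)[OF H0(1)] .
    qed
  qed
  then have m'Z: "m' \<in> Zk" using chamber_stabilizer[OF m'] m' by blast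
  have vN: "v \<in> NKa" "cls v \<in> WT" using v(1) unfolding V_def by blast+
  have 1: "cls v \<otimes>\<^bsub>Wg\<^esub> cls m = \<one>\<^bsub>Wg\<^esub>"
    using cls_Zk[OF m'Z] unfolding cls_mult[OF vN(1) m] m'_def .
  have c: "cls v \<in> carrier Wg" "cls m \<in> carrier Wg"
    using vN(1) m by (simp_all only: cls_carrier)
  from W.inv_equality[OF 1 c(2,1)] have "inv\<^bsub>Wg\<^esub> (cls m) = cls v" .
  then have "cls m = inv\<^bsub>Wg\<^esub> (cls v)" using W.inv_inv[OF c(2)] by (simp only:)
  then show ?thesis using subgroup.m_inv_closed[OF WT vN(2)] unfolding WT_def by (simp only:)
qed

lemma weyl_coset_eq:
  assumes H: "H \<in> closure (aa_plus G)" and w: "w \<in> carrier Wg" "w' \<in> carrier Wg"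
    and eq: "weyl_act G (inv\<^bsub>Wg\<^esub> w) H = weyl_act G (inv\<^bsub>Wg\<^esub> w') H"
  shows "weyl_subgroup G (Theta G H) #>\<^bsub>Wg\<^esub> w = weyl_subgroup G (Theta G H) #>\<^bsub>Wg\<^esub> w'"
proof -
  obtain m where m1: "m \<in> NKa" "w = cls m" using w(1) unfolding weyl_carrier by (rule bexE)
  obtain m' where m2: "m' \<in> NKa" "w' = cls m'" using w(2) unfolding weyl_carrier by (rule bexE)
  note m = m1 m2
  have Ha: "H \<in> aa G" using H by (rule closure_aa_plus)
  have "Ad G (inv m) H = Ad G (inv m') H" using eq m weyl_act_inv Ha by simp
  then have "Ad G (m' \<otimes> inv m) H = H" by (simp add: Ad_mult)
  then have "cls (m' \<otimes> inv m) \<in> weyl_subgroup G (Theta G H)"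
    by (rule weyl_stabilizer[OF H NKa_closed(1)[OF m(3) NKa_closed(2)[OF m(1)]]])
  moreover have "cls (m' \<otimes> inv m) \<otimes>\<^bsub>Wg\<^esub> w = w'"
    unfolding m(2,4) cls_mult[OF NKa_closed(1)[OF m(3) NKa_closed(2)[OF m(1)]] m(1)] by (simp add: m_assoc)
  ultimately have "w' \<in> weyl_subgroup G (Theta G H) #>\<^bsub>Wg\<^esub> w" unfolding r_coset_def by blast
  then show ?thesis by (rule W.repr_independence[OF _ w(1) weyl_subgroup_subgroup])
qed

lemma flag_st_cls:
  assumes m: "m \<in> NKa"
  shows "flag_st G H D0 (cls m) =
    {flag_point G (g \<otimes> n \<otimes> c \<otimes> m) | g n c. D0 = Ad G g H \<and> n \<in> N_H_minus G H \<and> c \<in> K_H G H}"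
  unfolding flag_st_def weyl_flag_cls[OF m] l_coset_flag by auto

text \<open>Equal limits mean that \<open>m \<otimes> inv m'\<close> fixes \<open>H\<close>, so it
  lies in \<open>K_H G H\<close> and is absorbed by the factor \<open>c\<close>.\<close>

lemma flag_st_eq:
  assumes H: "H \<in> aa G" and w: "w \<in> carrier Wg" "w' \<in> carrier Wg"
    and eq: "weyl_act G (inv\<^bsub>Wg\<^esub> w) H = weyl_act G (inv\<^bsub>Wg\<^esub> w') H"
  shows "flag_st G H D0 w \<subseteq> flag_st G H D0 w'"
proof -
  obtain m where m1: "m \<in> NKa" "w = cls m" using w(1) unfolding weyl_carrier by (rule bexE)
  obtain m' where m2: "m' \<in> NKa" "w' = cls m'" using w(2) unfolding weyl_carrier by (rule bexE)
  note m = m1 m2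
  have e: "Ad G (inv m) H = Ad G (inv m') H" using eq m weyl_act_inv H by simp
  show ?thesis
    unfolding m(2,4) flag_st_cls[OF m(1)] flag_st_cls[OF m(3)]
  proof clarify
    fix g n c assume "n \<in> N_H_minus G H" and c: "c \<in> K_H G H"
    have "Ad G (m \<otimes> inv m') H = H" unfolding Ad_mult e[symmetric] by simp
    moreover have "m \<otimes> inv m' \<in> KK G" by (intro KK_closed) (use m(1,3) in blast)+
    ultimately have "c \<otimes> (m \<otimes> inv m') \<in> K_H G H"
      using c KK_closed(1)[of c "m \<otimes> inv m'"] Ad_mult[of c "m \<otimes> inv m'"] unfolding K_H_iff by simp
    moreover have "g \<otimes> n \<otimes> c \<otimes> m = g \<otimes> n \<otimes> (c \<otimes> (m \<otimes> inv m')) \<otimes> m'" by (simp add: m_assoc)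
    ultimately show "\<exists>g' n' c'. flag_point G (g \<otimes> n \<otimes> c \<otimes> m) = flag_point G (g' \<otimes> n' \<otimes> c' \<otimes> m') \<and>
        Ad G g H = Ad G g' H \<and> n' \<in> N_H_minus G H \<and> c' \<in> K_H G H"
      using \<open>n \<in> N_H_minus G H\<close> by metis
  qed
qed

lemma flag_covering:
  assumes H: "H \<in> closure (aa_plus G)"
  shows "\<exists>w\<in>carrier Wg. flag_point G g \<in> flag_st G H (Ad G h H) w"
proof -
  have Ha: "H \<in> aa G" using H by (rule closure_aa_plus)
  obtain Z c m p where d: "Z \<in> gr H (\<lambda>r. r < 0)" "c \<in> K_H G H" "m \<in> NKa" "p \<in> min_parabolic G"
    "inv h \<otimes> g = lie_exp G Z \<otimes> c \<otimes> m \<otimes> p" by (rule bruhat[OF Ha])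
  have "h \<otimes> (inv h \<otimes> g) = h \<otimes> (lie_exp G Z \<otimes> c \<otimes> m \<otimes> p)" unfolding d(5) ..
  then have g: "g = h \<otimes> lie_exp G Z \<otimes> c \<otimes> m \<otimes> p" by (simp add: m_assoc)
  have "flag_point G (h \<otimes> lie_exp G Z \<otimes> c \<otimes> m) = flag_point G g"
    unfolding flag_point_eq g using d(4) by simp
  then have "flag_point G g \<in> flag_st G H (Ad G h H) (cls m)"
    unfolding flag_st_cls[OF d(3)] N_H_minus_eq[OF H] using d(1,2) by blast
  then show ?thesis using cls_carrier[OF d(3)] by blast
qed

end

section \<open>Cocycles on the flag bundle\<close>

context cartan_grp
begin

lemma carrier_eq: "carrier G = UNIV" by auto

lemma iw_decomp: obtains k u where "k \<in> KK G" "u \<in> NC" "g = k \<otimes> lie_exp G (iw g) \<otimes> u" "iw g \<in> aa G"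
proof -
  obtain k L Y where d: "k \<in> KK G" "L \<in> aa G" "Y \<in> nn G" "g = k \<otimes> lie_exp G L \<otimes> lie_exp G Y" by (rule KAN)
  then have "iw g = L" using iw_eq[OF d(1,2) exp_NC[OF d(3)]] by simp
  then show ?thesis using that d exp_NC[OF d(3)] by metis
qed

lemma iw_left: assumes "k \<in> KK G" shows "iw (k \<otimes> g) = iw g"
proof -
  obtain k' u where d: "k' \<in> KK G" "u \<in> NC" "g = k' \<otimes> lie_exp G (iw g) \<otimes> u" "iw g \<in> aa G" by (rule iw_decomp)
  have "k \<otimes> g = k \<otimes> (k' \<otimes> lie_exp G (iw g) \<otimes> u)" using d(3) by (rule arg_cong)
  then have "k \<otimes> g = (k \<otimes> k') \<otimes> lie_exp G (iw g) \<otimes> u" by (simp add: m_assoc)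
  then show ?thesis using iw_eq[OF KK_closed(1)[OF assms d(1)] d(4,2)] by simp
qed

lemma iw_exp_NC: "L \<in> aa G \<Longrightarrow> u \<in> NC \<Longrightarrow> iw (lie_exp G L \<otimes> u) = L"
  using iw_eq[OF KK_closed(3)] by simp

lemma one_NC: "\<one> \<in> NC"
  using exp_NC[of 0] by (simp add: nn_def span_0)

lemma iw_one: "iw \<one> = 0"
  using iw_exp_NC[OF subspace_0[OF aa_subspace] one_NC] by simp

lemma NC_conj_fixed:
  assumes u: "u \<in> NC" and fixed: "Ad G k H0 = H0" shows "inv k \<otimes> u \<otimes> k \<in> NC"
proof -
  have "conj_H0 t (inv k \<otimes> u \<otimes> k) = inv k \<otimes> conj_H0 t u \<otimes> k" for t
  proof -
    define h where "h = lie_exp G (t *\<^sub>R (- H0))"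
    have "lie_exp G (Ad G k (t *\<^sub>R (- H0))) = h"
      using fixed by (simp add: h_def linear_scale[OF Ad_linear] linear_neg[OF Ad_linear])
    then have "k \<otimes> h \<otimes> inv k = h" unfolding exp_Ad h_def .
    then have "k \<otimes> h \<otimes> inv k \<otimes> k = h \<otimes> k" by simp
    then have c: "k \<otimes> h = h \<otimes> k" by (simp add: m_assoc)
    have c1: "inv k \<otimes> h = h \<otimes> inv k"
    proof -
      have "inv k \<otimes> (k \<otimes> h) \<otimes> inv k = inv k \<otimes> (h \<otimes> k) \<otimes> inv k" unfolding c ..
      then show ?thesis by (simp add: m_assoc)
    qed
    have c2: "k \<otimes> inv h = inv h \<otimes> k"
    proof -
      have "inv h \<otimes> (k \<otimes> h) \<otimes> inv h = inv h \<otimes> (h \<otimes> k) \<otimes> inv h" unfolding c ..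
      then show ?thesis by (simp add: m_assoc)
    qed
    have "h \<otimes> (inv k \<otimes> u \<otimes> k) \<otimes> inv h = (h \<otimes> inv k) \<otimes> u \<otimes> (k \<otimes> inv h)" by (simp add: m_assoc)
    also have "\<dots> = inv k \<otimes> (h \<otimes> u \<otimes> inv h) \<otimes> k" unfolding c2 c1[symmetric] by (simp add: m_assoc)
    finally show ?thesis unfolding h_def .
  qed
  moreover have "((\<lambda>t. inv k \<otimes> conj_H0 t u \<otimes> k) \<longlongrightarrow> inv k \<otimes> \<one> \<otimes> k) at_top"
    using u by (intro tendsto_mult_group tendsto_const) (simp add: NC_def)
  ultimately show ?thesis by (simp add: NC_def)
qed

text \<open>The compact part of \<open>p\<close> lies in \<open>P\<close>, so it acts trivially on
  \<open>aa G\<close> and normalises \<open>NC\<close>; the part in \<open>A\<close> normalises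
  \<open>NC\<close> as well. All factors can be moved past each other. This additivity is what lets
  the cocycle descend to the flag bundle.\<close>

lemma iw_right: assumes p: "p \<in> min_parabolic G" shows "iw (g \<otimes> p) = iw g + iw p"
proof -
  obtain k u where g: "k \<in> KK G" "u \<in> NC" "g = k \<otimes> lie_exp G (iw g) \<otimes> u" "iw g \<in> aa G" by (rule iw_decomp)
  obtain k' L' Y where p': "k' \<in> KK G" "L' \<in> aa G" "Y \<in> nn G" "p = k' \<otimes> lie_exp G L' \<otimes> lie_exp G Y" by (rule KAN)
  define u' where "u' = lie_exp G Y"
  have u': "u' \<in> NC" unfolding u'_def using p'(3) by (rule exp_NC)
  have iwp: "iw p = L'" unfolding p'(4) u'_def[symmetric] by (rule iw_eq[OF p'(1,2) u'])
  have "lie_exp G L' \<otimes> u' \<in> min_parabolic G"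
    unfolding u'_def by (intro mp_mult exp_mp aa_pp nn_pp p')
  then have "p \<otimes> inv (lie_exp G L' \<otimes> u') \<in> min_parabolic G" using p mp_mult mp_inv by blast
  moreover have "p \<otimes> inv (lie_exp G L' \<otimes> u') = k'"
    unfolding p'(4) u'_def by (simp add: m_assoc inv_mult_group)
  ultimately have k': "k' \<in> min_parabolic G" by simp
  have fx: "Ad G k' X = X" if "X \<in> aa G" for X by (rule KK_mp_trivial[OF p'(1) k' that])
  define L where "L = iw g"
  have L: "L \<in> aa G" using g(4) by (simp add: L_def)
  have "k' \<otimes> lie_exp G L \<otimes> inv k' = lie_exp G L" using exp_Ad[of k' L] fx[OF L] by simp
  then have "k' \<otimes> lie_exp G L \<otimes> inv k' \<otimes> k' = lie_exp G L \<otimes> k'" by simp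
  then have c: "lie_exp G L \<otimes> k' = k' \<otimes> lie_exp G L" by (simp add: m_assoc)
  define u1 where "u1 = inv k' \<otimes> u \<otimes> k'"
  have u1: "u1 \<in> NC" unfolding u1_def by (rule NC_conj_fixed[OF g(2) fx[OF H0(1)]])
  define u2 where "u2 = inv (lie_exp G L') \<otimes> u1 \<otimes> lie_exp G L'"
  have u2: "u2 \<in> NC" unfolding u2_def by (rule NC_conj_aa[OF p'(2) u1])
  have e1: "u \<otimes> k' = k' \<otimes> u1" and e2: "u1 \<otimes> lie_exp G L' = lie_exp G L' \<otimes> u2"
    by (simp_all add: u1_def u2_def m_assoc)
  have "g \<otimes> p = (k \<otimes> lie_exp G L \<otimes> u) \<otimes> (k' \<otimes> lie_exp G L' \<otimes> u')"
    using g(3) p'(4) by (simp add: L_def u'_def)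
  also have "\<dots> = k \<otimes> (lie_exp G L \<otimes> (u \<otimes> k') \<otimes> (lie_exp G L' \<otimes> u'))" by (simp add: m_assoc)
  also have "\<dots> = k \<otimes> ((lie_exp G L \<otimes> k') \<otimes> (u1 \<otimes> lie_exp G L') \<otimes> u')" unfolding e1 by (simp add: m_assoc)
  also have "\<dots> = (k \<otimes> k') \<otimes> (lie_exp G L \<otimes> lie_exp G L') \<otimes> (u2 \<otimes> u')" unfolding c e2 by (simp add: m_assoc)
  also have "\<dots> = (k \<otimes> k') \<otimes> lie_exp G (L + L') \<otimes> (u2 \<otimes> u')" by (simp add: exp_aa_add[OF L p'(2)])
  finally have "iw (g \<otimes> p) = L + L'"
    using iw_eq[OF KK_closed(1)[OF g(1) p'(1)] subspace_add[OF aa_subspace L p'(2)] NC_mult[OF u2 u']] by simp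
  then show ?thesis by (simp add: L_def iwp)
qed

end

section \<open>The principal bundle, its compact subbundle and the lift of the cocycle\<close>

locale flow_bundle = cartan_grp G
  for G :: "('g::{t2_space,second_countable_topology}, 'l::euclidean_space, 'm) cartan_group_scheme" (structure) +
  fixes Q :: "('g, 'q::topological_space, 'x::metric_space) bundle_flow"
  assumes flow: "principal_bundle_flow G Q" and compact_base: "compact (UNIV :: 'x set)"
begin

abbreviation ra where "ra \<equiv> ract Q"
abbreviation pr where "pr \<equiv> proj Q"

lemma ra: "pr (ra q g) = pr q" "ra q \<one> = q" "ra (ra q g) h = ra q (g \<otimes> h)"
  "continuous_on UNIV (\<lambda>(q, g). ra q g)" "continuous_on UNIV pr"
  using flow unfolding principal_bundle_flow_def principal_bundle_def carrier_eq by auto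

lemma red: "r \<in> red Q \<Longrightarrow> k \<in> KK G \<Longrightarrow> ra r k \<in> red Q"
  using flow unfolding principal_bundle_flow_def principal_bundle_def by blast

lemma aut: "aut Q (ra q g) = ra (aut Q q) g" "continuous_on UNIV (aut Q)"
  using flow unfolding principal_bundle_flow_def homeomorphism_def by auto

lemma triv:
  obtains U \<Psi> \<Psi>' where "open U" "x \<in> U" "homeomorphism (U \<times> UNIV) (pr -` U) \<Psi> \<Psi>'"
    "\<And>y g. y \<in> U \<Longrightarrow> pr (\<Psi> (y, g)) = y" "\<And>y g h. y \<in> U \<Longrightarrow> ra (\<Psi> (y, g)) h = \<Psi> (y, g \<otimes> h)"
proof -
  have "\<exists>U \<Psi> \<Psi>'. open U \<and> x \<in> U \<and> homeomorphism (U \<times> UNIV) (UNIV \<inter> pr -` U) \<Psi> \<Psi>' \<and>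
        (\<forall>y\<in>U. \<forall>g\<in>UNIV. pr (\<Psi> (y, g)) = y \<and> (\<forall>h\<in>UNIV. ra (\<Psi> (y, g)) h = \<Psi> (y, g \<otimes> h)))"
    using flow unfolding principal_bundle_flow_def principal_bundle_def carrier_eq by blast
  then show ?thesis using that by (elim exE conjE) simp
qed

lemma red_triv:
  obtains U \<Psi> \<Psi>' where "open U" "x \<in> U" "homeomorphism (U \<times> KK G) (red Q \<inter> pr -` U) \<Psi> \<Psi>'"
    "\<And>y k. y \<in> U \<Longrightarrow> k \<in> KK G \<Longrightarrow> pr (\<Psi> (y, k)) = y"
    "\<And>y k h. y \<in> U \<Longrightarrow> k \<in> KK G \<Longrightarrow> h \<in> KK G \<Longrightarrow> ra (\<Psi> (y, k)) h = \<Psi> (y, k \<otimes> h)"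
proof -
  have "\<exists>U \<Psi> \<Psi>'. open U \<and> x \<in> U \<and> homeomorphism (U \<times> KK G) (red Q \<inter> pr -` U) \<Psi> \<Psi>' \<and>
        (\<forall>y\<in>U. \<forall>g\<in>KK G. pr (\<Psi> (y, g)) = y \<and> (\<forall>h\<in>KK G. ra (\<Psi> (y, g)) h = \<Psi> (y, g \<otimes> h)))"
    using flow unfolding principal_bundle_flow_def principal_bundle_def by blast
  then show ?thesis using that by (elim exE conjE) simp
qed

lemma fibre_transitive: assumes "pr q = pr q'" obtains g where "q' = ra q g"
proof -
  obtain U \<Psi> \<Psi>' where t: "open U" "pr q \<in> U" "homeomorphism (U \<times> UNIV) (pr -` U) \<Psi> \<Psi>'"
    "\<And>y g. y \<in> U \<Longrightarrow> pr (\<Psi> (y, g)) = y" "\<And>y g h. y \<in> U \<Longrightarrow> ra (\<Psi> (y, g)) h = \<Psi> (y, g \<otimes> h)"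
    by (rule triv[of "pr q"], rule that)
  have rep: "\<exists>g. q1 = \<Psi> (pr q, g)" if "pr q1 = pr q" for q1
  proof -
    have "q1 \<in> pr -` U" using t(2) that by simp
    then have "q1 \<in> \<Psi> ` (U \<times> UNIV)" using t(3) by (simp add: homeomorphism_def)
    then obtain y g where y: "y \<in> U" "q1 = \<Psi> (y, g)" by blast
    then have "y = pr q" using t(4)[OF y(1), of g] that by simp
    then show ?thesis using y(2) by blast
  qed
  obtain g where g: "q = \<Psi> (pr q, g)" using rep[OF refl] ..
  obtain g' where g': "q' = \<Psi> (pr q, g')" using rep[OF assms[symmetric]] ..
  have "ra (\<Psi> (pr q, g)) (inv g \<otimes> g') = q'" unfolding t(5)[OF t(2)] using g' by simp
  then show ?thesis using that g by metis
qed

lemma free: assumes "ra q g = ra q h" shows "g = h"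
proof -
  obtain U \<Psi> \<Psi>' where t: "open U" "pr q \<in> U" "homeomorphism (U \<times> UNIV) (pr -` U) \<Psi> \<Psi>'"
    "\<And>y g. y \<in> U \<Longrightarrow> pr (\<Psi> (y, g)) = y" "\<And>y g h. y \<in> U \<Longrightarrow> ra (\<Psi> (y, g)) h = \<Psi> (y, g \<otimes> h)"
    by (rule triv[of "pr q"], rule that)
  have "q \<in> pr -` U" using t(2) by simp
  then have "q \<in> \<Psi> ` (U \<times> UNIV)" using t(3) by (simp add: homeomorphism_def)
  then obtain y c where c: "y \<in> U" "q = \<Psi> (y, c)" by blast
  have "\<Psi> (y, c \<otimes> g) = \<Psi> (y, c \<otimes> h)" using assms unfolding c(2) t(5)[OF c(1)] .
  then have "\<Psi>' (\<Psi> (y, c \<otimes> g)) = \<Psi>' (\<Psi> (y, c \<otimes> h))" by (rule arg_cong)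
  then have "c \<otimes> g = c \<otimes> h" using t(3) c(1) by (simp add: homeomorphism_def)
  then have "inv c \<otimes> (c \<otimes> g) = inv c \<otimes> (c \<otimes> h)" by (rule arg_cong)
  then show ?thesis by simp
qed

lemma red_section:
  obtains U \<sigma> where "open U" "x \<in> U" "continuous_on U \<sigma>" "\<And>y. y \<in> U \<Longrightarrow> \<sigma> y \<in> red Q" "\<And>y. y \<in> U \<Longrightarrow> pr (\<sigma> y) = y"
proof -
  obtain U \<Psi> \<Psi>' where t: "open U" "x \<in> U" "homeomorphism (U \<times> KK G) (red Q \<inter> pr -` U) \<Psi> \<Psi>'"
    "\<And>y k. y \<in> U \<Longrightarrow> k \<in> KK G \<Longrightarrow> pr (\<Psi> (y, k)) = y"
    by (rule red_triv[of x], rule that)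
  have "continuous_on (U \<times> KK G) \<Psi>" "\<Psi> ` (U \<times> KK G) = red Q \<inter> pr -` U"
    using t(3) by (auto simp: homeomorphism_def)
  then have "continuous_on U (\<lambda>y. \<Psi> (y, \<one>))" "\<Psi> (y, \<one>) \<in> red Q" if "y \<in> U" for y
    using KK_closed(3) that by (auto intro!: continuous_on_compose2[of "U \<times> KK G" \<Psi>] continuous_intros)
  then show ?thesis using that[of U "\<lambda>y. \<Psi> (y, \<one>)"] t(1,2,4) KK_closed(3) by blast
qed

lemma red_transitive:
  assumes r: "r \<in> red Q" "r' \<in> red Q" "pr r = pr r'" obtains k where "k \<in> KK G" "r' = ra r k"
proof -
  obtain U \<Psi> \<Psi>' where t: "open U" "pr r \<in> U" "homeomorphism (U \<times> KK G) (red Q \<inter> pr -` U) \<Psi> \<Psi>'"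
    "\<And>y k. y \<in> U \<Longrightarrow> k \<in> KK G \<Longrightarrow> pr (\<Psi> (y, k)) = y"
    "\<And>y k h. y \<in> U \<Longrightarrow> k \<in> KK G \<Longrightarrow> h \<in> KK G \<Longrightarrow> ra (\<Psi> (y, k)) h = \<Psi> (y, k \<otimes> h)"
    by (rule red_triv[of "pr r"], rule that)
  have rep: "\<exists>k\<in>KK G. q1 = \<Psi> (pr r, k)" if "q1 \<in> red Q" "pr q1 = pr r" for q1
  proof -
    have "q1 \<in> red Q \<inter> pr -` U" using t(2) that by simp
    then have "q1 \<in> \<Psi> ` (U \<times> KK G)" using t(3) by (simp add: homeomorphism_def)
    then obtain y k where y: "y \<in> U" "k \<in> KK G" "q1 = \<Psi> (y, k)" by blast
    then have "y = pr r" using t(4)[OF y(1,2)] that by simp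
    then show ?thesis using y(2,3) by blast
  qed
  obtain k where k: "k \<in> KK G" "r = \<Psi> (pr r, k)" using rep[OF r(1) refl] ..
  obtain k' where k': "k' \<in> KK G" "r' = \<Psi> (pr r, k')" using rep[OF r(2) r(3)[symmetric]] ..
  have i: "inv k \<otimes> k' \<in> KK G" using k(1) k'(1) KK_closed by simp
  have "ra (\<Psi> (pr r, k)) (inv k \<otimes> k') = r'" unfolding t(5)[OF t(2) k(1) i] using k'(2) by simp
  then show ?thesis using that[OF i] k(2) by metis
qed

lemma red_ra: obtains r g where "r \<in> red Q" "q = ra r g"
proof -
  obtain U \<sigma> where "open U" "pr q \<in> U" "continuous_on U \<sigma>" "\<And>y. y \<in> U \<Longrightarrow> \<sigma> y \<in> red Q" "\<And>y. y \<in> U \<Longrightarrow> pr (\<sigma> y) = y"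
    by (rule red_section[of "pr q"], rule that)
  then have "\<sigma> (pr q) \<in> red Q" "pr (\<sigma> (pr q)) = pr q" by auto
  then show ?thesis using that fibre_transitive by metis
qed

text \<open>On the principal bundle the cocycle becomes a coboundary:
  \<open>a(n, q b\<^sub>0) = LQ (\<phi>\<^sub>n q) - LQ q\<close>.\<close>

definition LQ :: "'q \<Rightarrow> 'l" where
  "LQ q = iw (SOME g. \<exists>r\<in>red Q. q = ra r g)"

lemma LQ_eq: assumes r: "r \<in> red Q" shows "LQ (ra r g) = iw g"
proof -
  define g' where "g' = (SOME g'. \<exists>r'\<in>red Q. ra r g = ra r' g')"
  have "\<exists>g'. \<exists>r'\<in>red Q. ra r g = ra r' g'" using r by blast
  then have "\<exists>r'\<in>red Q. ra r g = ra r' g'" unfolding g'_def by (rule someI_ex)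
  then obtain r' where r': "r' \<in> red Q" "ra r g = ra r' g'" ..
  have "pr r = pr r'" using r'(2) ra(1) by metis
  then obtain k where k: "k \<in> KK G" "r' = ra r k" by (rule red_transitive[OF r r'(1)])
  have "ra r g = ra r (k \<otimes> g')" using r'(2) unfolding k(2) ra(3) .
  then have "g = k \<otimes> g'" by (rule free)
  then have "iw g = iw g'" using iw_left[OF k(1)] by simp
  then show ?thesis unfolding LQ_def g'_def by simp
qed

lemma LQ_red: "r \<in> red Q \<Longrightarrow> LQ r = 0"
  using LQ_eq[of r \<one>] by (simp add: ra(2) iw_one)

lemma LQ_mp: assumes "p \<in> min_parabolic G" shows "LQ (ra q p) = LQ q + iw p"
proof -
  obtain r g where r: "r \<in> red Q" "q = ra r g" by (rule red_ra)
  show ?thesis unfolding r(2) ra(3) LQ_eq[OF r(1)] by (rule iw_right[OF assms])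
qed

lemma aut_pow: "(aut Q ^^ n) (ra q g) = ra ((aut Q ^^ n) q) g"
  by (induction n) (simp_all add: aut(1))

lemma aut_pow_continuous: "continuous_on UNIV (aut Q ^^ n)"
proof (induction n)
  case (Suc n)
  show ?case unfolding funpow.simps(2) by (rule continuous_on_compose[OF Suc continuous_on_subset[OF aut(2)]]) simp
qed (simp add: id_def)

text \<open>The \<open>THE\<close> in \<open>iwasawa_log\<close> is legitimate: the Iwasawa
  decomposition gives existence, and independence of \<open>LQ\<close> from the chosen frame gives
  uniqueness.\<close>

lemma iwasawa_log_eq: "iwasawa_log G Q n r = LQ ((aut Q ^^ n) r)"
proof -
  let ?P = "\<lambda>L. L \<in> aa G \<and> (\<exists>r'\<in>red Q. \<exists>u\<in>NN G. (aut Q ^^ n) r = ra r' (lie_exp G L \<otimes> u))"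
  have eq: "L = LQ ((aut Q ^^ n) r)" if "?P L" for L
  proof -
    obtain r' u where u: "L \<in> aa G" "r' \<in> red Q" "u \<in> NN G" "(aut Q ^^ n) r = ra r' (lie_exp G L \<otimes> u)"
      using \<open>?P L\<close> by blast
    have "u \<in> NC" using u(3) NN_NC by blast
    then show ?thesis unfolding u(4) LQ_eq[OF u(2)] using iw_exp_NC[OF u(1)] by simp
  qed
  have ex: "\<exists>L. ?P L"
  proof -
    obtain r0 g where g: "r0 \<in> red Q" "(aut Q ^^ n) r = ra r0 g" by (rule red_ra)
    obtain k L Y where d: "k \<in> KK G" "L \<in> aa G" "Y \<in> nn G" "g = k \<otimes> lie_exp G L \<otimes> lie_exp G Y" by (rule KAN)
    have "(aut Q ^^ n) r = ra (ra r0 k) (lie_exp G L \<otimes> lie_exp G Y)"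
      unfolding ra(3) g(2) d(4) by (simp add: m_assoc)
    moreover have "lie_exp G Y \<in> NN G" using d(3) by (simp add: NN_def)
    ultimately show ?thesis using d(2) red[OF g(1) d(1)] by blast
  qed
  then obtain L0 where L0: "?P L0" ..
  have "L = L0" if "?P L" for L using eq[OF that] eq[OF L0] by (rule trans[OF _ sym])
  with L0 have "?P (THE L. ?P L)" by (rule theI)
  then show ?thesis unfolding iwasawa_log_def by (rule eq)
qed

text \<open>The point \<open>q b0\<close>. This map is onto the flag bundle and its fibres are the
  orbits of \<open>P\<close>, so functions and open sets of the flag bundle are studied through
  their pullbacks to \<open>Q\<close>.\<close>

definition pt :: "'q \<Rightarrow> ('q \<times> 'g set) set" where
  "pt q = flag_bundle_point G Q q (flag_point G \<one>)"

lemma flag_bundle_point_eq: "flag_bundle_point G Q q (flag_point G h) = {(ra q g, flag_point G (inv g \<otimes> h)) | g. True}"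
  unfolding assoc_point_def l_coset_flag by simp

lemma pt_eq: "pt q = {(ra q g, flag_point G (inv g)) | g. True}"
  unfolding pt_def flag_bundle_point_eq by simp

lemma flag_bundle_point_pt: "flag_bundle_point G Q q (flag_point G h) = pt (ra q h)"
proof (rule subset_antisym)
  show "flag_bundle_point G Q q (flag_point G h) \<subseteq> pt (ra q h)"
    unfolding flag_bundle_point_eq pt_eq
  proof clarify
    fix g
    have "ra q g = ra (ra q h) (inv h \<otimes> g)" by (simp add: ra(3))
    moreover have "flag_point G (inv g \<otimes> h) = flag_point G (inv (inv h \<otimes> g))" by (simp add: inv_mult_group)
    ultimately show "\<exists>g'. (ra q g, flag_point G (inv g \<otimes> h)) = (ra (ra q h) g', flag_point G (inv g')) \<and> True"
      by blast
  qed
  show "pt (ra q h) \<subseteq> flag_bundle_point G Q q (flag_point G h)"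
    unfolding flag_bundle_point_eq pt_eq
  proof clarify
    fix g
    have "flag_point G (inv g) = flag_point G (inv (h \<otimes> g) \<otimes> h)" by (simp add: inv_mult_group m_assoc)
    then show "\<exists>g'. (ra (ra q h) g, flag_point G (inv g)) = (ra q g', flag_point G (inv g' \<otimes> h)) \<and> True"
      by (auto simp: ra(3))
  qed
qed

lemma pt_eqD: assumes "pt q = pt q'" obtains p where "p \<in> min_parabolic G" "q' = ra q p"
proof -
  have "(q', flag_point G \<one>) \<in> pt q'" unfolding pt_eq by (auto intro!: exI[of _ \<one>] simp: ra(2))
  then have "(q', flag_point G \<one>) \<in> pt q" using assms by simp
  then obtain g where g: "q' = ra q g" "flag_point G \<one> = flag_point G (inv g)" unfolding pt_eq by blast
  have "inv g \<in> min_parabolic G" using g(2) unfolding flag_point_eq by simp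
  then show ?thesis using that g(1) mp_inv by fastforce
qed

lemma pt_mp: assumes "p \<in> min_parabolic G" shows "pt (ra q p) = pt q"
proof -
  have "flag_point G p = flag_point G \<one>" unfolding flag_point_eq using mp_inv[OF assms] by simp
  then have "flag_bundle_point G Q q (flag_point G p) = pt q" unfolding pt_def by simp
  then show ?thesis unfolding flag_bundle_point_pt .
qed

lemma pt_red: obtains r where "r \<in> red Q" "pt q = pt r"
proof -
  obtain r g where r: "r \<in> red Q" "q = ra r g" by (rule red_ra)
  obtain k p where k: "k \<in> KK G" "p \<in> min_parabolic G" "g = k \<otimes> p" by (rule KAN_mp)
  have "pt q = pt (ra (ra r k) p)" unfolding r(2) k(3) ra(3) ..
  then show ?thesis using that red[OF r(1) k(1)] pt_mp[OF k(2)] by simp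
qed

text \<open>A frame \<open>r = q p\<close> in \<open>red Q\<close> over the same point has
  \<open>LQ r = 0\<close>, which forces \<open>iw p = - LQ q\<close>; the same \<open>p\<close>
  shifts \<open>LQ\<close> after the flow, since the flow commutes with the right action.\<close>

lemma flag_cocycle_pt: "flag_cocycle G Q n (pt q) = LQ ((aut Q ^^ n) q) - LQ q"
proof -
  let ?P = "\<lambda>L. \<exists>r\<in>red Q. pt q = flag_bundle_point G Q r (flag_point G \<one>) \<and> L = iwasawa_log G Q n r"
  have eq: "L = LQ ((aut Q ^^ n) q) - LQ q" if "?P L" for L
  proof -
    obtain r where r: "r \<in> red Q" "pt q = pt r" "L = LQ ((aut Q ^^ n) r)"
      using \<open>?P L\<close> unfolding pt_def[symmetric] iwasawa_log_eq by blast
    obtain p where p: "p \<in> min_parabolic G" "r = ra q p" using r(2) by (rule pt_eqD)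
    have "LQ q + iw p = 0" using LQ_red[OF r(1)] unfolding p(2) LQ_mp[OF p(1)] .
    then have "iw p = - LQ q" by (rule minus_unique[symmetric])
    moreover have "L = LQ ((aut Q ^^ n) q) + iw p" unfolding r(3) p(2) aut_pow LQ_mp[OF p(1)] ..
    ultimately show ?thesis by simp
  qed
  obtain r where r: "r \<in> red Q" "pt q = pt r" by (rule pt_red[of q], rule that)
  have L0: "?P (iwasawa_log G Q n r)"
    unfolding pt_def[symmetric] by (rule bexI[OF _ r(1)], rule conjI[OF r(2) refl])
  have "L = iwasawa_log G Q n r" if "?P L" for L using eq[OF that] eq[OF L0] by (rule trans[OF _ sym])
  with L0 have "?P (THE L. ?P L)" by (rule theI)
  then show ?thesis unfolding flag_cocycle_def by (rule eq)
qed

lemma assoc_map_pt: "assoc_map Q (pt q) = pt (aut Q q)"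
  unfolding assoc_map_def pt_eq by (simp add: full_SetCompr_eq image_image aut(1))

lemma assoc_proj_point: "assoc_proj Q (assoc_point G Q act q v) = pr q"
proof -
  have "(SOME z. z \<in> assoc_point G Q act q v) \<in> assoc_point G Q act q v"
    by (rule someI[of _ "(ra q \<one>, act (inv \<one>) v)"]) (auto simp: assoc_point_def)
  then show ?thesis unfolding assoc_proj_def by (auto simp: assoc_point_def ra(1))
qed

lemma assoc_proj_pt: "assoc_proj Q (pt q) = pr q"
  unfolding pt_def by (rule assoc_proj_point)

end

lemma topspace_final_topology: "topspace (final_topology f X) = f ` topspace X"
proof (rule subset_antisym)
  show "topspace (final_topology f X) \<subseteq> f ` topspace X"
    using openin_topspace[of "final_topology f X"] unfolding openin_final_topology by (rule conjunct1)
  have "{x \<in> topspace X. f x \<in> f ` topspace X} = topspace X" by blast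
  then have "openin (final_topology f X) (f ` topspace X)" unfolding openin_final_topology by simp
  then show "f ` topspace X \<subseteq> topspace (final_topology f X)" by (rule openin_subset)
qed

lemma space_borel_of_topology: "space (borel_of_topology X) = topspace X"
  unfolding borel_of_topology_def by (rule space_measure_of) (use openin_subset in blast)

lemma borel_of_topology_open: "openin X U \<Longrightarrow> U \<in> sets (borel_of_topology X)"
  unfolding borel_of_topology_def by (rule in_measure_of) (use openin_subset in blast)+

section \<open>Topology of the flag bundle, continuity and boundedness of the cocycle\<close>

context flow_bundle
begin

lemma topspace_flag_bundle: "topspace (flag_bundle G Q) = range pt"
proof -
  have "topspace (flag_bundle G Q) = (\<lambda>(p, v). flag_bundle_point G Q p v) ` (UNIV \<times> range (flag_point G))"
    unfolding flag_bundle_def assoc_topology_def topspace_final_topology topspace_prod_topology topspace_euclidean ..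
  also have "\<dots> = range pt"
  proof (rule subset_antisym)
    show "(\<lambda>(p, v). flag_bundle_point G Q p v) ` (UNIV \<times> range (flag_point G)) \<subseteq> range pt"
      by (auto simp: flag_bundle_point_pt)
    show "range pt \<subseteq> (\<lambda>(p, v). flag_bundle_point G Q p v) ` (UNIV \<times> range (flag_point G))"
      unfolding pt_def by force
  qed
  finally show ?thesis .
qed

text \<open>The quotient map onto the flag manifold is open: the saturation of \<open>S\<close> is a
  union of right translates of \<open>S\<close> by elements of \<open>P\<close>.\<close>

lemma openin_flag_point:
  assumes "open S" shows "openin (final_topology (flag_point G) euclidean) (flag_point G ` S)"
proof -
  have "{x. flag_point G x \<in> flag_point G ` S} = (\<Union>p\<in>min_parabolic G. (\<lambda>g. g \<otimes> p) -` S)"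
  proof (intro subset_antisym subsetI)
    fix x assume "x \<in> {x. flag_point G x \<in> flag_point G ` S}"
    then obtain w where w: "w \<in> S" "flag_point G x = flag_point G w" by blast
    then have "inv x \<otimes> w \<in> min_parabolic G" by (simp add: flag_point_eq)
    moreover have "x \<otimes> (inv x \<otimes> w) \<in> S" using w(1) by simp
    ultimately show "x \<in> (\<Union>p\<in>min_parabolic G. (\<lambda>g. g \<otimes> p) -` S)" by blast
  next
    fix x assume "x \<in> (\<Union>p\<in>min_parabolic G. (\<lambda>g. g \<otimes> p) -` S)"
    then obtain p where p: "p \<in> min_parabolic G" "x \<otimes> p \<in> S" by blast
    then have "flag_point G x = flag_point G (x \<otimes> p)" by (simp add: flag_point_eq)
    then show "x \<in> {x. flag_point G x \<in> flag_point G ` S}" using p(2) by blast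
  qed
  moreover have "open ((\<lambda>g. g \<otimes> p) -` S)" for p
    using assms by (intro open_vimage continuous_intros)
  ultimately show ?thesis unfolding openin_final_topology by (simp add: open_UN image_mono)
qed

text \<open>The topology of the associated bundle comes from \<open>Q\<close> times the flag
  manifold, whereas openness is known on \<open>Q\<close> times \<open>G\<close>. Openness of the
  quotient map of the second factor carries boxes from one product to the other.\<close>

lemma openin_flag_bundle:
  assumes V: "V \<subseteq> range pt" "open (pt -` V)"
  shows "openin (flag_bundle G Q) V"
proof -
  let ?F = "final_topology (flag_point G) euclidean"
  let ?A = "{z \<in> topspace (prod_topology euclidean ?F). (\<lambda>(p, v). flag_bundle_point G Q p v) z \<in> V}"
  have op: "open ((\<lambda>(q, g). ra q g) -` (pt -` V))" by (rule open_vimage[OF V(2) ra(4)])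
  have "openin (prod_topology euclidean ?F) ?A"
  proof (subst openin_subopen, rule ballI)
    fix z assume z: "z \<in> ?A"
    then obtain q h where qh: "z = (q, flag_point G h)"
      unfolding topspace_prod_topology topspace_final_topology by auto
    have "(q, h) \<in> (\<lambda>(q, g). ra q g) -` (pt -` V)" using z by (simp add: qh flag_bundle_point_pt)
    then obtain A B where AB: "open A" "open B" "(q, h) \<in> A \<times> B" "A \<times> B \<subseteq> (\<lambda>(q, g). ra q g) -` (pt -` V)"
      by (rule open_prod_elim[OF op])
    have "openin (prod_topology euclidean ?F) (A \<times> flag_point G ` B)"
      using AB(1) openin_flag_point[OF AB(2)] by (simp add: openin_prod_Times_iff)
    moreover have "z \<in> A \<times> flag_point G ` B" using AB(3) qh by blast
    moreover have "A \<times> flag_point G ` B \<subseteq> ?A"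
    proof
      fix y assume "y \<in> A \<times> flag_point G ` B"
      then obtain a b where ab: "y = (a, flag_point G b)" "a \<in> A" "b \<in> B" by blast
      then have "pt (ra a b) \<in> V" using AB(4) by auto
      then show "y \<in> ?A"
        unfolding ab(1) by (simp add: flag_bundle_point_pt topspace_final_topology)
    qed
    ultimately show "\<exists>T. openin (prod_topology euclidean ?F) T \<and> z \<in> T \<and> T \<subseteq> ?A" by blast
  qed
  moreover have "V \<subseteq> (\<lambda>(p, v). flag_bundle_point G Q p v) ` topspace (prod_topology euclidean ?F)"
    using V(1) topspace_flag_bundle
    unfolding flag_bundle_def assoc_topology_def topspace_final_topology[symmetric] by simp
  ultimately show ?thesis
    unfolding flag_bundle_def assoc_topology_def openin_final_topology by blast
qed

lemma flag_bundle_measurable: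
  fixes F :: "('q \<times> 'g set) set \<Rightarrow> 'b::topological_space"
  assumes F: "continuous_on UNIV (\<lambda>q. F (pt q))" and M: "sets M = sets (borel_of_topology (flag_bundle G Q))"
  shows "F \<in> borel_measurable M"
proof (rule borel_measurableI)
  fix S :: "'b set" assume S: "open S"
  have "space M = range pt"
    using sets_eq_imp_space_eq[OF M] by (simp add: space_borel_of_topology topspace_flag_bundle)
  moreover have "openin (flag_bundle G Q) (F -` S \<inter> range pt)"
  proof (rule openin_flag_bundle)
    have "pt -` (F -` S \<inter> range pt) = (\<lambda>q. F (pt q)) -` S" by blast
    then show "open (pt -` (F -` S \<inter> range pt))" using open_vimage[OF S F] by simp
  qed simp
  ultimately show "F -` S \<inter> space M \<in> sets M" unfolding M by (simp add: borel_of_topology_open)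
qed

text \<open>Near each point a local section of \<open>red Q\<close> and a trivialisation express
  \<open>q\<close> as the section times a group element depending continuously on \<open>q\<close>,
  and \<open>LQ\<close> is the continuous Iwasawa projection of that element.\<close>

lemma LQ_continuous: "continuous_on UNIV LQ"
proof -
  have "\<exists>B. open B \<and> q0 \<in> B \<and> continuous_on B LQ" for q0
  proof -
    obtain U \<Psi> \<Psi>' where t: "open U" "pr q0 \<in> U" "homeomorphism (U \<times> UNIV) (pr -` U) \<Psi> \<Psi>'"
      "\<And>y g. y \<in> U \<Longrightarrow> pr (\<Psi> (y, g)) = y" "\<And>y g h. y \<in> U \<Longrightarrow> ra (\<Psi> (y, g)) h = \<Psi> (y, g \<otimes> h)"
      by (rule triv[of "pr q0"], rule that)
    obtain U' \<sigma> where s: "open U'" "pr q0 \<in> U'" "continuous_on U' \<sigma>" "\<And>y. y \<in> U' \<Longrightarrow> \<sigma> y \<in> red Q"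
      "\<And>y. y \<in> U' \<Longrightarrow> pr (\<sigma> y) = y" by (rule red_section[of "pr q0"], rule that)
    define B where "B = pr -` (U \<inter> U')"
    have B: "open B" "q0 \<in> B" unfolding B_def using open_vimage[OF open_Int[OF t(1) s(1)] ra(5)] t(2) s(2) by auto
    define f where "f q = iw (inv (snd (\<Psi>' (\<sigma> (pr q)))) \<otimes> snd (\<Psi>' q))" for q
    have "LQ q = f q" if q: "q \<in> B" for q
    proof -
      define y where "y = pr q"
      have y: "y \<in> U" "y \<in> U'" using q by (auto simp: B_def y_def)
      have rep: "q1 = \<Psi> (y, snd (\<Psi>' q1))" if "pr q1 = y" for q1
      proof -
        have "q1 \<in> pr -` U" using that y(1) by simp
        then have 1: "\<Psi> (\<Psi>' q1) = q1" "\<Psi>' q1 \<in> U \<times> UNIV"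
          using t(3) imageI[of q1 "pr -` U" \<Psi>'] unfolding homeomorphism_def by blast+
        obtain y' g where yg: "\<Psi>' q1 = (y', g)" by fastforce
        then have "y' = y" using t(4)[of y' g] 1 that by simp
        then show ?thesis using 1(1) yg by simp
      qed
      define a b where "a = snd (\<Psi>' (\<sigma> y))" and "b = snd (\<Psi>' q)"
      have "\<sigma> y = \<Psi> (y, a)" unfolding a_def by (rule rep[OF s(5)[OF y(2)]])
      moreover have "q = \<Psi> (y, b)" unfolding b_def by (rule rep) (simp add: y_def)
      ultimately have "q = ra (\<sigma> y) (inv a \<otimes> b)" using t(5)[OF y(1), of a "inv a \<otimes> b"] by simp
      then have "LQ q = iw (inv a \<otimes> b)" using LQ_eq[OF s(4)[OF y(2)]] by simp
      then show ?thesis by (simp add: f_def a_def b_def y_def)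
    qed
    moreover have "continuous_on B f"
    proof -
      have P: "continuous_on (pr -` U) \<Psi>'" using t(3) by (simp add: homeomorphism_def)
      have prB: "continuous_on B pr" using ra(5) continuous_on_subset by blast
      have "continuous_on B (\<lambda>q. \<sigma> (pr q))"
        by (rule continuous_on_compose2[OF s(3) prB]) (auto simp: B_def)
      then have "continuous_on B (\<lambda>q. \<Psi>' (\<sigma> (pr q)))"
        by (rule continuous_on_compose2[OF P]) (auto simp: B_def s(5))
      moreover have "continuous_on B \<Psi>'" by (rule continuous_on_subset[OF P]) (auto simp: B_def)
      ultimately have "continuous_on B (\<lambda>q. inv (snd (\<Psi>' (\<sigma> (pr q)))) \<otimes> snd (\<Psi>' q))"
        by (intro continuous_on_mult continuous_on_inv continuous_on_snd)
      then show ?thesis unfolding f_def by (rule continuous_on_compose2[OF continuous_iw]) simp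
    qed
    ultimately have "continuous_on B LQ" by (simp cong: continuous_on_cong)
    then show ?thesis using B by blast
  qed
  then obtain B where B: "\<And>q. open (B q)" "\<And>q. q \<in> B q" "\<And>q. continuous_on (B q) LQ" by metis
  have "continuous_on (\<Union>(range B)) LQ"
    by (rule continuous_on_open_Union) (use B(1,3) in auto)
  moreover have "\<Union>(range B) = UNIV" using B(2) by blast
  ultimately show ?thesis by simp
qed

lemma flag_cocycle_continuous: "continuous_on UNIV (\<lambda>q. flag_cocycle G Q n (pt q))"
proof -
  have "continuous_on UNIV (\<lambda>q. LQ ((aut Q ^^ n) q))"
    by (rule continuous_on_compose2[OF LQ_continuous aut_pow_continuous]) simp
  then show ?thesis unfolding flag_cocycle_pt by (intro continuous_on_diff LQ_continuous)
qed

lemma flag_cocycle_Suc: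
  "flag_cocycle G Q (Suc n) (pt q) = flag_cocycle G Q n (assoc_map Q (pt q)) + flag_cocycle G Q 1 (pt q)"
  by (simp add: assoc_map_pt flag_cocycle_pt funpow_swap1)

text \<open>Every point of the flag bundle has a frame in \<open>red Q\<close>, and over a small
  closed ball of the base these frames are the continuous image of the ball times the compact
  \<open>KK G\<close>. Finitely many such balls suffice.\<close>

lemma flag_cocycle_bounded: obtains C where "0 \<le> C" "\<And>q. norm (flag_cocycle G Q 1 (pt q)) \<le> C"
proof -
  define f where "f q = flag_cocycle G Q 1 (pt q)" for q
  have fc: "continuous_on UNIV f" unfolding f_def by (rule flag_cocycle_continuous)
  have "\<exists>U C. open U \<and> x \<in> U \<and> (\<forall>q. pr q \<in> U \<longrightarrow> norm (f q) \<le> C)" for x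
  proof -
    obtain U \<sigma> where s: "open U" "x \<in> U" "continuous_on U \<sigma>" "\<And>y. y \<in> U \<Longrightarrow> \<sigma> y \<in> red Q"
      "\<And>y. y \<in> U \<Longrightarrow> pr (\<sigma> y) = y" by (rule red_section[of x], rule that)
    obtain e where e: "0 < e" "cball x e \<subseteq> U" using s(1,2) open_contains_cball by blast
    have "compact (cball x e)" using compact_base closed_cball by (metis compact_Int_closed inf_top_left)
    then have c: "compact (cball x e \<times> KK G)" using KK_compact by (rule compact_Times)
    have s1: "continuous_on (cball x e \<times> KK G) (\<lambda>z. \<sigma> (fst z))"
      by (rule continuous_on_compose2[OF s(3)]) (use e(2) in \<open>auto intro: continuous_intros\<close>)
    have "continuous_on (cball x e \<times> KK G) (\<lambda>z. (\<sigma> (fst z), snd z))"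
      by (intro continuous_intros s1)
    then have "continuous_on (cball x e \<times> KK G) (\<lambda>z. (\<lambda>(q, g). ra q g) (\<sigma> (fst z), snd z))"
      by (rule continuous_on_compose2[OF ra(4)]) simp
    then have "continuous_on (cball x e \<times> KK G) (\<lambda>z. f ((\<lambda>(q, g). ra q g) (\<sigma> (fst z), snd z)))"
      by (rule continuous_on_compose2[OF fc]) simp
    from compact_continuous_image[OF this c]
    have "bounded ((\<lambda>z. f (ra (\<sigma> (fst z)) (snd z))) ` (cball x e \<times> KK G))"
      by (intro compact_imp_bounded) simp
    then obtain C where C: "\<And>z. z \<in> cball x e \<times> KK G \<Longrightarrow> norm (f (ra (\<sigma> (fst z)) (snd z))) \<le> C"
      unfolding bounded_iff by blast
    have "norm (f q) \<le> C" if q: "pr q \<in> ball x e" for q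
    proof -
      obtain r where r: "r \<in> red Q" "pt q = pt r" by (rule pt_red[of q], rule that)
      have "pr r = pr q" using r(2) assoc_proj_pt by metis
      then have y: "pr r \<in> cball x e" "pr r \<in> U" using q e(2) by auto
      obtain k where k: "k \<in> KK G" "r = ra (\<sigma> (pr r)) k"
        by (rule red_transitive[OF s(4)[OF y(2)] r(1) s(5)[OF y(2)]], rule that)
      have "f q = f (ra (\<sigma> (pr r)) k)" unfolding f_def r(2) using k(2) by simp
      then show ?thesis using C[of "(pr r, k)"] y(1) k(1) by simp
    qed
    then show ?thesis using e(1) by (intro exI[of _ "ball x e"] exI[of _ C]) simp
  qed
  then obtain U C where UC: "\<And>x. open (U x)" "\<And>x. x \<in> U x" "\<And>x q. pr q \<in> U x \<Longrightarrow> norm (f q) \<le> C x" by metis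
  have cov: "UNIV \<subseteq> (\<Union>x\<in>UNIV. U x)" using UC(2) by blast
  obtain D0 where D: "D0 \<subseteq> UNIV" "finite D0" "UNIV \<subseteq> (\<Union>x\<in>D0. U x)"
    by (rule compactE_image[OF compact_base UC(1) cov])
  have "norm (f q) \<le> Max (insert 0 (C ` D0))" for q
  proof -
    obtain x where "x \<in> D0" "pr q \<in> U x" using D(3) by blast
    then have "norm (f q) \<le> C x" "C x \<in> insert 0 (C ` D0)" using UC(3) by auto
    then show ?thesis using D(2) by (meson Max_ge finite_imageI finite_insert order_trans)
  qed
  moreover have "0 \<le> Max (insert 0 (C ` D0))" using D(2) by (intro Max_ge) auto
  ultimately show ?thesis using that unfolding f_def by blast
qed

end

section \<open>Ergodic measures on the flag bundle\<close>

text \<open>Passing from \<open>k\<close> to \<open>k + 1\<close> alters the averages by a factor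
  tending to 1 and a term tending to 0. With the cocycle relation this makes the convergence sets
  invariant under the flow.\<close>

lemma tendsto_average_shift:
  fixes f g :: "nat \<Rightarrow> 'a::real_normed_vector"
  assumes f: "\<And>k. f (Suc k) = g k + c"
  shows "(\<lambda>k. g k /\<^sub>R real k) \<longlonglongrightarrow> v \<longleftrightarrow> (\<lambda>k. f k /\<^sub>R real k) \<longlonglongrightarrow> v"
proof -
  have c: "(\<lambda>k. c /\<^sub>R real k) \<longlonglongrightarrow> 0"
    using tendsto_scaleR[OF lim_inverse_n tendsto_const, of c] by simp
  have shift: "(\<lambda>k. f k /\<^sub>R real k) \<longlonglongrightarrow> v \<longleftrightarrow> (\<lambda>k. (g k + c) /\<^sub>R real (Suc k)) \<longlonglongrightarrow> v"
    using filterlim_sequentially_Suc[of "\<lambda>k. f k /\<^sub>R real k" "nhds v"] by (simp only: f)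
  show ?thesis
    unfolding shift
  proof
    assume "(\<lambda>k. g k /\<^sub>R real k) \<longlonglongrightarrow> v"
    from tendsto_scaleR[OF LIMSEQ_n_over_Suc_n tendsto_add[OF this c]]
    have "(\<lambda>k. (real k / real (Suc k)) *\<^sub>R (g k /\<^sub>R real k + c /\<^sub>R real k)) \<longlonglongrightarrow> v" by simp
    then show "(\<lambda>k. (g k + c) /\<^sub>R real (Suc k)) \<longlonglongrightarrow> v"
    proof (rule Lim_transform_eventually)
      show "\<forall>\<^sub>F k in sequentially. (real k / real (Suc k)) *\<^sub>R (g k /\<^sub>R real k + c /\<^sub>R real k) = (g k + c) /\<^sub>R real (Suc k)"
        using eventually_gt_at_top[of 0]
      proof eventually_elim
        case (elim k)
        then have "(real k / real (Suc k)) * inverse (real k) = inverse (real (Suc k))" by (simp add: field_simps)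
        then show ?case by (simp only: scaleR_add_right[symmetric] scaleR_scaleR)
      qed
    qed
  next
    assume "(\<lambda>k. (g k + c) /\<^sub>R real (Suc k)) \<longlonglongrightarrow> v"
    from tendsto_diff[OF tendsto_scaleR[OF LIMSEQ_Suc_n_over_n this] c]
    have "(\<lambda>k. (real (Suc k) / real k) *\<^sub>R ((g k + c) /\<^sub>R real (Suc k)) - c /\<^sub>R real k) \<longlonglongrightarrow> v" by simp
    then show "(\<lambda>k. g k /\<^sub>R real k) \<longlonglongrightarrow> v"
    proof (rule Lim_transform_eventually)
      show "\<forall>\<^sub>F k in sequentially. (real (Suc k) / real k) *\<^sub>R ((g k + c) /\<^sub>R real (Suc k)) - c /\<^sub>R real k = g k /\<^sub>R real k"
        using eventually_gt_at_top[of 0]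
      proof eventually_elim
        case (elim k)
        have "(real (Suc k) / real k) * inverse (real (Suc k)) = inverse (real k)" by (simp add: field_simps)
        then have "(real (Suc k) / real k) *\<^sub>R ((g k + c) /\<^sub>R real (Suc k)) = (g k + c) /\<^sub>R real k"
          by (simp only: scaleR_scaleR)
        then show ?case by (simp add: scaleR_add_right)
      qed
    qed
  qed
qed

lemma convergence_set_measurable:
  fixes F :: "nat \<Rightarrow> 'a \<Rightarrow> 'b::{metric_space,second_countable_topology}"
  assumes [measurable]: "\<And>k. F k \<in> borel_measurable M"
  shows "{x \<in> space M. (\<lambda>k. F k x) \<longlonglongrightarrow> v} \<in> sets M"
proof -
  have "(\<lambda>k. F k x) \<longlonglongrightarrow> v \<longleftrightarrow> (\<forall>n::nat. \<exists>N. \<forall>k\<ge>N. dist (F k x) v < inverse (real (Suc n)))" for x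
    unfolding lim_sequentially
  proof (intro iffI allI impI)
    fix r :: real assume *: "\<forall>n::nat. \<exists>N. \<forall>k\<ge>N. dist (F k x) v < inverse (real (Suc n))" and "0 < r"
    obtain n where "inverse (real (Suc n)) < r" using reals_Archimedean[OF \<open>0 < r\<close>] by blast
    then show "\<exists>N. \<forall>k\<ge>N. dist (F k x) v < r" using * by (meson less_trans)
  qed simp
  moreover have "{x \<in> space M. \<forall>n::nat. \<exists>N. \<forall>k\<ge>N. dist (F k x) v < inverse (real (Suc n))} \<in> sets M"
    by measurable
  ultimately show ?thesis by simp
qed

section \<open>Strata as convergence sets, ergodicity and the integral\<close>

locale met_bundle = flow_bundle G Q
  for G :: "('g::{t2_space,second_countable_topology}, 'l::euclidean_space, 'm) cartan_group_scheme" (structure)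
    and Q :: "('g, 'q::topological_space, 'x::metric_space) bundle_flow" +
  fixes \<nu> :: "'x measure" and \<Omega> :: "'x set" and H :: 'l and chi :: "'x \<Rightarrow> ('q \<times> 'l) set"
    and M :: "('q \<times> 'g set) set measure"
  assumes base: "sets \<nu> = sets borel" and met: "met_data G Q \<nu> \<Omega> H chi"
    and sets_M: "sets M = sets (borel_of_topology (flag_bundle G Q))"
    and ergodic: "ergodic_measure (assoc_map Q) M" and marginal: "distr M borel (assoc_proj Q) = \<nu>"
begin

sublocale prob_space M
  using ergodic by (simp add: ergodic_measure_def invariant_measure_def)

lemma space_M: "space M = range pt"
  using sets_eq_imp_space_eq[OF sets_M] by (simp add: space_borel_of_topology topspace_flag_bundle)

lemma H: "H \<in> closure (aa_plus G)" "H \<in> aa G"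
proof -
  show "H \<in> closure (aa_plus G)" using met by (simp add: met_data_def)
  then show "H \<in> aa G" by (rule closure_aa_plus)
qed

definition conv_set :: "'l \<Rightarrow> ('q \<times> 'g set) set set" where
  "conv_set v = {\<xi> \<in> space M. (\<lambda>k. flag_cocycle G Q k \<xi> /\<^sub>R real k) \<longlonglongrightarrow> v}"

definition over_Omega :: "('q \<times> 'g set) set set" where
  "over_Omega = {\<xi> \<in> space M. assoc_proj Q \<xi> \<in> \<Omega>}"

abbreviation val :: "'g set \<Rightarrow> 'l" where "val w \<equiv> weyl_act G (inv\<^bsub>Wg\<^esub> w) H"

text \<open>A measurable map takes its values in the space of its target, here the adjoint orbit
  bundle; so \<open>chi x\<close> has a representative in the orbit of \<open>H\<close>.\<close>

lemma chi_point:
  assumes "x \<in> \<Omega>" obtains p g where "chi x = assoc_point G Q (Ad G) p (Ad G g H)" "pr p = x"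
proof -
  have "space \<nu> = UNIV" using sets_eq_imp_space_eq[OF base] by simp
  then have "x \<in> space (restrict_space \<nu> \<Omega>)" using assms by (simp add: space_restrict_space)
  moreover have "chi \<in> measurable (restrict_space \<nu> \<Omega>) (borel_of_topology (adjoint_orbit_bundle G Q H))"
    using met by (simp add: met_data_def)
  ultimately have "chi x \<in> topspace (adjoint_orbit_bundle G Q H)"
    unfolding space_borel_of_topology[symmetric] by (rule measurable_space[rotated])
  then have "chi x \<in> (\<lambda>(p, v). assoc_point G Q (Ad G) p v) ` (UNIV \<times> {Ad G g H | g. g \<in> carrier G})"
    unfolding adjoint_orbit_bundle_def assoc_topology_def topspace_final_topology
      topspace_prod_topology topspace_euclidean topspace_euclidean_subtopology .
  then obtain p g where pg: "chi x = assoc_point G Q (Ad G) p (Ad G g H)" by auto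
  have "assoc_proj Q (chi x) = x" using met assms by (simp add: met_data_def)
  then have "pr p = x" unfolding pg assoc_proj_point .
  then show ?thesis using that pg by blast
qed

lemma stratum_limit:
  assumes "x \<in> \<Omega>" "w \<in> carrier Wg" "\<xi> \<in> section_st G Q H (chi x) w"
  shows "(\<lambda>k. flag_cocycle G Q k \<xi> /\<^sub>R real k) \<longlonglongrightarrow> val w"
  using met assms unfolding met_data_def by blast

lemma stratum_covering:
  assumes "\<xi> \<in> over_Omega"
  shows "\<exists>w\<in>carrier Wg. \<xi> \<in> section_st G Q H (chi (assoc_proj Q \<xi>)) w"
proof -
  obtain q where q: "\<xi> = pt q" using assms by (auto simp: over_Omega_def space_M)
  have "assoc_proj Q \<xi> \<in> \<Omega>" using assms by (simp add: over_Omega_def)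
  then obtain p g where pg: "chi (assoc_proj Q \<xi>) = assoc_point G Q (Ad G) p (Ad G g H)" "pr p = assoc_proj Q \<xi>"
    by (rule chi_point)
  have "pr p = pr q" using pg(2) by (simp add: q assoc_proj_pt)
  then obtain h where h: "q = ra p h" by (rule fibre_transitive)
  obtain w where w: "w \<in> carrier Wg" "flag_point G h \<in> flag_st G H (Ad G g H) w"
    by (rule bexE[OF flag_covering[OF H(1)]])
  have "\<xi> = flag_bundle_point G Q p (flag_point G h)" unfolding flag_bundle_point_pt q h ..
  then have "\<xi> \<in> section_st G Q H (chi (assoc_proj Q \<xi>)) w"
    using w(2) pg(1) unfolding section_st_def by blast
  then show ?thesis using w(1) by blast
qed

lemma section_st_mono:
  assumes "w \<in> carrier Wg" "w' \<in> carrier Wg" "val w = val w'"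
  shows "section_st G Q H c w \<subseteq> section_st G Q H c w'"
  using flag_st_eq[OF H(2) assms] unfolding section_st_def by blast

text \<open>Points of a stratum have its limit by the Multiplicative Ergodic Theorem. Conversely a
  point over \<open>\<Omega>\<close> lies in some stratum, which must have the same limit and hence
  the same points. This is also the source of measurability of the strata.\<close>

lemma bundle_st_eq:
  assumes w: "w \<in> carrier Wg"
  shows "bundle_st G Q \<Omega> H chi w = conv_set (val w) \<inter> over_Omega"
proof (intro subset_antisym subsetI)
  fix \<xi> assume "\<xi> \<in> bundle_st G Q \<Omega> H chi w"
  then obtain x where x: "x \<in> \<Omega>" "\<xi> \<in> section_st G Q H (chi x) w" by (auto simp: bundle_st_def)
  then obtain p D0 b where d: "\<xi> = flag_bundle_point G Q p b" "chi x = assoc_point G Q (Ad G) p D0" "b \<in> flag_st G H D0 w"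
    unfolding section_st_def by blast
  obtain m where m: "m \<in> NKa" "w = cls m" using w unfolding weyl_carrier by (rule bexE)
  obtain h where h: "b = flag_point G h" using d(3) unfolding m(2) flag_st_cls[OF m(1)] by blast
  have xi: "\<xi> = pt (ra p h)" unfolding d(1) h flag_bundle_point_pt ..
  have "assoc_proj Q (chi x) = x" using met x(1) by (simp add: met_data_def)
  then have "pr p = x" unfolding d(2) assoc_proj_point .
  then have "assoc_proj Q \<xi> = x" unfolding xi assoc_proj_pt ra(1) .
  then show "\<xi> \<in> conv_set (val w) \<inter> over_Omega"
    using stratum_limit[OF x(1) w x(2)] x(1) by (simp add: conv_set_def over_Omega_def space_M xi)
next
  fix \<xi> assume xi: "\<xi> \<in> conv_set (val w) \<inter> over_Omega"
  then obtain w' where w': "w' \<in> carrier Wg" "\<xi> \<in> section_st G Q H (chi (assoc_proj Q \<xi>)) w'"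
    using stratum_covering by blast
  have Om: "assoc_proj Q \<xi> \<in> \<Omega>" using xi by (simp add: over_Omega_def)
  have "val w' = val w"
    using LIMSEQ_unique[OF stratum_limit[OF Om w']] xi by (simp add: conv_set_def)
  then have "\<xi> \<in> section_st G Q H (chi (assoc_proj Q \<xi>)) w"
    using section_st_mono[OF w'(1) w] w'(2) by blast
  then show "\<xi> \<in> bundle_st G Q \<Omega> H chi w" using Om unfolding bundle_st_def by blast
qed

lemma cocycle_measurable: "flag_cocycle G Q k \<in> borel_measurable M"
  by (rule flag_bundle_measurable[OF flag_cocycle_continuous sets_M])

lemma conv_set_measurable: "conv_set v \<in> sets M"
  unfolding conv_set_def using cocycle_measurable by (intro convergence_set_measurable) simp

lemma over_Omega_measurable: "over_Omega \<in> sets M" and prob_over_Omega: "prob over_Omega = 1"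
proof -
  have m: "assoc_proj Q \<in> borel_measurable M"
    by (rule flag_bundle_measurable[OF _ sets_M]) (simp add: assoc_proj_pt ra(5))
  have Om: "\<Omega> \<in> sets borel" using met base by (simp add: met_data_def)
  have e: "over_Omega = assoc_proj Q -` \<Omega> \<inter> space M" by (auto simp: over_Omega_def)
  show "over_Omega \<in> sets M" unfolding e by (rule measurable_sets[OF m Om])
  have "measure (distr M borel (assoc_proj Q)) \<Omega> = 1" using met marginal by (simp add: met_data_def)
  then show "prob over_Omega = 1" unfolding e by (simp add: measure_distr[OF m Om])
qed

lemma conv_set_invariant: "assoc_map Q -` conv_set v \<inter> space M = conv_set v"
proof -
  have "assoc_map Q \<xi> \<in> conv_set v \<longleftrightarrow> \<xi> \<in> conv_set v" if xi: "\<xi> \<in> space M" for \<xi>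
  proof -
    obtain q where q: "\<xi> = pt q" using xi space_M by auto
    have "assoc_map Q \<xi> \<in> space M" by (simp add: q assoc_map_pt space_M)
    moreover have "(\<lambda>k. flag_cocycle G Q k (assoc_map Q \<xi>) /\<^sub>R real k) \<longlonglongrightarrow> v \<longleftrightarrow>
        (\<lambda>k. flag_cocycle G Q k \<xi> /\<^sub>R real k) \<longlonglongrightarrow> v"
      by (rule tendsto_average_shift) (unfold q, rule flag_cocycle_Suc)
    ultimately show ?thesis using xi unfolding conv_set_def by blast
  qed
  moreover have "conv_set v \<subseteq> space M" by (auto simp: conv_set_def)
  ultimately show ?thesis by blast
qed

lemma prob_conv_set: "prob (conv_set v) = 0 \<or> prob (conv_set v) = 1"
proof -
  have "\<forall>A\<in>sets M. assoc_map Q -` A \<inter> space M = A \<longrightarrow> prob A = 0 \<or> prob A = 1"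
    using ergodic unfolding ergodic_measure_def by (rule conjunct2)
  from mp[OF bspec[OF this conv_set_measurable] conv_set_invariant] show ?thesis .
qed

text \<open>Only the limits need to be finite in number, not the Weyl group: they lie in the finite
  orbit of \<open>H\<close>, and the covering of \<open>over_Omega\<close> is indexed by
  limits.\<close>

lemma finite_values: "finite (val ` carrier Wg)"
proof (rule finite_subset[OF _ finite_orbit[OF H(2)]], rule subsetI)
  fix v assume "v \<in> val ` carrier Wg"
  then obtain w where w: "w \<in> carrier Wg" "v = val w" by (elim imageE) simp
  obtain m where m: "m \<in> NKa" "w = cls m" using w(1) unfolding weyl_carrier by (rule bexE)
  have "v = Ad G (inv m) H" unfolding w(2) m(2) by (rule weyl_act_inv[OF m(1) H(2)])
  then show "v \<in> {Ad G k H | k. k \<in> NKa}" using NKa_closed(2)[OF m(1)] by blast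
qed

lemma exists_value: obtains w where "w \<in> carrier Wg" "prob (conv_set (val w)) = 1"
proof (rule ccontr)
  assume "\<not> thesis"
  then have "prob (conv_set v) = 0" if "v \<in> val ` carrier Wg" for v
    using prob_conv_set[of v] that \<open>\<And>w. w \<in> carrier Wg \<Longrightarrow> prob (conv_set (val w)) = 1 \<Longrightarrow> thesis\<close> by blast
  then have "conv_set v \<in> null_sets M" if "v \<in> val ` carrier Wg" for v
    using that conv_set_measurable by (simp add: null_sets_def emeasure_eq_measure)
  then have "(\<Union>v\<in>val ` carrier Wg. conv_set v) \<in> null_sets M"
    by (intro null_sets.finite_UN finite_values)
  moreover have "over_Omega \<subseteq> (\<Union>v\<in>val ` carrier Wg. conv_set v)"
  proof
    fix \<xi> assume xi: "\<xi> \<in> over_Omega"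
    obtain w where w: "w \<in> carrier Wg" "\<xi> \<in> section_st G Q H (chi (assoc_proj Q \<xi>)) w"
      by (rule bexE[OF stratum_covering[OF xi]])
    have "assoc_proj Q \<xi> \<in> \<Omega>" "\<xi> \<in> space M" using xi by (auto simp: over_Omega_def)
    then have "\<xi> \<in> conv_set (val w)" using stratum_limit[OF _ w] by (simp add: conv_set_def)
    then show "\<xi> \<in> (\<Union>v\<in>val ` carrier Wg. conv_set v)" using w(1) by blast
  qed
  ultimately have "over_Omega \<in> null_sets M" using over_Omega_measurable by (metis null_sets_subset)
  then have "prob over_Omega = 0" by (rule measure_eq_0_null_sets)
  then show False using prob_over_Omega by simp
qed

lemma carried:
  assumes w: "w \<in> carrier Wg" and p: "prob (conv_set (val w)) = 1"
  shows "carried_by G Q \<Omega> H chi M w"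
  unfolding carried_by_def
proof (intro conjI ballI impI)
  have "AE \<xi> in M. \<xi> \<in> conv_set (val w) \<inter> over_Omega"
    using p prob_over_Omega by (simp add: prob_eq_1 conv_set_measurable over_Omega_measurable)
  then have "prob (conv_set (val w) \<inter> over_Omega) = 1"
    by (subst prob_eq_1) (simp_all add: conv_set_measurable over_Omega_measurable sets.Int)
  then show "emeasure M (bundle_st G Q \<Omega> H chi w) = 1"
    by (simp add: bundle_st_eq[OF w] emeasure_eq_measure)
  fix w' assume w': "w' \<in> carrier Wg"
    and ne: "weyl_subgroup G (Theta G H) #>\<^bsub>Wg\<^esub> w \<noteq> weyl_subgroup G (Theta G H) #>\<^bsub>Wg\<^esub> w'"
  show s: "bundle_st G Q \<Omega> H chi w' \<in> sets M"
    unfolding bundle_st_eq[OF w'] by (intro sets.Int conv_set_measurable over_Omega_measurable)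
  have "val w \<noteq> val w'" using weyl_coset_eq[OF H(1) w w'] ne by blast
  then have "conv_set (val w') \<inter> conv_set (val w) = {}"
    using LIMSEQ_unique by (auto simp: conv_set_def)
  then have "bundle_st G Q \<Omega> H chi w' \<subseteq> space M - conv_set (val w)"
    unfolding bundle_st_eq[OF w'] by (auto simp: over_Omega_def)
  then have "prob (bundle_st G Q \<Omega> H chi w') \<le> prob (space M - conv_set (val w))"
    by (intro finite_measure_mono sets.Diff sets.top conv_set_measurable)
  also have "\<dots> = 0" using p by (simp add: prob_compl conv_set_measurable)
  finally have "prob (bundle_st G Q \<Omega> H chi w') = 0" using measure_nonneg[of M] by (metis antisym)
  then show "emeasure M (bundle_st G Q \<Omega> H chi w') = 0" by (simp add: emeasure_eq_measure)
qed

lemma cocycle_integral: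
  assumes v: "prob (conv_set v) = 1"
  shows "integrable M (flag_cocycle G Q 1)" "(LINT \<xi>|M. flag_cocycle G Q 1 \<xi>) = v"
proof -
  obtain C where C: "0 \<le> C" "\<And>q. norm (flag_cocycle G Q 1 (pt q)) \<le> C" by (rule flag_cocycle_bounded, rule that)
  have bound: "norm (flag_cocycle G Q k (pt q)) \<le> real k * C" for k q
  proof (induction k arbitrary: q)
    case 0
    show ?case by (simp add: flag_cocycle_pt)
  next
    case (Suc k)
    have "norm (flag_cocycle G Q (Suc k) (pt q)) \<le> norm (flag_cocycle G Q k (pt (aut Q q))) + norm (flag_cocycle G Q 1 (pt q))"
      unfolding flag_cocycle_Suc assoc_map_pt by (rule norm_triangle_ineq)
    also have "\<dots> \<le> real k * C + C" by (rule add_mono[OF Suc.IH C(2)])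
    finally show ?case by (simp add: algebra_simps)
  qed
  have bM: "norm (flag_cocycle G Q k \<xi>) \<le> real k * C" if "\<xi> \<in> space M" for k \<xi>
    using that bound by (auto simp: space_M)
  have int: "integrable M (flag_cocycle G Q k)" for k
    by (rule integrable_const_bound[OF _ cocycle_measurable]) (rule AE_I2, rule bM)
  then show "integrable M (flag_cocycle G Q 1)" .
  have T: "assoc_map Q \<in> measurable M M" "distr M M (assoc_map Q) = M"
    using ergodic by (simp_all add: ergodic_measure_def invariant_measure_def)
  have step: "(LINT \<xi>|M. flag_cocycle G Q k (assoc_map Q \<xi>)) = (LINT \<xi>|M. flag_cocycle G Q k \<xi>)"
    "integrable M (\<lambda>\<xi>. flag_cocycle G Q k (assoc_map Q \<xi>))" for k
    using integral_distr[OF T(1) cocycle_measurable, of k] integrable_distr[OF T(1), of "flag_cocycle G Q k"] int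
    by (simp_all add: T(2))
  have lin: "(LINT \<xi>|M. flag_cocycle G Q k \<xi>) = real k *\<^sub>R (LINT \<xi>|M. flag_cocycle G Q 1 \<xi>)" for k
  proof (induction k)
    case 0
    have "(LINT \<xi>|M. flag_cocycle G Q 0 \<xi>) = (LINT \<xi>|M. 0)"
      by (rule Bochner_Integration.integral_cong) (auto simp: space_M flag_cocycle_pt)
    then show ?case by simp
  next
    case (Suc k)
    have "(LINT \<xi>|M. flag_cocycle G Q (Suc k) \<xi>) = (LINT \<xi>|M. flag_cocycle G Q k (assoc_map Q \<xi>) + flag_cocycle G Q 1 \<xi>)"
    proof (rule Bochner_Integration.integral_cong[OF refl])
      fix \<xi> assume "\<xi> \<in> space M"
      then obtain q where q: "\<xi> = pt q" unfolding space_M by (rule imageE)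
      show "flag_cocycle G Q (Suc k) \<xi> = flag_cocycle G Q k (assoc_map Q \<xi>) + flag_cocycle G Q 1 \<xi>"
        unfolding q by (rule flag_cocycle_Suc)
    qed
    also have "\<dots> = real k *\<^sub>R (LINT \<xi>|M. flag_cocycle G Q 1 \<xi>) + (LINT \<xi>|M. flag_cocycle G Q 1 \<xi>)"
      by (simp only: Bochner_Integration.integral_add[OF step(2) int] step(1) Suc)
    finally show ?case by (simp add: scaleR_add_left add.commute)
  qed
  have avg: "(LINT \<xi>|M. flag_cocycle G Q k \<xi> /\<^sub>R real k) = (LINT \<xi>|M. flag_cocycle G Q 1 \<xi>)" if "k > 0" for k
    using that by (simp add: lin[of k])
  have "(\<lambda>k. LINT \<xi>|M. flag_cocycle G Q k \<xi> /\<^sub>R real k) \<longlonglongrightarrow> (LINT \<xi>|M. v)"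
  proof (rule integral_dominated_convergence)
    show "(\<lambda>\<xi>. flag_cocycle G Q k \<xi> /\<^sub>R real k) \<in> borel_measurable M" for k
      using cocycle_measurable by simp
    show "AE \<xi> in M. (\<lambda>k. flag_cocycle G Q k \<xi> /\<^sub>R real k) \<longlonglongrightarrow> v"
    proof -
      have "AE \<xi> in M. \<xi> \<in> conv_set v" using v by (simp add: prob_eq_1 conv_set_measurable)
      then show ?thesis by (rule AE_mp) (auto simp: conv_set_def)
    qed
    \<comment> \<open>The same bound \<open>C\<close> serves every \<open>k\<close>; at
      \<open>k = 0\<close> the average is 0 because the inverse of 0 is 0.\<close>
    show "AE \<xi> in M. norm (flag_cocycle G Q k \<xi> /\<^sub>R real k) \<le> C" for k
    proof (rule AE_I2)
      fix \<xi> assume "\<xi> \<in> space M"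
      then show "norm (flag_cocycle G Q k \<xi> /\<^sub>R real k) \<le> C"
        using bM[of \<xi> k] C(1) by (cases "k = 0") (simp_all add: field_simps)
    qed
  qed simp_all
  moreover have "(\<lambda>k. LINT \<xi>|M. flag_cocycle G Q k \<xi> /\<^sub>R real k) \<longlonglongrightarrow> (LINT \<xi>|M. flag_cocycle G Q 1 \<xi>)"
    by (rule tendsto_eventually, rule eventually_mono[OF eventually_gt_at_top[of 0]]) (rule avg)
  ultimately show "(LINT \<xi>|M. flag_cocycle G Q 1 \<xi>) = v"
    by (simp add: LIMSEQ_unique prob_space)
qed

end

theorem proposition5p1:
  fixes G :: "('g::{t2_space,second_countable_topology}, 'l::euclidean_space) cartan_group"
    and Q :: "('g, 'q::topological_space, 'x::metric_space) bundle_flow"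
    and \<nu> :: "'x measure" and \<mu> :: "('q \<times> 'g set) set measure"
    and \<Omega> :: "'x set" and H\<^sub>L\<^sub>y :: 'l and chi\<^sub>L\<^sub>y :: "'x \<Rightarrow> ('q \<times> 'l) set"
  assumes "reductive_cartan_group G"
    and "compact (UNIV :: 'x set)"
    and "principal_bundle_flow G Q"
    and "sets \<nu> = sets borel" and "ergodic_measure (base_map Q) \<nu>"
    and "met_data G Q \<nu> \<Omega> H\<^sub>L\<^sub>y chi\<^sub>L\<^sub>y"
    and "sets \<mu> = sets (borel_of_topology (flag_bundle G Q))"
    and "ergodic_measure (assoc_map Q) \<mu>"
    and "distr \<mu> borel (assoc_proj Q) = \<nu>"
  shows "(\<exists>w\<in>carrier (weyl_group G). carried_by G Q \<Omega> H\<^sub>L\<^sub>y chi\<^sub>L\<^sub>y \<mu> w) \<and>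
    (\<forall>w\<in>carrier (weyl_group G). carried_by G Q \<Omega> H\<^sub>L\<^sub>y chi\<^sub>L\<^sub>y \<mu> w \<longrightarrow>
       integrable \<mu> (flag_cocycle G Q 1) \<and>
       (LINT \<xi>|\<mu>. flag_cocycle G Q 1 \<xi>) = weyl_act G (inv\<^bsub>weyl_group G\<^esub> w) H\<^sub>L\<^sub>y)"
proof -
  interpret met_bundle G Q \<nu> \<Omega> "H\<^sub>L\<^sub>y" "chi\<^sub>L\<^sub>y" \<mu>
    by unfold_locales (rule assms)+
  show ?thesis
  proof (intro conjI ballI impI)
    obtain w0 where "w0 \<in> carrier (weyl_group G)" "prob (conv_set (val w0)) = 1" by (rule exists_value)
    then show "\<exists>w\<in>carrier (weyl_group G). carried_by G Q \<Omega> H\<^sub>L\<^sub>y chi\<^sub>L\<^sub>y \<mu> w"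
      using carried by blast
    fix w assume w: "w \<in> carrier (weyl_group G)" and c: "carried_by G Q \<Omega> H\<^sub>L\<^sub>y chi\<^sub>L\<^sub>y \<mu> w"
    \<comment> \<open>The integral formula is claimed for every \<open>w\<close> that carries the
      measure, not only for the one just found, so full measure of its convergence set is recovered
      from \<open>carried_by\<close>.\<close>
    have "emeasure \<mu> (conv_set (val w) \<inter> over_Omega) = 1"
      using c unfolding carried_by_def bundle_st_eq[OF w] by blast
    then have "prob (conv_set (val w) \<inter> over_Omega) = 1" by (simp add: emeasure_eq_measure)
    moreover have "prob (conv_set (val w) \<inter> over_Omega) \<le> prob (conv_set (val w))"
      by (rule finite_measure_mono[OF Int_lower1 conv_set_measurable])
    ultimately have "prob (conv_set (val w)) = 1" using prob_conv_set[of "val w"] by linarith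
    then show "integrable \<mu> (flag_cocycle G Q 1)"
      "(LINT \<xi>|\<mu>. flag_cocycle G Q 1 \<xi>) = weyl_act G (inv\<^bsub>weyl_group G\<^esub> w) H\<^sub>L\<^sub>y"
      by (rule cocycle_integral)+
  qed
qed

end
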